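(* Let $\mathsf{X}=\mathsf{Top}_0$. For $\mathbb{T}$ the filter monad, the proper filter monad and the prime filter monad on $\mathsf{Top}_0$, the category $\mathsf{X}_{\mathrm{alg}}$ is, respectively, $\mathsf{ALat}$, $\mathsf{ADom}$ and $\mathsf{Spec}$. Moreover, in each of these cases, $\mathsf{X}_{\mathrm{alg}}$ is the closure under weighted limits of $\mathsf{X}_{\mathbb{T}}$ in $\mathsf{X}^{\mathbb{T}}$, and thus also in $\mathsf{Top}_0$.
   Context: $\mathsf{Top}_0$ is the category of $T_0$ spaces and continuous maps, order-enriched by the pointwise specialisation order ($x\le y$ iff every open set containing $x$ contains $y$). $\mathsf{S}$ is the Sierpiński space $\{0,1\}$ with $\{1\}$ open and $\{0\}$ not open. Monads: the filter monad $\mathbb{F}=(F,m,e)$ has $FX$ the set of all filters (the improper one included) of the lattice $\Omega X$ of open subsets of $X$, with topology generated by the sets $A^{\#}=\{\mathfrak{f}\mid A\in\mathfrak{f}\}$, $A\in\Omega X$; $Ff(\mathfrak{f})=\{B\mid f^{-1}(B)\in\mathfrak{f}\}$; $e_X(x)$ is the filter of open neighbourhoods of $x$; $m_X(\mathfrak{F})=\{A\mid A^{\#}\in\mathfrak{F}\}$. The proper filter monad and the prime filter monad are the submonads given by the subspaces of all proper filters, respectively all prime filters (proper filters $\mathfrak f$ such that $U\cup V\in\mathfrak{f}$ implies $U\in\mathfrak{f}$ or $V\in\mathfrak{f}$). They are of Kock-Zöberlein type with respect to the dual of the specialisation order, so algebra structures are unique and the Eilenberg-Moore category $\mathsf{X}^{\mathbb{T}}$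 is regarded as a (non-full) subcategory of $\mathsf{Top}_0$. It is, respectively: continuous lattices (Scott topology) with maps preserving directed suprema and all infima; bounded complete domains (Scott topology) with maps preserving directed suprema and non-empty infima; stably compact spaces with spectral maps. The Kleisli category $\mathsf{X}_{\mathbb{T}}$ is regarded as the full subcategory of $\mathsf{X}^{\mathbb{T}}$ of free algebras. Domain theory: an element $c$ of a poset with directed suprema is compact if $c\le\bigvee D$, $D$ directed, implies $c\le d$ for some $d\in D$. An algebraic domain is a poset with directed suprema in which every element is the directed supremum of the compact elements below it; an algebraic lattice is an algebraic domain which is a complete lattice. A poset is bounded complete if every subset with an upper bound has a least one (for domains, equivalently: all non-empty infima exist). $\mathsf{ALat}$: algebraic lattices with maps preserving directed suprema and all infima. $\mathsf{ADom}$: bounded complete algebraic domains with maps preserving directed suprema and all non-empty infima. In both cases objects are viewed as spaces with the Scott topology. A stably compact space is a sober, locally compact space in which finite intersections of compact saturated sets are compact (saturated = upper set in the specialisation order); a continuous map between such spaces is spectral if preimages of compact saturated sets are compact. A spectral space is a stably compact space whose compact open sets form a base. $\mathsf{Spec}$: spectral spaces and spectral maps. Weighted limits: for a small order-enriched category $\mathsf{D}$ and order-enriched functors $D:\mathsf{D}\to\mathsf{A}$, $W:\mathsf{D}\to\mathsf{Pos}$, a limit of $D$ weighted by $W$ is an object $L$ with morphisms $l_d^x:L\to Dd$ ($d\in\mathsf{D}$, $x\in Wd$) such that (a) $l_d^x\le l_d^y$ if $x\le y$, and $Dn\cdot l_d^x=l_{d'}^{Wn(x)}$ for $n:d\to d'$;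 (b) every family $a_d^x:A\to Dd$ satisfying the analogue of (a) is $a_d^x=l_d^x t$ for a unique $t:A\to L$, and $l_d^xt\le l_d^xt'$ for all $d,x$ implies $t\le t'$. $\mathsf{Top}_0$ has weighted limits, and $\mathsf{X}^{\mathbb{T}}$ is closed under them. A subcategory $\mathsf{A}$ of $\mathsf{B}$ is closed under weighted limits in $\mathsf{B}$ if every weighted limit in $\mathsf{B}$ of a diagram in $\mathsf{A}$ lies, with its projections, in $\mathsf{A}$ and is a weighted limit in $\mathsf{A}$. The closure under weighted limits of $\mathsf{X}_{\mathbb{T}}$ is the smallest subcategory containing $\mathsf{X}_{\mathbb{T}}$ and closed under weighted limits. $\mathsf{X}_{\mathrm{alg}}$: write $\mathbb{H}\mathrm{om}(X,Y)$ for the hom-posets of $\mathsf{X}^{\mathbb{T}}$ (note $\mathsf{S}\in\mathsf{X}^{\mathbb{T}}$). For a poset $I$, the cotensor $\pitchfork(I,\mathsf{S})$ is the space of all monotone families $(z_i)_{i\in I}$ in $\mathsf{S}$, a subspace of the power $\mathsf{S}^{I}$. For $X\in\mathsf{X}^{\mathbb{T}}$ let $\hat X=\pitchfork(\mathbb{H}\mathrm{om}(X,\mathsf{S}),\mathsf{S})$ with projections $\pi_f$, let $n_X:X\to\hat X$ be given by $\pi_f n_X=f$, and let $\alpha,\beta:\hat X\to\pitchfork(\mathbb{H}\mathrm{om}(\hat X,\mathsf{S}),\mathsf{S})$ be given on the projections $\hat\pi_g$, $g\in\mathbb{H}\mathrm{om}(\hat X,\mathsf S)$, by $\hat\pi_g\alpha=g$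 and $\hat\pi_g\beta=\pi_{g n_X}$. Then $\mathsf{X}_{\mathrm{alg}}$ is the full subcategory of $\mathsf{X}^{\mathbb{T}}$ of all objects $X$ for which $n_X$ is an equaliser of $\alpha$ and $\beta$ in $\mathsf{Top}_0$. *)

theory Defs
  imports "HOL-Analysis.Analysis" "HOL-Algebra.Complete_Lattice" "HOL-Library.Equipollence"
begin

section \<open>Order-enriched categories and weighted limits\<close>

text \<open>
  HOL has no type of all sets, so the size distinction is made relative to a type \<open>'u\<close>:
  a set is small if its cardinality is strictly below that of \<open>'u\<close>, and \<open>Top0\<close> consists of the
  small \<open>T\<^sub>0\<close> spaces with points in \<open>'u\<close>. If the cardinality of \<open>'u\<close> is inaccessible, this is the
  category of \<open>T\<^sub>0\<close> spaces of a Grothendieck universe (up to isomorphism of small spaces).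
  The cardinality of \<open>'u\<close> is not restricted here. Constructions that may leave \<open>'u\<close> (spaces of
  filters, cotensors) are defined polymorphically, for spaces over any type.
\<close>

definition small :: "'u set \<Rightarrow> bool" where
  "small A \<longleftrightarrow> A \<prec> (UNIV :: 'u set)"

text \<open>\<open>hcomp C x y z g f\<close> is the composite of \<open>f : x \<rightarrow> y\<close> and \<open>g : y \<rightarrow> z\<close>.\<close>

record ('o, 'm) ocat =
  obj :: "'o set"
  hom :: "'o \<Rightarrow> 'o \<Rightarrow> 'm set"
  idn :: "'o \<Rightarrow> 'm"
  hcomp :: "'o \<Rightarrow> 'o \<Rightarrow> 'o \<Rightarrow> 'm \<Rightarrow> 'm \<Rightarrow> 'm"
  hle :: "'o \<Rightarrow> 'o \<Rightarrow> 'm \<Rightarrow> 'm \<Rightarrow> bool"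

definition order_category :: "('o, 'm) ocat \<Rightarrow> bool" where
  "order_category C \<longleftrightarrow>
     (\<forall>x\<in>obj C. idn C x \<in> hom C x x) \<and>
     (\<forall>x\<in>obj C. \<forall>y\<in>obj C. \<forall>z\<in>obj C. \<forall>f\<in>hom C x y. \<forall>g\<in>hom C y z.
        hcomp C x y z g f \<in> hom C x z) \<and>
     (\<forall>x\<in>obj C. \<forall>y\<in>obj C. \<forall>f\<in>hom C x y.
        hcomp C x x y f (idn C x) = f \<and> hcomp C x y y (idn C y) f = f) \<and>
     (\<forall>w\<in>obj C. \<forall>x\<in>obj C. \<forall>y\<in>obj C. \<forall>z\<in>obj C.
        \<forall>f\<in>hom C w x. \<forall>g\<in>hom C x y. \<forall>h\<in>hom C y z.
          hcomp C w y z h (hcomp C w x y g f) = hcomp C w x z (hcomp C x y z h g) f) \<and>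
     (\<forall>x\<in>obj C. \<forall>y\<in>obj C. \<forall>f\<in>hom C x y. hle C x y f f) \<and>
     (\<forall>x\<in>obj C. \<forall>y\<in>obj C. \<forall>f\<in>hom C x y. \<forall>g\<in>hom C x y.
        hle C x y f g \<and> hle C x y g f \<longrightarrow> f = g) \<and>
     (\<forall>x\<in>obj C. \<forall>y\<in>obj C. \<forall>f\<in>hom C x y. \<forall>g\<in>hom C x y. \<forall>h\<in>hom C x y.
        hle C x y f g \<and> hle C x y g h \<longrightarrow> hle C x y f h) \<and>
     (\<forall>x\<in>obj C. \<forall>y\<in>obj C. \<forall>z\<in>obj C.
        \<forall>f\<in>hom C x y. \<forall>f'\<in>hom C x y. \<forall>g\<in>hom C y z. \<forall>g'\<in>hom C y z.
          hle C x y f f' \<and> hle C y z g g' \<longrightarrow>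
          hle C x z (hcomp C x y z g f) (hcomp C x y z g' f'))"

definition small_category :: "('u, 'u) ocat \<Rightarrow> bool" where
  "small_category D \<longleftrightarrow> order_category D \<and> small (obj D) \<and>
     (\<forall>x\<in>obj D. \<forall>y\<in>obj D. small (hom D x y))"

text \<open>\<open>Fm d d' n\<close> is the image of \<open>n : d \<rightarrow> d'\<close>.\<close>

definition order_functor ::
  "('i, 'n) ocat \<Rightarrow> ('o, 'm) ocat \<Rightarrow> ('i \<Rightarrow> 'o) \<Rightarrow> ('i \<Rightarrow> 'i \<Rightarrow> 'n \<Rightarrow> 'm) \<Rightarrow> bool" where
  "order_functor D A Fo Fm \<longleftrightarrow>
     (\<forall>d\<in>obj D. Fo d \<in> obj A) \<and>
     (\<forall>d\<in>obj D. \<forall>d'\<in>obj D. \<forall>n\<in>hom D d d'. Fm d d' n \<in> hom A (Fo d) (Fo d')) \<and>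
     (\<forall>d\<in>obj D. Fm d d (idn D d) = idn A (Fo d)) \<and>
     (\<forall>d\<in>obj D. \<forall>d'\<in>obj D. \<forall>d''\<in>obj D. \<forall>n\<in>hom D d d'. \<forall>n'\<in>hom D d' d''.
        Fm d d'' (hcomp D d d' d'' n' n) =
          hcomp A (Fo d) (Fo d') (Fo d'') (Fm d' d'' n') (Fm d d' n)) \<and>
     (\<forall>d\<in>obj D. \<forall>d'\<in>obj D. \<forall>n\<in>hom D d d'. \<forall>n'\<in>hom D d d'.
        hle D d d' n n' \<longrightarrow> hle A (Fo d) (Fo d') (Fm d d' n) (Fm d d' n'))"

text \<open>Morphisms are extensional functions, so that they are equal iff they agree on their domain.\<close>

definition Pos :: "('u gorder, 'u \<Rightarrow> 'u) ocat" where
  "Pos = \<lparr>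
     obj = {P. partial_order P \<and> small (carrier P)},
     hom = (\<lambda>P Q. {f \<in> carrier P \<rightarrow>\<^sub>E carrier Q.
              \<forall>x\<in>carrier P. \<forall>y\<in>carrier P. x \<sqsubseteq>\<^bsub>P\<^esub> y \<longrightarrow> f x \<sqsubseteq>\<^bsub>Q\<^esub> f y}),
     idn = (\<lambda>P. \<lambda>x\<in>carrier P. x),
     hcomp = (\<lambda>P Q R g f. compose (carrier P) g f),
     hle = (\<lambda>P Q f g. \<forall>x\<in>carrier P. f x \<sqsubseteq>\<^bsub>Q\<^esub> g x) \<rparr>"

definition weighted_cone ::
  "('o, 'm) ocat \<Rightarrow> ('i, 'n) ocat \<Rightarrow> ('i \<Rightarrow> 'o) \<Rightarrow> ('i \<Rightarrow> 'i \<Rightarrow> 'n \<Rightarrow> 'm) \<Rightarrow>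
   ('i \<Rightarrow> 'w gorder) \<Rightarrow> ('i \<Rightarrow> 'i \<Rightarrow> 'n \<Rightarrow> 'w \<Rightarrow> 'w) \<Rightarrow> 'o \<Rightarrow> ('i \<Rightarrow> 'w \<Rightarrow> 'm) \<Rightarrow> bool" where
  "weighted_cone B D Fo Fm Wo Wm L l \<longleftrightarrow>
     L \<in> obj B \<and>
     (\<forall>d\<in>obj D. \<forall>x\<in>carrier (Wo d). l d x \<in> hom B L (Fo d)) \<and>
     (\<forall>d\<in>obj D. \<forall>x\<in>carrier (Wo d). \<forall>y\<in>carrier (Wo d).
        x \<sqsubseteq>\<^bsub>Wo d\<^esub> y \<longrightarrow> hle B L (Fo d) (l d x) (l d y)) \<and>
     (\<forall>d\<in>obj D. \<forall>d'\<in>obj D. \<forall>n\<in>hom D d d'. \<forall>x\<in>carrier (Wo d).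
        hcomp B L (Fo d) (Fo d') (Fm d d' n) (l d x) = l d' (Wm d d' n x))"

definition weighted_limit ::
  "('o, 'm) ocat \<Rightarrow> ('i, 'n) ocat \<Rightarrow> ('i \<Rightarrow> 'o) \<Rightarrow> ('i \<Rightarrow> 'i \<Rightarrow> 'n \<Rightarrow> 'm) \<Rightarrow>
   ('i \<Rightarrow> 'w gorder) \<Rightarrow> ('i \<Rightarrow> 'i \<Rightarrow> 'n \<Rightarrow> 'w \<Rightarrow> 'w) \<Rightarrow> 'o \<Rightarrow> ('i \<Rightarrow> 'w \<Rightarrow> 'm) \<Rightarrow> bool" where
  "weighted_limit B D Fo Fm Wo Wm L l \<longleftrightarrow>
     weighted_cone B D Fo Fm Wo Wm L l \<and>
     (\<forall>A a. weighted_cone B D Fo Fm Wo Wm A a \<longrightarrow>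
        (\<exists>!t. t \<in> hom B A L \<and>
           (\<forall>d\<in>obj D. \<forall>x\<in>carrier (Wo d). a d x = hcomp B A L (Fo d) (l d x) t))) \<and>
     (\<forall>A\<in>obj B. \<forall>t\<in>hom B A L. \<forall>t'\<in>hom B A L.
        (\<forall>d\<in>obj D. \<forall>x\<in>carrier (Wo d).
           hle B A (Fo d) (hcomp B A L (Fo d) (l d x) t) (hcomp B A L (Fo d) (l d x) t')) \<longrightarrow>
        hle B A L t t')"

definition subcategory :: "('o, 'm) ocat \<Rightarrow> ('o, 'm) ocat \<Rightarrow> bool" where
  "subcategory A B \<longleftrightarrow>
     obj A \<subseteq> obj B \<and>
     (\<forall>x\<in>obj A. \<forall>y\<in>obj A. hom A x y \<subseteq> hom B x y) \<and>
     (\<forall>x\<in>obj A. idn B x \<in> hom A x x) \<and>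
     (\<forall>x\<in>obj A. \<forall>y\<in>obj A. \<forall>z\<in>obj A. \<forall>f\<in>hom A x y. \<forall>g\<in>hom A y z.
        hcomp B x y z g f \<in> hom A x z) \<and>
     idn A = idn B \<and> hcomp A = hcomp B \<and> hle A = hle B"

definition full_subcategory :: "('o, 'm) ocat \<Rightarrow> ('o \<Rightarrow> bool) \<Rightarrow> ('o, 'm) ocat" where
  "full_subcategory C P = C\<lparr>
     obj := {x \<in> obj C. P x},
     hom := (\<lambda>x y. if x \<in> obj C \<and> P x \<and> y \<in> obj C \<and> P y then hom C x y else {}) \<rparr>"

text \<open>
  Every small category and every small poset is isomorphic to one carried by \<open>'u\<close>, so it suffices
  to take diagrams and weights over \<open>'u\<close>.
\<close>

definition closed_under_weighted_limits ::
  "('u topology, 'u \<Rightarrow> 'u) ocat \<Rightarrow> ('u topology, 'u \<Rightarrow> 'u) ocat \<Rightarrow> bool" where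
  "closed_under_weighted_limits A B \<longleftrightarrow>
     (\<forall>(D :: ('u, 'u) ocat) Fo Fm (Wo :: 'u \<Rightarrow> 'u gorder) Wm L l.
        small_category D \<and> order_functor D A Fo Fm \<and> order_functor D Pos Wo Wm \<and>
        weighted_limit B D Fo Fm Wo Wm L l \<longrightarrow>
          L \<in> obj A \<and>
          (\<forall>d\<in>obj D. \<forall>x\<in>carrier (Wo d). l d x \<in> hom A L (Fo d)) \<and>
          weighted_limit A D Fo Fm Wo Wm L l)"

text \<open>\<open>A\<close> is the closure of \<open>A\<^sub>0\<close> under weighted limits in \<open>B\<close>.\<close>

definition is_weighted_limit_closure ::
  "('u topology, 'u \<Rightarrow> 'u) ocat \<Rightarrow> ('u topology, 'u \<Rightarrow> 'u) ocat \<Rightarrow>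
   ('u topology, 'u \<Rightarrow> 'u) ocat \<Rightarrow> bool" where
  "is_weighted_limit_closure B A\<^sub>0 A \<longleftrightarrow>
     subcategory A B \<and> subcategory A\<^sub>0 A \<and> closed_under_weighted_limits A B \<and>
     (\<forall>A'. subcategory A' B \<and> subcategory A\<^sub>0 A' \<and> closed_under_weighted_limits A' B \<longrightarrow>
        subcategory A A')"


section \<open>Categories of \<open>T\<^sub>0\<close> spaces\<close>

definition spec_le :: "'a topology \<Rightarrow> 'a \<Rightarrow> 'a \<Rightarrow> bool" where
  "spec_le X x y \<longleftrightarrow> (\<forall>U. openin X U \<and> x \<in> U \<longrightarrow> y \<in> U)"

definition spec_order :: "'a topology \<Rightarrow> 'a gorder" where
  "spec_order X = \<lparr> carrier = topspace X, eq = (=), le = spec_le X \<rparr>"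

definition space_category ::
  "('u topology \<Rightarrow> bool) \<Rightarrow> ('u topology \<Rightarrow> 'u topology \<Rightarrow> ('u \<Rightarrow> 'u) \<Rightarrow> bool) \<Rightarrow>
   ('u topology, 'u \<Rightarrow> 'u) ocat" where
  "space_category P Q =
     (let O' = {X. t0_space X \<and> small (topspace X) \<and> P X} in \<lparr>
       obj = O',
       hom = (\<lambda>X Y. {f \<in> topspace X \<rightarrow>\<^sub>E topspace Y. X \<in> O' \<and> Y \<in> O' \<and> Q X Y f}),
       idn = (\<lambda>X. \<lambda>x\<in>topspace X. x),
       hcomp = (\<lambda>X Y Z g f. compose (topspace X) g f),
       hle = (\<lambda>X Y f g. \<forall>x\<in>topspace X. spec_le Y (f x) (g x)) \<rparr>)"

definition Top0 :: "('u topology, 'u \<Rightarrow> 'u) ocat" where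
  "Top0 = space_category (\<lambda>X. True) continuous_map"


section \<open>The filter monads and their algebras\<close>

definition open_filter :: "'a topology \<Rightarrow> 'a set set \<Rightarrow> bool" where
  "open_filter X \<ff> \<longleftrightarrow>
     (\<forall>U\<in>\<ff>. openin X U) \<and> topspace X \<in> \<ff> \<and>
     (\<forall>U\<in>\<ff>. \<forall>V\<in>\<ff>. U \<inter> V \<in> \<ff>) \<and>
     (\<forall>U\<in>\<ff>. \<forall>V. openin X V \<and> U \<subseteq> V \<longrightarrow> V \<in> \<ff>)"

datatype filter_kind = AllFilters | ProperFilters | PrimeFilters

fun of_kind :: "filter_kind \<Rightarrow> 'a topology \<Rightarrow> 'a set set \<Rightarrow> bool" where
  "of_kind AllFilters X \<ff> \<longleftrightarrow> True"
| "of_kind ProperFilters X \<ff> \<longleftrightarrow> {} \<notin> \<ff>"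
| "of_kind PrimeFilters X \<ff> \<longleftrightarrow> {} \<notin> \<ff> \<and>
     (\<forall>U V. openin X U \<and> openin X V \<and> U \<union> V \<in> \<ff> \<longrightarrow> U \<in> \<ff> \<or> V \<in> \<ff>)"

definition all_filter_space :: "'a topology \<Rightarrow> 'a set set topology" where
  "all_filter_space X =
     topology_generated_by {{\<ff>. open_filter X \<ff> \<and> A \<in> \<ff>} | A. openin X A}"

definition filter_space :: "filter_kind \<Rightarrow> 'a topology \<Rightarrow> 'a set set topology" where
  "filter_space k X = subtopology (all_filter_space X) {\<ff>. of_kind k X \<ff>}"

definition filter_map ::
  "'a topology \<Rightarrow> 'b topology \<Rightarrow> ('a \<Rightarrow> 'b) \<Rightarrow> 'a set set \<Rightarrow> 'b set set" where
  "filter_map X Y f \<ff> = {B. openin Y B \<and> {x \<in> topspace X. f x \<in> B} \<in> \<ff>}"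

definition filter_unit :: "'a topology \<Rightarrow> 'a \<Rightarrow> 'a set set" where
  "filter_unit X x = {U. openin X U \<and> x \<in> U}"

definition filter_mult ::
  "filter_kind \<Rightarrow> 'a topology \<Rightarrow> 'a set set set set \<Rightarrow> 'a set set" where
  "filter_mult k X \<FF> = {A. openin X A \<and> {\<ff> \<in> topspace (filter_space k X). A \<in> \<ff>} \<in> \<FF>}"

definition algebra :: "filter_kind \<Rightarrow> 'a topology \<Rightarrow> ('a set set \<Rightarrow> 'a) \<Rightarrow> bool" where
  "algebra k X a \<longleftrightarrow>
     t0_space X \<and> continuous_map (filter_space k X) X a \<and>
     (\<forall>x\<in>topspace X. a (filter_unit X x) = x) \<and>
     (\<forall>\<FF>\<in>topspace (filter_space k (filter_space k X)).
        a (filter_map (filter_space k X) X a \<FF>) = a (filter_mult k X \<FF>))"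

text \<open>The structures \<open>a\<close> and \<open>b\<close> are unique on the spaces of filters, as the monads are Kock-Zoeberlein.\<close>

definition algebra_hom ::
  "filter_kind \<Rightarrow> 'a topology \<Rightarrow> 'b topology \<Rightarrow> ('a \<Rightarrow> 'b) \<Rightarrow> bool" where
  "algebra_hom k X Y f \<longleftrightarrow>
     continuous_map X Y f \<and>
     (\<exists>a b. algebra k X a \<and> algebra k Y b \<and>
        (\<forall>\<ff>\<in>topspace (filter_space k X). f (a \<ff>) = b (filter_map X Y f \<ff>)))"

definition EM :: "filter_kind \<Rightarrow> ('u topology, 'u \<Rightarrow> 'u) ocat" where
  "EM k = space_category (\<lambda>X. \<exists>a. algebra k X a) (algebra_hom k)"

text \<open>
  The carrier of a free algebra consists of sets of sets, so a free algebra in \<open>EM k\<close> is an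
  isomorphic copy, with points in \<open>'u\<close>, of some \<open>filter_space k Y\<close> with structure \<open>filter_mult k Y\<close>.
\<close>

definition free_algebra :: "filter_kind \<Rightarrow> 'u topology \<Rightarrow> bool" where
  "free_algebra k X \<longleftrightarrow>
     (\<exists>Y :: 'u topology. Y \<in> obj Top0 \<and>
        (\<exists>a h. algebra k X a \<and> homeomorphic_map (filter_space k Y) X h \<and>
           (\<forall>\<FF>\<in>topspace (filter_space k (filter_space k Y)).
              h (filter_mult k Y \<FF>) = a (filter_map (filter_space k Y) X h \<FF>))))"

definition Kleisli :: "filter_kind \<Rightarrow> ('u topology, 'u \<Rightarrow> 'u) ocat" where
  "Kleisli k = full_subcategory (EM k) (free_algebra k)"


section \<open>The category \<open>X\<^sub>a\<^sub>l\<^sub>g\<close>\<close>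

definition sierpinski :: "bool topology" where
  "sierpinski = topology (\<lambda>U. U \<in> {{}, {True}, UNIV})"

definition Hom_S :: "filter_kind \<Rightarrow> 'a topology \<Rightarrow> ('a \<Rightarrow> bool) gorder" where
  "Hom_S k X = \<lparr>
     carrier = {f \<in> extensional (topspace X). algebra_hom k X sierpinski f},
     eq = (=),
     le = (\<lambda>f g. \<forall>x\<in>topspace X. spec_le sierpinski (f x) (g x)) \<rparr>"

definition cotensor_S :: "'i gorder \<Rightarrow> ('i \<Rightarrow> bool) topology" where
  "cotensor_S I = subtopology (product_topology (\<lambda>i. sierpinski) (carrier I))
     {z. \<forall>i\<in>carrier I. \<forall>j\<in>carrier I. i \<sqsubseteq>\<^bsub>I\<^esub> j \<longrightarrow> spec_le sierpinski (z i) (z j)}"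

definition hat :: "filter_kind \<Rightarrow> 'a topology \<Rightarrow> (('a \<Rightarrow> bool) \<Rightarrow> bool) topology" where
  "hat k X = cotensor_S (Hom_S k X)"

definition hat_n :: "filter_kind \<Rightarrow> 'a topology \<Rightarrow> 'a \<Rightarrow> (('a \<Rightarrow> bool) \<Rightarrow> bool)" where
  "hat_n k X x = (\<lambda>f\<in>carrier (Hom_S k X). f x)"

definition hat_alpha ::
  "filter_kind \<Rightarrow> 'a topology \<Rightarrow> (('a \<Rightarrow> bool) \<Rightarrow> bool) \<Rightarrow> ((('a \<Rightarrow> bool) \<Rightarrow> bool) \<Rightarrow> bool) \<Rightarrow> bool" where
  "hat_alpha k X z = (\<lambda>g\<in>carrier (Hom_S k (hat k X)). g z)"

definition hat_beta ::
  "filter_kind \<Rightarrow> 'a topology \<Rightarrow> (('a \<Rightarrow> bool) \<Rightarrow> bool) \<Rightarrow> ((('a \<Rightarrow> bool) \<Rightarrow> bool) \<Rightarrow> bool) \<Rightarrow> bool" where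
  "hat_beta k X z =
     (\<lambda>g\<in>carrier (Hom_S k (hat k X)). z (compose (topspace X) g (hat_n k X)))"

text \<open>
  Equalisers in the category of \<open>T\<^sub>0\<close> spaces. The spaces \<open>Y\<close> and \<open>Z\<close> may live on other types; the
  universal property is tested on the objects of \<open>Top0\<close> over the type of points of \<open>X\<close>.
\<close>

definition is_equaliser ::
  "'u topology \<Rightarrow> 'b topology \<Rightarrow> 'c topology \<Rightarrow> ('u \<Rightarrow> 'b) \<Rightarrow> ('b \<Rightarrow> 'c) \<Rightarrow> ('b \<Rightarrow> 'c) \<Rightarrow> bool" where
  "is_equaliser X Y Z n p q \<longleftrightarrow>
     t0_space X \<and> t0_space Y \<and> t0_space Z \<and>
     continuous_map X Y n \<and> continuous_map Y Z p \<and> continuous_map Y Z q \<and>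
     (\<forall>x\<in>topspace X. p (n x) = q (n x)) \<and>
     (\<forall>(A :: 'u topology) h. A \<in> obj Top0 \<and> continuous_map A Y h \<and>
        (\<forall>w\<in>topspace A. p (h w) = q (h w)) \<longrightarrow>
        (\<exists>!t. t \<in> extensional (topspace A) \<and> continuous_map A X t \<and>
           (\<forall>w\<in>topspace A. n (t w) = h w)))"

definition X_alg :: "filter_kind \<Rightarrow> ('u topology, 'u \<Rightarrow> 'u) ocat" where
  "X_alg k = full_subcategory (EM k) (\<lambda>X.
     is_equaliser X (hat k X) (cotensor_S (Hom_S k (hat k X)))
       (hat_n k X) (hat_alpha k X) (hat_beta k X))"


section \<open>Algebraic domains and spectral spaces\<close>

definition directed_in :: "'a gorder \<Rightarrow> 'a set \<Rightarrow> bool" where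
  "directed_in P D \<longleftrightarrow> D \<subseteq> carrier P \<and> D \<noteq> {} \<and>
     (\<forall>x\<in>D. \<forall>y\<in>D. \<exists>z\<in>D. x \<sqsubseteq>\<^bsub>P\<^esub> z \<and> y \<sqsubseteq>\<^bsub>P\<^esub> z)"

definition directed_complete :: "'a gorder \<Rightarrow> bool" where
  "directed_complete P \<longleftrightarrow> partial_order P \<and> (\<forall>D. directed_in P D \<longrightarrow> (\<exists>s. is_lub P s D))"

definition compact_element :: "'a gorder \<Rightarrow> 'a \<Rightarrow> bool" where
  "compact_element P c \<longleftrightarrow> c \<in> carrier P \<and>
     (\<forall>D s. directed_in P D \<and> is_lub P s D \<and> c \<sqsubseteq>\<^bsub>P\<^esub> s \<longrightarrow> (\<exists>d\<in>D. c \<sqsubseteq>\<^bsub>P\<^esub> d))"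

definition algebraic_domain :: "'a gorder \<Rightarrow> bool" where
  "algebraic_domain P \<longleftrightarrow> directed_complete P \<and>
     (\<forall>x\<in>carrier P. directed_in P {c. compact_element P c \<and> c \<sqsubseteq>\<^bsub>P\<^esub> x} \<and>
        is_lub P x {c. compact_element P c \<and> c \<sqsubseteq>\<^bsub>P\<^esub> x})"

definition algebraic_lattice :: "'a gorder \<Rightarrow> bool" where
  "algebraic_lattice P \<longleftrightarrow> algebraic_domain P \<and> complete_lattice P"

definition bounded_complete :: "'a gorder \<Rightarrow> bool" where
  "bounded_complete P \<longleftrightarrow>
     (\<forall>A. A \<subseteq> carrier P \<and> Upper P A \<noteq> {} \<longrightarrow> (\<exists>s. is_lub P s A))"

definition scott_open :: "'a gorder \<Rightarrow> 'a set \<Rightarrow> bool" where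
  "scott_open P U \<longleftrightarrow> U \<subseteq> carrier P \<and>
     (\<forall>x\<in>U. \<forall>y\<in>carrier P. x \<sqsubseteq>\<^bsub>P\<^esub> y \<longrightarrow> y \<in> U) \<and>
     (\<forall>D s. directed_in P D \<and> is_lub P s D \<and> s \<in> U \<longrightarrow> D \<inter> U \<noteq> {})"

text \<open>
  A poset viewed as a space with its Scott topology has the original order as specialisation order,
  so these spaces are the ones carrying the Scott topology of their own specialisation order.
\<close>

definition scott_space :: "'a topology \<Rightarrow> bool" where
  "scott_space X \<longleftrightarrow> (\<forall>U. openin X U \<longleftrightarrow> scott_open (spec_order X) U)"

definition preserves_directed_sups :: "'a gorder \<Rightarrow> 'b gorder \<Rightarrow> ('a \<Rightarrow> 'b) \<Rightarrow> bool" where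
  "preserves_directed_sups P Q f \<longleftrightarrow>
     (\<forall>D s. directed_in P D \<and> is_lub P s D \<longrightarrow> is_lub Q (f s) (f ` D))"

definition preserves_infs :: "'a gorder \<Rightarrow> 'b gorder \<Rightarrow> ('a \<Rightarrow> 'b) \<Rightarrow> bool" where
  "preserves_infs P Q f \<longleftrightarrow>
     (\<forall>A i. A \<subseteq> carrier P \<and> is_glb P i A \<longrightarrow> is_glb Q (f i) (f ` A))"

definition preserves_nonempty_infs :: "'a gorder \<Rightarrow> 'b gorder \<Rightarrow> ('a \<Rightarrow> 'b) \<Rightarrow> bool" where
  "preserves_nonempty_infs P Q f \<longleftrightarrow>
     (\<forall>A i. A \<subseteq> carrier P \<and> A \<noteq> {} \<and> is_glb P i A \<longrightarrow> is_glb Q (f i) (f ` A))"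

definition ALat :: "('u topology, 'u \<Rightarrow> 'u) ocat" where
  "ALat = space_category
     (\<lambda>X. scott_space X \<and> algebraic_lattice (spec_order X))
     (\<lambda>X Y f. preserves_directed_sups (spec_order X) (spec_order Y) f \<and>
              preserves_infs (spec_order X) (spec_order Y) f)"

definition ADom :: "('u topology, 'u \<Rightarrow> 'u) ocat" where
  "ADom = space_category
     (\<lambda>X. scott_space X \<and> algebraic_domain (spec_order X) \<and> bounded_complete (spec_order X))
     (\<lambda>X Y f. preserves_directed_sups (spec_order X) (spec_order Y) f \<and>
              preserves_nonempty_infs (spec_order X) (spec_order Y) f)"

definition sober_space :: "'a topology \<Rightarrow> bool" where
  "sober_space X \<longleftrightarrow>
     (\<forall>C. closedin X C \<and> C \<noteq> {} \<and>
        (\<forall>A B. closedin X A \<and> closedin X B \<and> C \<subseteq> A \<union> B \<longrightarrow> C \<subseteq> A \<or> C \<subseteq> B) \<longrightarrow>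
        (\<exists>!x. x \<in> topspace X \<and> C = X closure_of {x}))"

definition compact_saturated :: "'a topology \<Rightarrow> 'a set \<Rightarrow> bool" where
  "compact_saturated X K \<longleftrightarrow> compactin X K \<and>
     (\<forall>x\<in>K. \<forall>y\<in>topspace X. spec_le X x y \<longrightarrow> y \<in> K)"

text \<open>
  Local compactness is meant in the sense of a neighbourhood base of compact sets at each point; the
  library's \<open>locally_compact_space\<close> is weaker for spaces that are not Hausdorff. The empty
  intersection of compact saturated sets is the whole space.
\<close>

definition stably_compact_space :: "'a topology \<Rightarrow> bool" where
  "stably_compact_space X \<longleftrightarrow>
     sober_space X \<and> neighbourhood_base_of (compactin X) X \<and>
     (\<forall>\<K>. finite \<K> \<and> (\<forall>K\<in>\<K>. compact_saturated X K) \<longrightarrow> compactin X (topspace X \<inter> \<Inter>\<K>))"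

definition spectral_space :: "'a topology \<Rightarrow> bool" where
  "spectral_space X \<longleftrightarrow> stably_compact_space X \<and>
     openin X = arbitrary union_of (\<lambda>K. openin X K \<and> compactin X K)"

definition spectral_map :: "'a topology \<Rightarrow> 'b topology \<Rightarrow> ('a \<Rightarrow> 'b) \<Rightarrow> bool" where
  "spectral_map X Y f \<longleftrightarrow> continuous_map X Y f \<and>
     (\<forall>K. compact_saturated Y K \<longrightarrow> compactin X {x \<in> topspace X. f x \<in> K})"

definition Spec :: "('u topology, 'u \<Rightarrow> 'u) ocat" where
  "Spec = space_category spectral_space spectral_map"

end

theory Submission
  imports Defs
begin

text \<open>
An object X of the category of algebras is determined, when it lies in the subcategory in
question, by the family of its open sets whose characteristic map is a homomorphism. This family
is a base of X closed under the operations that filters of the given kind preserve (finite meets;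
the empty set in the proper case; binary joins in the prime case), and every filter of that kind in
it is the trace of the neighbourhood filter of a unique point. Conversely such a base makes X an
algebra and consists of all those open sets; in the prime case this uses the prime filter theorem.
Its members are the up-sets of compact elements (and possibly the empty set), respectively the
compact open sets. Homomorphisms between such objects are the maps pulling the families back into
each other, so weighted limits are computed in the ambient category of spaces. Finally X is the
limit, weighted by its family and the square of that family, of a diagram formed by the two-point
space and its square, which are free algebras.
\<close>

section \<open>Filters on families of sets\<close>

text \<open>Three obstacles shape the proof. A weighted limit in the category of algebras or in
  \<open>Top0\<close> is known only by its universal property, so its points, its topology and its
  homomorphic sets must be recovered from that property: the points by testing against a two-point
  space, the topology by factoring the same cone through a second topology on the same set. Next,
  the subcategories competing for the closure are not full, so after the objects the morphisms have
  to be caught as well; each of them is the factorisation of a cone built from legs. Finally, the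
  presenting diagram needs small weights, whereas smallness means cardinality below that of
  \<open>'u\<close>, which is not assumed to be a strong limit. Hence the power set of a space gives
  no bound on its homomorphic sets; instead an infinite space has at most as many of them as points.
  The square enters the diagram because meets and joins are binary; the two projections are among
  its arrows, which makes a leg at the square a pair of legs at the two-point space.\<close>

abbreviation opens :: "'a topology \<Rightarrow> 'a set set" where
  "opens X \<equiv> {U. openin X U}"

text \<open>For \<open>AllFilters\<close> the empty set is not demanded: in an algebra of the filter
  monad the improper filter converges, so the empty set is not homomorphic.\<close>

definition k_closed :: "filter_kind \<Rightarrow> 'a set \<Rightarrow> 'a set set \<Rightarrow> bool" where
  "k_closed k T B \<longleftrightarrow> B \<subseteq> Pow T \<and> T \<in> B \<and> (\<forall>U\<in>B. \<forall>V\<in>B. U \<inter> V \<in> B) \<and>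
     (k \<noteq> AllFilters \<longrightarrow> {} \<in> B) \<and> (k = PrimeFilters \<longrightarrow> (\<forall>U\<in>B. \<forall>V\<in>B. U \<union> V \<in> B))"

definition k_filter :: "filter_kind \<Rightarrow> 'a set \<Rightarrow> 'a set set \<Rightarrow> 'a set set \<Rightarrow> bool" where
  "k_filter k T B F \<longleftrightarrow> F \<subseteq> B \<and> T \<in> F \<and> (\<forall>U\<in>F. \<forall>V\<in>F. U \<inter> V \<in> F) \<and>
     (\<forall>U\<in>F. \<forall>V\<in>B. U \<subseteq> V \<longrightarrow> V \<in> F) \<and> (k \<noteq> AllFilters \<longrightarrow> {} \<notin> F) \<and>
     (k = PrimeFilters \<longrightarrow> (\<forall>U\<in>B. \<forall>V\<in>B. U \<union> V \<in> F \<longrightarrow> U \<in> F \<or> V \<in> F))"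

text \<open>The homomorphic sets of a cotensor or of a weighted limit are accessible only through
  generators, the inverse images along projections or legs. An inductive closure lets statements
  about preimages and filters be checked on generators.\<close>

inductive_set kcl :: "filter_kind \<Rightarrow> 'a set \<Rightarrow> 'a set set \<Rightarrow> 'a set set"
  for k T S where
  kcl_base: "U \<in> S \<Longrightarrow> U \<in> kcl k T S"
| kcl_top: "T \<in> kcl k T S"
| kcl_Int: "U \<in> kcl k T S \<Longrightarrow> V \<in> kcl k T S \<Longrightarrow> U \<inter> V \<in> kcl k T S"
| kcl_empty: "k \<noteq> AllFilters \<Longrightarrow> {} \<in> kcl k T S"
| kcl_Un: "k = PrimeFilters \<Longrightarrow> U \<in> kcl k T S \<Longrightarrow> V \<in> kcl k T S \<Longrightarrow> U \<union> V \<in> kcl k T S"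

lemma k_closed_kcl:
  assumes "S \<subseteq> Pow T"
  shows "k_closed k T (kcl k T S)"
proof -
  have "U \<subseteq> T" if "U \<in> kcl k T S" for U
    using that assms by (induction) auto
  then show ?thesis
    unfolding k_closed_def by (auto intro: kcl.intros)
qed

lemma kcl_least:
  assumes "S \<subseteq> B" "k_closed k T B"
  shows "kcl k T S \<subseteq> B"
proof
  fix U assume "U \<in> kcl k T S"
  then show "U \<in> B"
    by induction (use assms in \<open>auto simp: k_closed_def\<close>)
qed

lemma k_filterD:
  assumes "k_filter k T B F"
  shows k_filter_subset: "F \<subseteq> B"
    and k_filter_top: "T \<in> F"
    and k_filter_Int: "\<And>U V. U \<in> F \<Longrightarrow> V \<in> F \<Longrightarrow> U \<inter> V \<in> F"
    and k_filter_mono: "\<And>U V. U \<in> F \<Longrightarrow> V \<in> B \<Longrightarrow> U \<subseteq> V \<Longrightarrow> V \<in> F"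
    and k_filter_empty: "k \<noteq> AllFilters \<Longrightarrow> {} \<notin> F"
    and k_filter_prime: "\<And>U V. k = PrimeFilters \<Longrightarrow> U \<in> B \<Longrightarrow> V \<in> B \<Longrightarrow> U \<union> V \<in> F \<Longrightarrow> U \<in> F \<or> V \<in> F"
  using assms unfolding k_filter_def by blast+

lemma k_closedD:
  assumes "k_closed k T B"
  shows k_closed_subset: "\<And>U. U \<in> B \<Longrightarrow> U \<subseteq> T"
    and k_closed_top: "T \<in> B"
    and k_closed_Int: "\<And>U V. U \<in> B \<Longrightarrow> V \<in> B \<Longrightarrow> U \<inter> V \<in> B"
    and k_closed_empty: "k \<noteq> AllFilters \<Longrightarrow> {} \<in> B"
    and k_closed_Un: "\<And>U V. k = PrimeFilters \<Longrightarrow> U \<in> B \<Longrightarrow> V \<in> B \<Longrightarrow> U \<union> V \<in> B"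
  using assms unfolding k_closed_def by blast+

lemma k_filter_Int_iff:
  assumes "k_filter k T B F" "U \<in> B" "V \<in> B"
  shows "U \<inter> V \<in> F \<longleftrightarrow> U \<in> F \<and> V \<in> F"
  using assms unfolding k_filter_def by (metis inf_le1 inf_le2)

lemma k_filter_Un_iff:
  assumes "k_filter PrimeFilters T B F" "k_closed PrimeFilters T B" "U \<in> B" "V \<in> B"
  shows "U \<union> V \<in> F \<longleftrightarrow> U \<in> F \<or> V \<in> F"
  using assms unfolding k_filter_def k_closed_def by (metis sup_ge1 sup_ge2)

lemma k_filter_point:
  assumes "x \<in> T" "T \<in> B" "k_closed k T B"
  shows "k_filter k T B {U \<in> B. x \<in> U}"
  using assms unfolding k_filter_def k_closed_def by auto

text \<open>Membership in a filter of the given kind commutes with the operations that build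
  \<open>kcl\<close>, so agreement on generators propagates by induction; primeness turns unions
  into disjunctions.\<close>

lemma k_filter_kcl_eqI:
  assumes S: "S \<subseteq> Pow T"
    and F: "k_filter k T (kcl k T S) F" and G: "k_filter k T (kcl k T S) G"
    and FG: "\<And>U. U \<in> S \<Longrightarrow> U \<in> F \<longleftrightarrow> U \<in> G"
  shows "F = G"
proof -
  have "U \<in> F \<longleftrightarrow> U \<in> G" if "U \<in> kcl k T S" for U
    using that
  proof induction
    case (kcl_Int U V)
    then show ?case using k_filter_Int_iff[OF F] k_filter_Int_iff[OF G] by blast
  next
    case (kcl_Un U V)
    then show ?case
      using k_filter_Un_iff k_closed_kcl[OF S] F G by metis
  qed (use FG F G in \<open>auto simp: k_filter_def\<close>)
  moreover have "F \<subseteq> kcl k T S" "G \<subseteq> kcl k T S"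
    using F G by (auto simp: k_filter_def)
  ultimately show ?thesis by blast
qed

text \<open>Inverse image commutes with all operations concerned. Taking \<open>f\<close> to be the
  identity restricts a filter to a subfamily; taking it to be a leg gives the component of a filter
  on a limit.\<close>

lemma k_filter_vimage:
  assumes F: "k_filter k T B F" and f: "f \<in> T \<rightarrow> T'" and B': "k_closed k T' B'"
    and B: "\<And>V. V \<in> B' \<Longrightarrow> {x \<in> T. f x \<in> V} \<in> B"
  shows "k_filter k T' B' {V \<in> B'. {x \<in> T. f x \<in> V} \<in> F}"
proof -
  have 1: "{x \<in> T. f x \<in> U \<inter> V} = {x \<in> T. f x \<in> U} \<inter> {x \<in> T. f x \<in> V}"
    and 2: "{x \<in> T. f x \<in> U \<union> V} = {x \<in> T. f x \<in> U} \<union> {x \<in> T. f x \<in> V}" for U V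
    by auto
  have 3: "{x \<in> T. f x \<in> T'} = T" using f by auto
  have 4: "{x \<in> T. f x \<in> {}} = {}" by auto
  have 5: "{x \<in> T. f x \<in> V} \<in> F" if "{x \<in> T. f x \<in> U} \<in> F" "U \<subseteq> V" "V \<in> B'" for U V
  proof -
    have "{x \<in> T. f x \<in> U} \<subseteq> {x \<in> T. f x \<in> V}" using that by auto
    then show ?thesis using F that B[of V] unfolding k_filter_def by blast
  qed
  show ?thesis
    unfolding k_filter_def
  proof (intro conjI ballI impI)
    show "T' \<in> {V \<in> B'. {x \<in> T. f x \<in> V} \<in> F}"
      using B' F by (simp add: 3 k_closed_def k_filter_def)
    show "{} \<notin> {V \<in> B'. {x \<in> T. f x \<in> V} \<in> F}" if "k \<noteq> AllFilters"
      using F that by (simp add: k_filter_def)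
  next
    fix U V assume "U \<in> {V \<in> B'. {x \<in> T. f x \<in> V} \<in> F}" "V \<in> {V \<in> B'. {x \<in> T. f x \<in> V} \<in> F}"
    then show "U \<inter> V \<in> {V \<in> B'. {x \<in> T. f x \<in> V} \<in> F}"
      using B' F unfolding mem_Collect_eq 1 by (simp add: k_closed_def k_filter_def)
  next
    fix U V assume "k = PrimeFilters" "U \<in> B'" "V \<in> B'" "U \<union> V \<in> {V \<in> B'. {x \<in> T. f x \<in> V} \<in> F}"
    then show "U \<in> {V \<in> B'. {x \<in> T. f x \<in> V} \<in> F} \<or> V \<in> {V \<in> B'. {x \<in> T. f x \<in> V} \<in> F}"
      using B[of U] B[of V] F unfolding mem_Collect_eq 2 by (simp add: k_filter_def)
  qed (use 5 in auto)
qed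

text \<open>A filter maximal among those that contain \<open>F\<close> and avoid the ideal
  \<open>I\<close> is prime: if it misses \<open>U\<close> and \<open>V\<close>, one of its members
  cuts \<open>U\<close> down below a member of the ideal and another does so for \<open>V\<close>,
  and then \<open>U \<union> V\<close> in the filter would force a member of the ideal into
  it.\<close>

lemma prime_filter_exists:
  assumes B: "k_closed PrimeFilters T B"
    and F: "k_filter AllFilters T B F"
    and I: "I \<subseteq> B" "{} \<in> I" "\<And>U V. U \<in> I \<Longrightarrow> V \<in> I \<Longrightarrow> U \<union> V \<in> I"
      "\<And>U V. U \<in> I \<Longrightarrow> V \<in> B \<Longrightarrow> V \<subseteq> U \<Longrightarrow> V \<in> I"
    and FI: "F \<inter> I = {}"
  obtains P where "k_filter PrimeFilters T B P" "F \<subseteq> P" "P \<inter> I = {}"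
proof -
  let ?A = "{G. k_filter AllFilters T B G \<and> F \<subseteq> G \<and> G \<inter> I = {}}"
  have "\<exists>M\<in>?A. \<forall>X\<in>?A. M \<subseteq> X \<longrightarrow> X = M"
  proof (rule subset_Zorn_nonempty)
    show "?A \<noteq> {}" using F FI by blast
    fix \<C> assume C: "\<C> \<noteq> {}" "subset.chain ?A \<C>"
    then have CA: "\<C> \<subseteq> ?A" and lin: "\<And>X Y. X \<in> \<C> \<Longrightarrow> Y \<in> \<C> \<Longrightarrow> X \<subseteq> Y \<or> Y \<subseteq> X"
      by (auto simp: subset_chain_def)
    have mem: "X \<subseteq> B" "T \<in> X" "F \<subseteq> X" "X \<inter> I = {}"
      "\<And>U V. U \<in> X \<Longrightarrow> V \<in> X \<Longrightarrow> U \<inter> V \<in> X"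
      "\<And>U V. U \<in> X \<Longrightarrow> V \<in> B \<Longrightarrow> U \<subseteq> V \<Longrightarrow> V \<in> X"
      if "X \<in> \<C>" for X
      using CA that by (auto simp: k_filter_def)
    obtain X where X: "X \<in> \<C>" using C(1) by blast
    have "k_filter AllFilters T B (\<Union>\<C>)"
      unfolding k_filter_def
    proof (intro conjI ballI impI)
      show "\<Union>\<C> \<subseteq> B" using mem(1) by blast
      show "T \<in> \<Union>\<C>" using mem(2) X by blast
    next
      fix U V assume "U \<in> \<Union>\<C>" "V \<in> \<Union>\<C>"
      then obtain Y Z where "Y \<in> \<C>" "U \<in> Y" "Z \<in> \<C>" "V \<in> Z" by blast
      then obtain W where "W \<in> \<C>" "U \<in> W" "V \<in> W" using lin[of Y Z] by blast
      then show "U \<inter> V \<in> \<Union>\<C>" using mem(5)[of W U V] by blast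
    next
      fix U V assume "U \<in> \<Union>\<C>" "V \<in> B" "U \<subseteq> V"
      then show "V \<in> \<Union>\<C>" using mem(6) by blast
    qed auto
    moreover have "F \<subseteq> \<Union>\<C>" using mem(3) X by blast
    moreover have "\<Union>\<C> \<inter> I = {}" using mem(4) by blast
    ultimately show "\<Union>\<C> \<in> ?A" by blast
  qed
  then obtain P where PA: "P \<in> ?A" and PM: "\<forall>X\<in>?A. P \<subseteq> X \<longrightarrow> X = P" ..
  have P: "k_filter AllFilters T B P" "F \<subseteq> P" "P \<inter> I = {}"
    using PA by simp_all
  have max: "G = P" if "k_filter AllFilters T B G" "F \<subseteq> G" "G \<inter> I = {}" "P \<subseteq> G" for G
    using PM that by simp
  \<comment> \<open>The filter generated by \<open>P\<close> and \<open>U\<close> is strictly larger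
    than \<open>P\<close>, so maximality forces it to meet the ideal.\<close>
  have ext: "\<exists>m\<in>P. \<exists>i\<in>I. m \<inter> U \<subseteq> i" if U: "U \<in> B" "U \<notin> P" for U
  proof (rule ccontr)
    assume no: "\<not> ?thesis"
    let ?G = "{W \<in> B. \<exists>m\<in>P. m \<inter> U \<subseteq> W}"
    have TB: "T \<in> P" "P \<subseteq> B" "\<And>V W. V \<in> P \<Longrightarrow> W \<in> P \<Longrightarrow> V \<inter> W \<in> P" "T \<in> B"
      "\<And>V W. V \<in> B \<Longrightarrow> W \<in> B \<Longrightarrow> V \<inter> W \<in> B"
      using P B by (auto simp: k_filter_def k_closed_def)
    have "V \<inter> W \<in> ?G" if VW: "V \<in> ?G" "W \<in> ?G" for V W
    proof -
      obtain m m' where "m \<in> P" "m \<inter> U \<subseteq> V" "m' \<in> P" "m' \<inter> U \<subseteq> W" using VW by blast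
      then have "m \<inter> m' \<in> P" "(m \<inter> m') \<inter> U \<subseteq> V \<inter> W" using TB by auto
      moreover have "V \<inter> W \<in> B" using VW TB by simp
      ultimately show ?thesis by blast
    qed
    moreover have "T \<in> ?G" using TB(1,2,4) U B by (auto simp: k_closed_def intro!: bexI[of _ T])
    moreover have "W \<in> ?G" if "V \<in> ?G" "W \<in> B" "V \<subseteq> W" for V W
      using that by blast
    ultimately have G: "k_filter AllFilters T B ?G"
      unfolding k_filter_def by (intro conjI ballI impI) simp_all
    have PG: "P \<subseteq> ?G" using TB by blast
    have "U \<in> ?G" using U TB by blast
    moreover have "?G \<inter> I = {}" using no by blast
    ultimately show False using max[OF G _ _ PG] PG P(2) U by blast
  qed
  have "U \<in> P \<or> V \<in> P" if UV: "U \<in> B" "V \<in> B" "U \<union> V \<in> P" for U V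
  proof (rule ccontr)
    assume "\<not> ?thesis"
    then obtain m i m' i' where m: "m \<in> P" "i \<in> I" "m \<inter> U \<subseteq> i" "m' \<in> P" "i' \<in> I" "m' \<inter> V \<subseteq> i'"
      using ext[OF UV(1)] ext[OF UV(2)] by blast
    then have "m \<inter> m' \<inter> (U \<union> V) \<in> P" using P(1) UV by (simp add: k_filter_def)
    moreover have "m \<inter> m' \<inter> (U \<union> V) \<subseteq> i \<union> i'" using m by blast
    moreover have "i \<union> i' \<in> I" using m I by blast
    ultimately have "i \<union> i' \<in> P" using P(1) subsetD[OF I(1)] unfolding k_filter_def by metis
    then show False using P(3) \<open>i \<union> i' \<in> I\<close> by blast
  qed
  moreover have "{} \<notin> P" using P(3) I(2) by blast
  ultimately have "k_filter PrimeFilters T B P"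
    using P(1) unfolding k_filter_def by simp
  then show thesis using that P(2,3) by simp
qed

section \<open>Spaces of filters\<close>

lemma k_closed_opens: "k_closed k (topspace X) (opens X)"
  by (auto simp: k_closed_def dest: openin_subset)

lemma open_filter_of_kind_iff:
  "open_filter X F \<and> of_kind k X F \<longleftrightarrow> k_filter k (topspace X) (opens X) F"
proof -
  have 1: "F \<subseteq> opens X \<longleftrightarrow> (\<forall>U\<in>F. openin X U)" by blast
  have 2: "(\<forall>V\<in>opens X. P V) \<longleftrightarrow> (\<forall>V. openin X V \<longrightarrow> P V)" for P by simp
  show ?thesis
    unfolding open_filter_def k_filter_def 1 2
    by (cases k) (simp_all only: of_kind.simps filter_kind.distinct simp_thms imp_conjL conj_assoc all_simps(6))
qed

lemma open_filter_iff: "open_filter X F \<longleftrightarrow> k_filter AllFilters (topspace X) (opens X) F"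
  using open_filter_of_kind_iff[of X F AllFilters] by simp

text \<open>A filter contains \<open>A \<inter> B\<close> iff it contains both \<open>A\<close> and
  \<open>B\<close>, so the subbase is closed under binary intersection and is a base; openness
  becomes a pointwise condition.\<close>

lemma openin_all_filter_space:
  "openin (all_filter_space X) W \<longleftrightarrow> W \<subseteq> {F. open_filter X F} \<and>
     (\<forall>F\<in>W. \<exists>A\<in>F. \<forall>G. open_filter X G \<and> A \<in> G \<longrightarrow> G \<in> W)"
proof
  assume "openin (all_filter_space X) W"
  then have "generate_topology_on {{\<ff>. open_filter X \<ff> \<and> A \<in> \<ff>} | A. openin X A} W"
    by (simp add: all_filter_space_def openin_topology_generated_by_iff)
  then show "W \<subseteq> {F. open_filter X F} \<and> (\<forall>F\<in>W. \<exists>A\<in>F. \<forall>G. open_filter X G \<and> A \<in> G \<longrightarrow> G \<in> W)"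
  proof induction
    case (Int a b)
    have "\<exists>A\<in>F. \<forall>G. open_filter X G \<and> A \<in> G \<longrightarrow> G \<in> a \<inter> b" if "F \<in> a \<inter> b" for F
    proof -
      have Fa: "F \<in> a" and Fb: "F \<in> b" using \<open>F \<in> a \<inter> b\<close> by simp_all
      obtain A where A: "A \<in> F" "\<forall>G. open_filter X G \<and> A \<in> G \<longrightarrow> G \<in> a"
        using conjunct2[OF Int.IH(1)] Fa by fast
      obtain A' where A': "A' \<in> F" "\<forall>G. open_filter X G \<and> A' \<in> G \<longrightarrow> G \<in> b"
        using conjunct2[OF Int.IH(2)] Fb by fast
      have F: "open_filter X F" using conjunct1[OF Int.IH(1)] Fa by fast
      then have "A \<inter> A' \<in> F" using A(1) A'(1) by (simp add: open_filter_iff k_filter_Int)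
      moreover have "A \<in> G \<and> A' \<in> G" if "open_filter X G" "A \<inter> A' \<in> G" for G
        using that k_filter_Int_iff[of AllFilters "topspace X" "opens X" G A A'] F A(1) A'(1)
        by (auto simp: open_filter_iff dest: k_filter_subset)
      ultimately show ?thesis using A(2) A'(2) by fast
    qed
    then show ?case using Int.IH by fast
  next
    case (UN K)
    show ?case
    proof (intro conjI ballI)
      show "\<Union>K \<subseteq> {F. open_filter X F}" using UN.IH by fast
      fix F assume "F \<in> \<Union>K"
      then obtain k where "k \<in> K" "F \<in> k" by blast
      then show "\<exists>A\<in>F. \<forall>G. open_filter X G \<and> A \<in> G \<longrightarrow> G \<in> \<Union>K"
        using conjunct2[OF UN.IH[of k]] by fast
    qed
  qed auto
next
  assume R: "W \<subseteq> {F. open_filter X F} \<and> (\<forall>F\<in>W. \<exists>A\<in>F. \<forall>G. open_filter X G \<and> A \<in> G \<longrightarrow> G \<in> W)"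
  have "\<exists>T. openin (all_filter_space X) T \<and> F \<in> T \<and> T \<subseteq> W" if F: "F \<in> W" for F
  proof -
    obtain A where A: "A \<in> F" "\<forall>G. open_filter X G \<and> A \<in> G \<longrightarrow> G \<in> W" using R F by blast
    have "open_filter X F" using conjunct1[OF R] F by fast
    then have "openin X A" using A(1) by (auto simp: open_filter_iff dest: k_filter_subset)
    then have "openin (all_filter_space X) {G. open_filter X G \<and> A \<in> G}"
      unfolding all_filter_space_def by (intro topology_generated_by_Basis) auto
    then show ?thesis using A \<open>open_filter X F\<close> by (intro exI conjI) (assumption, simp, fast)
  qed
  then show "openin (all_filter_space X) W"
    by (subst openin_subopen) blast
qed

lemma topspace_filter_space:
  "topspace (filter_space k X) = {F. k_filter k (topspace X) (opens X) F}"
proof -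
  have "openin (all_filter_space X) {F. open_filter X F}"
    unfolding openin_all_filter_space by (auto simp: open_filter_iff dest: k_filter_top)
  then have 1: "topspace (all_filter_space X) = {F. open_filter X F}"
    by (metis openin_all_filter_space openin_subset openin_topspace subset_antisym)
  show ?thesis
    unfolding filter_space_def topspace_subtopology 1 by (auto simp: open_filter_of_kind_iff[symmetric])
qed

lemma openin_filter_space:
  "openin (filter_space k X) W \<longleftrightarrow> W \<subseteq> topspace (filter_space k X) \<and>
     (\<forall>F\<in>W. \<exists>A\<in>F. \<forall>G\<in>topspace (filter_space k X). A \<in> G \<longrightarrow> G \<in> W)"
  (is "_ \<longleftrightarrow> ?R")
proof -
  have T: "topspace (filter_space k X) = {F. open_filter X F} \<inter> {F. of_kind k X F}"
  proof -
    have "openin (all_filter_space X) {F. open_filter X F}"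
      unfolding openin_all_filter_space by (auto simp: open_filter_iff dest: k_filter_top)
    then have "topspace (all_filter_space X) = {F. open_filter X F}"
      by (metis openin_all_filter_space openin_subset openin_topspace subset_antisym)
    then show ?thesis by (simp add: filter_space_def)
  qed
  show ?thesis
  proof
    assume "openin (filter_space k X) W"
    then obtain V where "openin (all_filter_space X) V" "W = V \<inter> {F. of_kind k X F}"
      by (auto simp: filter_space_def openin_subtopology)
    then show ?R unfolding openin_all_filter_space T by blast
  next
    assume R: ?R
    \<comment> \<open>The union of those basic sets of the space of all filters whose trace on the
      chosen kind lies in \<open>W\<close>.\<close>
    let ?V = "{F. open_filter X F \<and> (\<exists>A\<in>F. \<forall>G\<in>topspace (filter_space k X). A \<in> G \<longrightarrow> G \<in> W)}"
    have "openin (all_filter_space X) ?V"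
      unfolding openin_all_filter_space by blast
    moreover have "W = ?V \<inter> {F. of_kind k X F}" using R T by blast
    ultimately show "openin (filter_space k X) W"
      by (auto simp: filter_space_def openin_subtopology)
  qed
qed

definition sharp :: "filter_kind \<Rightarrow> 'a topology \<Rightarrow> 'a set \<Rightarrow> 'a set set set" where
  "sharp k X A = {F \<in> topspace (filter_space k X). A \<in> F}"

lemma openin_sharp: "openin (filter_space k X) (sharp k X A)"
  unfolding openin_filter_space sharp_def by auto

lemma mem_sharp: "F \<in> sharp k X A \<longleftrightarrow> k_filter k (topspace X) (opens X) F \<and> A \<in> F"
  by (simp add: sharp_def topspace_filter_space)

lemma sharp_topspace: "sharp k X (topspace X) = topspace (filter_space k X)"
  by (auto simp: mem_sharp topspace_filter_space dest: k_filter_top)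

lemma sharp_Int:
  assumes "openin X A" "openin X B"
  shows "sharp k X (A \<inter> B) = sharp k X A \<inter> sharp k X B"
  using k_filter_Int_iff[of k "topspace X" "opens X" _ A B] assms
  by (simp add: set_eq_iff mem_sharp) blast

lemma sharp_empty: "k \<noteq> AllFilters \<Longrightarrow> sharp k X {} = {}"
  by (auto simp: mem_sharp dest: k_filter_empty)

lemma sharp_Un:
  assumes "openin X A" "openin X B"
  shows "sharp PrimeFilters X (A \<union> B) = sharp PrimeFilters X A \<union> sharp PrimeFilters X B"
  using k_filter_Un_iff[of "topspace X" "opens X" _ A B] assms k_closed_opens[of PrimeFilters X]
  by (simp add: set_eq_iff mem_sharp) blast

lemma sharp_mono: "openin X B \<Longrightarrow> A \<subseteq> B \<Longrightarrow> sharp k X A \<subseteq> sharp k X B"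
  by (auto simp: mem_sharp dest: k_filter_mono[where V = B])

lemma filter_mult_eq: "filter_mult k X FF = {A. openin X A \<and> sharp k X A \<in> FF}"
  by (simp add: filter_mult_def sharp_def)

lemma filter_unit_in: "x \<in> topspace X \<Longrightarrow> filter_unit X x \<in> topspace (filter_space k X)"
  unfolding topspace_filter_space filter_unit_def
  using k_filter_point[of x "topspace X" "opens X" k] k_closed_opens by auto

lemma filter_map_in:
  assumes "continuous_map X Y f" "F \<in> topspace (filter_space k X)"
  shows "filter_map X Y f F \<in> topspace (filter_space k Y)"
  using k_filter_vimage[of k "topspace X" "opens X" F f "topspace Y" "opens Y"] assms
  unfolding topspace_filter_space filter_map_def
  by (auto simp: k_closed_opens continuous_map_def)

text \<open>\<open>sharp\<close> preserves the operations that define the kind, so pulling a filter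
  back along it stays within the kind.\<close>

lemma filter_mult_in:
  assumes "FF \<in> topspace (filter_space k (filter_space k X))"
  shows "filter_mult k X FF \<in> topspace (filter_space k X)"
proof -
  let ?Z = "filter_space k X"
  have FF: "k_filter k (topspace ?Z) (opens ?Z) FF"
    using assms unfolding topspace_filter_space[of k ?Z] by (rule CollectD)
  have "k_filter k (topspace X) (opens X) (filter_mult k X FF)"
    unfolding filter_mult_eq k_filter_def
  proof (intro conjI ballI impI)
    show "topspace X \<in> {A. openin X A \<and> sharp k X A \<in> FF}"
      using k_filter_top[OF FF] by (simp add: sharp_topspace)
    show "{} \<notin> {A. openin X A \<and> sharp k X A \<in> FF}" if "k \<noteq> AllFilters"
      using k_filter_empty[OF FF that] by (simp add: sharp_empty[OF that])
  next
    fix U V assume "U \<in> {A. openin X A \<and> sharp k X A \<in> FF}" "V \<in> {A. openin X A \<and> sharp k X A \<in> FF}"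
    then show "U \<inter> V \<in> {A. openin X A \<and> sharp k X A \<in> FF}"
      using k_filter_Int[OF FF] by (simp add: sharp_Int openin_Int)
  next
    fix U V assume "U \<in> {A. openin X A \<and> sharp k X A \<in> FF}" "V \<in> opens X" "U \<subseteq> V"
    then show "V \<in> {A. openin X A \<and> sharp k X A \<in> FF}"
      using k_filter_mono[OF FF _ _ sharp_mono[of X V U k]] by (simp add: openin_sharp)
  next
    fix U V assume "k = PrimeFilters" "U \<in> opens X" "V \<in> opens X"
      "U \<union> V \<in> {A. openin X A \<and> sharp k X A \<in> FF}"
    then show "U \<in> {A. openin X A \<and> sharp k X A \<in> FF} \<or> V \<in> {A. openin X A \<and> sharp k X A \<in> FF}"
      using k_filter_prime[OF FF] by (simp add: sharp_Un openin_sharp)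
  qed auto
  then show ?thesis by (simp add: topspace_filter_space)
qed

section \<open>Algebras\<close>

lemma t0_space_eqI:
  assumes "t0_space X" "x \<in> topspace X" "y \<in> topspace X"
    and "\<And>U. openin X U \<Longrightarrow> x \<in> U \<longleftrightarrow> y \<in> U"
  shows "x = y"
  using assms unfolding t0_space_def by metis

text \<open>
  The next two lemmas say that a continuous retraction \<open>a\<close> of the unit sends a filter \<open>F\<close> to the
  largest point all of whose neighbourhoods belong to \<open>F\<close>.
\<close>

lemma retraction_mem:
  assumes a: "continuous_map (filter_space k X) X a" "\<forall>x\<in>topspace X. a (filter_unit X x) = x"
    and F: "F \<in> topspace (filter_space k X)" and U: "openin X U" "a F \<in> U"
  shows "U \<in> F"
proof -
  have "openin (filter_space k X) {G \<in> topspace (filter_space k X). a G \<in> U}"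
    using a(1) U(1) by (simp add: continuous_map_def)
  then obtain A where A: "A \<in> F" "\<forall>G\<in>topspace (filter_space k X). A \<in> G \<longrightarrow>
      G \<in> {G \<in> topspace (filter_space k X). a G \<in> U}"
    unfolding openin_filter_space using F U(2) by blast
  have k: "k_filter k (topspace X) (opens X) F" using F by (simp add: topspace_filter_space)
  have "openin X A" using k_filter_subset[OF k] A(1) by blast
  have "A \<subseteq> U"
  proof
    fix y assume y: "y \<in> A"
    then have yX: "y \<in> topspace X" using openin_subset[OF \<open>openin X A\<close>] by blast
    have "A \<in> filter_unit X y" using y \<open>openin X A\<close> by (simp add: filter_unit_def)
    then show "y \<in> U" using A(2) filter_unit_in[OF yX, of k] a(2) yX by fastforce
  qed
  then show ?thesis using k_filter_mono[OF k A(1)] U(1) by simp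
qed

lemma retraction_nhd:
  assumes a: "continuous_map (filter_space k X) X a" "\<forall>x\<in>topspace X. a (filter_unit X x) = x"
    and U: "openin X U" "x \<in> U"
  obtains B where "openin X B" "x \<in> B" "\<And>G. G \<in> topspace (filter_space k X) \<Longrightarrow> B \<in> G \<Longrightarrow> a G \<in> U"
proof -
  have x: "x \<in> topspace X" using U openin_subset by blast
  have "openin (filter_space k X) {G \<in> topspace (filter_space k X). a G \<in> U}"
    using a(1) U(1) by (simp add: continuous_map_def)
  moreover have "filter_unit X x \<in> {G \<in> topspace (filter_space k X). a G \<in> U}"
    using filter_unit_in[OF x] a(2) x U(2) by simp
  ultimately obtain B where "B \<in> filter_unit X x" "\<forall>G\<in>topspace (filter_space k X). B \<in> G \<longrightarrow>
      G \<in> {G \<in> topspace (filter_space k X). a G \<in> U}"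
    unfolding openin_filter_space by blast
  then show thesis using that[of B] by (simp add: filter_unit_def)
qed

lemma retraction_largest:
  assumes a: "continuous_map (filter_space k X) X a" "\<forall>x\<in>topspace X. a (filter_unit X x) = x"
    and F: "F \<in> topspace (filter_space k X)" "filter_unit X x \<subseteq> F" and U: "openin X U" "x \<in> U"
  shows "a F \<in> U"
proof -
  obtain B where B: "openin X B" "x \<in> B" "\<And>G. G \<in> topspace (filter_space k X) \<Longrightarrow> B \<in> G \<Longrightarrow> a G \<in> U"
    using retraction_nhd[OF a U] by blast
  then have "B \<in> F" using F(2) by (auto simp: filter_unit_def)
  then show ?thesis using B(3) F(1) by blast
qed

text \<open>
  The associativity law is automatic, as for every Kock-Zoeberlein monad.
\<close>

lemma algebraI:
  assumes t0: "t0_space X"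
    and a: "continuous_map (filter_space k X) X a" "\<forall>x\<in>topspace X. a (filter_unit X x) = x"
  shows "algebra k X a"
  unfolding algebra_def
proof (intro conjI ballI)
  let ?Z = "filter_space k X"
  fix FF assume FF: "FF \<in> topspace (filter_space k ?Z)"
  then have kf: "k_filter k (topspace ?Z) (opens ?Z) FF"
    unfolding topspace_filter_space[of k ?Z] by (rule CollectD)
  let ?x = "a (filter_mult k X FF)" and ?y = "a (filter_map ?Z X a FF)"
  have aopen: "openin ?Z {G \<in> topspace ?Z. a G \<in> A}" if "openin X A" for A
    using a(1) that by (simp add: continuous_map_def)
  have xin: "?x \<in> topspace X" and yin: "?y \<in> topspace X"
    using a(1) filter_mult_in[OF FF] filter_map_in[OF a(1) FF] by (auto simp: continuous_map_def)
  \<comment> \<open>Each of the two values is the largest point whose neighbourhoods belong to its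
    filter. It is therefore enough that the neighbourhoods of either value belong to the filter of
    the other; the axiom T0 then identifies the values.\<close>
  have "filter_unit X ?x \<subseteq> filter_map ?Z X a FF"
  proof
    fix A assume "A \<in> filter_unit X ?x"
    then have A: "openin X A" "?x \<in> A" by (auto simp: filter_unit_def)
    obtain B where B: "openin X B" "?x \<in> B" "\<And>G. G \<in> topspace ?Z \<Longrightarrow> B \<in> G \<Longrightarrow> a G \<in> A"
      using retraction_nhd[OF a A] by blast
    have "sharp k X B \<in> FF"
      using retraction_mem[OF a filter_mult_in[OF FF] B(1,2)] by (simp add: filter_mult_eq)
    moreover have "sharp k X B \<subseteq> {G \<in> topspace ?Z. a G \<in> A}"
      using B(3) by (auto simp: sharp_def)
    ultimately have "{G \<in> topspace ?Z. a G \<in> A} \<in> FF"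
      using k_filter_mono[OF kf] aopen[OF A(1)] by simp
    then show "A \<in> filter_map ?Z X a FF" using A by (simp add: filter_map_def)
  qed
  then have xy: "?y \<in> A" if "openin X A" "?x \<in> A" for A
    using retraction_largest[OF a filter_map_in[OF a(1) FF]] that by blast
  have "filter_unit X ?y \<subseteq> filter_mult k X FF"
  proof
    fix A assume "A \<in> filter_unit X ?y"
    then have A: "openin X A" "?y \<in> A" by (auto simp: filter_unit_def)
    have "{G \<in> topspace ?Z. a G \<in> A} \<in> FF"
      using retraction_mem[OF a filter_map_in[OF a(1) FF] A] by (simp add: filter_map_def)
    moreover have "{G \<in> topspace ?Z. a G \<in> A} \<subseteq> sharp k X A"
      using retraction_mem[OF a _ A(1)] by (auto simp: sharp_def)
    ultimately have "sharp k X A \<in> FF"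
      using k_filter_mono[OF kf] openin_sharp[of k X A] by simp
    then show "A \<in> filter_mult k X FF" using A by (simp add: filter_mult_eq)
  qed
  then have "?x \<in> A" if "openin X A" "?y \<in> A" for A
    using retraction_largest[OF a filter_mult_in[OF FF]] that by blast
  then show "?y = ?x"
    using t0_space_eqI[OF t0 yin xin] xy by blast
qed (use t0 a in auto)

lemma algebraD:
  assumes "algebra k X a"
  shows algebra_t0: "t0_space X"
    and algebra_continuous: "continuous_map (filter_space k X) X a"
    and algebra_unit: "\<forall>x\<in>topspace X. a (filter_unit X x) = x"
  using assms by (simp_all add: algebra_def)

lemma algebra_in:
  "algebra k X a \<Longrightarrow> k_filter k (topspace X) (opens X) F \<Longrightarrow> a F \<in> topspace X"
  using algebra_continuous[of k X a] by (auto simp: continuous_map_def topspace_filter_space)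

lemma algebra_mem:
  assumes "algebra k X a" "k_filter k (topspace X) (opens X) F" "openin X U" "a F \<in> U"
  shows "U \<in> F"
  using retraction_mem[OF algebra_continuous[OF assms(1)] algebra_unit[OF assms(1)]] assms(2-)
  by (simp add: topspace_filter_space)

lemma algebra_largest:
  assumes "algebra k X a" "k_filter k (topspace X) (opens X) F" "filter_unit X x \<subseteq> F"
    "openin X U" "x \<in> U"
  shows "a F \<in> U"
  using retraction_largest[OF algebra_continuous[OF assms(1)] algebra_unit[OF assms(1)]] assms(2-)
  by (simp add: topspace_filter_space)

text \<open>The largest point whose neighbourhoods all belong to \<open>F\<close> is described
  without reference to a structure map.\<close>

lemma algebra_unique:
  assumes a: "algebra k X a" and b: "algebra k X b" and F: "k_filter k (topspace X) (opens X) F"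
  shows "a F = b F"
proof (rule t0_space_eqI[OF algebra_t0[OF a] algebra_in[OF a F] algebra_in[OF b F]])
  fix U assume U: "openin X U"
  have "filter_unit X (a F) \<subseteq> F" "filter_unit X (b F) \<subseteq> F"
    using algebra_mem[OF a F] algebra_mem[OF b F] by (auto simp: filter_unit_def)
  then show "a F \<in> U \<longleftrightarrow> b F \<in> U"
    using algebra_largest[OF a F _ U] algebra_largest[OF b F _ U] by blast
qed

section \<open>Homomorphic open sets\<close>

text \<open>
  \<open>KO k X\<close> consists of the open sets whose characteristic map to the Sierpinski space is a
  homomorphism of algebras.
\<close>

definition KO :: "filter_kind \<Rightarrow> 'a topology \<Rightarrow> 'a set set" where
  "KO k X = {U. openin X U \<and>
     (\<exists>a. algebra k X a \<and> (\<forall>F. k_filter k (topspace X) (opens X) F \<longrightarrow> (a F \<in> U \<longleftrightarrow> U \<in> F)))}"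

lemma KO_iff:
  assumes "algebra k X a"
  shows "U \<in> KO k X \<longleftrightarrow>
     openin X U \<and> (\<forall>F. k_filter k (topspace X) (opens X) F \<longrightarrow> (a F \<in> U \<longleftrightarrow> U \<in> F))"
    (is "_ \<longleftrightarrow> ?R")
proof
  assume "U \<in> KO k X"
  then obtain b where b: "algebra k X b" and o: "openin X U"
    and bU: "\<forall>F. k_filter k (topspace X) (opens X) F \<longrightarrow> (b F \<in> U \<longleftrightarrow> U \<in> F)"
    unfolding KO_def by blast
  then show ?R using algebra_unique[OF assms b] by simp
next
  assume ?R
  then show "U \<in> KO k X" using assms by (simp add: KO_def) blast
qed

lemma KO_openin: "U \<in> KO k X \<Longrightarrow> openin X U"
  by (simp add: KO_def)

text \<open>For a homomorphic \<open>U\<close> the limit of a filter lies in \<open>U\<close> iff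
  \<open>U\<close> belongs to the filter, and filters of the given kind respect exactly these
  operations.\<close>

lemma k_closed_KO:
  assumes a: "algebra k X a"
  shows "k_closed k (topspace X) (KO k X)"
  unfolding k_closed_def
proof (intro conjI ballI impI)
  show "KO k X \<subseteq> Pow (topspace X)"
    using openin_subset by (auto simp: KO_def)
  show "topspace X \<in> KO k X"
    by (auto simp: KO_iff[OF a] algebra_in[OF a] dest: k_filter_top)
  show "{} \<in> KO k X" if "k \<noteq> AllFilters"
    using that by (auto simp: KO_iff[OF a] dest: k_filter_empty)
next
  fix U V assume "U \<in> KO k X" "V \<in> KO k X"
  then show "U \<inter> V \<in> KO k X"
    using k_filter_Int_iff[of k "topspace X" "opens X" _ U V] by (auto simp: KO_iff[OF a])
next
  fix U V assume "k = PrimeFilters" "U \<in> KO k X" "V \<in> KO k X"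
  then show "U \<union> V \<in> KO k X"
    using k_filter_Un_iff[of "topspace X" "opens X" _ U V] k_closed_opens[of k X]
    unfolding KO_iff[OF a] by (simp add: openin_Un)
qed

definition is_base :: "'a topology \<Rightarrow> 'a set set \<Rightarrow> bool" where
  "is_base X B \<longleftrightarrow> (\<forall>U\<in>B. openin X U) \<and>
     (\<forall>W x. openin X W \<and> x \<in> W \<longrightarrow> (\<exists>U\<in>B. x \<in> U \<and> U \<subseteq> W))"

lemma is_base_openin: "is_base X B \<Longrightarrow> U \<in> B \<Longrightarrow> openin X U"
  by (simp add: is_base_def)

lemma is_baseE:
  assumes "is_base X B" "openin X W" "x \<in> W"
  obtains U where "U \<in> B" "x \<in> U" "U \<subseteq> W"
  using assms unfolding is_base_def by meson

lemma is_base_mem_mono: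
  assumes "is_base X B" "openin X W" "x \<in> W" and xy: "\<And>U. U \<in> B \<Longrightarrow> x \<in> U \<Longrightarrow> y \<in> U"
  shows "y \<in> W"
proof -
  obtain U where "U \<in> B" "x \<in> U" "U \<subseteq> W" using is_baseE[OF assms(1-3)] .
  then show ?thesis using xy[of U] by (simp add: subsetD)
qed

lemma is_base_t0_eqI:
  assumes "is_base X B" "t0_space X" "x \<in> topspace X" "y \<in> topspace X"
    and xy: "\<And>U. U \<in> B \<Longrightarrow> x \<in> U \<longleftrightarrow> y \<in> U"
  shows "x = y"
proof (rule t0_space_eqI[OF assms(2-4)])
  fix U assume U: "openin X U"
  show "x \<in> U \<longleftrightarrow> y \<in> U"
    using is_base_mem_mono[OF assms(1) U, of x y] is_base_mem_mono[OF assms(1) U, of y x] xy by metis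
qed

lemma is_base_spec_le:
  assumes "is_base X B"
  shows "spec_le X x y \<longleftrightarrow> (\<forall>U\<in>B. x \<in> U \<longrightarrow> y \<in> U)"
  using is_base_mem_mono[OF assms, of _ x y] is_base_openin[OF assms] unfolding spec_le_def by metis

lemma is_base_continuous_map:
  assumes B: "is_base Y B" and f: "f \<in> topspace X \<rightarrow> topspace Y"
    and o: "\<And>V. V \<in> B \<Longrightarrow> openin X {x \<in> topspace X. f x \<in> V}"
  shows "continuous_map X Y f"
  unfolding continuous_map_def
proof (intro conjI allI impI)
  fix W assume W: "openin Y W"
  show "openin X {x \<in> topspace X. f x \<in> W}"
  proof (subst openin_subopen, intro ballI)
    fix x assume x: "x \<in> {x \<in> topspace X. f x \<in> W}"
    then obtain V where "V \<in> B" "f x \<in> V" "V \<subseteq> W" using is_baseE[OF B W] by blast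
    then show "\<exists>T. openin X T \<and> x \<in> T \<and> T \<subseteq> {x \<in> topspace X. f x \<in> W}"
      using o[of V] x by (intro exI[of _ "{x \<in> topspace X. f x \<in> V}"]) auto
  qed
qed (rule f)

lemma algebra_hom_KO:
  assumes f: "algebra_hom k X Y f" and V: "V \<in> KO k Y"
  shows "{x \<in> topspace X. f x \<in> V} \<in> KO k X"
proof -
  obtain a b where a: "algebra k X a" and b: "algebra k Y b" and c: "continuous_map X Y f"
    and ab: "\<And>F. F \<in> topspace (filter_space k X) \<Longrightarrow> f (a F) = b (filter_map X Y f F)"
    using f unfolding algebra_hom_def by blast
  have o: "openin Y V" using V by (rule KO_openin)
  show ?thesis
    unfolding KO_iff[OF a]
  proof (intro conjI allI impI)
    show "openin X {x \<in> topspace X. f x \<in> V}" using c o by (simp add: continuous_map_def)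
    fix F assume F: "k_filter k (topspace X) (opens X) F"
    then have F': "F \<in> topspace (filter_space k X)" by (simp add: topspace_filter_space)
    have "f (a F) \<in> V \<longleftrightarrow> V \<in> filter_map X Y f F"
      using ab[OF F'] V filter_map_in[OF c F'] unfolding KO_iff[OF b] topspace_filter_space by simp
    then show "a F \<in> {x \<in> topspace X. f x \<in> V} \<longleftrightarrow> {x \<in> topspace X. f x \<in> V} \<in> F"
      using algebra_in[OF a F] o by (simp add: filter_map_def)
  qed
qed

text \<open>Both sides of the homomorphism equation lie in the same homomorphic sets of
  \<open>Y\<close>, since either membership says that the inverse image of the set belongs to the
  filter. Only \<open>Y\<close> must have a base of such sets; \<open>X\<close> ranges over all
  algebras.\<close>

lemma algebra_homI:
  assumes a: "algebra k X a" and b: "algebra k Y b" and base: "is_base Y (KO k Y)"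
    and f: "f \<in> topspace X \<rightarrow> topspace Y"
    and fV: "\<And>V. V \<in> KO k Y \<Longrightarrow> {x \<in> topspace X. f x \<in> V} \<in> KO k X"
  shows "algebra_hom k X Y f"
  unfolding algebra_hom_def
proof (intro conjI exI ballI)
  show c: "continuous_map X Y f"
    using is_base_continuous_map[OF base f] fV KO_openin by blast
  show "algebra k X a" "algebra k Y b" by fact+
  fix F assume F': "F \<in> topspace (filter_space k X)"
  then have F: "k_filter k (topspace X) (opens X) F" by (simp add: topspace_filter_space)
  have G: "k_filter k (topspace Y) (opens Y) (filter_map X Y f F)"
    using filter_map_in[OF c F'] by (simp add: topspace_filter_space)
  show "f (a F) = b (filter_map X Y f F)"
  proof (rule is_base_t0_eqI[OF base algebra_t0[OF b]])
    show "f (a F) \<in> topspace Y" using f algebra_in[OF a F] by blast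
    show "b (filter_map X Y f F) \<in> topspace Y" using algebra_in[OF b G] .
    fix V assume V: "V \<in> KO k Y"
    have "f (a F) \<in> V \<longleftrightarrow> {x \<in> topspace X. f x \<in> V} \<in> F"
      using fV[OF V] F algebra_in[OF a F] unfolding KO_iff[OF a] by auto
    also have "\<dots> \<longleftrightarrow> V \<in> filter_map X Y f F"
      using KO_openin[OF V] by (simp add: filter_map_def)
    also have "\<dots> \<longleftrightarrow> b (filter_map X Y f F) \<in> V"
      using V G unfolding KO_iff[OF b] by blast
    finally show "f (a F) \<in> V \<longleftrightarrow> b (filter_map X Y f F) \<in> V" .
  qed
qed

section \<open>Spaces presented by their homomorphic open sets\<close>

text \<open>The last clause says that the filters in \<open>B\<close> are the traces of points; in a
  T0 space the point is unique because \<open>B\<close> is a base. For prime filters this is the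
  pointwise form of Stone duality.\<close>

definition kbasis :: "filter_kind \<Rightarrow> 'a topology \<Rightarrow> 'a set set \<Rightarrow> bool" where
  "kbasis k X B \<longleftrightarrow> is_base X B \<and> k_closed k (topspace X) B \<and>
     (\<forall>F. k_filter k (topspace X) B F \<longrightarrow> (\<exists>x\<in>topspace X. F = {U \<in> B. x \<in> U}))"

lemma k_filter_restrict:
  assumes F: "k_filter k T B F" and B': "k_closed k T B'" "B' \<subseteq> B"
  shows "k_filter k T B' (F \<inter> B')"
proof -
  have "{x \<in> T. x \<in> V} = V" if "V \<in> B'" for V using k_closed_subset[OF B'(1) that] by blast
  moreover from this have "F \<inter> B' = {V \<in> B'. {x \<in> T. x \<in> V} \<in> F}" by auto
  ultimately show ?thesis
    using k_filter_vimage[OF F, of "\<lambda>x. x" T B'] B' by (simp add: subset_iff)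
qed

text \<open>The structure map sends a filter \<open>F\<close> to the point that realises the trace
  \<open>F \<inter> B\<close>. The inverse image of a basic \<open>V\<close> is then
  \<open>sharp k X V\<close>, whence continuity.\<close>

lemma kbasis_algebra:
  assumes t0: "t0_space X" and B: "kbasis k X B"
  obtains a where "algebra k X a"
    "\<And>F U. k_filter k (topspace X) (opens X) F \<Longrightarrow> U \<in> B \<Longrightarrow> a F \<in> U \<longleftrightarrow> U \<in> F"
proof -
  have base: "is_base X B" and cl: "k_closed k (topspace X) B"
    and real: "\<And>F. k_filter k (topspace X) B F \<Longrightarrow> \<exists>x\<in>topspace X. F = {U \<in> B. x \<in> U}"
    using B by (auto simp: kbasis_def)
  have Bo: "B \<subseteq> opens X" using is_base_openin[OF base] by blast
  define a where "a F = (SOME x. x \<in> topspace X \<and> F \<inter> B = {U \<in> B. x \<in> U})" for F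
  have a: "a F \<in> topspace X \<and> F \<inter> B = {U \<in> B. a F \<in> U}"
    if "k_filter k (topspace X) (opens X) F" for F
  proof -
    have "\<exists>x. x \<in> topspace X \<and> F \<inter> B = {U \<in> B. x \<in> U}"
      using real[OF k_filter_restrict[OF that cl Bo]] by (simp add: Bex_def)
    then show ?thesis unfolding a_def by (rule someI_ex)
  qed
  have aU: "a F \<in> U \<longleftrightarrow> U \<in> F" if "k_filter k (topspace X) (opens X) F" "U \<in> B" for F U
  proof -
    have "U \<in> F \<inter> B \<longleftrightarrow> U \<in> {U \<in> B. a F \<in> U}" using a[OF that(1)] by simp
    then show ?thesis using that(2) by simp
  qed
  have "algebra k X a"
  proof (rule algebraI[OF t0])
    show "continuous_map (filter_space k X) X a"
    proof (rule is_base_continuous_map[OF base])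
      show "a \<in> topspace (filter_space k X) \<rightarrow> topspace X"
        using a by (auto simp: topspace_filter_space)
      fix V assume "V \<in> B"
      then have "{F \<in> topspace (filter_space k X). a F \<in> V} = sharp k X V"
        using aU by (auto simp: mem_sharp topspace_filter_space)
      then show "openin (filter_space k X) {F \<in> topspace (filter_space k X). a F \<in> V}"
        by (simp add: openin_sharp)
    qed
    show "\<forall>x\<in>topspace X. a (filter_unit X x) = x"
    proof
      fix x assume x: "x \<in> topspace X"
      have F: "k_filter k (topspace X) (opens X) (filter_unit X x)"
        using filter_unit_in[OF x] by (simp add: topspace_filter_space)
      show "a (filter_unit X x) = x"
      proof (rule is_base_t0_eqI[OF base t0 _ x])
        show "a (filter_unit X x) \<in> topspace X" using a[OF F] by simp
        show "a (filter_unit X x) \<in> U \<longleftrightarrow> x \<in> U" if "U \<in> B" for U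
          using aU[OF F that] Bo that by (auto simp: filter_unit_def)
      qed
    qed
  qed
  then show thesis using that aU by blast
qed

lemma principal_k_filter:
  assumes "openin X U" "k = AllFilters \<or> k = ProperFilters \<and> U \<noteq> {}"
  shows "k_filter k (topspace X) (opens X) {V. openin X V \<and> U \<subseteq> V}"
  using assms openin_subset[OF assms(1)] unfolding k_filter_def by auto

lemma kbasis_KO:
  assumes t0: "t0_space X" and B: "kbasis k X B"
  shows "KO k X = B"
proof -
  obtain a where a: "algebra k X a"
    and aU: "\<And>F U. k_filter k (topspace X) (opens X) F \<Longrightarrow> U \<in> B \<Longrightarrow> a F \<in> U \<longleftrightarrow> U \<in> F"
    using kbasis_algebra[OF t0 B] by blast
  have base: "is_base X B" and cl: "k_closed k (topspace X) B"
    using B by (auto simp: kbasis_def)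
  have Bo: "B \<subseteq> opens X" using is_base_openin[OF base] by blast
  have "U \<in> B" if U: "U \<in> KO k X" for U
  proof -
    have Uo: "openin X U" using U by (rule KO_openin)
    have UF: "a F \<in> U" if "k_filter k (topspace X) (opens X) F" "U \<in> F" for F
      using U that unfolding KO_iff[OF a] by blast
    show ?thesis
    proof (cases "k = PrimeFilters")
      case False
      show ?thesis
      proof (cases "k = AllFilters \<or> U \<noteq> {}")
        case True
        let ?F = "{V. openin X V \<and> U \<subseteq> V}"
        have F: "k_filter k (topspace X) (opens X) ?F"
          using principal_k_filter[OF Uo] True False by (cases k) auto
        have "a ?F \<in> U" using UF[OF F] Uo by simp
        then obtain V where V: "V \<in> B" "a ?F \<in> V" "V \<subseteq> U" using is_baseE[OF base Uo] by blast
        then have "U \<subseteq> V" using aU[OF F V(1)] by simp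
        then show ?thesis using V by (simp add: subset_antisym)
      next
        case F: False
        then show ?thesis using k_closed_empty[OF cl] by simp
      qed
    next
      case True
      show ?thesis
      proof (rule ccontr)
        assume no: "U \<notin> B"
        \<comment> \<open>If \<open>U\<close> is not basic, it is not below any basic subset of
          itself, so its principal filter misses this ideal. A prime filter separating the two would
          converge into \<open>U\<close> and hence contain a basic subset of \<open>U\<close>, which
          is in the ideal.\<close>
        let ?I = "{W. openin X W \<and> (\<exists>V\<in>B. W \<subseteq> V \<and> V \<subseteq> U)}" and ?F = "{V. openin X V \<and> U \<subseteq> V}"
        have "{} \<in> ?I" using k_closed_empty[OF cl] True by auto
        moreover have "V \<union> W \<in> ?I" if "V \<in> ?I" "W \<in> ?I" for V W
        proof -
          obtain V' W' where "V' \<in> B" "W' \<in> B" "V \<subseteq> V'" "W \<subseteq> W'" "V' \<subseteq> U" "W' \<subseteq> U"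
            using \<open>V \<in> ?I\<close> \<open>W \<in> ?I\<close> by blast
          moreover from this have "V' \<union> W' \<in> B" using k_closed_Un[OF cl True] by simp
          ultimately show ?thesis using that by (intro CollectI conjI bexI[of _ "V' \<union> W'"]) auto
        qed
        moreover have "?F \<inter> ?I = {}"
        proof -
          have False if "U \<subseteq> W" "W \<subseteq> V" "V \<subseteq> U" "V \<in> B" for V W
            using no that by (metis subset_antisym subset_trans)
          then show ?thesis by blast
        qed
        ultimately obtain P where P: "k_filter PrimeFilters (topspace X) (opens X) P" "?F \<subseteq> P" "P \<inter> ?I = {}"
        proof (rule_tac prime_filter_exists[OF k_closed_opens[of PrimeFilters X] principal_k_filter[OF Uo], of ?I])
          show "?I \<subseteq> opens X" by blast
          show "V \<in> ?I" if "U' \<in> ?I" "V \<in> opens X" "V \<subseteq> U'" for U' V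
            using that by auto
        qed auto
        have "U \<in> P" using P(2) Uo by blast
        then have "a P \<in> U" using UF P(1) True by simp
        then obtain V where V: "V \<in> B" "a P \<in> V" "V \<subseteq> U" using is_baseE[OF base Uo] by blast
        then have "V \<in> P" using aU[of P V] P(1) True by simp
        then show False using P(3) V Bo by blast
      qed
    qed
  qed
  moreover have "U \<in> KO k X" if "U \<in> B" for U
    using that Bo aU unfolding KO_iff[OF a] by blast
  ultimately show ?thesis by blast
qed

text \<open>A filter \<open>G\<close> of homomorphic sets is extended to a filter of open sets with
  the same homomorphic members; the limit of the extension realises \<open>G\<close>. The upward
  closure of \<open>G\<close> serves, except for prime filters, where it need not be prime.\<close>

lemma kbasis_KO_self:
  assumes a: "algebra k X a" and base: "is_base X (KO k X)"
  shows "kbasis k X (KO k X)"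
  unfolding kbasis_def
proof (intro conjI allI impI)
  show "is_base X (KO k X)" by fact
  show cl: "k_closed k (topspace X) (KO k X)" using k_closed_KO[OF a] .
  fix G assume G: "k_filter k (topspace X) (KO k X) G"
  let ?F = "{V. openin X V \<and> (\<exists>U\<in>G. U \<subseteq> V)}"
  have GK: "G \<subseteq> KO k X" using k_filter_subset[OF G] .
  have F0: "k_filter AllFilters (topspace X) (opens X) ?F"
    unfolding k_filter_def
  proof (intro conjI ballI impI)
    show "topspace X \<in> ?F" using k_filter_top[OF G] by auto
    fix U V assume "U \<in> ?F" "V \<in> ?F"
    then obtain U' V' where "U' \<in> G" "V' \<in> G" "U' \<subseteq> U" "V' \<subseteq> V" by blast
    then have "U' \<inter> V' \<in> G" "U' \<inter> V' \<subseteq> U \<inter> V" using k_filter_Int[OF G] by auto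
    then show "U \<inter> V \<in> ?F" using \<open>U \<in> ?F\<close> \<open>V \<in> ?F\<close> by auto
  next
    fix U V assume "U \<in> ?F" "V \<in> opens X" "U \<subseteq> V"
    then show "V \<in> ?F" by auto
  qed auto
  have FG: "V \<in> ?F \<longleftrightarrow> V \<in> G" if "V \<in> KO k X" for V
    using k_filter_mono[OF G _ that] that KO_openin by auto
  have "\<exists>P. k_filter k (topspace X) (opens X) P \<and> (\<forall>V\<in>KO k X. V \<in> P \<longleftrightarrow> V \<in> G)"
  proof (cases "k = PrimeFilters")
    case False
    have "{} \<notin> ?F" if "k \<noteq> AllFilters"
      using k_filter_empty[OF G that] by auto
    then have "k_filter k (topspace X) (opens X) ?F"
      using F0 False unfolding k_filter_def by simp
    then show ?thesis using FG by (intro exI[of _ ?F]) simp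
  next
    case True
    \<comment> \<open>The ideal generated by the homomorphic sets outside \<open>G\<close>; it is
      closed under unions because \<open>G\<close> is prime. A prime filter avoiding it acquires no
      new homomorphic member.\<close>
    let ?I = "{W. openin X W \<and> (\<exists>V\<in>KO k X - G. W \<subseteq> V)}"
    have e: "{} \<in> ?I"
      using k_closed_empty[OF cl] k_filter_empty[OF G] True by (intro CollectI conjI bexI[of _ "{}"]) auto
    have u: "V \<union> W \<in> ?I" if "V \<in> ?I" "W \<in> ?I" for V W
    proof -
      obtain V' W' where VW: "V' \<in> KO k X - G" "W' \<in> KO k X - G" "V \<subseteq> V'" "W \<subseteq> W'"
        using \<open>V \<in> ?I\<close> \<open>W \<in> ?I\<close> by blast
      then have "V' \<union> W' \<in> KO k X - G"
        using k_closed_Un[OF cl True, of V' W'] k_filter_prime[OF G True, of V' W'] by blast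
      then show ?thesis using VW that by (intro CollectI conjI bexI[of _ "V' \<union> W'"]) auto
    qed
    have d: "?F \<inter> ?I = {}"
    proof -
      have False if "U \<in> G" "U \<subseteq> W" "W \<subseteq> V" "V \<in> KO k X - G" for U V W
        using k_filter_mono[OF G that(1), of V] that by blast
      then show ?thesis by blast
    qed
    obtain P where P: "k_filter PrimeFilters (topspace X) (opens X) P" "?F \<subseteq> P" "P \<inter> ?I = {}"
    proof (rule prime_filter_exists[OF k_closed_opens[of PrimeFilters X] F0 _ e u _ d])
      show "?I \<subseteq> opens X" by blast
      show "V \<in> ?I" if "U \<in> ?I" "V \<in> opens X" "V \<subseteq> U" for U V
        using that by auto
    qed blast
    have "V \<in> P \<longleftrightarrow> V \<in> G" if "V \<in> KO k X" for V
    proof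
      assume "V \<in> G" then show "V \<in> P" using FG[OF that] P(2) by blast
    next
      assume V: "V \<in> P"
      show "V \<in> G"
      proof (rule ccontr)
        assume "V \<notin> G"
        then have "V \<in> ?I" using that KO_openin[OF that] by blast
        then show False using V P(3) by blast
      qed
    qed
    then show ?thesis using P(1) True by auto
  qed
  then obtain P where P: "k_filter k (topspace X) (opens X) P" "\<And>V. V \<in> KO k X \<Longrightarrow> V \<in> P \<longleftrightarrow> V \<in> G"
    by blast
  have "V \<in> G \<longleftrightarrow> a P \<in> V" if "V \<in> KO k X" for V
    using P(2)[OF that] that P(1) unfolding KO_iff[OF a] by simp
  then have "G = {U \<in> KO k X. a P \<in> U}" using GK by blast
  then show "\<exists>x\<in>topspace X. G = {U \<in> KO k X. x \<in> U}"
    using algebra_in[OF a P(1)] by blast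
qed

section \<open>Bases and topologies given by generators\<close>

lemma is_base_kcl:
  assumes S: "\<And>U. U \<in> S \<Longrightarrow> openin X U"
    and nb: "\<And>W x. openin X W \<Longrightarrow> x \<in> W \<Longrightarrow> \<exists>U\<in>kcl k (topspace X) S. x \<in> U \<and> U \<subseteq> W"
  shows "is_base X (kcl k (topspace X) S)"
proof -
  have "openin X U" if "U \<in> kcl k (topspace X) S" for U
    using that by induction (simp_all add: S openin_Int openin_Un)
  then show ?thesis using nb by (simp add: is_base_def)
qed

text \<open>A filter and the trace of a point that agree on the generators agree everywhere, so only
  the generators have to be realised.\<close>

lemma kbasis_kclI:
  assumes base: "is_base X (kcl k (topspace X) S)"
    and real: "\<And>F. k_filter k (topspace X) (kcl k (topspace X) S) F \<Longrightarrow>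
                 \<exists>x\<in>topspace X. \<forall>U\<in>S. x \<in> U \<longleftrightarrow> U \<in> F"
  shows "kbasis k X (kcl k (topspace X) S)"
proof -
  have S: "S \<subseteq> Pow (topspace X)"
    using is_base_openin[OF base kcl_base] openin_subset by blast
  have cl: "k_closed k (topspace X) (kcl k (topspace X) S)" using k_closed_kcl[OF S] .
  have "\<exists>x\<in>topspace X. F = {U \<in> kcl k (topspace X) S. x \<in> U}"
    if F: "k_filter k (topspace X) (kcl k (topspace X) S) F" for F
  proof -
    obtain x where x: "x \<in> topspace X" "\<forall>U\<in>S. x \<in> U \<longleftrightarrow> U \<in> F" using real[OF F] by blast
    have "F = {U \<in> kcl k (topspace X) S. x \<in> U}"
    proof (rule k_filter_kcl_eqI[OF S F])
      show "k_filter k (topspace X) (kcl k (topspace X) S) {U \<in> kcl k (topspace X) S. x \<in> U}"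
        using k_filter_point[OF x(1) kcl_top cl] .
    qed (use x kcl_base[of _ S k "topspace X"] in auto)
    then show ?thesis using x(1) by blast
  qed
  then show ?thesis using base cl by (simp add: kbasis_def)
qed

lemma kcl_vimage:
  assumes B: "k_closed k T B" and f: "f \<in> T \<rightarrow> T'" and S: "\<And>V. V \<in> S \<Longrightarrow> {x \<in> T. f x \<in> V} \<in> B"
    and V: "V \<in> kcl k T' S"
  shows "{x \<in> T. f x \<in> V} \<in> B"
  using V
proof induction
  case kcl_top
  have "{x \<in> T. f x \<in> T'} = T" using f by auto
  then show ?case using k_closed_top[OF B] by simp
next
  case (kcl_Int U V)
  have "{x \<in> T. f x \<in> U \<inter> V} = {x \<in> T. f x \<in> U} \<inter> {x \<in> T. f x \<in> V}" by auto
  then show ?case using k_closed_Int[OF B] kcl_Int by simp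
next
  case (kcl_Un U V)
  have "{x \<in> T. f x \<in> U \<union> V} = {x \<in> T. f x \<in> U} \<union> {x \<in> T. f x \<in> V}" by auto
  then show ?case using k_closed_Un[OF B] kcl_Un by simp
qed (use S k_closed_empty[OF B] in simp_all)

lemma is_base_kcl_continuous_map:
  assumes B: "is_base Y (kcl k (topspace Y) S)" and f: "f \<in> topspace X \<rightarrow> topspace Y"
    and o: "\<And>V. V \<in> S \<Longrightarrow> openin X {x \<in> topspace X. f x \<in> V}"
  shows "continuous_map X Y f"
proof (rule is_base_continuous_map[OF B f])
  fix V assume "V \<in> kcl k (topspace Y) S"
  then have "{x \<in> topspace X. f x \<in> V} \<in> opens X"
    by (rule kcl_vimage[OF k_closed_opens[of k X] f, rotated]) (simp add: o)
  then show "openin X {x \<in> topspace X. f x \<in> V}" by simp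
qed

text \<open>Adding \<open>T\<close> to the subbase keeps all of \<open>T\<close> as underlying set
  even if \<open>S\<close> does not cover it. This allows a given set of points in \<open>'u\<close>
  to be given another topology.\<close>

definition generated_topology :: "'a set \<Rightarrow> 'a set set \<Rightarrow> 'a topology" where
  "generated_topology T S = topology_generated_by (insert T S)"

lemma topspace_generated_topology: "S \<subseteq> Pow T \<Longrightarrow> topspace (generated_topology T S) = T"
  by (auto simp: generated_topology_def)

lemma openin_generated_topology: "U \<in> S \<Longrightarrow> openin (generated_topology T S) U"
  by (simp add: generated_topology_def topology_generated_by_Basis)

lemma is_base_generated_topology:
  assumes S: "S \<subseteq> Pow T"
  shows "is_base (generated_topology T S) (kcl k T S)"
proof -
  have "\<exists>U\<in>kcl k T S. x \<in> U \<and> U \<subseteq> W" if "openin (generated_topology T S) W" "x \<in> W" for W x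
  proof -
    have "generate_topology_on (insert T S) W"
      using that by (simp add: generated_topology_def openin_topology_generated_by_iff)
    then show ?thesis using \<open>x \<in> W\<close>
    proof (induction arbitrary: x)
      case (Int a b)
      obtain U V where "U \<in> kcl k T S" "x \<in> U" "U \<subseteq> a" "V \<in> kcl k T S" "x \<in> V" "V \<subseteq> b"
        using Int.IH(1)[of x] Int.IH(2)[of x] Int.prems by auto
      then show ?case by (intro bexI[of _ "U \<inter> V"] conjI kcl_Int) auto
    next
      case (UN K)
      then obtain a where a: "a \<in> K" "x \<in> a" by blast
      then obtain U where "U \<in> kcl k T S" "x \<in> U" "U \<subseteq> a" using UN.IH[OF a] by blast
      then show ?case using a(1) by (intro bexI[of _ U]) auto
    next
      case (Basis s)
      then show ?case by (intro bexI[of _ s]) (auto intro: kcl_base kcl_top)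
    qed simp
  qed
  then have "is_base (generated_topology T S) (kcl k (topspace (generated_topology T S)) S)"
    by (intro is_base_kcl openin_generated_topology)
      (simp_all add: topspace_generated_topology[OF S])
  then show ?thesis by (simp add: topspace_generated_topology[OF S])
qed

text \<open>The objects of \<open>X_alg\<close> without the size condition and without reference to
  \<open>hat\<close>; in this form it applies to cotensors too, whose points need not lie in
  \<open>'u\<close>.\<close>

definition alg_space :: "filter_kind \<Rightarrow> 'a topology \<Rightarrow> bool" where
  "alg_space k X \<longleftrightarrow> t0_space X \<and> kbasis k X (KO k X)"

lemma alg_spaceI:
  assumes "t0_space X" "kbasis k X B"
  shows "alg_space k X" "KO k X = B"
  using kbasis_KO[OF assms] assms by (simp_all add: alg_space_def)

lemma alg_spaceD:
  assumes "alg_space k X"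
  shows alg_space_t0: "t0_space X"
    and alg_space_kbasis: "kbasis k X (KO k X)"
    and alg_space_base: "is_base X (KO k X)"
    and alg_space_closed: "k_closed k (topspace X) (KO k X)"
    and alg_space_point: "\<And>F. k_filter k (topspace X) (KO k X) F \<Longrightarrow>
      \<exists>x\<in>topspace X. F = {U \<in> KO k X. x \<in> U}"
  using assms by (simp_all add: alg_space_def kbasis_def)

lemma alg_space_algebra: "alg_space k X \<Longrightarrow> \<exists>a. algebra k X a"
  using kbasis_algebra[of X k "KO k X"] unfolding alg_space_def by metis

text \<open>In an algebra the closure properties and the realisation of filters hold for the
  homomorphic sets once these form a base.\<close>

lemma alg_space_iff: "alg_space k X \<longleftrightarrow> (\<exists>a. algebra k X a) \<and> is_base X (KO k X)"
  using alg_space_algebra[of k X] alg_space_base[of k X] kbasis_KO_self[of k X] algebra_t0[of k X]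
  unfolding alg_space_def by metis

lemma algebra_hom_iff:
  assumes X: "\<exists>a. algebra k X a" and Y: "alg_space k Y" and S: "KO k Y = kcl k (topspace Y) S"
  shows "algebra_hom k X Y f \<longleftrightarrow> f \<in> topspace X \<rightarrow> topspace Y \<and>
    (\<forall>V\<in>S. {x \<in> topspace X. f x \<in> V} \<in> KO k X)"
proof -
  obtain a b where a: "algebra k X a" and b: "algebra k Y b"
    using X alg_space_algebra[OF Y] by blast
  have "algebra_hom k X Y f \<Longrightarrow> f \<in> topspace X \<rightarrow> topspace Y"
    by (simp add: algebra_hom_def continuous_map_def)
  then show ?thesis
    using algebra_hom_KO[of k X Y f] kcl_base[of _ S k "topspace Y"]
      algebra_homI[OF a b alg_space_base[OF Y], of f] kcl_vimage[OF k_closed_KO[OF a], of f "topspace Y" S]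
    unfolding S by blast
qed

lemma kcl_eq_self: "k_closed k T B \<Longrightarrow> kcl k T B = B"
  using kcl_least[of B B k T] kcl_base by blast

lemma algebra_hom_iff_KO:
  assumes "\<exists>a. algebra k X a" "alg_space k Y"
  shows "algebra_hom k X Y f \<longleftrightarrow> f \<in> topspace X \<rightarrow> topspace Y \<and>
    (\<forall>V\<in>KO k Y. {x \<in> topspace X. f x \<in> V} \<in> KO k X)"
  using algebra_hom_iff[OF assms, of "KO k Y"] kcl_eq_self[OF alg_space_closed[OF assms(2)]] by simp

section \<open>Sierpinski space and its cotensors\<close>

lemma openin_sierpinski: "openin sierpinski U \<longleftrightarrow> U \<in> {{}, {True}, UNIV}"
proof -
  have "istopology (\<lambda>U. U \<in> {{}, {True}, UNIV})"
    unfolding istopology_def by (auto simp: subset_iff)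
  then show ?thesis by (simp add: sierpinski_def)
qed

lemma topspace_sierpinski: "topspace sierpinski = UNIV"
  using openin_sierpinski openin_subset by (metis insertI1 insertI2 top.extremum_uniqueI)

lemma spec_le_sierpinski: "spec_le sierpinski b c \<longleftrightarrow> (b \<longrightarrow> c)"
  by (auto simp: spec_le_def openin_sierpinski)

lemma t0_sierpinski: "t0_space sierpinski"
  unfolding t0_space_def openin_sierpinski by auto

lemma kbasis_sierpinski: "kbasis k sierpinski (kcl k UNIV {{True}})"
proof -
  have "is_base sierpinski (kcl k (topspace sierpinski) {{True}})"
  proof (rule is_base_kcl)
    fix W and x :: bool assume "openin sierpinski W" "x \<in> W"
    then have "W = {True} \<or> W = UNIV" by (auto simp: openin_sierpinski)
    then show "\<exists>U\<in>kcl k (topspace sierpinski) {{True}}. x \<in> U \<and> U \<subseteq> W"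
      using \<open>x \<in> W\<close> kcl_base[of "{True}" "{{True}}"] kcl_top[of UNIV k "{{True}}"]
      by (auto simp: topspace_sierpinski)
  qed (simp add: openin_sierpinski)
  moreover have "\<exists>x\<in>topspace sierpinski. \<forall>U\<in>{{True}}. x \<in> U \<longleftrightarrow> U \<in> F" for F
    by (simp add: topspace_sierpinski)
  ultimately have "kbasis k sierpinski (kcl k (topspace sierpinski) {{True}})"
    by (rule kbasis_kclI)
  then show ?thesis by (simp add: topspace_sierpinski)
qed

lemma alg_space_sierpinski: "alg_space k sierpinski" "KO k sierpinski = kcl k UNIV {{True}}"
  using alg_spaceI[OF t0_sierpinski kbasis_sierpinski] .

lemma carrier_Hom_S:
  assumes "\<exists>a. algebra k X a"
  shows "f \<in> carrier (Hom_S k X) \<longleftrightarrow>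
    f \<in> extensional (topspace X) \<and> {x \<in> topspace X. f x} \<in> KO k X"
  using algebra_hom_iff[OF assms alg_space_sierpinski(1), of "{{True}}" f]
  by (simp add: alg_space_sierpinski(2) topspace_sierpinski Hom_S_def)

definition proj_set :: "'i gorder \<Rightarrow> 'i \<Rightarrow> ('i \<Rightarrow> bool) set" where
  "proj_set I i = {z \<in> topspace (cotensor_S I). z i}"

lemma topspace_cotensor_S:
  "topspace (cotensor_S I) = {z \<in> extensional (carrier I).
     \<forall>i\<in>carrier I. \<forall>j\<in>carrier I. i \<sqsubseteq>\<^bsub>I\<^esub> j \<longrightarrow> z i \<longrightarrow> z j}"
  by (auto simp: cotensor_S_def topspace_sierpinski spec_le_sierpinski PiE_def)

text \<open>The only open set of the Sierpinski space that is neither empty nor full is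
  \<open>{True}\<close>, so finite intersections of the sets \<open>proj_set I i\<close> form a
  base. A filter \<open>F\<close> is realised by the family of truth values of
  \<open>proj_set I i \<in> F\<close>, which is monotone because \<open>F\<close> is upward
  closed.\<close>

lemma t0_cotensor_S: "t0_space (cotensor_S I)"
  and kbasis_cotensor_S:
    "kbasis k (cotensor_S I) (kcl k (topspace (cotensor_S I)) (proj_set I ` carrier I))"
proof -
  let ?C = "cotensor_S I" and ?P = "proj_set I"
  let ?K = "kcl k (topspace ?C) (?P ` carrier I)"
  have Po: "openin ?C (?P i)" if "i \<in> carrier I" for i
  proof -
    have "continuous_map ?C sierpinski (\<lambda>z. z i)"
      unfolding cotensor_S_def
      by (intro continuous_map_from_subtopology continuous_map_product_projection that)
    then have "openin ?C {z \<in> topspace ?C. z i \<in> {True}}"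
      by (rule openin_continuous_map_preimage) (simp add: openin_sierpinski)
    then show ?thesis by (simp add: proj_set_def)
  qed
  show "t0_space ?C"
    unfolding t0_space_def
  proof (intro ballI impI)
    fix y z assume yz: "y \<in> topspace ?C" "z \<in> topspace ?C" "y \<noteq> z"
    then obtain i where "i \<in> carrier I" "y i \<noteq> z i"
      using extensionalityI[of y "carrier I" z] unfolding topspace_cotensor_S by blast
    then show "\<exists>U. openin ?C U \<and> (y \<notin> U) = (z \<in> U)"
      using Po[of i] yz by (intro exI[of _ "?P i"]) (auto simp: proj_set_def)
  qed
  have base: "is_base ?C ?K"
  proof (rule is_base_kcl)
    fix W z assume W: "openin ?C W" "z \<in> W"
    then have zT: "z \<in> topspace ?C" using openin_subset by blast
    obtain V where V: "openin (product_topology (\<lambda>i. sierpinski) (carrier I)) V" "W = V \<inter> topspace ?C"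
    proof -
      have "openin (subtopology (product_topology (\<lambda>i. sierpinski) (carrier I))
         {z. \<forall>i\<in>carrier I. \<forall>j\<in>carrier I. i \<sqsubseteq>\<^bsub>I\<^esub> j \<longrightarrow> spec_le sierpinski (z i) (z j)}) W"
        using W(1) unfolding cotensor_S_def .
      then obtain V where "openin (product_topology (\<lambda>i. sierpinski) (carrier I)) V"
        "W = V \<inter> {z. \<forall>i\<in>carrier I. \<forall>j\<in>carrier I. i \<sqsubseteq>\<^bsub>I\<^esub> j \<longrightarrow> spec_le sierpinski (z i) (z j)}"
        unfolding openin_subtopology by blast
      moreover from this have "W = V \<inter> topspace ?C"
        using openin_subset[of "product_topology (\<lambda>i. sierpinski) (carrier I)" V]
        unfolding cotensor_S_def topspace_subtopology by blast
      ultimately show thesis using that by blast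
    qed
    have "z \<in> V" using W(2) V(2) by simp
    then obtain U where U: "finite {i \<in> carrier I. U i \<noteq> topspace sierpinski}"
      "\<forall>i\<in>carrier I. openin sierpinski (U i)" "z \<in> Pi\<^sub>E (carrier I) U" "Pi\<^sub>E (carrier I) U \<subseteq> V"
      using V(1)[unfolded openin_product_topology_alt] by meson
    \<comment> \<open>The coordinates that the basic box really restricts; at these the factor is
      \<open>{True}\<close>, as it contains \<open>z i\<close> and is not everything.\<close>
    let ?J = "{i \<in> carrier I. U i \<noteq> UNIV}"
    have UT: "U i = {True}" if "i \<in> ?J" for i
      using that U(2,3) unfolding openin_sierpinski by (auto simp: PiE_iff)
    have fin: "finite ?J" using U(1) by (simp add: topspace_sierpinski)
    have "topspace ?C \<inter> (\<Inter>i\<in>J. ?P i) \<in> ?K" if "finite J" "J \<subseteq> carrier I" for J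
      using that
    proof (induction J)
      case (insert i J)
      have "topspace ?C \<inter> (\<Inter>j\<in>insert i J. ?P j) = ?P i \<inter> (topspace ?C \<inter> (\<Inter>j\<in>J. ?P j))" by auto
      also have "\<dots> \<in> ?K"
        using kcl_Int[OF kcl_base insert.IH] insert.prems by simp
      finally show ?case .
    qed (simp add: kcl_top)
    then have "topspace ?C \<inter> (\<Inter>i\<in>?J. ?P i) \<in> ?K" using fin by blast
    moreover have "z \<in> topspace ?C \<inter> (\<Inter>i\<in>?J. ?P i)"
    proof -
      have "z i" if "i \<in> ?J" for i using U(3) UT[OF that] that by (auto simp: PiE_iff)
      then show ?thesis using zT by (auto simp: proj_set_def)
    qed
    moreover have "topspace ?C \<inter> (\<Inter>i\<in>?J. ?P i) \<subseteq> W"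
    proof
      fix y assume y: "y \<in> topspace ?C \<inter> (\<Inter>i\<in>?J. ?P i)"
      have "y i \<in> U i" if "i \<in> carrier I" for i
        using y that UT[of i] by (cases "i \<in> ?J") (auto simp: proj_set_def)
      moreover have "y \<in> extensional (carrier I)" using y by (simp add: topspace_cotensor_S)
      ultimately have "y \<in> Pi\<^sub>E (carrier I) U" by (simp add: PiE_iff)
      then show "y \<in> W" using U(4) V(2) y by blast
    qed
    ultimately show "\<exists>U\<in>?K. z \<in> U \<and> U \<subseteq> W"
      by (intro bexI[of _ "topspace ?C \<inter> (\<Inter>i\<in>?J. ?P i)"] conjI)
  qed (use Po in auto)
  show "kbasis k ?C ?K"
  proof (rule kbasis_kclI[OF base])
    fix F assume F: "k_filter k (topspace ?C) ?K F"
    define z where "z = (\<lambda>i\<in>carrier I. ?P i \<in> F)"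
    have zT: "z \<in> topspace ?C"
    proof -
      have "?P j \<in> F" if ij: "i \<in> carrier I" "j \<in> carrier I" "i \<sqsubseteq>\<^bsub>I\<^esub> j" "?P i \<in> F" for i j
      proof (rule k_filter_mono[OF F ij(4)])
        show "?P j \<in> ?K" using ij by (auto intro: kcl_base)
        show "?P i \<subseteq> ?P j" using ij by (auto simp: proj_set_def topspace_cotensor_S)
      qed
      then show ?thesis by (auto simp: topspace_cotensor_S z_def)
    qed
    then show "\<exists>x\<in>topspace ?C. \<forall>U\<in>?P ` carrier I. x \<in> U \<longleftrightarrow> U \<in> F"
      by (intro bexI[of _ z]) (auto simp: proj_set_def z_def)
  qed
qed

lemma alg_space_cotensor_S: "alg_space k (cotensor_S I)"
  and KO_cotensor_S: "KO k (cotensor_S I) = kcl k (topspace (cotensor_S I)) (proj_set I ` carrier I)"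
  using alg_spaceI[OF t0_cotensor_S kbasis_cotensor_S] by simp_all

lemma continuous_map_cotensor_S:
  assumes "\<And>x. x \<in> topspace X \<Longrightarrow> f x \<in> topspace (cotensor_S I)"
    and "\<And>i. i \<in> carrier I \<Longrightarrow> openin X {x \<in> topspace X. f x i}"
  shows "continuous_map X (cotensor_S I) f"
proof (rule is_base_kcl_continuous_map)
  show "is_base (cotensor_S I) (kcl AllFilters (topspace (cotensor_S I)) (proj_set I ` carrier I))"
    using kbasis_cotensor_S unfolding kbasis_def by blast
  show "openin X {x \<in> topspace X. f x \<in> V}" if "V \<in> proj_set I ` carrier I" for V
  proof -
    obtain i where "i \<in> carrier I" "V = proj_set I i"
      using \<open>V \<in> proj_set I ` carrier I\<close> by blast
    then have "{x \<in> topspace X. f x \<in> V} = {x \<in> topspace X. f x i}"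
      using assms(1) by (auto simp: proj_set_def)
    then show ?thesis using assms(2) \<open>i \<in> carrier I\<close> by simp
  qed
qed (use assms(1) in auto)

section \<open>The objects of the category of algebraic spaces\<close>

definition ind :: "'a topology \<Rightarrow> 'a set \<Rightarrow> 'a \<Rightarrow> bool" where
  "ind X U = (\<lambda>x\<in>topspace X. x \<in> U)"

lemma Collect_ind: "openin X U \<Longrightarrow> {x \<in> topspace X. ind X U x} = U"
  using openin_subset by (auto simp: ind_def)

lemma ind_Collect: "f \<in> extensional (topspace X) \<Longrightarrow> ind X {x \<in> topspace X. f x} = f"
  by (rule extensionalityI[of _ "topspace X"]) (simp_all add: ind_def)

lemma le_Hom_S: "f \<sqsubseteq>\<^bsub>Hom_S k X\<^esub> g \<longleftrightarrow> (\<forall>x\<in>topspace X. f x \<longrightarrow> g x)"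
  by (simp add: Hom_S_def spec_le_sierpinski)

lemma ind_in_Hom_S:
  assumes "\<exists>a. algebra k X a" "U \<in> KO k X"
  shows "ind X U \<in> carrier (Hom_S k X)"
  using Collect_ind[OF KO_openin[OF assms(2)]] assms(2)
  by (simp add: carrier_Hom_S[OF assms(1)] ind_def)

lemma hat_algebra: "\<exists>a. algebra k (hat k X) a"
  unfolding hat_def using alg_space_algebra[OF alg_space_cotensor_S] .

lemma topspace_hat:
  "topspace (hat k X) = {z \<in> extensional (carrier (Hom_S k X)).
     \<forall>f\<in>carrier (Hom_S k X). \<forall>g\<in>carrier (Hom_S k X).
       (\<forall>x\<in>topspace X. f x \<longrightarrow> g x) \<longrightarrow> z f \<longrightarrow> z g}"
  unfolding hat_def topspace_cotensor_S le_Hom_S ..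

lemma hat_mono:
  assumes "z \<in> topspace (hat k X)" "f \<in> carrier (Hom_S k X)" "g \<in> carrier (Hom_S k X)"
    "\<forall>x\<in>topspace X. f x \<longrightarrow> g x" "z f"
  shows "z g"
proof -
  have "\<forall>f\<in>carrier (Hom_S k X). \<forall>g\<in>carrier (Hom_S k X).
       (\<forall>x\<in>topspace X. f x \<longrightarrow> g x) \<longrightarrow> z f \<longrightarrow> z g"
    using assms(1) unfolding topspace_hat by (elim CollectE conjE)
  then show ?thesis using assms(2-) by simp
qed

lemma KO_hat:
  assumes "f \<in> carrier (Hom_S k X)"
  shows "{z \<in> topspace (hat k X). z f} \<in> KO k (hat k X)"
  unfolding hat_def KO_cotensor_S using assms by (intro kcl_base) (auto simp: proj_set_def)

lemma hat_n_in: "x \<in> topspace X \<Longrightarrow> hat_n k X x \<in> topspace (hat k X)"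
  by (simp add: topspace_hat hat_n_def)

lemma algebra_hom_hat_n:
  assumes X: "\<exists>a. algebra k X a"
  shows "algebra_hom k X (hat k X) (hat_n k X)"
proof -
  have "{x \<in> topspace X. hat_n k X x \<in> V} \<in> KO k X"
    if "V \<in> proj_set (Hom_S k X) ` carrier (Hom_S k X)" for V
  proof -
    obtain f where f: "f \<in> carrier (Hom_S k X)" "V = proj_set (Hom_S k X) f"
      using \<open>V \<in> _\<close> by blast
    then have "{x \<in> topspace X. hat_n k X x \<in> V} = {x \<in> topspace X. f x}"
      using hat_n_in[of _ X k] by (auto simp: proj_set_def hat_def hat_n_def)
    then show ?thesis using f(1) by (simp add: carrier_Hom_S[OF X])
  qed
  then show ?thesis
    unfolding hat_def algebra_hom_iff[OF X alg_space_cotensor_S KO_cotensor_S]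
    using hat_n_in[of _ X k] by (auto simp: hat_def)
qed

lemma Hom_S_compose_hat_n:
  assumes X: "\<exists>a. algebra k X a" and g: "g \<in> carrier (Hom_S k (hat k X))"
  shows "compose (topspace X) g (hat_n k X) \<in> carrier (Hom_S k X)"
proof -
  have "{z \<in> topspace (hat k X). g z} \<in> KO k (hat k X)"
    using g by (simp add: carrier_Hom_S[OF hat_algebra])
  then have "{x \<in> topspace X. hat_n k X x \<in> {z \<in> topspace (hat k X). g z}} \<in> KO k X"
    by (rule algebra_hom_KO[OF algebra_hom_hat_n[OF X]])
  moreover have "{x \<in> topspace X. hat_n k X x \<in> {z \<in> topspace (hat k X). g z}} =
      {x \<in> topspace X. compose (topspace X) g (hat_n k X) x}"
    by (intro Collect_cong conj_cong refl) (simp add: compose_eq hat_n_in)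
  ultimately show ?thesis by (simp add: carrier_Hom_S[OF X])
qed

lemma hat_alpha_eq_iff:
  "hat_alpha k X z = hat_beta k X z \<longleftrightarrow>
     (\<forall>g\<in>carrier (Hom_S k (hat k X)). g z = z (compose (topspace X) g (hat_n k X)))"
    (is "?l \<longleftrightarrow> ?r")
proof
  assume ?l
  show ?r
  proof
    fix g assume "g \<in> carrier (Hom_S k (hat k X))"
    moreover have "hat_alpha k X z g = hat_beta k X z g" using \<open>?l\<close> by simp
    ultimately show "g z = z (compose (topspace X) g (hat_n k X))"
      by (simp add: hat_alpha_def hat_beta_def)
  qed
next
  assume ?r
  then show ?l unfolding hat_alpha_def hat_beta_def by (intro restrict_ext) blast
qed

lemma hat_alpha_n:
  assumes X: "\<exists>a. algebra k X a" and x: "x \<in> topspace X"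
  shows "hat_alpha k X (hat_n k X x) = hat_beta k X (hat_n k X x)"
  unfolding hat_alpha_eq_iff
proof
  fix g assume g: "g \<in> carrier (Hom_S k (hat k X))"
  show "g (hat_n k X x) = hat_n k X x (compose (topspace X) g (hat_n k X))"
    using Hom_S_compose_hat_n[OF X g] x by (simp add: hat_n_def[of k X x] compose_eq)
qed

lemma continuous_hat_alpha:
  "continuous_map (hat k X) (cotensor_S (Hom_S k (hat k X))) (hat_alpha k X)"
proof (rule continuous_map_cotensor_S)
  fix z assume "z \<in> topspace (hat k X)"
  then show "hat_alpha k X z \<in> topspace (cotensor_S (Hom_S k (hat k X)))"
    by (simp add: topspace_cotensor_S hat_alpha_def le_Hom_S)
next
  fix g assume g: "g \<in> carrier (Hom_S k (hat k X))"
  then have "openin (hat k X) {z \<in> topspace (hat k X). g z}"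
    using carrier_Hom_S[OF hat_algebra] KO_openin by blast
  then show "openin (hat k X) {z \<in> topspace (hat k X). hat_alpha k X z g}"
    using g by (simp add: hat_alpha_def)
qed

lemma continuous_hat_beta:
  assumes X: "\<exists>a. algebra k X a"
  shows "continuous_map (hat k X) (cotensor_S (Hom_S k (hat k X))) (hat_beta k X)"
proof (rule continuous_map_cotensor_S)
  fix z assume z: "z \<in> topspace (hat k X)"
  have "z (compose (topspace X) h (hat_n k X))"
    if gh: "g \<in> carrier (Hom_S k (hat k X))" "h \<in> carrier (Hom_S k (hat k X))"
      "\<forall>x\<in>topspace (hat k X). g x \<longrightarrow> h x" "z (compose (topspace X) g (hat_n k X))" for g h
  proof -
    have "\<forall>x\<in>topspace X. compose (topspace X) g (hat_n k X) x \<longrightarrow> compose (topspace X) h (hat_n k X) x"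
      using gh(3) hat_n_in[of _ X k] by (simp add: compose_eq)
    then show ?thesis
      using hat_mono[OF z Hom_S_compose_hat_n[OF X gh(1)] Hom_S_compose_hat_n[OF X gh(2)]] gh(4)
      by simp
  qed
  then show "hat_beta k X z \<in> topspace (cotensor_S (Hom_S k (hat k X)))"
    by (simp add: topspace_cotensor_S hat_beta_def le_Hom_S)
next
  fix g assume g: "g \<in> carrier (Hom_S k (hat k X))"
  have "openin (hat k X) {z \<in> topspace (hat k X). z (compose (topspace X) g (hat_n k X))}"
    using KO_openin[OF KO_hat[OF Hom_S_compose_hat_n[OF X g]]] .
  then show "openin (hat k X) {z \<in> topspace (hat k X). hat_beta k X z g}"
    using g by (simp add: hat_beta_def)
qed

text \<open>For an equalised \<open>z\<close> the sets \<open>U\<close> with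
  \<open>z (ind X U)\<close> form a filter: the sets \<open>?P U\<close> of \<open>hat k X\<close>
  meet and join along \<open>hat_n\<close> as the sets \<open>U\<close> do in \<open>X\<close>, and
  \<open>z\<close> cannot tell apart what agrees along \<open>hat_n\<close>. The point realising
  this filter is sent to \<open>z\<close>.\<close>

lemma hat_equalised_point:
  assumes X: "alg_space k X" and z: "z \<in> topspace (hat k X)"
    and ab: "hat_alpha k X z = hat_beta k X z"
  shows "\<exists>x\<in>topspace X. hat_n k X x = z"
proof -
  have Xa: "\<exists>a. algebra k X a" using alg_space_algebra[OF X] .
  have cl: "k_closed k (topspace X) (KO k X)" using alg_space_closed[OF X] .
  have clh: "k_closed k (topspace (hat k X)) (KO k (hat k X))"
    unfolding hat_def using alg_space_closed[OF alg_space_cotensor_S] .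
  let ?P = "\<lambda>U. {z \<in> topspace (hat k X). z (ind X U)}"
  have PK: "?P U \<in> KO k (hat k X)" if "U \<in> KO k X" for U
    using KO_hat[OF ind_in_Hom_S[OF Xa that]] .
  have nP: "hat_n k X x \<in> ?P U \<longleftrightarrow> x \<in> U" if "U \<in> KO k X" "x \<in> topspace X" for U x
    using hat_n_in[OF that(2)] ind_in_Hom_S[OF Xa that(1)] that(2) by (simp add: hat_n_def ind_def)
  \<comment> \<open>This is the equaliser condition at the characteristic map of \<open>B\<close>,
    whose composite with \<open>hat_n\<close> is that of \<open>U\<close>.\<close>
  have key: "z \<in> B \<longleftrightarrow> z (ind X U)"
    if B: "B \<in> KO k (hat k X)" and U: "\<And>x. x \<in> topspace X \<Longrightarrow> hat_n k X x \<in> B \<longleftrightarrow> x \<in> U" for B U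
  proof -
    have "ind (hat k X) B \<in> carrier (Hom_S k (hat k X))" using ind_in_Hom_S[OF hat_algebra B] .
    then have "ind (hat k X) B z = z (compose (topspace X) (ind (hat k X) B) (hat_n k X))"
      using ab unfolding hat_alpha_eq_iff by blast
    moreover have "compose (topspace X) (ind (hat k X) B) (hat_n k X) = ind X U"
      using U hat_n_in[of _ X k]
      by (intro extensionalityI[of _ "topspace X"]) (simp_all add: compose_eq ind_def)
    ultimately show ?thesis using z by (simp add: ind_def)
  qed
  have zmono: "z (ind X V)" if "z (ind X U)" "U \<in> KO k X" "V \<in> KO k X" "U \<subseteq> V" for U V
  proof -
    have "\<forall>x\<in>topspace X. ind X U x \<longrightarrow> ind X V x" using that(4) by (auto simp: ind_def)
    then show ?thesis
      using hat_mono[OF z ind_in_Hom_S[OF Xa that(2)] ind_in_Hom_S[OF Xa that(3)]] that(1) by simp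
  qed
  let ?G = "{U \<in> KO k X. z (ind X U)}"
  have "k_filter k (topspace X) (KO k X) ?G"
    unfolding k_filter_def
  proof (intro conjI ballI impI)
    show "topspace X \<in> ?G"
      using key[OF k_closed_top[OF clh], of "topspace X"] z hat_n_in[of _ X k] k_closed_top[OF cl] by simp
    show "{} \<notin> ?G" if "k \<noteq> AllFilters"
      using key[OF k_closed_empty[OF clh that], of "{}"] by simp
  next
    fix U V assume "U \<in> ?G" "V \<in> ?G"
    then have UV: "U \<in> KO k X" "V \<in> KO k X" "z \<in> ?P U \<inter> ?P V" using z by auto
    have "z \<in> ?P U \<inter> ?P V \<longleftrightarrow> z (ind X (U \<inter> V))"
      by (rule key[OF k_closed_Int[OF clh PK[OF UV(1)] PK[OF UV(2)]]])
        (simp only: Int_iff nP[OF UV(1)] nP[OF UV(2)])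
    then show "U \<inter> V \<in> ?G" using UV k_closed_Int[OF cl] by simp
  next
    fix U V assume "U \<in> ?G" "V \<in> KO k X" "U \<subseteq> V"
    then show "V \<in> ?G" using zmono by blast
  next
    fix U V assume k: "k = PrimeFilters" and UV: "U \<in> KO k X" "V \<in> KO k X" "U \<union> V \<in> ?G"
    have "z \<in> ?P U \<union> ?P V \<longleftrightarrow> z (ind X (U \<union> V))"
      by (rule key[OF k_closed_Un[OF clh k PK[OF UV(1)] PK[OF UV(2)]]])
        (simp only: Un_iff nP[OF UV(1)] nP[OF UV(2)])
    then show "U \<in> ?G \<or> V \<in> ?G" using UV by auto
  qed auto
  then obtain x where x: "x \<in> topspace X" "?G = {U \<in> KO k X. x \<in> U}"
    using alg_space_point[OF X] by blast
  have "hat_n k X x = z"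
  proof (rule extensionalityI)
    show "z \<in> extensional (carrier (Hom_S k X))" using z by (simp add: topspace_hat)
    show "hat_n k X x \<in> extensional (carrier (Hom_S k X))" by (simp add: hat_n_def)
    fix f assume f: "f \<in> carrier (Hom_S k X)"
    let ?U = "{x \<in> topspace X. f x}"
    have U: "?U \<in> KO k X" and e: "f \<in> extensional (topspace X)"
      using f by (simp_all add: carrier_Hom_S[OF Xa])
    have "?U \<in> ?G \<longleftrightarrow> ?U \<in> {U \<in> KO k X. x \<in> U}" unfolding x(2) ..
    then have "z (ind X ?U) \<longleftrightarrow> f x" using U x(1) by simp
    then show "hat_n k X x f = z f" using f by (simp add: ind_Collect[OF e] hat_n_def)
  qed
  then show ?thesis using x(1) by blast
qed

lemma in_TopI: "t0_space X \<Longrightarrow> small (topspace X) \<Longrightarrow> X \<in> obj Top0"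
  by (simp add: Top0_def space_category_def)

lemma finite_small: "infinite (UNIV :: 'u set) \<Longrightarrow> finite (A :: 'u set) \<Longrightarrow> small A"
  by (simp add: small_def finite_lesspoll_infinite)

text \<open>Two test spaces suffice for the forward direction: a single point yields injectivity of
  \<open>hat_n\<close>, and a second topology on the points of \<open>X\<close> yields the base.
  Conversely equalised points are realised one by one, and continuity of the resulting map is read
  off the projections.\<close>

lemma is_equaliser_hat_iff:
  fixes X :: "'u topology"
  assumes inf: "infinite (UNIV :: 'u set)" and X: "\<exists>a. algebra k X a" and sm: "small (topspace X)"
  shows "is_equaliser X (hat k X) (cotensor_S (Hom_S k (hat k X)))
      (hat_n k X) (hat_alpha k X) (hat_beta k X) \<longleftrightarrow> is_base X (KO k X)"
proof
  assume eq: "is_equaliser X (hat k X) (cotensor_S (Hom_S k (hat k X)))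
      (hat_n k X) (hat_alpha k X) (hat_beta k X)"
  have cl: "k_closed k (topspace X) (KO k X)" using X k_closed_KO by blast
  have univ: "\<forall>(A :: 'u topology) h. A \<in> obj Top0 \<and> continuous_map A (hat k X) h \<and>
        (\<forall>w\<in>topspace A. hat_alpha k X (h w) = hat_beta k X (h w)) \<longrightarrow>
        (\<exists>!t. t \<in> extensional (topspace A) \<and> continuous_map A X t \<and>
           (\<forall>w\<in>topspace A. hat_n k X (t w) = h w))"
    using eq unfolding is_equaliser_def by (elim conjE)
  have factor: "\<exists>!t. t \<in> extensional (topspace A) \<and> continuous_map A X t \<and>
      (\<forall>w\<in>topspace A. hat_n k X (t w) = hat_n k X (s w))"
    if A: "t0_space A" "small (topspace A)" and s: "s \<in> topspace A \<rightarrow> topspace X"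
      and c: "continuous_map A (hat k X) (\<lambda>w. hat_n k X (s w))" for A :: "'u topology" and s
  proof -
    have "\<forall>w\<in>topspace A. hat_alpha k X (hat_n k X (s w)) = hat_beta k X (hat_n k X (s w))"
      using hat_alpha_n[OF X] s by blast
    then show ?thesis
      using univ[THEN spec, of A, THEN spec, of "\<lambda>w. hat_n k X (s w)"] in_TopI[OF A] c by simp
  qed
  have inj: "x = y" if xy: "x \<in> topspace X" "y \<in> topspace X" "hat_n k X x = hat_n k X y" for x y
  proof -
    \<comment> \<open>A one-point test space: the constant maps to \<open>x\<close> and to
      \<open>y\<close> factor the same map, so uniqueness identifies them.\<close>
    let ?A = "generated_topology {x} {}"
    have T: "topspace ?A = {x}" by (rule topspace_generated_topology) simp
    define Q where "Q t \<longleftrightarrow> t \<in> extensional (topspace ?A) \<and> continuous_map ?A X t \<and>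
        (\<forall>w\<in>topspace ?A. hat_n k X (t w) = hat_n k X x)" for t
    have ex: "\<exists>!t. Q t"
      unfolding Q_def using xy(1) hat_n_in[OF xy(1)] T inf
      by (intro factor) (auto simp: t0_space_def intro: finite_small)
    have cst: "continuous_map ?A X (\<lambda>w\<in>topspace ?A. c)" if "c \<in> topspace X" for c
      using continuous_map_eq[of ?A X "\<lambda>w. c" "\<lambda>w\<in>topspace ?A. c"] that by simp
    have "Q (\<lambda>w\<in>topspace ?A. x)" "Q (\<lambda>w\<in>topspace ?A. y)"
      unfolding Q_def using cst xy by simp_all
    then have "(\<lambda>w\<in>topspace ?A. x) = (\<lambda>w\<in>topspace ?A. y)" using ex by blast
    then have "(\<lambda>w\<in>topspace ?A. x) x = (\<lambda>w\<in>topspace ?A. y) x" by simp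
    then show ?thesis using T by simp
  qed
  \<comment> \<open>The points of \<open>X\<close> with the topology generated by the homomorphic
    sets. \<open>hat_n\<close> is continuous for it, and the factorisation through \<open>X\<close>
    is the identity by injectivity, so the open sets of \<open>X\<close> are open here as
    well.\<close>
  let ?A = "generated_topology (topspace X) (KO k X)"
  have sub: "KO k X \<subseteq> Pow (topspace X)" using k_closed_subset[OF cl] by blast
  have T: "topspace ?A = topspace X" by (rule topspace_generated_topology[OF sub])
  have f_open: "openin ?A {x \<in> topspace X. f x}" if "f \<in> carrier (Hom_S k X)" for f
    using that by (intro openin_generated_topology) (simp add: carrier_Hom_S[OF X])
  have "t0_space ?A"
    unfolding t0_space_def T
  proof (intro ballI impI)
    fix x y assume xy: "x \<in> topspace X" "y \<in> topspace X" "x \<noteq> y"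
    then have "hat_n k X x \<noteq> hat_n k X y" using inj by blast
    then obtain f where "f \<in> carrier (Hom_S k X)" "f x \<noteq> f y"
      using restrict_ext[of "carrier (Hom_S k X)" "\<lambda>f. f x" "\<lambda>f. f y"] by (auto simp: hat_n_def)
    then show "\<exists>U. openin ?A U \<and> (x \<notin> U) = (y \<in> U)"
      using f_open xy by (intro exI[of _ "{x \<in> topspace X. f x}"]) auto
  qed
  moreover have "continuous_map ?A (hat k X) (\<lambda>w. hat_n k X w)"
    unfolding hat_def
  proof (rule continuous_map_cotensor_S)
    show "hat_n k X x \<in> topspace (cotensor_S (Hom_S k X))" if "x \<in> topspace ?A" for x
      using hat_n_in[of x X k] that T by (simp add: hat_def)
    show "openin ?A {x \<in> topspace ?A. hat_n k X x f}" if "f \<in> carrier (Hom_S k X)" for f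
      using f_open[OF that] that T by (simp add: hat_n_def)
  qed
  ultimately obtain t where t: "continuous_map ?A X t" "\<forall>w\<in>topspace ?A. hat_n k X (t w) = hat_n k X w"
    using factor[of ?A "\<lambda>w. w"] sm T by auto
  have "t w = w" if "w \<in> topspace X" for w
    using inj[of "t w" w] t that T by (auto simp: continuous_map_def)
  then have "continuous_map ?A X (\<lambda>w. w)"
    using continuous_map_eq[OF t(1)] T by simp
  then have "openin ?A W" if "openin X W" for W
    using openin_continuous_map_preimage[of ?A X "\<lambda>w. w" W] that T openin_subset[OF that]
    by (simp add: Collect_conj_eq Int_absorb1)
  moreover have "is_base ?A (KO k X)"
    using is_base_generated_topology[OF sub, of k] kcl_eq_self[OF cl] by simp
  ultimately show "is_base X (KO k X)"
    using KO_openin unfolding is_base_def by metis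
next
  assume base: "is_base X (KO k X)"
  then have alg: "alg_space k X" using X by (simp add: alg_space_iff)
  have t0: "t0_space X" using alg_space_t0[OF alg] .
  have inj: "x = y" if xy: "x \<in> topspace X" "y \<in> topspace X" "hat_n k X x = hat_n k X y" for x y
  proof (rule is_base_t0_eqI[OF base t0 xy(1,2)])
    fix U assume U: "U \<in> KO k X"
    have "hat_n k X x (ind X U) = hat_n k X y (ind X U)" using xy(3) by simp
    then show "x \<in> U \<longleftrightarrow> y \<in> U"
      using ind_in_Hom_S[OF X U] xy by (simp add: hat_n_def ind_def)
  qed
  show "is_equaliser X (hat k X) (cotensor_S (Hom_S k (hat k X)))
      (hat_n k X) (hat_alpha k X) (hat_beta k X)"
    unfolding is_equaliser_def
  proof (intro conjI allI impI)
    show "t0_space X" by fact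
    show "t0_space (hat k X)" unfolding hat_def by (rule t0_cotensor_S)
    show "t0_space (cotensor_S (Hom_S k (hat k X)))" by (rule t0_cotensor_S)
    show "continuous_map X (hat k X) (hat_n k X)"
      using algebra_hom_hat_n[OF X] by (simp add: algebra_hom_def)
    show "continuous_map (hat k X) (cotensor_S (Hom_S k (hat k X))) (hat_alpha k X)"
      by (rule continuous_hat_alpha)
    show "continuous_map (hat k X) (cotensor_S (Hom_S k (hat k X))) (hat_beta k X)"
      by (rule continuous_hat_beta[OF X])
    show "\<forall>x\<in>topspace X. hat_alpha k X (hat_n k X x) = hat_beta k X (hat_n k X x)"
      using hat_alpha_n[OF X] by blast
  next
    fix A :: "'u topology" and h
    assume "A \<in> obj Top0 \<and> continuous_map A (hat k X) h \<and>
      (\<forall>w\<in>topspace A. hat_alpha k X (h w) = hat_beta k X (h w))"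
    then have h: "continuous_map A (hat k X) h"
      and hw: "\<And>w. w \<in> topspace A \<Longrightarrow> hat_alpha k X (h w) = hat_beta k X (h w)" by auto
    have hT: "h w \<in> topspace (hat k X)" if "w \<in> topspace A" for w
      using h that by (auto simp: continuous_map_def)
    have "\<forall>w\<in>topspace A. \<exists>x. x \<in> topspace X \<and> hat_n k X x = h w"
      using hat_equalised_point[OF alg hT hw] by blast
    then obtain t0 where t0: "\<forall>w\<in>topspace A. t0 w \<in> topspace X \<and> hat_n k X (t0 w) = h w"
      by (rule bchoice[THEN exE])
    let ?t = "restrict t0 (topspace A)"
    have c: "continuous_map A X ?t"
    proof (rule is_base_continuous_map[OF base])
      show "?t \<in> topspace A \<rightarrow> topspace X" using t0 by auto
      fix V assume V: "V \<in> KO k X"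
      have "?t w \<in> V \<longleftrightarrow> h w (ind X V)" if "w \<in> topspace A" for w
      proof -
        have "hat_n k X (t0 w) (ind X V) = h w (ind X V)" using t0 that by simp
        then show ?thesis using t0 that ind_in_Hom_S[OF X V] by (simp add: hat_n_def ind_def)
      qed
      then have "{w \<in> topspace A. ?t w \<in> V} = {w \<in> topspace A. h w \<in> {z \<in> topspace (hat k X). z (ind X V)}}"
        using hT by auto
      then show "openin A {w \<in> topspace A. ?t w \<in> V}"
        using openin_continuous_map_preimage[OF h KO_openin[OF KO_hat[OF ind_in_Hom_S[OF X V]]]] by simp
    qed
    show "\<exists>!t. t \<in> extensional (topspace A) \<and> continuous_map A X t \<and> (\<forall>w\<in>topspace A. hat_n k X (t w) = h w)"
    proof (rule ex1I[of _ ?t])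
      show "?t \<in> extensional (topspace A) \<and> continuous_map A X ?t \<and> (\<forall>w\<in>topspace A. hat_n k X (?t w) = h w)"
        using c t0 by simp
      fix t assume t: "t \<in> extensional (topspace A) \<and> continuous_map A X t \<and> (\<forall>w\<in>topspace A. hat_n k X (t w) = h w)"
      show "t = ?t"
      proof (rule extensionalityI)
        fix w assume w: "w \<in> topspace A"
        have "t w \<in> topspace X" using t w by (auto simp: continuous_map_def)
        then show "t w = ?t w" using inj[of "t w" "t0 w"] t t0 w by simp
      qed (use t in auto)
    qed
  qed
qed

lemma obj_EM: "X \<in> obj (EM k) \<longleftrightarrow> t0_space X \<and> small (topspace X) \<and> (\<exists>a. algebra k X a)"
  by (simp add: EM_def space_category_def)

lemma hom_EM: "f \<in> hom (EM k) X Y \<longleftrightarrow>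
    f \<in> topspace X \<rightarrow>\<^sub>E topspace Y \<and> X \<in> obj (EM k) \<and> Y \<in> obj (EM k) \<and> algebra_hom k X Y f"
  by (auto simp: EM_def space_category_def)

lemma obj_X_alg:
  fixes X :: "'u topology"
  assumes "infinite (UNIV :: 'u set)"
  shows "X \<in> obj (X_alg k) \<longleftrightarrow> alg_space k X \<and> small (topspace X)"
  using is_equaliser_hat_iff[OF assms] alg_space_t0[of k X]
  by (auto simp: X_alg_def full_subcategory_def obj_EM alg_space_iff)

lemma hom_X_alg:
  fixes X :: "'u topology"
  assumes "infinite (UNIV :: 'u set)"
  shows "f \<in> hom (X_alg k) X Y \<longleftrightarrow> f \<in> topspace X \<rightarrow>\<^sub>E topspace Y \<and>
    X \<in> obj (X_alg k) \<and> Y \<in> obj (X_alg k) \<and> (\<forall>V\<in>KO k Y. {x \<in> topspace X. f x \<in> V} \<in> KO k X)"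
proof (cases "X \<in> obj (X_alg k) \<and> Y \<in> obj (X_alg k)")
  case True
  then have XY: "alg_space k X" "alg_space k Y" by (simp_all add: obj_X_alg[OF assms])
  have "hom (X_alg k) X Y = hom (EM k) X Y" "X \<in> obj (EM k)" "Y \<in> obj (EM k)"
    using True by (auto simp: X_alg_def full_subcategory_def)
  then show ?thesis
    using True algebra_hom_iff_KO[OF alg_space_algebra[OF XY(1)] XY(2), of f]
    by (auto simp: hom_EM PiE_def)
next
  case False
  then have "hom (X_alg k) X Y = {}"
    by (auto simp: X_alg_def full_subcategory_def)
  then show ?thesis using False by auto
qed

section \<open>Algebraic domains\<close>

lemma spec_leD: "spec_le X x y \<Longrightarrow> openin X U \<Longrightarrow> x \<in> U \<Longrightarrow> y \<in> U"
  by (simp add: spec_le_def)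

lemma spec_le_refl: "spec_le X x x"
  by (simp add: spec_le_def)

lemma spec_le_trans: "spec_le X x y \<Longrightarrow> spec_le X y z \<Longrightarrow> spec_le X x z"
  by (simp add: spec_le_def)

lemma spec_le_antisym:
  "t0_space X \<Longrightarrow> x \<in> topspace X \<Longrightarrow> y \<in> topspace X \<Longrightarrow> spec_le X x y \<Longrightarrow> spec_le X y x \<Longrightarrow> x = y"
  by (rule t0_space_eqI) (auto dest: spec_leD)

lemma spec_order_simps:
  "carrier (spec_order X) = topspace X" "x \<sqsubseteq>\<^bsub>spec_order X\<^esub> y \<longleftrightarrow> spec_le X x y"
  "x .=\<^bsub>spec_order X\<^esub> y \<longleftrightarrow> x = y"
  by (simp_all add: spec_order_def)

lemma partial_order_spec_order: "t0_space X \<Longrightarrow> partial_order (spec_order X)"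
  by unfold_locales
    (auto simp: spec_order_simps spec_le_refl fun_eq_iff intro: spec_le_trans spec_le_antisym)

lemma is_lub_spec_order:
  "is_lub (spec_order X) s A \<longleftrightarrow> s \<in> topspace X \<and> (\<forall>x\<in>A \<inter> topspace X. spec_le X x s) \<and>
     (\<forall>u\<in>topspace X. (\<forall>x\<in>A \<inter> topspace X. spec_le X x u) \<longrightarrow> spec_le X s u)"
  unfolding least_def Upper_def spec_order_simps by auto

lemma is_glb_spec_order:
  "is_glb (spec_order X) i A \<longleftrightarrow> i \<in> topspace X \<and> (\<forall>x\<in>A \<inter> topspace X. spec_le X i x) \<and>
     (\<forall>u\<in>topspace X. (\<forall>x\<in>A \<inter> topspace X. spec_le X u x) \<longrightarrow> spec_le X u i)"
  unfolding greatest_def Lower_def spec_order_simps by auto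

lemma is_lub_spec_orderD:
  assumes "is_lub (spec_order X) s A"
  shows lub_in: "s \<in> topspace X"
    and lub_upper: "\<And>x. x \<in> A \<Longrightarrow> x \<in> topspace X \<Longrightarrow> spec_le X x s"
    and lub_least: "\<And>u. u \<in> topspace X \<Longrightarrow> (\<And>x. x \<in> A \<Longrightarrow> x \<in> topspace X \<Longrightarrow> spec_le X x u) \<Longrightarrow> spec_le X s u"
  using assms unfolding is_lub_spec_order by simp_all

lemma is_glb_spec_orderD:
  assumes "is_glb (spec_order X) i A"
  shows glb_in: "i \<in> topspace X"
    and glb_lower: "\<And>x. x \<in> A \<Longrightarrow> x \<in> topspace X \<Longrightarrow> spec_le X i x"
    and glb_greatest: "\<And>u. u \<in> topspace X \<Longrightarrow> (\<And>x. x \<in> A \<Longrightarrow> x \<in> topspace X \<Longrightarrow> spec_le X u x) \<Longrightarrow> spec_le X u i"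
  using assms unfolding is_glb_spec_order by simp_all

lemma is_lub_spec_order_unique:
  assumes "t0_space X" "is_lub (spec_order X) s A" "is_lub (spec_order X) s' A"
  shows "s = s'"
  using assms spec_le_antisym[of X s s'] unfolding is_lub_spec_order by blast

lemma is_glb_spec_order_unique:
  assumes "t0_space X" "is_glb (spec_order X) s A" "is_glb (spec_order X) s' A"
  shows "s = s'"
  using assms spec_le_antisym[of X s s'] unfolding is_glb_spec_order by blast

lemma directed_in_spec_order:
  "directed_in (spec_order X) D \<longleftrightarrow> D \<subseteq> topspace X \<and> D \<noteq> {} \<and>
     (\<forall>x\<in>D. \<forall>y\<in>D. \<exists>z\<in>D. spec_le X x z \<and> spec_le X y z)"
  by (simp add: directed_in_def spec_order_simps)

lemma scott_openD:
  assumes "scott_open (spec_order X) W"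
  shows scott_open_subset: "W \<subseteq> topspace X"
    and scott_open_up: "\<And>x y. x \<in> W \<Longrightarrow> y \<in> topspace X \<Longrightarrow> spec_le X x y \<Longrightarrow> y \<in> W"
    and scott_open_directed: "\<And>D s. directed_in (spec_order X) D \<Longrightarrow> is_lub (spec_order X) s D \<Longrightarrow> s \<in> W \<Longrightarrow> D \<inter> W \<noteq> {}"
  using assms unfolding scott_open_def spec_order_simps by (elim conjE; metis)+

section \<open>Suprema, infima and compact elements in algebraic spaces\<close>

definition up :: "'a topology \<Rightarrow> 'a \<Rightarrow> 'a set" where
  "up X c = {x \<in> topspace X. spec_le X c x}"

lemma mem_up: "x \<in> up X c \<longleftrightarrow> x \<in> topspace X \<and> spec_le X c x"
  by (simp add: up_def)

lemma up_self: "c \<in> topspace X \<Longrightarrow> c \<in> up X c"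
  by (simp add: mem_up spec_le_refl)

lemma up_least: "openin X U \<Longrightarrow> c \<in> U \<Longrightarrow> up X c \<subseteq> U"
  by (auto simp: mem_up dest: spec_leD)

lemma up_mono: "spec_le X c d \<Longrightarrow> up X d \<subseteq> up X c"
  by (auto simp: mem_up intro: spec_le_trans)

text \<open>The homomorphic sets meeting a directed \<open>D\<close> form a filter of every kind:
  directedness gives intersections, and meeting a union means meeting one of its parts. The point
  realising it is the supremum, and its neighbourhoods meet \<open>D\<close>.\<close>

lemma alg_space_directed_sup:
  assumes X: "alg_space k X" and D: "directed_in (spec_order X) D"
  shows "\<exists>s. is_lub (spec_order X) s D \<and> (\<forall>U. openin X U \<longrightarrow> s \<in> U \<longrightarrow> D \<inter> U \<noteq> {})"
proof -
  let ?K = "KO k X"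
  let ?F = "{U \<in> ?K. D \<inter> U \<noteq> {}}"
  have base: "is_base X ?K" and cl: "k_closed k (topspace X) ?K"
    using alg_space_base[OF X] alg_space_closed[OF X] .
  have DX: "D \<subseteq> topspace X" and Dn: "D \<noteq> {}"
    and dir: "\<And>x y. x \<in> D \<Longrightarrow> y \<in> D \<Longrightarrow> \<exists>z\<in>D. spec_le X x z \<and> spec_le X y z"
    using D by (simp_all add: directed_in_spec_order)
  have kf: "k_filter k (topspace X) ?K ?F"
    unfolding k_filter_def
  proof (intro conjI ballI impI)
    show "topspace X \<in> ?F" using k_closed_top[OF cl] DX Dn by auto
  next
    fix U V assume "U \<in> ?F" "V \<in> ?F"
    then obtain x y where xy: "x \<in> D" "x \<in> U" "y \<in> D" "y \<in> V" and UV: "U \<in> ?K" "V \<in> ?K" by auto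
    obtain z where "z \<in> D" "spec_le X x z" "spec_le X y z" using dir[OF xy(1,3)] by auto
    then have "z \<in> D \<inter> (U \<inter> V)"
      using spec_leD[of X x z U] spec_leD[of X y z V] xy KO_openin[OF UV(1)] KO_openin[OF UV(2)] by simp
    then show "U \<inter> V \<in> ?F" using k_closed_Int[OF cl UV] by auto
  qed auto
  obtain s where s: "s \<in> topspace X" "?F = {U \<in> ?K. s \<in> U}"
    using alg_space_point[OF X kf] by (rule bexE)
  have sU: "s \<in> U \<longleftrightarrow> D \<inter> U \<noteq> {}" if "U \<in> ?K" for U
  proof -
    have "U \<in> ?F \<longleftrightarrow> U \<in> {U \<in> ?K. s \<in> U}" unfolding s(2) ..
    then show ?thesis using that by simp
  qed
  have "is_lub (spec_order X) s D"
    unfolding is_lub_spec_order is_base_spec_le[OF base]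
  proof (intro conjI ballI impI)
    fix x U assume "x \<in> D \<inter> topspace X" "U \<in> ?K" "x \<in> U"
    then show "s \<in> U" using sU by auto
  next
    fix u U assume u: "\<forall>x\<in>D \<inter> topspace X. \<forall>U\<in>?K. x \<in> U \<longrightarrow> u \<in> U" and U: "U \<in> ?K" "s \<in> U"
    then obtain x where x: "x \<in> D" "x \<in> U" using sU by auto
    then have "x \<in> D \<inter> topspace X" using DX by (simp add: subsetD)
    from u[rule_format, OF this U(1) x(2)] show "u \<in> U" .
  qed (rule s(1))
  moreover have "D \<inter> W \<noteq> {}" if W: "openin X W" "s \<in> W" for W
  proof -
    obtain U where "U \<in> ?K" "s \<in> U" "U \<subseteq> W" using is_baseE[OF base W] .
    then show ?thesis using sU by auto
  qed
  ultimately show ?thesis by (intro exI[of _ s]) simp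
qed

lemma alg_space_lub_mem:
  assumes X: "alg_space k X" and D: "directed_in (spec_order X) D" "is_lub (spec_order X) s D"
    and U: "openin X U" "s \<in> U"
  shows "D \<inter> U \<noteq> {}"
proof -
  obtain s' where s': "is_lub (spec_order X) s' D \<and> (\<forall>U. openin X U \<longrightarrow> s' \<in> U \<longrightarrow> D \<inter> U \<noteq> {})"
    using alg_space_directed_sup[OF X D(1)] ..
  then have "s = s'" using is_lub_spec_order_unique[OF alg_space_t0[OF X] D(2)] by simp
  then show ?thesis using s' U by simp
qed

text \<open>The infimum realises the filter of the homomorphic sets that include \<open>A\<close>.
  This filter is proper iff \<open>A\<close> is nonempty, and in general it is not prime.\<close>

lemma alg_space_inf:
  assumes X: "alg_space k X" and k: "k \<noteq> PrimeFilters"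
    and A: "A \<subseteq> topspace X" "k = AllFilters \<or> A \<noteq> {}"
  shows "\<exists>i. is_glb (spec_order X) i A \<and> (\<forall>U\<in>KO k X. i \<in> U \<longleftrightarrow> A \<subseteq> U)"
proof -
  let ?K = "KO k X"
  let ?F = "{U \<in> ?K. A \<subseteq> U}"
  have base: "is_base X ?K" and cl: "k_closed k (topspace X) ?K"
    using alg_space_base[OF X] alg_space_closed[OF X] .
  have kf: "k_filter k (topspace X) ?K ?F"
    unfolding k_filter_def
  proof (intro conjI ballI impI)
    show "topspace X \<in> ?F" using k_closed_top[OF cl] A(1) by auto
    show "U \<inter> V \<in> ?F" if "U \<in> ?F" "V \<in> ?F" for U V
      using that k_closed_Int[OF cl] by auto
  qed (use k A(2) in auto)
  obtain i where i: "i \<in> topspace X" "?F = {U \<in> ?K. i \<in> U}"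
    using alg_space_point[OF X kf] by (rule bexE)
  have iU: "i \<in> U \<longleftrightarrow> A \<subseteq> U" if "U \<in> ?K" for U
  proof -
    have "U \<in> ?F \<longleftrightarrow> U \<in> {U \<in> ?K. i \<in> U}" unfolding i(2) ..
    then show ?thesis using that by simp
  qed
  have "is_glb (spec_order X) i A"
    unfolding is_glb_spec_order is_base_spec_le[OF base]
  proof (intro conjI ballI impI)
    fix x U assume "x \<in> A \<inter> topspace X" "U \<in> ?K" "i \<in> U"
    then show "x \<in> U" using iU by auto
  next
    fix u U assume u: "\<forall>x\<in>A \<inter> topspace X. \<forall>U\<in>?K. u \<in> U \<longrightarrow> x \<in> U" and U: "U \<in> ?K" "u \<in> U"
    have "A \<subseteq> U"
    proof
      fix x assume "x \<in> A"
      then have "x \<in> A \<inter> topspace X" using A(1) by (simp add: subsetD)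
      from u[rule_format, OF this U] show "x \<in> U" .
    qed
    then show "i \<in> U" using iU[OF U(1)] by simp
  qed (rule i(1))
  then show ?thesis using iU by (intro exI[of _ i] conjI ballI)
qed

lemma alg_space_glb_mem:
  assumes "alg_space k X" "k \<noteq> PrimeFilters" "A \<subseteq> topspace X" "k = AllFilters \<or> A \<noteq> {}"
    and i: "is_glb (spec_order X) i A" and U: "U \<in> KO k X"
  shows "i \<in> U \<longleftrightarrow> A \<subseteq> U"
proof -
  obtain j where "is_glb (spec_order X) j A \<and> (\<forall>U\<in>KO k X. j \<in> U \<longleftrightarrow> A \<subseteq> U)"
    using alg_space_inf[OF assms(1-4)] ..
  then have "i = j" "j \<in> U \<longleftrightarrow> A \<subseteq> U"
    using is_glb_spec_order_unique[OF alg_space_t0[OF assms(1)] i] U by simp_all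
  then show ?thesis by simp
qed

text \<open>The infimum of \<open>U\<close> lies in each homomorphic set that includes
  \<open>U\<close>, in particular in \<open>U\<close> itself, so it is the least element of
  \<open>U\<close>.\<close>

lemma alg_space_principal:
  assumes X: "alg_space k X" and k: "k \<noteq> PrimeFilters" and U: "U \<in> KO k X" "k = AllFilters \<or> U \<noteq> {}"
  obtains c where "c \<in> topspace X" "U = up X c"
proof -
  have UX: "U \<subseteq> topspace X" using openin_subset[OF KO_openin[OF U(1)]] .
  obtain c where c: "is_glb (spec_order X) c U \<and> (\<forall>V\<in>KO k X. c \<in> V \<longleftrightarrow> U \<subseteq> V)"
    using alg_space_inf[OF X k UX U(2)] ..
  have cU: "c \<in> U" using c[THEN conjunct2, rule_format, OF U(1)] by simp
  have "U = up X c"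
  proof
    show "up X c \<subseteq> U" using up_least[OF KO_openin[OF U(1)] cU] .
    show "U \<subseteq> up X c"
    proof
      fix x assume x: "x \<in> U"
      then have "x \<in> topspace X" using UX by (rule subsetD[rotated])
      then show "x \<in> up X c" using glb_lower[OF conjunct1[OF c] x] by (simp add: mem_up)
    qed
  qed
  then show thesis using that[OF glb_in[OF conjunct1[OF c]]] by simp
qed

text \<open>Each homomorphic set around \<open>x\<close> is the up-set of some element of
  \<open>G\<close>. Hence \<open>G\<close> is directed because two homomorphic sets intersect in a
  third, and \<open>x\<close> is its supremum because these sets determine the order.\<close>

lemma alg_space_compact_directed:
  assumes X: "alg_space k X" and k: "k \<noteq> PrimeFilters" and x: "x \<in> topspace X"
  defines "G \<equiv> {c \<in> topspace X. up X c \<in> KO k X \<and> spec_le X c x}"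
  shows "directed_in (spec_order X) G" "is_lub (spec_order X) x G"
proof -
  let ?K = "KO k X"
  have base: "is_base X ?K" and cl: "k_closed k (topspace X) ?K"
    using alg_space_base[OF X] alg_space_closed[OF X] .
  have ex: "\<exists>c\<in>G. U = up X c" if U: "U \<in> ?K" "x \<in> U" for U
  proof -
    obtain c where "c \<in> topspace X" "U = up X c"
      using alg_space_principal[OF X k U(1)] U(2) by auto
    then show ?thesis using U by (auto simp: G_def mem_up)
  qed
  show "directed_in (spec_order X) G"
    unfolding directed_in_spec_order
  proof (intro conjI ballI)
    show "G \<subseteq> topspace X" by (auto simp: G_def)
    show "G \<noteq> {}" using ex[OF k_closed_top[OF cl] x] by auto
    fix c d assume cd: "c \<in> G" "d \<in> G"
    then have "up X c \<inter> up X d \<in> ?K" "x \<in> up X c \<inter> up X d"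
      using k_closed_Int[OF cl] x by (auto simp: G_def mem_up)
    then obtain e where e: "e \<in> G" "up X c \<inter> up X d = up X e" using ex by blast
    then have "e \<in> up X c \<inter> up X d" using up_self[of e X] by (simp add: G_def)
    then show "\<exists>z\<in>G. spec_le X c z \<and> spec_le X d z"
      using e(1) by (intro bexI[of _ e]) (simp_all add: mem_up)
  qed
  show "is_lub (spec_order X) x G"
    unfolding is_lub_spec_order
  proof (intro conjI ballI impI)
    show "x \<in> topspace X" by fact
    show "spec_le X c x" if "c \<in> G \<inter> topspace X" for c using that by (simp add: G_def)
    fix u assume u: "u \<in> topspace X" "\<forall>c\<in>G \<inter> topspace X. spec_le X c u"
    show "spec_le X x u"
      unfolding is_base_spec_le[OF base]
    proof (intro ballI impI)
      fix U assume "U \<in> ?K" "x \<in> U"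
      then obtain c where "c \<in> G" "U = up X c" using ex by blast
      then have "c \<in> G \<inter> topspace X" by (simp add: G_def)
      then have "spec_le X c u" using u(2) by (rule bspec[rotated])
      then show "u \<in> U" using u(1) \<open>U = up X c\<close> by (simp add: mem_up)
    qed
  qed
qed

text \<open>A compact \<open>c\<close> is the directed supremum of the elements below it with
  homomorphic up-set, so it lies below one of them and equals it. Conversely an open up-set meets
  every directed set whose supremum it contains.\<close>

lemma alg_space_compact_element_iff:
  assumes X: "alg_space k X" and k: "k \<noteq> PrimeFilters"
  shows "compact_element (spec_order X) c \<longleftrightarrow> c \<in> topspace X \<and> up X c \<in> KO k X"
proof
  assume c: "compact_element (spec_order X) c"
  then have cX: "c \<in> topspace X" by (simp add: compact_element_def spec_order_simps)
  have "\<exists>d\<in>D. spec_le X c d" if "directed_in (spec_order X) D" "is_lub (spec_order X) s D" "spec_le X c s" for D s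
    using c that unfolding compact_element_def spec_order_simps by blast
  from this[OF alg_space_compact_directed[OF X k cX] spec_le_refl]
  obtain d where d: "d \<in> topspace X" "up X d \<in> KO k X" "spec_le X d c" "spec_le X c d"
    by auto
  then have "c = d" using spec_le_antisym[OF alg_space_t0[OF X] cX] by simp
  then show "c \<in> topspace X \<and> up X c \<in> KO k X" using d by simp
next
  assume c: "c \<in> topspace X \<and> up X c \<in> KO k X"
  show "compact_element (spec_order X) c"
    unfolding compact_element_def spec_order_simps
  proof (intro conjI allI impI)
    fix D s assume D: "directed_in (spec_order X) D \<and> is_lub (spec_order X) s D \<and> spec_le X c s"
    then have "s \<in> up X c" using lub_in by (auto simp: mem_up)
    then have "D \<inter> up X c \<noteq> {}"
      using alg_space_lub_mem[OF X, of D s "up X c"] D KO_openin[OF conjunct2[OF c]] by simp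
    then show "\<exists>d\<in>D. spec_le X c d" by (auto simp: mem_up)
  qed (use c in simp)
qed

text \<open>A bounded supremum is the infimum of the nonempty set of upper bounds. A Scott open set
  around \<open>x\<close> contains a compact element below \<open>x\<close>, and with it that
  element's up-set, which is open in \<open>X\<close>.\<close>

lemma alg_space_domain:
  assumes X: "alg_space k X" and k: "k \<noteq> PrimeFilters"
  shows "scott_space X" "algebraic_domain (spec_order X)" "bounded_complete (spec_order X)"
proof -
  let ?P = "spec_order X"
  have t0: "t0_space X" using alg_space_t0[OF X] .
  have G: "{c. compact_element ?P c \<and> c \<sqsubseteq>\<^bsub>?P\<^esub> x} =
      {c \<in> topspace X. up X c \<in> KO k X \<and> spec_le X c x}" for x
    unfolding alg_space_compact_element_iff[OF X k] spec_order_simps by auto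
  show "algebraic_domain ?P"
    unfolding algebraic_domain_def directed_complete_def G
  proof (intro conjI ballI allI impI)
    show "partial_order ?P" using partial_order_spec_order[OF t0] .
    show "\<exists>s. is_lub ?P s D" if "directed_in ?P D" for D
      using alg_space_directed_sup[OF X that] by blast
    fix x assume "x \<in> carrier ?P"
    then have x: "x \<in> topspace X" by (simp add: spec_order_simps)
    from alg_space_compact_directed[OF X k x]
    show "directed_in ?P {c \<in> topspace X. up X c \<in> KO k X \<and> spec_le X c x}"
      "is_lub ?P x {c \<in> topspace X. up X c \<in> KO k X \<and> spec_le X c x}" .
  qed
  show "bounded_complete ?P"
    unfolding bounded_complete_def
  proof (intro allI impI)
    fix A assume A: "A \<subseteq> carrier ?P \<and> Upper ?P A \<noteq> {}"
    have Ups: "Upper ?P A = {u \<in> topspace X. \<forall>x\<in>A. spec_le X x u}"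
      using A by (auto simp: Upper_def spec_order_simps)
    have "Upper ?P A \<subseteq> topspace X" unfolding Ups by simp
    moreover have "k = AllFilters \<or> Upper ?P A \<noteq> {}" using A by (elim conjE) (rule disjI2)
    ultimately have "\<exists>s. is_glb ?P s (Upper ?P A) \<and> (\<forall>U\<in>KO k X. s \<in> U \<longleftrightarrow> Upper ?P A \<subseteq> U)"
      by (rule alg_space_inf[OF X k])
    then obtain s where s: "is_glb ?P s (Upper ?P A)" by (elim exE conjE)
    have AX: "A \<subseteq> topspace X" using A by (simp add: spec_order_simps)
    have "is_lub ?P s A"
      unfolding is_lub_spec_order
    proof (intro conjI ballI impI)
      show "s \<in> topspace X" using glb_in[OF s] .
      fix x assume x: "x \<in> A \<inter> topspace X"
      show "spec_le X x s"
      proof (rule glb_greatest[OF s])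
        show "x \<in> topspace X" using x by simp
        show "spec_le X x u" if "u \<in> Upper ?P A" for u using that x unfolding Ups by simp
      qed
    next
      fix u assume u: "u \<in> topspace X" "\<forall>x\<in>A \<inter> topspace X. spec_le X x u"
      have "spec_le X x u" if "x \<in> A" for x
        using bspec[OF u(2), of x] that AX by auto
      then have "u \<in> Upper ?P A" unfolding Ups using u(1) by simp
      then show "spec_le X s u" using glb_lower[OF s _ u(1)] by simp
    qed
    then show "\<exists>s. is_lub ?P s A" ..
  qed
  show "scott_space X"
    unfolding scott_space_def
  proof (intro allI iffI)
    fix W assume W: "openin X W"
    show "scott_open ?P W"
      unfolding scott_open_def spec_order_simps
    proof (intro conjI ballI allI impI)
      show "W \<subseteq> topspace X" using openin_subset[OF W] .
      show "y \<in> W" if "x \<in> W" "spec_le X x y" for x y using spec_leD[OF that(2) W that(1)] .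
      show "D \<inter> W \<noteq> {}" if "directed_in ?P D \<and> is_lub ?P s D \<and> s \<in> W" for D s
        using that alg_space_lub_mem[OF X _ _ W] by (elim conjE)
    qed
  next
    fix W assume W: "scott_open ?P W"
    show "openin X W"
    proof (subst openin_subopen, intro ballI)
      fix x assume xW: "x \<in> W"
      then have x: "x \<in> topspace X" using scott_open_subset[OF W] by blast
      let ?G = "{c \<in> topspace X. up X c \<in> KO k X \<and> spec_le X c x}"
      have "?G \<inter> W \<noteq> {}"
        using scott_open_directed[OF W alg_space_compact_directed[OF X k x] xW] .
      then obtain c where c: "c \<in> topspace X" "up X c \<in> KO k X" "spec_le X c x" "c \<in> W" by blast
      have "y \<in> W" if "y \<in> topspace X" "spec_le X c y" for y
        using scott_open_up[OF W c(4)] that by simp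
      then have "up X c \<subseteq> W" by (auto simp: mem_up)
      then show "\<exists>T. openin X T \<and> x \<in> T \<and> T \<subseteq> W"
        using c x KO_openin by (intro exI[of _ "up X c"]) (simp add: mem_up)
    qed
  qed
qed

lemma alg_space_AllFilters_complete:
  assumes X: "alg_space AllFilters X"
  shows "complete_lattice (spec_order X)"
proof -
  let ?P = "spec_order X"
  interpret partial_order ?P using partial_order_spec_order[OF alg_space_t0[OF X]] .
  have inf: "\<exists>i. is_glb ?P i A" if "A \<subseteq> topspace X" for A
    using alg_space_inf[OF X _ that] by auto
  show ?thesis
  proof (rule complete_latticeI)
    fix A assume A: "A \<subseteq> carrier ?P"
    show "\<exists>i. is_glb ?P i A" using inf A by (simp add: spec_order_simps)
    obtain t where "is_glb ?P t {}" using inf[of "{}"] by blast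
    then have "t \<in> Upper ?P A"
      using A unfolding is_glb_spec_order by (auto simp: Upper_def spec_order_simps)
    then show "\<exists>s. is_lub ?P s A"
      using alg_space_domain(3)[OF X] A unfolding bounded_complete_def by auto
  qed
qed

text \<open>The up-sets of compact elements intersect in such up-sets because a bounded join of two
  compact elements is compact. A filter \<open>F\<close> of these sets is realised by the directed
  supremum of the compact \<open>c\<close> with \<open>up X c \<in> F\<close>. The empty set is
  added except for \<open>AllFilters\<close>, where the top element lies in all up-sets.\<close>

lemma domain_alg_space:
  assumes k: "k \<noteq> PrimeFilters" and t0: "t0_space X" and scott: "scott_space X"
    and ad: "algebraic_domain (spec_order X)" and bc: "bounded_complete (spec_order X)"
    and top: "k = AllFilters \<Longrightarrow> \<exists>t\<in>topspace X. \<forall>x\<in>topspace X. spec_le X x t"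
  shows "alg_space k X"
proof -
  let ?P = "spec_order X"
  define C where "C = {c. compact_element ?P c}"
  define B where "B = up X ` C \<union> (if k = AllFilters then {} else {{}})"
  have CX: "c \<in> topspace X" if "c \<in> C" for c
    using that by (simp add: C_def compact_element_def spec_order_simps)
  have comp: "\<exists>d\<in>D. spec_le X c d"
    if "c \<in> C" "directed_in ?P D" "is_lub ?P s D" "spec_le X c s" for c D s
    using that unfolding C_def compact_element_def spec_order_simps mem_Collect_eq by blast
  have sup: "\<exists>s. is_lub ?P s D" if "directed_in ?P D" for D
    using ad that by (simp add: algebraic_domain_def directed_complete_def)
  have dirC: "directed_in ?P {c \<in> C. spec_le X c x}" "is_lub ?P x {c \<in> C. spec_le X c x}"
    if "x \<in> topspace X" for x
    using ad that by (simp_all add: algebraic_domain_def spec_order_simps C_def)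
  have so: "openin X U \<longleftrightarrow> scott_open ?P U" for U
    using scott by (simp add: scott_space_def)
  have up_open: "openin X (up X c)" if c: "c \<in> C" for c
    unfolding so scott_open_def spec_order_simps
  proof (intro conjI ballI allI impI)
    show "up X c \<subseteq> topspace X" by (auto simp: mem_up)
    show "y \<in> up X c" if "x \<in> up X c" "y \<in> topspace X" "spec_le X x y" for x y
      using that spec_le_trans by (auto simp: mem_up)
    fix D s assume D: "directed_in ?P D \<and> is_lub ?P s D \<and> s \<in> up X c"
    then obtain d where "d \<in> D" "spec_le X c d" using comp[OF c, of D s] by (auto simp: mem_up)
    moreover have "D \<subseteq> topspace X" using D by (simp add: directed_in_spec_order)
    ultimately have "d \<in> D \<inter> up X c" by (simp add: mem_up subsetD)
    then show "D \<inter> up X c \<noteq> {}" by blast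
  qed
  have Bo: "openin X U" if "U \<in> B" for U
    using that up_open by (auto simp: B_def split: if_splits)
  have up_ne: "up X c \<noteq> {}" if "c \<in> C" for c
    using up_self[OF CX[OF that]] by auto
  have base: "is_base X B"
    unfolding is_base_def
  proof (intro conjI ballI allI impI)
    fix W x assume W: "openin X W \<and> x \<in> W"
    then have x: "x \<in> topspace X" using openin_subset by blast
    have "scott_open ?P W" "x \<in> W" using W unfolding so by simp_all
    from scott_open_directed[OF this(1) dirC[OF x] this(2)] obtain c where c: "c \<in> C" "spec_le X c x" "c \<in> W" by blast
    then show "\<exists>U\<in>B. x \<in> U \<and> U \<subseteq> W"
      using x up_least[of X W c] W by (intro bexI[of _ "up X c"]) (auto simp: B_def mem_up)
  qed (rule Bo)
  \<comment> \<open>The least element is the supremum of the empty set; it is compact since directed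
    sets are nonempty, and its up-set is the whole space.\<close>
  have bot: "\<exists>c\<in>C. topspace X = up X c" if ne: "topspace X \<noteq> {}"
  proof -
    have "Upper ?P {} \<noteq> {}" using ne by (auto simp: Upper_def spec_order_simps)
    then obtain b where b: "is_lub ?P b {}"
      using bc unfolding bounded_complete_def by blast
    then have bX: "b \<in> topspace X" and ble: "\<And>x. x \<in> topspace X \<Longrightarrow> spec_le X b x"
      unfolding is_lub_spec_order by simp_all
    have "compact_element ?P b"
      unfolding compact_element_def spec_order_simps
    proof (intro conjI allI impI)
      fix D s assume "directed_in ?P D \<and> is_lub ?P s D \<and> spec_le X b s"
      then have "D \<subseteq> topspace X" "D \<noteq> {}" by (simp_all add: directed_in_spec_order)
      then show "\<exists>d\<in>D. spec_le X b d" using ble by auto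
    qed (rule bX)
    moreover have "topspace X = up X b" using ble by (auto simp: mem_up)
    ultimately show ?thesis unfolding C_def by blast
  qed
  have Int: "\<exists>e\<in>C. up X c \<inter> up X d = up X e"
    if cd: "c \<in> C" "d \<in> C" and ne: "up X c \<inter> up X d \<noteq> {}" for c d
  proof -
    have "Upper ?P {c, d} \<noteq> {}" using ne by (auto simp: Upper_def spec_order_simps mem_up)
    moreover have "{c, d} \<subseteq> carrier ?P" using CX cd by (simp add: spec_order_simps)
    ultimately obtain e where e: "is_lub ?P e {c, d}"
      using bc unfolding bounded_complete_def by blast
    then have eX: "e \<in> topspace X" and ce: "spec_le X c e" "spec_le X d e"
      and le: "\<And>u. u \<in> topspace X \<Longrightarrow> spec_le X c u \<Longrightarrow> spec_le X d u \<Longrightarrow> spec_le X e u"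
      using CX cd unfolding is_lub_spec_order by simp_all
    have "compact_element ?P e"
      unfolding compact_element_def spec_order_simps
    proof (intro conjI allI impI)
      fix D s assume D: "directed_in ?P D \<and> is_lub ?P s D \<and> spec_le X e s"
      obtain x where x: "x \<in> D" "spec_le X c x"
        using comp[OF cd(1), of D s] D spec_le_trans[OF ce(1)] by blast
      obtain y where y: "y \<in> D" "spec_le X d y"
        using comp[OF cd(2), of D s] D spec_le_trans[OF ce(2)] by blast
      have dir: "\<forall>x\<in>D. \<forall>y\<in>D. \<exists>z\<in>D. spec_le X x z \<and> spec_le X y z" and DX: "D \<subseteq> topspace X"
        using D by (simp_all add: directed_in_spec_order)
      obtain z where z: "z \<in> D" "spec_le X x z" "spec_le X y z"
        using dir x(1) y(1) by blast
      have "spec_le X e z"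
        using le[of z] z DX spec_le_trans[OF x(2) z(2)] spec_le_trans[OF y(2) z(3)] by auto
      then show "\<exists>d\<in>D. spec_le X e d" using z(1) by blast
    qed (rule eX)
    moreover have "up X c \<inter> up X d = up X e"
      using le spec_le_trans[OF ce(1)] spec_le_trans[OF ce(2)] by (auto simp: mem_up)
    ultimately show ?thesis unfolding C_def by blast
  qed
  have ne_all: "up X c \<inter> up X d \<noteq> {}"
    if kcd: "k = AllFilters" "c \<in> topspace X" "d \<in> topspace X" for c d
  proof -
    obtain t where "t \<in> topspace X" "\<forall>x\<in>topspace X. spec_le X x t" using top[OF kcd(1)] by blast
    then have "t \<in> up X c \<inter> up X d" using kcd by (simp add: mem_up)
    then show ?thesis by blast
  qed
  have TB: "topspace X \<in> B"
  proof (cases "topspace X = {}")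
    case True
    \<comment> \<open>The empty space occurs for proper filters only, where the empty set is a
      member of \<open>B\<close>; for \<open>AllFilters\<close> there is a top element.\<close>
    then have "k \<noteq> AllFilters" using top by auto
    then show ?thesis using True by (simp add: B_def)
  next
    case False
    then show ?thesis using bot by (auto simp: B_def)
  qed
  have "U \<inter> V \<in> B" if UV: "U \<in> B" "V \<in> B" for U V
  proof (cases "U \<inter> V = {}")
    case True
    have "k \<noteq> AllFilters"
    proof
      assume k: "k = AllFilters"
      then obtain c d where "c \<in> C" "U = up X c" "d \<in> C" "V = up X d"
        using UV by (auto simp: B_def)
      then show False using ne_all[OF k, of c d] CX True by simp
    qed
    then show ?thesis using True by (simp add: B_def)
  next
    case False
    then obtain c d where "c \<in> C" "U = up X c" "d \<in> C" "V = up X d"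
      using UV by (auto simp: B_def split: if_splits)
    then show ?thesis using Int[of c d] False by (auto simp: B_def)
  qed
  moreover have "B \<subseteq> Pow (topspace X)" using openin_subset[OF Bo] by blast
  moreover have "{} \<in> B" if "k \<noteq> AllFilters" using that by (simp add: B_def)
  ultimately have cl: "k_closed k (topspace X) B"
    unfolding k_closed_def using TB k by simp
  have "\<exists>x\<in>topspace X. F = {U \<in> B. x \<in> U}" if F: "k_filter k (topspace X) B F" for F
  proof -
    have Fne: "U \<noteq> {}" if "U \<in> F" for U
    proof (cases "k = AllFilters")
      case True
      then obtain c where "c \<in> C" "U = up X c"
        using k_filter_subset[OF F] \<open>U \<in> F\<close> by (auto simp: B_def)
      then show ?thesis using up_ne by simp
    next
      case False
      then show ?thesis using k_filter_empty[OF F] \<open>U \<in> F\<close> by auto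
    qed
    have Fup: "\<exists>c\<in>C. U = up X c" if "U \<in> F" for U
      using k_filter_subset[OF F] that Fne[OF that] by (auto simp: B_def split: if_splits)
    let ?D = "{c \<in> C. up X c \<in> F}"
    have dir: "directed_in ?P ?D"
      unfolding directed_in_spec_order
    proof (intro conjI ballI)
      show "?D \<subseteq> topspace X" using CX by auto
      show "?D \<noteq> {}" using Fup[OF k_filter_top[OF F]] k_filter_top[OF F] by auto
      fix c d assume cd: "c \<in> ?D" "d \<in> ?D"
      then have I: "up X c \<inter> up X d \<in> F" using k_filter_Int[OF F] by simp
      then obtain e where e: "e \<in> C" "up X c \<inter> up X d = up X e" using Fup by blast
      then have "e \<in> up X c \<inter> up X d" using up_self[OF CX[OF e(1)]] by simp
      then have "spec_le X c e \<and> spec_le X d e" by (simp only: Int_iff mem_up)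
      moreover have "e \<in> ?D" using e I by simp
      ultimately show "\<exists>z\<in>?D. spec_le X c z \<and> spec_le X d z" by (rule bexI)
    qed
    obtain s where s: "is_lub ?P s ?D" using sup[OF dir] by blast
    have sX: "s \<in> topspace X" using s by (simp add: is_lub_spec_order)
    have "U \<in> F \<longleftrightarrow> s \<in> U" if U: "U \<in> B" for U
    proof
      assume UF: "U \<in> F"
      then obtain c where c: "c \<in> C" "U = up X c" using Fup by blast
      then have "c \<in> ?D \<inter> topspace X" using UF CX by simp
      then have "spec_le X c s" using s unfolding is_lub_spec_order by blast
      then show "s \<in> U" using c(2) sX by (simp add: mem_up)
    next
      assume sU: "s \<in> U"
      then obtain c where c: "c \<in> C" "U = up X c" using U by (auto simp: B_def split: if_splits)
      then obtain d where "d \<in> ?D" "spec_le X c d"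
        using comp[OF c(1) dir s] sU by (auto simp: mem_up)
      then show "U \<in> F" using k_filter_mono[OF F _ U, of "up X d"] up_mono[of X c d] c(2) by simp
    qed
    then have "F = {U \<in> B. s \<in> U}" using k_filter_subset[OF F] by auto
    then show ?thesis using sX by blast
  qed
  then have "kbasis k X B" using base cl by (simp add: kbasis_def)
  then show ?thesis using alg_spaceI(1)[OF t0] by blast
qed

text \<open>Suprema and infima are determined by the homomorphic sets around them, which gives
  preservation. In the other direction let \<open>V = up Y c\<close>: its inverse image is Scott
  open, and if nonempty it contains its own infimum, since the image of that infimum is an infimum
  of elements above \<open>c\<close>; so it is a single basic set.\<close>

lemma alg_space_hom_domain:
  assumes X: "alg_space k X" and Y: "alg_space k Y" and k: "k \<noteq> PrimeFilters"
    and f: "f \<in> topspace X \<rightarrow> topspace Y"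
  shows "(\<forall>V\<in>KO k Y. {x \<in> topspace X. f x \<in> V} \<in> KO k X) \<longleftrightarrow>
    preserves_directed_sups (spec_order X) (spec_order Y) f \<and>
    (\<forall>A i. A \<subseteq> topspace X \<and> (k = AllFilters \<or> A \<noteq> {}) \<and> is_glb (spec_order X) i A \<longrightarrow>
       is_glb (spec_order Y) (f i) (f ` A))"
    (is "?L \<longleftrightarrow> ?D \<and> ?I")
proof
  assume L: ?L
  have t0: "t0_space Y" and base: "is_base Y (KO k Y)"
    using alg_space_t0[OF Y] alg_space_base[OF Y] .
  have mono: "spec_le Y (f x) (f y)" if "spec_le X x y" "x \<in> topspace X" "y \<in> topspace X" for x y
    unfolding is_base_spec_le[OF base]
  proof (intro ballI impI)
    fix V assume "V \<in> KO k Y" "f x \<in> V"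
    then show "f y \<in> V" using spec_leD[OF that(1) KO_openin, of "{x \<in> topspace X. f x \<in> V}" k] L that by simp
  qed
  have ?D
    unfolding preserves_directed_sups_def
  proof (intro allI impI)
    fix D s assume D: "directed_in (spec_order X) D \<and> is_lub (spec_order X) s D"
    then have DX: "D \<subseteq> topspace X" "D \<noteq> {}" and sX: "s \<in> topspace X"
      and dir: "\<And>x y. x \<in> D \<Longrightarrow> y \<in> D \<Longrightarrow> \<exists>z\<in>D. spec_le X x z \<and> spec_le X y z"
      by (simp_all add: directed_in_spec_order is_lub_spec_order)
    show "is_lub (spec_order Y) (f s) (f ` D)"
      unfolding is_lub_spec_order
    proof (intro conjI ballI impI)
      show "f s \<in> topspace Y" using f sX by auto
      show "spec_le Y y (f s)" if "y \<in> f ` D \<inter> topspace Y" for y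
      proof -
        obtain x where x: "x \<in> D" "y = f x" using \<open>y \<in> f ` D \<inter> topspace Y\<close> by blast
        then have "x \<in> topspace X" using DX by (simp add: subsetD)
        then show ?thesis using mono[OF lub_upper[OF conjunct2[OF D] x(1)]] sX x(2) by simp
      qed
      fix u assume u: "\<forall>y\<in>f ` D \<inter> topspace Y. spec_le Y y u"
      show "spec_le Y (f s) u"
        unfolding is_base_spec_le[OF base]
      proof (intro ballI impI)
        fix V assume V: "V \<in> KO k Y" "f s \<in> V"
        have "D \<inter> {x \<in> topspace X. f x \<in> V} \<noteq> {}"
          using alg_space_lub_mem[OF X, of D s "{x \<in> topspace X. f x \<in> V}"] D L V sX KO_openin by auto
        then obtain x where x: "x \<in> D" "f x \<in> V" by blast
        then have "f x \<in> f ` D \<inter> topspace Y" using f DX by auto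
        then have "spec_le Y (f x) u" using u by (rule bspec[rotated])
        then show "u \<in> V" using spec_leD[OF _ KO_openin[OF V(1)]] x by blast
      qed
    qed
  qed
  moreover have ?I
  proof (intro allI impI)
    fix A i assume A: "A \<subseteq> topspace X \<and> (k = AllFilters \<or> A \<noteq> {}) \<and> is_glb (spec_order X) i A"
    then have iX: "i \<in> topspace X" by (simp add: is_glb_spec_order)
    have "f ` A \<subseteq> topspace Y" "k = AllFilters \<or> f ` A \<noteq> {}" using f A by auto
    then obtain j where j: "is_glb (spec_order Y) j (f ` A)" "\<forall>V\<in>KO k Y. j \<in> V \<longleftrightarrow> f ` A \<subseteq> V"
      using alg_space_inf[OF Y k] by blast
    have "f i = j"
    proof (rule is_base_t0_eqI[OF base t0])
      show "f i \<in> topspace Y" using f iX by auto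
      show "j \<in> topspace Y" using j(1) by (simp add: is_glb_spec_order)
      fix V assume V: "V \<in> KO k Y"
      have "i \<in> {x \<in> topspace X. f x \<in> V} \<longleftrightarrow> A \<subseteq> {x \<in> topspace X. f x \<in> V}"
        using alg_space_glb_mem[OF X k] A L V by blast
      then show "f i \<in> V \<longleftrightarrow> j \<in> V" using j(2) V A iX by auto
    qed
    then show "is_glb (spec_order Y) (f i) (f ` A)" using j(1) by simp
  qed
  ultimately show "?D \<and> ?I" ..
next
  assume R: "?D \<and> ?I"
  have D: "is_lub (spec_order Y) (f s) (f ` D)"
    if "directed_in (spec_order X) D" "is_lub (spec_order X) s D" for D s
    using R that unfolding preserves_directed_sups_def by blast
  have glbs: "is_glb (spec_order Y) (f i) (f ` A)"
    if "A \<subseteq> topspace X" "k = AllFilters \<or> A \<noteq> {}" "is_glb (spec_order X) i A" for A i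
    using conjunct2[OF R] that by blast
  \<comment> \<open>Monotonicity is extracted from directed suprema: \<open>{x, y}\<close> is
    directed with supremum \<open>y\<close>.\<close>
  have mono: "spec_le Y (f x) (f y)" if xy: "spec_le X x y" "x \<in> topspace X" "y \<in> topspace X" for x y
  proof -
    have "directed_in (spec_order X) {x, y}" "is_lub (spec_order X) y {x, y}"
      using xy spec_le_refl[of X] by (auto simp: directed_in_spec_order is_lub_spec_order)
    then have "is_lub (spec_order Y) (f y) (f ` {x, y})" by (rule D)
    then show ?thesis using f xy by (intro lub_upper) auto
  qed
  have base: "is_base X (KO k X)" and cl: "k_closed k (topspace X) (KO k X)"
    using alg_space_base[OF X] alg_space_closed[OF X] .
  show ?L
  proof
    fix V assume V: "V \<in> KO k Y"
    have Vo: "openin Y V" using KO_openin[OF V] .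
    let ?W = "{x \<in> topspace X. f x \<in> V}"
    have "scott_open (spec_order X) ?W"
      unfolding scott_open_def spec_order_simps
    proof (intro conjI ballI allI impI)
      show "y \<in> ?W" if "x \<in> ?W" "y \<in> topspace X" "spec_le X x y" for x y
        using that spec_leD[OF mono Vo] by auto
      fix E s assume E: "directed_in (spec_order X) E \<and> is_lub (spec_order X) s E \<and> s \<in> ?W"
      then have EX: "E \<subseteq> topspace X" "E \<noteq> {}"
        and dir: "\<And>x y. x \<in> E \<Longrightarrow> y \<in> E \<Longrightarrow> \<exists>z\<in>E. spec_le X x z \<and> spec_le X y z"
        by (simp_all add: directed_in_spec_order)
      have "directed_in (spec_order Y) (f ` E)"
        unfolding directed_in_spec_order
      proof (intro conjI ballI)
        show "f ` E \<subseteq> topspace Y" "f ` E \<noteq> {}" using f EX by auto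
        fix a b assume "a \<in> f ` E" "b \<in> f ` E"
        then obtain x y where xy: "x \<in> E" "a = f x" "y \<in> E" "b = f y" by blast
        obtain z where z: "z \<in> E" "spec_le X x z" "spec_le X y z" using dir[OF xy(1,3)] by blast
        then have "spec_le Y a (f z)" "spec_le Y b (f z)" using mono xy EX by auto
        then show "\<exists>z\<in>f ` E. spec_le Y a z \<and> spec_le Y b z" using z(1) by blast
      qed
      then have "f ` E \<inter> V \<noteq> {}"
        using alg_space_lub_mem[OF Y _ D[of E s] Vo] E by simp
      then show "E \<inter> ?W \<noteq> {}" using EX by auto
    qed auto
    then have Wo: "openin X ?W" using alg_space_domain(1)[OF X k] by (simp add: scott_space_def)
    \<comment> \<open>Preserving the empty infimum means preserving the top element, which lies in
      every \<open>up Y c\<close>.\<close>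
    have ne: "?W \<noteq> {}" if kA: "k = AllFilters"
    proof -
      obtain c where c: "c \<in> topspace Y" "V = up Y c" using alg_space_principal[OF Y k V] kA by auto
      obtain t where t: "is_glb (spec_order X) t {}" using alg_space_inf[OF X k, of "{}"] kA by blast
      then have "is_glb (spec_order Y) (f t) (f ` {})" using kA by (intro glbs) simp_all
      then have "f t \<in> V" using c unfolding is_glb_spec_order by (simp add: mem_up)
      moreover have "t \<in> topspace X" using t unfolding is_glb_spec_order by simp
      ultimately show ?thesis by auto
    qed
    show "?W \<in> KO k X"
    proof (cases "?W = {}")
      case True
      then have "k \<noteq> AllFilters" using ne by blast
      then show ?thesis unfolding True by (rule k_closed_empty[OF cl])
    next
      case False
      have "?W \<subseteq> topspace X" by auto
      obtain i where i: "is_glb (spec_order X) i ?W"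
        using alg_space_inf[OF X k \<open>?W \<subseteq> topspace X\<close> disjI2[OF False]] by (elim exE conjE)
      have fi: "is_glb (spec_order Y) (f i) (f ` ?W)"
        by (rule glbs[OF \<open>?W \<subseteq> topspace X\<close> disjI2[OF False] i])
      have iX: "i \<in> topspace X" using glb_in[OF i] .
      have "V \<noteq> {}" using False by auto
      then obtain c where c: "c \<in> topspace Y" "V = up Y c" using alg_space_principal[OF Y k V] by auto
      have "\<forall>y\<in>f ` ?W \<inter> topspace Y. spec_le Y c y" using c(2) by (auto simp: mem_up)
      then have "spec_le Y c (f i)" by (intro glb_greatest[OF fi c(1)]) simp
      then have iW: "i \<in> ?W" using iX c(2) f by (auto simp: mem_up)
      obtain U where U: "U \<in> KO k X" "i \<in> U" "U \<subseteq> ?W" using is_baseE[OF base Wo iW] .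
      have "?W \<subseteq> U"
        using spec_leD[OF glb_lower[OF i] KO_openin[OF U(1)] U(2)] by blast
      then show ?thesis using U by (simp add: subset_antisym)
    qed
  qed
qed

text \<open>The trivial comparisons of kinds give both conditions the shape in which
  \<open>alg_space_hom_domain\<close> states them for general \<open>k\<close>.\<close>

lemma preserves_iff:
  assumes "f \<in> topspace X \<rightarrow> topspace Y"
  shows "preserves_infs (spec_order X) (spec_order Y) f \<longleftrightarrow>
    (\<forall>A i. A \<subseteq> topspace X \<and> (AllFilters = AllFilters \<or> A \<noteq> {}) \<and> is_glb (spec_order X) i A \<longrightarrow>
       is_glb (spec_order Y) (f i) (f ` A))"
    and "preserves_nonempty_infs (spec_order X) (spec_order Y) f \<longleftrightarrow>
    (\<forall>A i. A \<subseteq> topspace X \<and> (ProperFilters = AllFilters \<or> A \<noteq> {}) \<and> is_glb (spec_order X) i A \<longrightarrow>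
       is_glb (spec_order Y) (f i) (f ` A))"
  unfolding preserves_infs_def preserves_nonempty_infs_def spec_order_simps by simp_all

section \<open>Identification with the categories of domains\<close>

lemma ocat_eqI:
  fixes A B :: "('o, 'm) ocat"
  assumes "obj A = obj B" "\<And>x y. hom A x y = hom B x y" "idn A = idn B" "hcomp A = hcomp B" "hle A = hle B"
  shows "A = B"
  using assms by (intro ocat.equality ext) simp_all

text \<open>Identities, composition and order coincide by construction, and on both sides the
  hom-sets between non-objects are empty. Matching objects and morphisms therefore gives equality of
  the categories, not merely equivalence.\<close>

lemma X_alg_eq_space_category:
  assumes inf: "infinite (UNIV :: 'u set)"
    and obj: "\<And>X :: 'u topology. t0_space X \<Longrightarrow> alg_space k X \<longleftrightarrow> P X"
    and hom: "\<And>(X :: 'u topology) (Y :: 'u topology) f. alg_space k X \<Longrightarrow> alg_space k Y \<Longrightarrow> f \<in> topspace X \<rightarrow> topspace Y \<Longrightarrow>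
        (\<forall>V\<in>KO k Y. {x \<in> topspace X. f x \<in> V} \<in> KO k X) \<longleftrightarrow> Q X Y f"
  shows "(X_alg k :: ('u topology, 'u \<Rightarrow> 'u) ocat) = space_category P Q"
proof (rule ocat_eqI)
  have o: "X \<in> obj (X_alg k) \<longleftrightarrow> X \<in> obj (space_category P Q)" for X :: "'u topology"
    using obj[of X] alg_space_t0[of k X] unfolding obj_X_alg[OF inf] space_category_def Let_def by auto
  then show "obj (X_alg k :: ('u topology, 'u \<Rightarrow> 'u) ocat) = obj (space_category P Q)" by blast
  fix X Y :: "'u topology"
  show "hom (X_alg k) X Y = hom (space_category P Q) X Y"
  proof (rule Set.set_eqI)
    fix f
    have "f \<in> hom (space_category P Q) X Y \<longleftrightarrow> f \<in> topspace X \<rightarrow>\<^sub>E topspace Y \<and>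
       X \<in> obj (space_category P Q) \<and> Y \<in> obj (space_category P Q) \<and> Q X Y f"
      by (simp add: space_category_def Let_def)
    then show "f \<in> hom (X_alg k) X Y \<longleftrightarrow> f \<in> hom (space_category P Q) X Y"
      unfolding hom_X_alg[OF inf] o[symmetric] using hom[of X Y f] obj_X_alg[OF inf]
      by (auto simp: PiE_def)
  qed
qed (simp_all add: X_alg_def full_subcategory_def EM_def space_category_def Let_def)

lemma X_alg_AllFilters:
  assumes "infinite (UNIV :: 'u set)"
  shows "(X_alg AllFilters :: ('u topology, 'u \<Rightarrow> 'u) ocat) = ALat"
  unfolding ALat_def
proof (rule X_alg_eq_space_category[OF assms])
  fix X :: "'u topology" assume t0: "t0_space X"
  show "alg_space AllFilters X \<longleftrightarrow> scott_space X \<and> algebraic_lattice (spec_order X)"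
  proof
    assume "alg_space AllFilters X"
    then show "scott_space X \<and> algebraic_lattice (spec_order X)"
      unfolding algebraic_lattice_def
      using alg_space_domain[of AllFilters X] alg_space_AllFilters_complete[of X] by simp
  next
    assume R: "scott_space X \<and> algebraic_lattice (spec_order X)"
    then interpret complete_lattice "spec_order X" by (simp add: algebraic_lattice_def)
    have "bounded_complete (spec_order X)"
      using sup_exists by (simp add: bounded_complete_def)
    moreover obtain t where "is_glb (spec_order X) t {}" using inf_exists[of "{}"] by blast
    then have "\<exists>t\<in>topspace X. \<forall>x\<in>topspace X. spec_le X x t"
      unfolding is_glb_spec_order by auto
    ultimately show "alg_space AllFilters X"
      using R t0 by (intro domain_alg_space) (simp_all add: algebraic_lattice_def)
  qed
next
  fix X Y :: "'u topology" and f
  assume "alg_space AllFilters X" "alg_space AllFilters Y" "f \<in> topspace X \<rightarrow> topspace Y"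
  then show "(\<forall>V\<in>KO AllFilters Y. {x \<in> topspace X. f x \<in> V} \<in> KO AllFilters X) \<longleftrightarrow>
      preserves_directed_sups (spec_order X) (spec_order Y) f \<and> preserves_infs (spec_order X) (spec_order Y) f"
    using alg_space_hom_domain[of AllFilters X Y f] preserves_iff(1)[of f X Y] by simp
qed

lemma X_alg_ProperFilters:
  assumes "infinite (UNIV :: 'u set)"
  shows "(X_alg ProperFilters :: ('u topology, 'u \<Rightarrow> 'u) ocat) = ADom"
  unfolding ADom_def
proof (rule X_alg_eq_space_category[OF assms])
  fix X :: "'u topology" assume t0: "t0_space X"
  show "alg_space ProperFilters X \<longleftrightarrow>
      scott_space X \<and> algebraic_domain (spec_order X) \<and> bounded_complete (spec_order X)"
    using alg_space_domain[of ProperFilters X] domain_alg_space[OF _ t0, of ProperFilters]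
    by (metis filter_kind.distinct(2,6))
next
  fix X Y :: "'u topology" and f
  assume "alg_space ProperFilters X" "alg_space ProperFilters Y" "f \<in> topspace X \<rightarrow> topspace Y"
  then show "(\<forall>V\<in>KO ProperFilters Y. {x \<in> topspace X. f x \<in> V} \<in> KO ProperFilters X) \<longleftrightarrow>
      preserves_directed_sups (spec_order X) (spec_order Y) f \<and>
      preserves_nonempty_infs (spec_order X) (spec_order Y) f"
    using alg_space_hom_domain[of ProperFilters X Y f] preserves_iff(2)[of f X Y] by simp
qed

section \<open>Spectral spaces\<close>

text \<open>If a cover had no finite subcover, a prime filter would contain all of \<open>M\<close>
  and avoid every finitely covered open set. Its limit lies in all members of \<open>M\<close>, as
  these are homomorphic, hence in some \<open>C\<close> of the cover; then \<open>C\<close> belongs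
  to the filter although it covers itself.\<close>

lemma KO_Inter_compact:
  assumes a: "algebra PrimeFilters X a" and M: "M \<subseteq> KO PrimeFilters X"
  shows "compactin X (topspace X \<inter> \<Inter>M)"
  unfolding compactin_def
proof (intro conjI allI impI)
  fix \<U> assume U: "(\<forall>U\<in>\<U>. openin X U) \<and> topspace X \<inter> \<Inter>M \<subseteq> \<Union>\<U>"
  show "\<exists>\<V>. finite \<V> \<and> \<V> \<subseteq> \<U> \<and> topspace X \<inter> \<Inter>M \<subseteq> \<Union>\<V>"
  proof (rule ccontr)
    assume no: "\<not> ?thesis"
    let ?F = "{V. openin X V \<and> (\<exists>N. finite N \<and> N \<subseteq> M \<and> topspace X \<inter> \<Inter>N \<subseteq> V)}"
    let ?I = "{V. openin X V \<and> (\<exists>\<V>. finite \<V> \<and> \<V> \<subseteq> \<U> \<and> V \<subseteq> \<Union>\<V>)}"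
    have F: "k_filter AllFilters (topspace X) (opens X) ?F"
      unfolding k_filter_def
    proof (intro conjI ballI impI)
      show "topspace X \<in> ?F" by (auto intro: exI[of _ "{}"])
    next
      fix V W assume "V \<in> ?F" "W \<in> ?F"
      then obtain N N' where N: "finite N" "N \<subseteq> M" "topspace X \<inter> \<Inter>N \<subseteq> V"
        "finite N'" "N' \<subseteq> M" "topspace X \<inter> \<Inter>N' \<subseteq> W" and o: "openin X V" "openin X W" by auto
      have "topspace X \<inter> \<Inter>(N \<union> N') = (topspace X \<inter> \<Inter>N) \<inter> (topspace X \<inter> \<Inter>N')" by auto
      then have "topspace X \<inter> \<Inter>(N \<union> N') \<subseteq> V \<inter> W" using Int_mono[OF N(3,6)] by simp
      then show "V \<inter> W \<in> ?F" using openin_Int[OF o] N(1,2,4,5)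
        by (intro CollectI conjI exI[of _ "N \<union> N'"]) simp_all
    next
      fix V W assume "V \<in> ?F" "W \<in> opens X" "V \<subseteq> W"
      then obtain N where N: "finite N" "N \<subseteq> M" "topspace X \<inter> \<Inter>N \<subseteq> V" by auto
      show "W \<in> ?F"
        using N(1,2) order_trans[OF N(3) \<open>V \<subseteq> W\<close>] \<open>W \<in> opens X\<close>
        by (intro CollectI conjI exI[of _ N]) simp_all
    qed auto
    have e: "{} \<in> ?I" by (auto intro: exI[of _ "{}"])
    have u: "V \<union> W \<in> ?I" if VW: "V \<in> ?I" "W \<in> ?I" for V W
    proof -
      obtain \<V> \<W> where c: "finite \<V>" "\<V> \<subseteq> \<U>" "V \<subseteq> \<Union>\<V>" "finite \<W>" "\<W> \<subseteq> \<U>" "W \<subseteq> \<Union>\<W>"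
        using VW by auto
      have "V \<union> W \<subseteq> \<Union>(\<V> \<union> \<W>)" using Un_mono[OF c(3,6)] by simp
      moreover have "openin X (V \<union> W)" using VW by (simp add: openin_Un)
      ultimately show ?thesis using c(1,2,4,5)
        by (intro CollectI conjI exI[of _ "\<V> \<union> \<W>"]) simp_all
    qed
    have d: "?F \<inter> ?I = {}"
    proof (rule ccontr)
      assume "?F \<inter> ?I \<noteq> {}"
      then obtain V N \<V> where V: "N \<subseteq> M" "topspace X \<inter> \<Inter>N \<subseteq> V" "finite \<V>" "\<V> \<subseteq> \<U>" "V \<subseteq> \<Union>\<V>"
        by auto
      have "topspace X \<inter> \<Inter>M \<subseteq> topspace X \<inter> \<Inter>N" using V(1) by auto
      then have "topspace X \<inter> \<Inter>M \<subseteq> \<Union>\<V>" using V(2,5) by (meson order_trans)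
      then show False using no V(3,4) by (metis (no_types))
    qed
    obtain P where P: "k_filter PrimeFilters (topspace X) (opens X) P" "?F \<subseteq> P" "P \<inter> ?I = {}"
    proof (rule prime_filter_exists[OF k_closed_opens[of PrimeFilters X] F _ e u _ d])
      show "?I \<subseteq> opens X" by auto
      fix V W assume VW: "V \<in> ?I" "W \<in> opens X" "W \<subseteq> V"
      then obtain \<V> where v: "finite \<V>" "\<V> \<subseteq> \<U>" "V \<subseteq> \<Union>\<V>" by auto
      show "W \<in> ?I"
        using v(1,2) order_trans[OF VW(3) v(3)] VW(2) by (intro CollectI conjI exI[of _ \<V>]) simp_all
    qed auto
    have "a P \<in> V" if V: "V \<in> M" for V
    proof -
      have VK: "V \<in> KO PrimeFilters X" using M V by (rule subsetD)
      then have "V \<in> ?F" using KO_openin[OF VK] V by (auto intro!: exI[of _ "{V}"])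
      then have "V \<in> P" using P(2) by (rule subsetD[rotated])
      then show ?thesis using VK P(1) unfolding KO_iff[OF a] by simp
    qed
    then have "a P \<in> topspace X \<inter> \<Inter>M" using algebra_in[OF a P(1)] by simp
    then obtain C where C: "C \<in> \<U>" "a P \<in> C" using U by auto
    then have Co: "openin X C" using U by simp
    have "C \<in> P" using algebra_mem[OF a P(1) Co C(2)] .
    moreover have "C \<in> ?I" using C(1) Co by (auto intro!: exI[of _ "{C}"])
    ultimately show False using P(3) by (metis (lifting) disjoint_iff)
  qed
qed auto

lemma KO_compact:
  assumes a: "algebra PrimeFilters X a" and U: "U \<in> KO PrimeFilters X"
  shows "compactin X U"
proof -
  have "topspace X \<inter> \<Inter>{U} = U" using openin_subset[OF KO_openin[OF U]] by auto
  then show ?thesis using KO_Inter_compact[OF a, of "{U}"] U by simp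
qed

lemma k_closed_finite_Union:
  assumes "k_closed PrimeFilters T B" "finite \<V>" "\<V> \<subseteq> B"
  shows "\<Union>\<V> \<in> B"
  using assms(2,3)
  by (induction) (simp_all add: k_closed_empty[OF assms(1)] k_closed_Un[OF assms(1)])

lemma compactin_finite_cover:
  assumes "compactin X Q" "\<And>x. x \<in> Q \<Longrightarrow> \<exists>U\<in>\<U>. x \<in> U" "\<And>U. U \<in> \<U> \<Longrightarrow> openin X U"
  obtains \<V> where "finite \<V>" "\<V> \<subseteq> \<U>" "Q \<subseteq> \<Union>\<V>"
proof -
  have "Q \<subseteq> \<Union>\<U>" using assms(2) by auto
  then have "\<exists>\<V>. finite \<V> \<and> \<V> \<subseteq> \<U> \<and> Q \<subseteq> \<Union>\<V>"
    using assms(1,3) by (simp add: compactin_def)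
  then show thesis using that by (elim exE conjE)
qed

text \<open>A compact open set is a finite union of the basic sets inside it.\<close>

lemma base_compact_open:
  assumes base: "is_base X B" and cl: "k_closed PrimeFilters (topspace X) B"
    and U: "openin X U" "compactin X U"
  shows "U \<in> B"
proof -
  obtain \<V> where V: "finite \<V>" "\<V> \<subseteq> {V \<in> B. V \<subseteq> U}" "U \<subseteq> \<Union>\<V>"
  proof (rule compactin_finite_cover[OF U(2), of "{V \<in> B. V \<subseteq> U}"])
    show "\<exists>V\<in>{V \<in> B. V \<subseteq> U}. x \<in> V" if x: "x \<in> U" for x
    proof -
      obtain V where "V \<in> B" "x \<in> V" "V \<subseteq> U" using is_baseE[OF base U(1) x] .
      then show ?thesis by auto
    qed
    show "openin X V" if "V \<in> {V \<in> B. V \<subseteq> U}" for V using that is_base_openin[OF base] by simp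
  qed
  have "\<Union>\<V> = U" using V(2,3) by auto
  moreover have "\<V> \<subseteq> B" using V(2) by auto
  ultimately show ?thesis using k_closed_finite_Union[OF cl V(1)] by simp
qed

lemma KO_PrimeFilters_iff:
  assumes X: "alg_space PrimeFilters X"
  shows "U \<in> KO PrimeFilters X \<longleftrightarrow> openin X U \<and> compactin X U"
  using alg_space_algebra[OF X] KO_compact[of X _ U] KO_openin[of U PrimeFilters X]
    base_compact_open[OF alg_space_base[OF X] alg_space_closed[OF X], of U] by (metis (no_types))

text \<open>For \<open>y\<close> outside a saturated \<open>Q\<close>, no point of \<open>Q\<close>
  is below \<open>y\<close>, so each has a homomorphic neighbourhood that omits \<open>y\<close>; by
  compactness the union of finitely many of these includes \<open>Q\<close>.\<close>

lemma compact_saturated_eq_Inter: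
  assumes X: "alg_space PrimeFilters X" and Q: "compact_saturated X Q"
  shows "Q = topspace X \<inter> \<Inter>{U \<in> KO PrimeFilters X. Q \<subseteq> U}"
proof
  have cQ: "compactin X Q" using Q by (simp add: compact_saturated_def)
  then have QX: "Q \<subseteq> topspace X" by (rule compactin_subset_topspace)
  then show "Q \<subseteq> topspace X \<inter> \<Inter>{U \<in> KO PrimeFilters X. Q \<subseteq> U}" by auto
  show "topspace X \<inter> \<Inter>{U \<in> KO PrimeFilters X. Q \<subseteq> U} \<subseteq> Q"
  proof (intro subsetI)
    fix y assume y: "y \<in> topspace X \<inter> \<Inter>{U \<in> KO PrimeFilters X. Q \<subseteq> U}"
    show "y \<in> Q"
    proof (rule ccontr)
      assume yQ: "y \<notin> Q"
      obtain \<V> where V: "finite \<V>" "\<V> \<subseteq> {U \<in> KO PrimeFilters X. y \<notin> U}" "Q \<subseteq> \<Union>\<V>"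
      proof (rule compactin_finite_cover[OF cQ, of "{U \<in> KO PrimeFilters X. y \<notin> U}"])
        show "\<exists>U\<in>{U \<in> KO PrimeFilters X. y \<notin> U}. x \<in> U" if x: "x \<in> Q" for x
        proof -
          have "\<not> spec_le X x y" using Q x y yQ by (auto simp: compact_saturated_def)
          then show ?thesis unfolding is_base_spec_le[OF alg_space_base[OF X]] by auto
        qed
        show "openin X U" if "U \<in> {U \<in> KO PrimeFilters X. y \<notin> U}" for U
          using that KO_openin[of U PrimeFilters X] by simp
      qed
      have "\<V> \<subseteq> KO PrimeFilters X" using V(2) by auto
      then have "\<Union>\<V> \<in> KO PrimeFilters X"
        using k_closed_finite_Union[OF alg_space_closed[OF X] V(1)] by simp
      then have "\<Union>\<V> \<in> {U \<in> KO PrimeFilters X. Q \<subseteq> U}" using V(3) by (rule_tac CollectI) (rule conjI)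
      then have "y \<in> \<Union>\<V>" by (rule InterD[OF IntD2[OF y]])
      then show False using V(2) by auto
    qed
  qed
qed

text \<open>For sobriety, the homomorphic sets meeting an irreducible closed \<open>C\<close> form a
  prime filter, irreducibility being closure under intersection; the point realising it is the
  generic point of \<open>C\<close>. Intersections of compact saturated sets are intersections of
  homomorphic sets, which are compact.\<close>

lemma alg_space_spectral:
  assumes X: "alg_space PrimeFilters X"
  shows "spectral_space X"
proof -
  let ?K = "KO PrimeFilters X"
  have base: "is_base X ?K" and cl: "k_closed PrimeFilters (topspace X) ?K" and t0: "t0_space X"
    using alg_space_base[OF X] alg_space_closed[OF X] alg_space_t0[OF X] .
  obtain a where a: "algebra PrimeFilters X a" using alg_space_algebra[OF X] ..
  have co: "compactin X U" if "U \<in> ?K" for U using KO_compact[OF a that] .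
  have nb: "\<exists>U. U \<in> ?K \<and> x \<in> U \<and> U \<subseteq> W" if "openin X W" "x \<in> W" for W x
    using is_baseE[OF base that] by blast
  have "sober_space X"
    unfolding sober_space_def
  proof (intro allI impI)
    fix C assume A: "closedin X C \<and> C \<noteq> {} \<and>
        (\<forall>A B. closedin X A \<and> closedin X B \<and> C \<subseteq> A \<union> B \<longrightarrow> C \<subseteq> A \<or> C \<subseteq> B)"
    then have C: "closedin X C" "C \<noteq> {}" by simp_all
    have irr: "C \<subseteq> A \<or> C \<subseteq> B" if "closedin X A" "closedin X B" "C \<subseteq> A \<union> B" for A B
      using A that by simp
    have CX: "C \<subseteq> topspace X" using closedin_subset[OF C(1)] .
    let ?G = "{U \<in> ?K. U \<inter> C \<noteq> {}}"
    have G: "k_filter PrimeFilters (topspace X) ?K ?G"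
      unfolding k_filter_def
    proof (intro conjI ballI impI)
      show "topspace X \<in> ?G" using k_closed_top[OF cl] C CX by auto
    next
      fix U V assume UV: "U \<in> ?G" "V \<in> ?G"
      then have UVK: "U \<in> ?K" "V \<in> ?K" by simp_all
      have "U \<inter> V \<inter> C \<noteq> {}"
      proof
        assume "U \<inter> V \<inter> C = {}"
        then have "C \<subseteq> (topspace X - U) \<union> (topspace X - V)" using CX by auto
        moreover have "closedin X (topspace X - U)" "closedin X (topspace X - V)"
          using UVK[THEN KO_openin] by (auto intro: closedin_diff)
        ultimately have "C \<subseteq> topspace X - U \<or> C \<subseteq> topspace X - V" using irr by simp
        then show False using UV by auto
      qed
      then show "U \<inter> V \<in> ?G" using k_closed_Int[OF cl UVK] by simp
    qed auto
    obtain x where x: "x \<in> topspace X" "?G = {U \<in> ?K. x \<in> U}"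
      using alg_space_point[OF X G] by (rule bexE)
    have xU: "x \<in> U \<longleftrightarrow> U \<inter> C \<noteq> {}" if "U \<in> ?K" for U
    proof -
      have "U \<in> ?G \<longleftrightarrow> U \<in> {U \<in> ?K. x \<in> U}" unfolding x(2) ..
      then show ?thesis using that by simp
    qed
    have xC: "x \<in> C"
    proof (rule ccontr)
      assume "x \<notin> C"
      then have "x \<in> topspace X - C" "openin X (topspace X - C)"
        using x(1) C(1) by (simp_all add: openin_diff)
      then obtain U where U: "U \<in> ?K" "x \<in> U" "U \<subseteq> topspace X - C" using nb by blast
      then have "U \<inter> C \<noteq> {}" using xU[OF U(1)] by simp
      then show False using U(3) by auto
    qed
    have "C = X closure_of {x}"
    proof
      show "X closure_of {x} \<subseteq> C" using C(1) xC by (intro closure_of_minimal) simp_all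
      show "C \<subseteq> X closure_of {x}"
      proof
        fix y assume y: "y \<in> C"
        have "x \<in> W" if W: "openin X W" "y \<in> W" for W
        proof -
          obtain U where U: "U \<in> ?K" "y \<in> U" "U \<subseteq> W" using nb[OF W] by blast
          then have "U \<inter> C \<noteq> {}" using y by auto
          then have "x \<in> U" using xU[OF U(1)] by simp
          then show ?thesis using U(3) by (rule subsetD[rotated])
        qed
        then show "y \<in> X closure_of {x}" using y CX by (auto simp: in_closure_of)
      qed
    qed
    moreover have "y = x" if y: "y \<in> topspace X" "C = X closure_of {y}" for y
    proof -
      have "X closure_of {x} = X closure_of {y}" using \<open>C = X closure_of {x}\<close> y by simp
      moreover have "z \<in> X closure_of {z}" if "z \<in> topspace X" for z
        using that by (auto simp: in_closure_of)
      ultimately have "x \<in> X closure_of {y}" "y \<in> X closure_of {x}" using x(1) y(1) by auto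
      then show "y = x" by (intro t0_space_eqI[OF t0 y(1) x(1)]) (auto simp: in_closure_of)
    qed
    ultimately show "\<exists>!x. x \<in> topspace X \<and> C = X closure_of {x}"
      using x(1) by (intro ex1I[of _ x]) simp_all
  qed
  moreover have "neighbourhood_base_of (compactin X) X"
    unfolding neighbourhood_base_of
    using nb co KO_openin by (metis subset_refl)
  moreover have "compactin X (topspace X \<inter> \<Inter>\<K>)"
    if K: "finite \<K> \<and> (\<forall>Q\<in>\<K>. compact_saturated X Q)" for \<K>
  proof -
    let ?M = "\<Union>Q\<in>\<K>. {U \<in> ?K. Q \<subseteq> U}"
    have Q: "topspace X \<inter> \<Inter>{U \<in> ?K. Q \<subseteq> U} = Q" if "Q \<in> \<K>" for Q
      using compact_saturated_eq_Inter[OF X, of Q] conjunct2[OF K] that by (metis (no_types))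
    have "topspace X \<inter> \<Inter>?M = topspace X \<inter> (\<Inter>Q\<in>\<K>. topspace X \<inter> \<Inter>{U \<in> ?K. Q \<subseteq> U})" by blast
    also have "(\<Inter>Q\<in>\<K>. topspace X \<inter> \<Inter>{U \<in> ?K. Q \<subseteq> U}) = (\<Inter>Q\<in>\<K>. Q)"
      by (rule INF_cong[OF refl Q])
    finally have "topspace X \<inter> \<Inter>?M = topspace X \<inter> \<Inter>\<K>" by simp
    moreover have "?M \<subseteq> ?K" by blast
    ultimately show ?thesis using KO_Inter_compact[OF a, of ?M] by (metis (no_types))
  qed
  moreover have "openin X = arbitrary union_of (\<lambda>U. openin X U \<and> compactin X U)"
    unfolding openin_topology_base_unique using nb co KO_openin by (metis (no_types))
  ultimately show ?thesis
    unfolding spectral_space_def stably_compact_space_def by simp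
qed

text \<open>The compact open sets are closed under the lattice operations; a prime filter of them is
  realised by the generic point of an irreducible closed set obtained from sobriety.\<close>

lemma spectral_alg_space:
  assumes t0: "t0_space X" and S: "spectral_space X"
  shows "alg_space PrimeFilters X"
proof -
  let ?B = "{U. openin X U \<and> compactin X U}"
  have sober: "sober_space X"
    and inter: "\<And>\<K>. finite \<K> \<Longrightarrow> (\<And>K. K \<in> \<K> \<Longrightarrow> compact_saturated X K) \<Longrightarrow> compactin X (topspace X \<inter> \<Inter>\<K>)"
    and un: "openin X = arbitrary union_of (\<lambda>K. openin X K \<and> compactin X K)"
    using S by (simp_all add: spectral_space_def stably_compact_space_def)
  have sat: "compact_saturated X U" if "U \<in> ?B" for U
    using that by (auto simp: compact_saturated_def dest: spec_leD)
  have base: "is_base X ?B"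
    using un unfolding openin_topology_base_unique is_base_def by simp
  have top: "compactin X (topspace X)" using inter[of "{}"] by simp
  have "compactin X (U \<inter> V)" if "U \<in> ?B" "V \<in> ?B" for U V
  proof -
    have "topspace X \<inter> \<Inter>{U, V} = U \<inter> V" using that openin_subset[of X U] by auto
    moreover have "compactin X (topspace X \<inter> \<Inter>{U, V})" using sat that by (intro inter) auto
    ultimately show ?thesis by simp
  qed
  moreover have "?B \<subseteq> Pow (topspace X)" using openin_subset[of X] by blast
  ultimately have cl: "k_closed PrimeFilters (topspace X) ?B"
    unfolding k_closed_def using top by (simp add: compactin_Un openin_Int openin_Un)
  have "\<exists>x\<in>topspace X. F = {U \<in> ?B. x \<in> U}" if F: "k_filter PrimeFilters (topspace X) ?B F" for F
  proof -
    have fin: "\<exists>V\<in>\<V>. V \<in> F" if "finite \<V>" "\<V> \<subseteq> ?B" "\<Union>\<V> \<in> F" for \<V>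
      using that
    proof (induction \<V>)
      case empty
      then show ?case using k_filter_empty[OF F] by simp
    next
      case (insert V \<V>)
      have "\<Union>\<V> \<in> ?B" using k_closed_finite_Union[OF cl insert.hyps(1)] insert.prems(1) by simp
      then have "V \<in> F \<or> \<Union>\<V> \<in> F"
        using k_filter_prime[OF F, of V "\<Union>\<V>"] insert.prems by simp
      then show ?case using insert.IH insert.prems by auto
    qed
    \<comment> \<open>The complement of all compact open sets outside \<open>F\<close>. By
      compactness and primeness a compact open set meets it iff it belongs to \<open>F\<close>, and
      closure of \<open>F\<close> under intersections makes it irreducible.\<close>
    let ?C = "topspace X - \<Union>{U \<in> ?B. U \<notin> F}"
    have UC: "U \<in> F \<longleftrightarrow> U \<inter> ?C \<noteq> {}" if U: "U \<in> ?B" for U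
    proof
      assume UF: "U \<in> F"
      show "U \<inter> ?C \<noteq> {}"
      proof
        assume "U \<inter> ?C = {}"
        then have cov: "\<exists>V\<in>{V \<in> ?B. V \<notin> F}. x \<in> V" if "x \<in> U" for x
          using that openin_subset[of X U] U by blast
        have cU: "compactin X U" using U by simp
        obtain \<V> where V: "finite \<V>" "\<V> \<subseteq> {V \<in> ?B. V \<notin> F}" "U \<subseteq> \<Union>\<V>"
        proof (rule compactin_finite_cover[OF cU, of "{V \<in> ?B. V \<notin> F}"])
          show "\<exists>V\<in>{V \<in> ?B. V \<notin> F}. x \<in> V" if "x \<in> U" for x using cov[OF that] .
          show "openin X V" if "V \<in> {V \<in> ?B. V \<notin> F}" for V using that by simp
        qed
        have VB: "\<V> \<subseteq> ?B" using V(2) by auto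
        have "\<Union>\<V> \<in> F"
          using k_filter_mono[OF F UF k_closed_finite_Union[OF cl V(1) VB] V(3)] .
        then obtain V' where "V' \<in> \<V>" "V' \<in> F" using fin[OF V(1) VB] by blast
        then show False using V(2) by auto
      qed
    next
      assume "U \<inter> ?C \<noteq> {}"
      then show "U \<in> F" using U by auto
    qed
    have TF: "topspace X \<in> F" using k_filter_top[OF F] .
    have Cne: "?C \<noteq> {}" using UC[of "topspace X"] TF top by auto
    have Ccl: "closedin X ?C" by (intro closedin_diff openin_Union) auto
    have irr: "?C \<subseteq> A \<or> ?C \<subseteq> B" if AB: "closedin X A" "closedin X B" "?C \<subseteq> A \<union> B" for A B
    proof (rule ccontr)
      assume "\<not> (?C \<subseteq> A \<or> ?C \<subseteq> B)"
      then have no: "\<not> ?C \<subseteq> A" "\<not> ?C \<subseteq> B" by (metis (no_types))+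
      have ex: "\<exists>U. U \<in> F \<and> U \<in> ?B \<and> U \<inter> A' = {}" if A': "closedin X A'" "\<not> ?C \<subseteq> A'" for A'
      proof -
        obtain y where y: "y \<in> ?C" "y \<notin> A'" using A'(2) by blast
        then have "openin X (topspace X - A')" "y \<in> topspace X - A'" using A'(1) by (simp_all add: openin_diff)
        then obtain U where U: "U \<in> ?B" "y \<in> U" "U \<subseteq> topspace X - A'" by (rule is_baseE[OF base])
        then have "U \<inter> ?C \<noteq> {}" using y by blast
        then have "U \<in> F" using UC[OF U(1)] by simp
        moreover have "U \<inter> A' = {}" using U(3) by auto
        ultimately show ?thesis using U(1) by blast
      qed
      obtain U where U: "U \<in> F" "U \<in> ?B" "U \<inter> A = {}" using ex[OF AB(1) no(1)] by blast
      obtain V where V: "V \<in> F" "V \<in> ?B" "V \<inter> B = {}" using ex[OF AB(2) no(2)] by blast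
      have "U \<inter> V \<in> F" using k_filter_Int[OF F U(1) V(1)] .
      then have "U \<inter> V \<inter> ?C \<noteq> {}" using UC[OF k_closed_Int[OF cl U(2) V(2)]] by simp
      then obtain y where "y \<in> U" "y \<in> V" "y \<in> ?C" by blast
      then have "y \<in> A \<union> B" using AB(3) by (rule_tac subsetD)
      then show False using U(3) V(3) \<open>y \<in> U\<close> \<open>y \<in> V\<close> by auto
    qed
    have "closedin X ?C \<and> ?C \<noteq> {} \<and>
        (\<forall>A B. closedin X A \<and> closedin X B \<and> ?C \<subseteq> A \<union> B \<longrightarrow> ?C \<subseteq> A \<or> ?C \<subseteq> B)"
      by (intro conjI Ccl Cne allI impI irr; elim conjE)
    then have "\<exists>!x. x \<in> topspace X \<and> ?C = X closure_of {x}"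
      by (rule sober[unfolded sober_space_def, THEN spec, of ?C, THEN mp])
    then obtain x where x: "x \<in> topspace X" "?C = X closure_of {x}" by (elim ex1E conjE)
    have "x \<in> U \<longleftrightarrow> U \<in> F" if U: "U \<in> ?B" for U
    proof -
      have "U \<inter> X closure_of {x} \<noteq> {} \<longleftrightarrow> x \<in> U"
        using U x(1) by (auto simp: in_closure_of)
      then show ?thesis using UC[OF U] unfolding x(2) by simp
    qed
    then have "F = {U \<in> ?B. x \<in> U}" using k_filter_subset[OF F] by auto
    then show ?thesis using x(1) by blast
  qed
  then have "kbasis PrimeFilters X ?B" using base cl by (simp add: kbasis_def)
  then show ?thesis using alg_spaceI(1)[OF t0] by blast
qed

text \<open>A compact saturated set is an intersection of homomorphic sets, so its inverse image is
  one too and hence compact. Conversely homomorphic sets are compact open, in particular compact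
  saturated.\<close>

lemma alg_space_hom_spectral:
  assumes X: "alg_space PrimeFilters X" and Y: "alg_space PrimeFilters Y"
    and f: "f \<in> topspace X \<rightarrow> topspace Y"
  shows "(\<forall>V\<in>KO PrimeFilters Y. {x \<in> topspace X. f x \<in> V} \<in> KO PrimeFilters X) \<longleftrightarrow> spectral_map X Y f"
    (is "?L \<longleftrightarrow> _")
proof
  assume L: ?L
  obtain a where a: "algebra PrimeFilters X a" using alg_space_algebra[OF X] ..
  have "continuous_map X Y f"
    using L by (intro is_base_continuous_map[OF alg_space_base[OF Y] f] KO_openin[where k = PrimeFilters]) simp
  moreover have "compactin X {x \<in> topspace X. f x \<in> Q}" if Q: "compact_saturated Y Q" for Q
  proof -
    let ?M = "{V \<in> KO PrimeFilters Y. Q \<subseteq> V}"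
    let ?N = "(\<lambda>V. {x \<in> topspace X. f x \<in> V}) ` ?M"
    have "Q = topspace Y \<inter> \<Inter>?M" by (rule compact_saturated_eq_Inter[OF Y Q])
    then have "f x \<in> Q \<longleftrightarrow> f x \<in> topspace Y \<inter> \<Inter>?M" for x by simp
    then have "{x \<in> topspace X. f x \<in> Q} = topspace X \<inter> \<Inter>?N" using f by auto
    moreover have "?N \<subseteq> KO PrimeFilters X" using L by auto
    ultimately show ?thesis using KO_Inter_compact[OF a] by simp
  qed
  ultimately show "spectral_map X Y f" by (simp add: spectral_map_def)
next
  assume f: "spectral_map X Y f"
  show ?L
  proof
    fix V assume "V \<in> KO PrimeFilters Y"
    then have V: "openin Y V" "compactin Y V" by (simp_all add: KO_PrimeFilters_iff[OF Y])
    then have "compact_saturated Y V" by (auto simp: compact_saturated_def dest: spec_leD)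
    then show "{x \<in> topspace X. f x \<in> V} \<in> KO PrimeFilters X"
      using f V(1) by (simp add: KO_PrimeFilters_iff[OF X] spectral_map_def continuous_map_def)
  qed
qed

lemma X_alg_PrimeFilters:
  assumes "infinite (UNIV :: 'u set)"
  shows "(X_alg PrimeFilters :: ('u topology, 'u \<Rightarrow> 'u) ocat) = Spec"
  unfolding Spec_def
proof (rule X_alg_eq_space_category[OF assms])
  show "alg_space PrimeFilters X \<longleftrightarrow> spectral_space X" if "t0_space X" for X :: "'u topology"
    using alg_space_spectral spectral_alg_space[OF that] by (rule iffI)
qed (rule alg_space_hom_spectral)

section \<open>Finite spaces with prescribed points\<close>

text \<open>The topology on \<open>'b\<close> with subbase \<open>S\<close>, copied along
  \<open>\<nu>\<close> into the type in which the points of objects must lie.\<close>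

definition code_space :: "('b \<Rightarrow> 'a) \<Rightarrow> 'b set set \<Rightarrow> 'a topology" where
  "code_space \<nu> S = generated_topology (range \<nu>) ((`) \<nu> ` S)"

lemma topspace_code_space: "topspace (code_space \<nu> S) = range \<nu>"
  unfolding code_space_def by (rule topspace_generated_topology) auto

text \<open>By \<open>sep\<close> and \<open>real\<close> the points correspond to the truth
  assignments on \<open>S\<close>, so the space is a copy of a power of the Sierpinski space and any
  filter is realised on the generators.\<close>

lemma code_space_alg:
  assumes inj: "inj \<nu>"
    and sep: "\<And>a b. a \<noteq> b \<Longrightarrow> \<exists>P\<in>S. a \<in> P \<longleftrightarrow> b \<notin> P"
    and real: "\<And>Q. \<exists>b. \<forall>P\<in>S. b \<in> P \<longleftrightarrow> Q P"
  shows "alg_space k (code_space \<nu> S)"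
    and "KO k (code_space \<nu> S) = kcl k (topspace (code_space \<nu> S)) ((`) \<nu> ` S)"
proof -
  let ?X = "code_space \<nu> S" and ?S = "(`) \<nu> ` S"
  have sub: "?S \<subseteq> Pow (range \<nu>)" by auto
  have mem: "\<nu> b \<in> \<nu> ` P \<longleftrightarrow> b \<in> P" for b P by (rule inj_image_mem_iff[OF inj])
  have t0: "t0_space ?X"
    unfolding t0_space_def topspace_code_space
  proof (intro ballI impI)
    fix x y assume "x \<in> range \<nu>" "y \<in> range \<nu>" "x \<noteq> y"
    then obtain a b where ab: "x = \<nu> a" "y = \<nu> b" "a \<noteq> b" by auto
    then obtain P where P: "P \<in> S" "a \<in> P \<longleftrightarrow> b \<notin> P" using sep by blast
    then have "openin ?X (\<nu> ` P)"
      unfolding code_space_def by (intro openin_generated_topology) simp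
    then show "\<exists>U. openin ?X U \<and> (x \<notin> U) = (y \<in> U)"
      using P(2) ab mem by (intro exI[of _ "\<nu> ` P"]) simp
  qed
  have base: "is_base ?X (kcl k (topspace ?X) ?S)"
    using is_base_generated_topology[OF sub] by (simp add: topspace_code_space) (simp add: code_space_def)
  have "kbasis k ?X (kcl k (topspace ?X) ?S)"
  proof (rule kbasis_kclI[OF base])
    fix F
    obtain b where b: "\<forall>P\<in>S. b \<in> P \<longleftrightarrow> \<nu> ` P \<in> F" using real[of "\<lambda>P. \<nu> ` P \<in> F"] ..
    then show "\<exists>x\<in>topspace ?X. \<forall>U\<in>?S. x \<in> U \<longleftrightarrow> U \<in> F"
      by (intro bexI[of _ "\<nu> b"]) (simp_all add: mem topspace_code_space)
  qed
  then show "alg_space k ?X" "KO k ?X = kcl k (topspace ?X) ?S"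
    using alg_spaceI[OF t0] by simp_all
qed

text \<open>A copy of the Sierpinski space, with open point \<open>\<iota> True\<close>.\<close>

definition point_space :: "(bool \<Rightarrow> 'a) \<Rightarrow> 'a topology" where
  "point_space \<iota> = code_space \<iota> {{True}}"

lemma topspace_point_space: "topspace (point_space \<iota>) = range \<iota>"
  by (simp add: point_space_def topspace_code_space)

lemma point_space_alg:
  assumes "inj \<iota>"
  shows "alg_space k (point_space \<iota>)"
    and "KO k (point_space \<iota>) = kcl k (topspace (point_space \<iota>)) {{\<iota> True}}"
proof -
  have "\<exists>b. \<forall>P\<in>{{True}}. b \<in> P \<longleftrightarrow> Q P" for Q :: "bool set \<Rightarrow> bool" by (rule exI[of _ "Q {True}"]) simp
  note * = code_space_alg[OF assms _ this, where k = k]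
  show "alg_space k (point_space \<iota>)" "KO k (point_space \<iota>) = kcl k (topspace (point_space \<iota>)) {{\<iota> True}}"
    unfolding point_space_def using * by auto
qed

section \<open>The subcategory relations\<close>

lemma obj_Top0: "X \<in> obj Top0 \<longleftrightarrow> t0_space X \<and> small (topspace X)"
  by (simp add: Top0_def space_category_def Let_def)

lemma hom_Top0: "f \<in> hom Top0 X Y \<longleftrightarrow>
    f \<in> topspace X \<rightarrow>\<^sub>E topspace Y \<and> X \<in> obj Top0 \<and> Y \<in> obj Top0 \<and> continuous_map X Y f"
  by (auto simp: Top0_def space_category_def Let_def)

lemma ops_Top0:
  "idn Top0 = (\<lambda>X. \<lambda>x\<in>topspace X. x)"
  "hcomp Top0 = (\<lambda>X Y Z g f. compose (topspace X) g f)"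
  "hle Top0 = (\<lambda>X Y f g. \<forall>x\<in>topspace X. spec_le Y (f x) (g x))"
  by (simp_all add: Top0_def space_category_def Let_def)

lemma ops_EM: "idn (EM k) = idn Top0" "hcomp (EM k) = hcomp Top0" "hle (EM k) = hle Top0"
  by (simp_all add: EM_def Top0_def space_category_def Let_def)

lemma ops_full: "idn (full_subcategory C P) = idn C" "hcomp (full_subcategory C P) = hcomp C"
    "hle (full_subcategory C P) = hle C"
  by (simp_all add: full_subcategory_def)

lemma ops_X_alg: "idn (X_alg k) = idn Top0" "hcomp (X_alg k) = hcomp Top0" "hle (X_alg k) = hle Top0"
  by (simp_all add: X_alg_def ops_full ops_EM)

lemma X_alg_idn:
  fixes X :: "'u topology"
  assumes inf: "infinite (UNIV :: 'u set)" and X: "X \<in> obj (X_alg k)"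
  shows "(\<lambda>x\<in>topspace X. x) \<in> hom (X_alg k) X X"
proof -
  have "{x \<in> topspace X. (\<lambda>x\<in>topspace X. x) x \<in> V} = V" if "V \<in> KO k X" for V
    using openin_subset[OF KO_openin[OF that]] by auto
  then show ?thesis unfolding hom_X_alg[OF inf] using X by simp
qed

lemma X_alg_compose:
  fixes X Y Z :: "'u topology"
  assumes inf: "infinite (UNIV :: 'u set)"
    and f: "f \<in> hom (X_alg k) X Y" and g: "g \<in> hom (X_alg k) Y Z"
  shows "compose (topspace X) g f \<in> hom (X_alg k) X Z"
proof -
  have f': "f \<in> topspace X \<rightarrow>\<^sub>E topspace Y" "X \<in> obj (X_alg k)"
    "\<And>V. V \<in> KO k Y \<Longrightarrow> {x \<in> topspace X. f x \<in> V} \<in> KO k X"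
    and g': "g \<in> topspace Y \<rightarrow>\<^sub>E topspace Z" "Z \<in> obj (X_alg k)"
    "\<And>V. V \<in> KO k Z \<Longrightarrow> {x \<in> topspace Y. g x \<in> V} \<in> KO k Y"
    using f g unfolding hom_X_alg[OF inf] by simp_all
  have fY: "f x \<in> topspace Y" if "x \<in> topspace X" for x using f'(1) that by (rule PiE_mem)
  have gZ: "g y \<in> topspace Z" if "y \<in> topspace Y" for y using g'(1) that by (rule PiE_mem)
  have "{x \<in> topspace X. compose (topspace X) g f x \<in> V} \<in> KO k X" if "V \<in> KO k Z" for V
  proof -
    have "{x \<in> topspace X. compose (topspace X) g f x \<in> V} =
        {x \<in> topspace X. f x \<in> {y \<in> topspace Y. g y \<in> V}}"
      using fY by (intro Collect_cong conj_cong refl) (simp add: compose_eq)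
    then show ?thesis using f'(3)[OF g'(3)[OF that]] by simp
  qed
  moreover have "compose (topspace X) g f \<in> topspace X \<rightarrow>\<^sub>E topspace Z"
    unfolding PiE_iff using fY gZ by (simp add: compose_eq)
  ultimately show ?thesis unfolding hom_X_alg[OF inf] using f'(2) g'(2) by simp
qed

lemma X_alg_hom_Top0:
  fixes X Y :: "'u topology"
  assumes inf: "infinite (UNIV :: 'u set)" and f: "f \<in> hom (X_alg k) X Y"
  shows "f \<in> hom Top0 X Y"
proof -
  have f': "f \<in> topspace X \<rightarrow>\<^sub>E topspace Y" "X \<in> obj (X_alg k)" "Y \<in> obj (X_alg k)"
    "\<And>V. V \<in> KO k Y \<Longrightarrow> {x \<in> topspace X. f x \<in> V} \<in> KO k X"
    using f unfolding hom_X_alg[OF inf] by simp_all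
  have X: "alg_space k X" "small (topspace X)" and Y: "alg_space k Y" "small (topspace Y)"
    using f'(2,3) by (simp_all add: obj_X_alg[OF inf])
  have "continuous_map X Y f"
  proof (rule is_base_continuous_map[OF alg_space_base[OF Y(1)]])
    show "f \<in> topspace X \<rightarrow> topspace Y" using f'(1) by (simp add: PiE_def)
    show "openin X {x \<in> topspace X. f x \<in> V}" if "V \<in> KO k Y" for V
      using KO_openin[OF f'(4)[OF that]] .
  qed
  then show ?thesis
    unfolding hom_Top0 obj_Top0 using f'(1) X Y alg_space_t0[OF X(1)] alg_space_t0[OF Y(1)] by simp
qed

lemma subcategory_X_alg_EM:
  assumes inf: "infinite (UNIV :: 'u set)"
  shows "subcategory (X_alg k :: ('u topology, 'u \<Rightarrow> 'u) ocat) (EM k)"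
  unfolding subcategory_def ops_X_alg ops_EM ops_Top0
proof (intro conjI ballI refl)
  show "obj (X_alg k) \<subseteq> obj (EM k :: ('u topology, 'u \<Rightarrow> 'u) ocat)"
    by (auto simp: X_alg_def full_subcategory_def)
  show "hom (X_alg k) X Y \<subseteq> hom (EM k) X Y" for X Y :: "'u topology"
    by (auto simp: X_alg_def full_subcategory_def)
qed (auto intro: X_alg_idn[OF inf] X_alg_compose[OF inf])

lemma subcategory_X_alg_Top0:
  assumes inf: "infinite (UNIV :: 'u set)"
  shows "subcategory (X_alg k :: ('u topology, 'u \<Rightarrow> 'u) ocat) Top0"
  unfolding subcategory_def ops_X_alg ops_Top0
proof (intro conjI ballI refl)
  show "obj (X_alg k) \<subseteq> (obj Top0 :: 'u topology set)"
    using alg_space_t0[of k] by (auto simp: obj_X_alg[OF inf] obj_Top0)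
qed (auto intro: X_alg_idn[OF inf] X_alg_compose[OF inf] X_alg_hom_Top0[OF inf])

section \<open>Closure under weighted limits\<close>

text \<open>
  \<open>B\<close> stands for the category of algebras, with \<open>G = KO k\<close>, or for \<open>Top0\<close>, with \<open>G = opens\<close>. The
  map \<open>e q\<close> represents the point \<open>q\<close> by a morphism from a two-point space, sending the smaller point
  to \<open>q\<close>; for the filter monad no constant map will do, as the top element is preserved.
\<close>

locale ambient =
  fixes k :: filter_kind and B :: "('u topology, 'u \<Rightarrow> 'u) ocat" and G :: "'u topology \<Rightarrow> 'u set set"
    and \<iota> :: "bool \<Rightarrow> 'u"
  assumes inf: "infinite (UNIV :: 'u set)" and inj: "inj \<iota>"
    and sub: "subcategory (X_alg k) B" and ops: "hcomp B = hcomp Top0" "hle B = hle Top0"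
    and obj_B: "\<And>A. A \<in> obj B \<Longrightarrow> A \<in> obj Top0"
    and hom_B_Top0: "\<And>A A' f. f \<in> hom B A A' \<Longrightarrow> f \<in> hom Top0 A A'"
    and hom_B: "\<And>A X t. A \<in> obj B \<Longrightarrow> X \<in> obj (X_alg k) \<Longrightarrow> t \<in> hom B A X \<longleftrightarrow>
       t \<in> topspace A \<rightarrow>\<^sub>E topspace X \<and> (\<forall>V\<in>KO k X. {w \<in> topspace A. t w \<in> V} \<in> G A)"
    and probe: "\<And>L. L \<in> obj B \<Longrightarrow> \<exists>e. \<forall>q\<in>topspace L. e q \<in> hom B (point_space \<iota>) L \<and> e q (\<iota> False) = q \<and>
       (\<forall>q'\<in>topspace L. \<forall>s. e q s = e q' s \<or> e q s = q \<and> e q' s = q')"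
begin

lemma hcomp_B: "hcomp B X Y Z g f = compose (topspace X) g f"
  and hle_B: "hle B X Y f g \<longleftrightarrow> (\<forall>x\<in>topspace X. spec_le Y (f x) (g x))"
  by (simp_all add: ops ops_Top0)

lemma ops_X_alg_B: "hcomp (X_alg k) = hcomp B" "hle (X_alg k) = hle B"
  by (simp_all add: ops ops_X_alg)

lemma X_alg_obj_B: "X \<in> obj (X_alg k) \<Longrightarrow> X \<in> obj B"
  using sub by (auto simp: subcategory_def)

lemma X_alg_hom_B: "f \<in> hom (X_alg k) X Y \<Longrightarrow> f \<in> hom B X Y"
proof -
  assume f: "f \<in> hom (X_alg k) X Y"
  have "\<forall>x\<in>obj (X_alg k). \<forall>y\<in>obj (X_alg k). hom (X_alg k) x y \<subseteq> hom B x y"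
    using sub unfolding subcategory_def by (elim conjE)
  from this[THEN bspec, THEN bspec, of X Y] have "hom (X_alg k) X Y \<subseteq> hom B X Y"
    using f by (simp add: hom_X_alg[OF inf])
  then show ?thesis using f by (rule subsetD)
qed

lemma point_space_obj: "point_space \<iota> \<in> obj (X_alg k)"
  using point_space_alg[OF inj] finite_small[OF inf]
  by (simp add: obj_X_alg[OF inf] topspace_point_space)

lemma point_space_hom:
  assumes X: "X \<in> obj (X_alg k)" and t: "t \<in> range \<iota> \<rightarrow>\<^sub>E topspace X"
    and V: "\<And>V. V \<in> KO k X \<Longrightarrow> {s \<in> range \<iota>. t s \<in> V} \<in> {range \<iota>, {\<iota> True}} \<union> (if k = AllFilters then {} else {{}})"
  shows "t \<in> hom (X_alg k) (point_space \<iota>) X"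
  unfolding hom_X_alg[OF inf] topspace_point_space
proof (intro conjI ballI)
  have K: "KO k (point_space \<iota>) = kcl k (range \<iota>) {{\<iota> True}}"
    using point_space_alg(2)[OF inj] by (simp add: topspace_point_space)
  have "{range \<iota>, {\<iota> True}} \<union> (if k = AllFilters then {} else {{}}) \<subseteq> KO k (point_space \<iota>)"
    using kcl_base[of "{\<iota> True}" "{{\<iota> True}}" k "range \<iota>"] kcl_top[of "range \<iota>" k "{{\<iota> True}}"]
      kcl_empty[of k "range \<iota>" "{{\<iota> True}}"]
    unfolding K by simp
  then show "{s \<in> range \<iota>. t s \<in> V} \<in> KO k (point_space \<iota>)" if "V \<in> KO k X" for V
    using V[OF that] by (rule subsetD)
qed (use X t point_space_obj in auto)

context
  fixes D :: "('i, 'n) ocat" and Fo Fm and Wo :: "'i \<Rightarrow> 'w gorder" and Wm L l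
  assumes F: "order_functor D (X_alg k) Fo Fm" and W: "order_functor D Pos Wo Wm"
    and lim: "weighted_limit B D Fo Fm Wo Wm L l"
begin

lemma Fo_obj: "d \<in> obj D \<Longrightarrow> Fo d \<in> obj (X_alg k)"
  using F by (simp add: order_functor_def)

lemma Fo_alg: "d \<in> obj D \<Longrightarrow> alg_space k (Fo d)"
  using Fo_obj by (simp add: obj_X_alg[OF inf])

lemma Fm_hom: "d \<in> obj D \<Longrightarrow> d' \<in> obj D \<Longrightarrow> n \<in> hom D d d' \<Longrightarrow> Fm d d' n \<in> hom (X_alg k) (Fo d) (Fo d')"
  using F unfolding order_functor_def by (elim conjE) blast

lemma Fm_PiE: "d \<in> obj D \<Longrightarrow> d' \<in> obj D \<Longrightarrow> n \<in> hom D d d' \<Longrightarrow>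
    Fm d d' n \<in> topspace (Fo d) \<rightarrow>\<^sub>E topspace (Fo d')"
  using Fm_hom[of d d' n] by (simp add: hom_X_alg[OF inf])

lemma Fm_KO: "d \<in> obj D \<Longrightarrow> d' \<in> obj D \<Longrightarrow> n \<in> hom D d d' \<Longrightarrow> V \<in> KO k (Fo d') \<Longrightarrow>
    {y \<in> topspace (Fo d). Fm d d' n y \<in> V} \<in> KO k (Fo d)"
  using Fm_hom[of d d' n] unfolding hom_X_alg[OF inf] by simp

lemma Wm_in: "d \<in> obj D \<Longrightarrow> d' \<in> obj D \<Longrightarrow> n \<in> hom D d d' \<Longrightarrow> x \<in> carrier (Wo d) \<Longrightarrow>
    Wm d d' n x \<in> carrier (Wo d')"
proof -
  assume *: "d \<in> obj D" "d' \<in> obj D" "n \<in> hom D d d'" "x \<in> carrier (Wo d)"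
  have "Wm d d' n \<in> hom Pos (Wo d) (Wo d')"
    using W *(1-3) unfolding order_functor_def by (elim conjE) blast
  then show ?thesis using *(4) by (auto simp: Pos_def)
qed

lemma cone: "weighted_cone B D Fo Fm Wo Wm L l"
  using lim by (simp add: weighted_limit_def)

lemma L_obj: "L \<in> obj B"
  using cone by (simp add: weighted_cone_def)

lemma l_hom: "d \<in> obj D \<Longrightarrow> x \<in> carrier (Wo d) \<Longrightarrow> l d x \<in> hom B L (Fo d)"
  using cone unfolding weighted_cone_def by (elim conjE) blast

lemma l_PiE: "d \<in> obj D \<Longrightarrow> x \<in> carrier (Wo d) \<Longrightarrow> l d x \<in> topspace L \<rightarrow>\<^sub>E topspace (Fo d)"
  using l_hom[of d x] hom_B[OF L_obj Fo_obj] by simp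

lemma l_mono: "d \<in> obj D \<Longrightarrow> x \<in> carrier (Wo d) \<Longrightarrow> y \<in> carrier (Wo d) \<Longrightarrow> x \<sqsubseteq>\<^bsub>Wo d\<^esub> y \<Longrightarrow>
    w \<in> topspace L \<Longrightarrow> spec_le (Fo d) (l d x w) (l d y w)"
  using cone unfolding weighted_cone_def hle_B by (elim conjE) blast

lemma l_nat: "d \<in> obj D \<Longrightarrow> d' \<in> obj D \<Longrightarrow> n \<in> hom D d d' \<Longrightarrow> x \<in> carrier (Wo d) \<Longrightarrow>
    compose (topspace L) (Fm d d' n) (l d x) = l d' (Wm d d' n x)"
  using cone unfolding weighted_cone_def hcomp_B by (elim conjE) blast

lemma lim_factor:
  assumes "weighted_cone B D Fo Fm Wo Wm A a"
  shows "\<exists>!t. t \<in> hom B A L \<and>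
    (\<forall>d\<in>obj D. \<forall>x\<in>carrier (Wo d). a d x = compose (topspace A) (l d x) t)"
proof -
  have "\<forall>A a. weighted_cone B D Fo Fm Wo Wm A a \<longrightarrow>
        (\<exists>!t. t \<in> hom B A L \<and>
           (\<forall>d\<in>obj D. \<forall>x\<in>carrier (Wo d). a d x = compose (topspace A) (l d x) t))"
    using lim unfolding weighted_limit_def hcomp_B by (elim conjE)
  then show ?thesis using assms by simp
qed

lemma lim_reflect:
  assumes "A \<in> obj B" "t \<in> hom B A L" "t' \<in> hom B A L"
    and le: "\<And>d x w. d \<in> obj D \<Longrightarrow> x \<in> carrier (Wo d) \<Longrightarrow> w \<in> topspace A \<Longrightarrow>
      spec_le (Fo d) (l d x (t w)) (l d x (t' w))"
    and w: "w \<in> topspace A"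
  shows "spec_le L (t w) (t' w)"
proof -
  have "\<forall>A\<in>obj B. \<forall>t\<in>hom B A L. \<forall>t'\<in>hom B A L.
        (\<forall>d\<in>obj D. \<forall>x\<in>carrier (Wo d). \<forall>w\<in>topspace A.
           spec_le (Fo d) (compose (topspace A) (l d x) t w) (compose (topspace A) (l d x) t' w)) \<longrightarrow>
        (\<forall>w\<in>topspace A. spec_le L (t w) (t' w))"
    using lim unfolding weighted_limit_def hcomp_B hle_B by (elim conjE)
  from this[rule_format, OF assms(1-3) _ w] show ?thesis using le by (simp add: compose_eq)
qed

text \<open>The points are compared through the probes \<open>e q\<close> and \<open>e q'\<close>.
  Where these differ, their values are \<open>q\<close> and \<open>q'\<close>, which no leg tells
  apart; reflection of the order by the legs, applied both ways, gives equality.\<close>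

lemma separate:
  assumes q: "q \<in> topspace L" and q': "q' \<in> topspace L"
    and eq: "\<And>d x. d \<in> obj D \<Longrightarrow> x \<in> carrier (Wo d) \<Longrightarrow> l d x q = l d x q'"
  shows "q = q'"
proof -
  obtain e where e: "\<forall>q\<in>topspace L. e q \<in> hom B (point_space \<iota>) L \<and> e q (\<iota> False) = q \<and>
       (\<forall>q'\<in>topspace L. \<forall>s. e q s = e q' s \<or> e q s = q \<and> e q' s = q')"
    using probe[OF L_obj] ..
  have leq: "l d x (e q s) = l d x (e q' s)" if "d \<in> obj D" "x \<in> carrier (Wo d)" for d x s
  proof -
    have "e q s = e q' s \<or> e q s = q \<and> e q' s = q'" using e q q' by simp
    then show ?thesis using eq[OF that] by auto
  qed
  have h: "e q \<in> hom B (point_space \<iota>) L" "e q' \<in> hom B (point_space \<iota>) L"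
    and F: "e q (\<iota> False) = q" "e q' (\<iota> False) = q'" using e q q' by simp_all
  have i: "\<iota> False \<in> topspace (point_space \<iota>)" by (simp add: topspace_point_space)
  have "spec_le L (e q (\<iota> False)) (e q' (\<iota> False))" "spec_le L (e q' (\<iota> False)) (e q (\<iota> False))"
    by (rule lim_reflect[OF X_alg_obj_B[OF point_space_obj] _ _ _ i];
      (rule h | simp add: leq spec_le_refl))+
  then show "q = q'"
    using spec_le_antisym[of L q q'] q q' obj_B[OF L_obj] unfolding F by (simp add: obj_Top0)
qed

text \<open>A compatible family of points becomes a cone with vertex the two-point space, and the
  factorisation of this cone is evaluated at \<open>\<iota> False\<close>. This yields the points of
  \<open>L\<close> without a construction of the limit.\<close>

lemma realise:
  assumes p: "\<And>d x. d \<in> obj D \<Longrightarrow> x \<in> carrier (Wo d) \<Longrightarrow> p d x \<in> topspace (Fo d)"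
    and mono: "\<And>d x y. d \<in> obj D \<Longrightarrow> x \<in> carrier (Wo d) \<Longrightarrow> y \<in> carrier (Wo d) \<Longrightarrow> x \<sqsubseteq>\<^bsub>Wo d\<^esub> y \<Longrightarrow>
      spec_le (Fo d) (p d x) (p d y)"
    and nat: "\<And>d d' n x. d \<in> obj D \<Longrightarrow> d' \<in> obj D \<Longrightarrow> n \<in> hom D d d' \<Longrightarrow> x \<in> carrier (Wo d) \<Longrightarrow>
      Fm d d' n (p d x) = p d' (Wm d d' n x)"
  shows "\<exists>q\<in>topspace L. \<forall>d\<in>obj D. \<forall>x\<in>carrier (Wo d). l d x q = p d x"
proof -
  \<comment> \<open>For \<open>AllFilters\<close> the family of all homomorphic sets is itself a
    filter; the point realising it is the top element.\<close>
  have "\<exists>t. t \<in> topspace (Fo d) \<and> (\<forall>V\<in>KO k (Fo d). t \<in> V)" if kA: "k = AllFilters" and d: "d \<in> obj D" for d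
  proof -
    have cl: "k_closed k (topspace (Fo d)) (KO k (Fo d))" using alg_space_closed[OF Fo_alg[OF d]] .
    have "k_filter k (topspace (Fo d)) (KO k (Fo d)) (KO k (Fo d))"
      unfolding k_filter_def using kA k_closed_top[OF cl] k_closed_Int[OF cl] by simp
    from alg_space_point[OF Fo_alg[OF d] this]
    obtain t where t: "t \<in> topspace (Fo d)" "KO k (Fo d) = {U \<in> KO k (Fo d). t \<in> U}" ..
    have "t \<in> V" if "V \<in> KO k (Fo d)" for V
      using that by (subst (asm) t(2)) simp
    then show ?thesis using t(1) by blast
  qed
  then obtain T where T: "\<And>d. k = AllFilters \<Longrightarrow> d \<in> obj D \<Longrightarrow> T d \<in> topspace (Fo d)"
    "\<And>d V. k = AllFilters \<Longrightarrow> d \<in> obj D \<Longrightarrow> V \<in> KO k (Fo d) \<Longrightarrow> T d \<in> V" by metis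
  \<comment> \<open>The value at \<open>\<iota> False\<close> carries the information. For the
    filter monad the open point is sent to the top, so that inverse images of homomorphic sets are
    never empty.\<close>
  define a where "a d x = (\<lambda>s\<in>range \<iota>. if s = \<iota> False \<or> k \<noteq> AllFilters then p d x else T d)" for d x
  let ?S = "point_space \<iota>"
  have a_in: "a d x \<in> range \<iota> \<rightarrow>\<^sub>E topspace (Fo d)" if "d \<in> obj D" "x \<in> carrier (Wo d)" for d x
    using p[OF that] T(1)[OF _ that(1)] by (auto simp: a_def)
  have r: "range \<iota> = {\<iota> False, \<iota> True}" by (simp add: UNIV_bool insert_commute)
  have ne: "\<iota> True \<noteq> \<iota> False" using inj by (simp add: inj_eq)
  have a_hom: "a d x \<in> hom (X_alg k) ?S (Fo d)" if d: "d \<in> obj D" "x \<in> carrier (Wo d)" for d x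
  proof (rule point_space_hom[OF Fo_obj[OF d(1)] a_in[OF d]])
    fix V assume V: "V \<in> KO k (Fo d)"
    show "{s \<in> range \<iota>. a d x s \<in> V} \<in> {range \<iota>, {\<iota> True}} \<union> (if k = AllFilters then {} else {{}})"
    proof (cases "p d x \<in> V")
      case True
      then have "{s \<in> range \<iota>. a d x s \<in> V} = range \<iota>" using T(2)[OF _ d(1) V] by (auto simp: a_def)
      then show ?thesis by simp
    next
      case False
      show ?thesis
      proof (cases "k = AllFilters")
        case True
        then have "{s \<in> range \<iota>. a d x s \<in> V} = {\<iota> True}"
          using T(2)[OF _ d(1) V] False ne by (auto simp: a_def r)
        then show ?thesis by simp
      next
        case kp: False
        then have "{s \<in> range \<iota>. a d x s \<in> V} = {}" using False by (auto simp: a_def)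
        then show ?thesis using kp by simp
      qed
    qed
  qed
  have S_cone: "weighted_cone B D Fo Fm Wo Wm ?S a"
    unfolding weighted_cone_def hcomp_B hle_B topspace_point_space
  proof (intro conjI ballI impI)
    show "?S \<in> obj B" using X_alg_obj_B[OF point_space_obj] .
    show "a d x \<in> hom B ?S (Fo d)" if "d \<in> obj D" "x \<in> carrier (Wo d)" for d x
      using X_alg_hom_B[OF a_hom[OF that]] .
    show "spec_le (Fo d) (a d x s) (a d y s)"
      if "d \<in> obj D" "x \<in> carrier (Wo d)" "y \<in> carrier (Wo d)" "x \<sqsubseteq>\<^bsub>Wo d\<^esub> y" "s \<in> range \<iota>" for d x y s
      using mono[OF that(1-4)] that(5) by (simp add: a_def spec_le_refl)
    fix d d' n x assume d: "d \<in> obj D" "d' \<in> obj D" "n \<in> hom D d d'" "x \<in> carrier (Wo d)"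
    \<comment> \<open>Top elements are the points lying in every homomorphic set, and inverse images
      of homomorphic sets are homomorphic.\<close>
    have TT: "Fm d d' n (T d) = T d'" if kA: "k = AllFilters"
    proof (rule is_base_t0_eqI[OF alg_space_base[OF Fo_alg[OF d(2)]] alg_space_t0[OF Fo_alg[OF d(2)]]])
      show "Fm d d' n (T d) \<in> topspace (Fo d')" using Fm_PiE[OF d(1-3)] T(1)[OF kA d(1)] by (rule PiE_mem)
      show "T d' \<in> topspace (Fo d')" using T(1)[OF kA d(2)] .
      fix V assume V: "V \<in> KO k (Fo d')"
      have "T d \<in> {y \<in> topspace (Fo d). Fm d d' n y \<in> V}" using T(2)[OF kA d(1) Fm_KO[OF d(1-3) V]] .
      then show "Fm d d' n (T d) \<in> V \<longleftrightarrow> T d' \<in> V" using T(2)[OF kA d(2) V] by simp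
    qed
    show "compose (range \<iota>) (Fm d d' n) (a d x) = a d' (Wm d d' n x)"
    proof (rule extensionalityI[of _ "range \<iota>"])
      fix s assume "s \<in> range \<iota>"
      then show "compose (range \<iota>) (Fm d d' n) (a d x) s = a d' (Wm d d' n x) s"
        using nat[OF d] TT by (simp add: compose_eq a_def)
    qed (simp_all add: a_def)
  qed
  obtain t where t: "t \<in> hom B ?S L"
    "\<forall>d\<in>obj D. \<forall>x\<in>carrier (Wo d). a d x = compose (topspace ?S) (l d x) t"
    using lim_factor[OF S_cone] by (elim ex1E conjE)
  have i: "\<iota> False \<in> topspace ?S" by (simp add: topspace_point_space)
  have "t (\<iota> False) \<in> topspace L" using hom_B_Top0[OF t(1)] i by (auto simp: hom_Top0)
  moreover have "l d x (t (\<iota> False)) = p d x" if "d \<in> obj D" "x \<in> carrier (Wo d)" for d x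
  proof -
    have "a d x (\<iota> False) = compose (topspace ?S) (l d x) t (\<iota> False)" using t(2) that by simp
    then show ?thesis using i by (simp add: compose_eq a_def)
  qed
  ultimately show ?thesis by blast
qed

section \<open>The limit rebuilt from its legs\<close>

definition subbasics :: "'u set set" where
  "subbasics = {{w \<in> topspace L. l d x w \<in> V} | d x V. d \<in> obj D \<and> x \<in> carrier (Wo d) \<and> V \<in> KO k (Fo d)}"

lemma subbasicsI: "d \<in> obj D \<Longrightarrow> x \<in> carrier (Wo d) \<Longrightarrow> V \<in> KO k (Fo d) \<Longrightarrow>
    {w \<in> topspace L. l d x w \<in> V} \<in> subbasics"
  unfolding subbasics_def by blast

lemma subbasicsE:
  assumes "U \<in> subbasics"
  obtains d x V where "d \<in> obj D" "x \<in> carrier (Wo d)" "V \<in> KO k (Fo d)" "U = {w \<in> topspace L. l d x w \<in> V}"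
  using assms unfolding subbasics_def by (elim CollectE exE conjE)

lemma subbasics_Pow: "subbasics \<subseteq> Pow (topspace L)"
  by (auto elim!: subbasicsE)

lemma t0_generated: "t0_space (generated_topology (topspace L) subbasics)"
  unfolding t0_space_def topspace_generated_topology[OF subbasics_Pow]
proof (intro ballI impI)
  fix q q' assume q: "q \<in> topspace L" "q' \<in> topspace L" "q \<noteq> q'"
  then obtain d x where d: "d \<in> obj D" "x \<in> carrier (Wo d)" and ne: "l d x q \<noteq> l d x q'"
    using separate[OF q(1,2)] by blast
  have in': "l d x q \<in> topspace (Fo d)" "l d x q' \<in> topspace (Fo d)"
    using PiE_mem[OF l_PiE[OF d]] q by simp_all
  obtain V where V: "V \<in> KO k (Fo d)" "\<not> (l d x q \<in> V \<longleftrightarrow> l d x q' \<in> V)"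
    using is_base_t0_eqI[OF alg_space_base[OF Fo_alg[OF d(1)]] alg_space_t0[OF Fo_alg[OF d(1)]] in'] ne by blast
  let ?U = "{w \<in> topspace L. l d x w \<in> V}"
  have "openin (generated_topology (topspace L) subbasics) ?U"
    by (rule openin_generated_topology[OF subbasicsI[OF d V(1)]])
  moreover have "(q \<notin> ?U) = (q' \<in> ?U)" using V(2) q by simp
  ultimately show "\<exists>U. openin (generated_topology (topspace L) subbasics) U \<and> (q \<notin> U) = (q' \<in> U)" by blast
qed

text \<open>Through the legs a filter on \<open>L\<close> induces a filter on each component, hence
  a point there. Order and naturality of the legs make these points compatible, so a point of
  \<open>L\<close> has them as its coordinates.\<close>

lemma kbasis_generated:
  "kbasis k (generated_topology (topspace L) subbasics) (kcl k (topspace L) subbasics)"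
proof -
  let ?A = "generated_topology (topspace L) subbasics" and ?K = "kcl k (topspace L) subbasics"
  have T: "topspace ?A = topspace L" by (rule topspace_generated_topology[OF subbasics_Pow])
  have base: "is_base ?A (kcl k (topspace ?A) subbasics)"
    unfolding T by (rule is_base_generated_topology[OF subbasics_Pow])
  have "kbasis k ?A (kcl k (topspace ?A) subbasics)"
  proof (rule kbasis_kclI[OF base], unfold T)
    fix F assume F: "k_filter k (topspace L) ?K F"
    let ?Q = "\<lambda>d x. {V \<in> KO k (Fo d). {w \<in> topspace L. l d x w \<in> V} \<in> F}"
    have ex: "\<exists>y\<in>topspace (Fo d). ?Q d x = {V \<in> KO k (Fo d). y \<in> V}"
      if d: "d \<in> obj D" "x \<in> carrier (Wo d)" for d x
    proof (rule alg_space_point[OF Fo_alg[OF d(1)]], rule k_filter_vimage[OF F])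
      show "l d x \<in> topspace L \<rightarrow> topspace (Fo d)" using l_PiE[OF d] by (simp add: PiE_def)
      show "k_closed k (topspace (Fo d)) (KO k (Fo d))" using alg_space_closed[OF Fo_alg[OF d(1)]] .
      show "{w \<in> topspace L. l d x w \<in> V} \<in> ?K" if "V \<in> KO k (Fo d)" for V
        using kcl_base[OF subbasicsI[OF d that]] .
    qed
    define p where "p d x = (SOME y. y \<in> topspace (Fo d) \<and> ?Q d x = {V \<in> KO k (Fo d). y \<in> V})" for d x
    have p0: "p d x \<in> topspace (Fo d) \<and> ?Q d x = {V \<in> KO k (Fo d). p d x \<in> V}"
      if "d \<in> obj D" "x \<in> carrier (Wo d)" for d x
      unfolding p_def by (rule someI_ex) (rule ex[OF that, unfolded Bex_def])
    note p = p0[THEN conjunct1]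
    have pV: "p d x \<in> V \<longleftrightarrow> {w \<in> topspace L. l d x w \<in> V} \<in> F"
      if "d \<in> obj D" "x \<in> carrier (Wo d)" "V \<in> KO k (Fo d)" for d x V
    proof -
      have "V \<in> ?Q d x \<longleftrightarrow> V \<in> {V \<in> KO k (Fo d). p d x \<in> V}"
        using p0[OF that(1,2), THEN conjunct2] by (rule arg_cong)
      then show ?thesis using that(3) by simp
    qed
    have "\<exists>q\<in>topspace L. \<forall>d\<in>obj D. \<forall>x\<in>carrier (Wo d). l d x q = p d x"
    proof (rule realise[OF p])
      fix d x y assume d: "d \<in> obj D" "x \<in> carrier (Wo d)" "y \<in> carrier (Wo d)" "x \<sqsubseteq>\<^bsub>Wo d\<^esub> y"
      show "spec_le (Fo d) (p d x) (p d y)"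
        unfolding is_base_spec_le[OF alg_space_base[OF Fo_alg[OF d(1)]]]
      proof (intro ballI impI)
        fix V assume V: "V \<in> KO k (Fo d)" "p d x \<in> V"
        have "{w \<in> topspace L. l d x w \<in> V} \<subseteq> {w \<in> topspace L. l d y w \<in> V}"
          using spec_leD[OF l_mono[OF d] KO_openin[OF V(1)]] by blast
        then show "p d y \<in> V"
          using k_filter_mono[OF F _ kcl_base[OF subbasicsI[OF d(1,3) V(1)]]] V
            pV[OF d(1,2) V(1)] pV[OF d(1,3) V(1)] by blast
      qed
    next
      fix d d' n x assume d: "d \<in> obj D" "d' \<in> obj D" "n \<in> hom D d d'" "x \<in> carrier (Wo d)"
      show "Fm d d' n (p d x) = p d' (Wm d d' n x)"
      proof (rule is_base_t0_eqI[OF alg_space_base[OF Fo_alg[OF d(2)]] alg_space_t0[OF Fo_alg[OF d(2)]]])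
        show "Fm d d' n (p d x) \<in> topspace (Fo d')" using Fm_PiE[OF d(1-3)] p[OF d(1,4)] by (rule PiE_mem)
        show "p d' (Wm d d' n x) \<in> topspace (Fo d')" using p[OF d(2) Wm_in[OF d]] .
        fix V assume V: "V \<in> KO k (Fo d')"
        let ?V = "{y \<in> topspace (Fo d). Fm d d' n y \<in> V}"
        have "{w \<in> topspace L. l d x w \<in> ?V} = {w \<in> topspace L. l d' (Wm d d' n x) w \<in> V}"
          unfolding l_nat[OF d, symmetric]
          using PiE_mem[OF l_PiE[OF d(1,4)]] by (intro Collect_cong conj_cong refl) (simp add: compose_eq)
        then have "p d x \<in> ?V \<longleftrightarrow> p d' (Wm d d' n x) \<in> V"
          using pV[OF d(1,4) Fm_KO[OF d(1-3) V]] pV[OF d(2) Wm_in[OF d] V] by simp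
        then show "Fm d d' n (p d x) \<in> V \<longleftrightarrow> p d' (Wm d d' n x) \<in> V" using p[OF d(1,4)] by simp
      qed
    qed
    then obtain q where q: "q \<in> topspace L" "\<And>d x. d \<in> obj D \<Longrightarrow> x \<in> carrier (Wo d) \<Longrightarrow> l d x q = p d x" by blast
    have "q \<in> U \<longleftrightarrow> U \<in> F" if "U \<in> subbasics" for U
    proof -
      obtain d x V where d: "d \<in> obj D" "x \<in> carrier (Wo d)" "V \<in> KO k (Fo d)"
        and U: "U = {w \<in> topspace L. l d x w \<in> V}" using \<open>U \<in> subbasics\<close> by (rule subbasicsE)
      show ?thesis using pV[OF d] q(1) q(2)[OF d(1,2)] unfolding U by simp
    qed
    then show "\<exists>q\<in>topspace L. \<forall>U\<in>subbasics. q \<in> U \<longleftrightarrow> U \<in> F" using q(1) by blast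
  qed
  then show ?thesis by (simp only: T)
qed

text \<open>With the generated topology \<open>L\<close> is an algebraic space and the legs still
  form a cone. Its factorisation through \<open>L\<close> fixes every point, since the legs separate
  points, so the topology of \<open>L\<close> is contained in the generated one; continuity of the
  legs gives the other inclusion.\<close>

lemma L_eq_generated: "L = generated_topology (topspace L) subbasics"
proof -
  let ?A = "generated_topology (topspace L) subbasics"
  have T: "topspace ?A = topspace L" by (rule topspace_generated_topology[OF subbasics_Pow])
  have alg: "alg_space k ?A" and KO: "KO k ?A = kcl k (topspace L) subbasics"
    using alg_spaceI[OF t0_generated kbasis_generated] by simp_all
  have Aobj: "?A \<in> obj (X_alg k)"
    using alg obj_B[OF L_obj] by (simp add: obj_X_alg[OF inf] T obj_Top0)
  have lA: "l d x \<in> hom (X_alg k) ?A (Fo d)" if d: "d \<in> obj D" "x \<in> carrier (Wo d)" for d x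
    unfolding hom_X_alg[OF inf] T KO
    using Aobj Fo_obj[OF d(1)] l_PiE[OF d] kcl_base[OF subbasicsI[OF d]] by simp
  have A_cone: "weighted_cone B D Fo Fm Wo Wm ?A l"
    unfolding weighted_cone_def hcomp_B hle_B T
    using X_alg_obj_B[OF Aobj] X_alg_hom_B[OF lA] l_mono l_nat by simp
  obtain t where t: "t \<in> hom B ?A L"
    "\<forall>d\<in>obj D. \<forall>x\<in>carrier (Wo d). l d x = compose (topspace ?A) (l d x) t"
    using lim_factor[OF A_cone] by (elim ex1E conjE)
  have tc: "continuous_map ?A L t" using hom_B_Top0[OF t(1)] by (simp add: hom_Top0)
  have "t w = w" if w: "w \<in> topspace L" for w
  proof (rule separate)
    show "t w \<in> topspace L" using tc w by (auto simp: continuous_map_def T)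
    show "l d x (t w) = l d x w" if d: "d \<in> obj D" "x \<in> carrier (Wo d)" for d x
    proof -
      have "l d x w = compose (topspace ?A) (l d x) t w"
        using t(2)[rule_format, OF d] by (rule arg_cong)
      then show ?thesis using w by (simp add: compose_eq T)
    qed
  qed (rule w)
  then have "continuous_map ?A L (\<lambda>w. w)" using continuous_map_eq[OF tc] T by simp
  then have 1: "openin ?A U" if "openin L U" for U
    using openin_continuous_map_preimage[of ?A L "\<lambda>w. w" U] that openin_subset[OF that]
    by (simp add: T Collect_conj_eq Int_absorb1)
  have "continuous_map L ?A (\<lambda>w. w)"
  proof (rule is_base_kcl_continuous_map)
    show "is_base ?A (kcl k (topspace ?A) subbasics)"
      unfolding T by (rule is_base_generated_topology[OF subbasics_Pow])
    show "(\<lambda>w. w) \<in> topspace L \<rightarrow> topspace ?A" by (simp add: T)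
    fix U assume "U \<in> subbasics"
    then obtain d x V where d: "d \<in> obj D" "x \<in> carrier (Wo d)" "V \<in> KO k (Fo d)"
      and U: "U = {w \<in> topspace L. l d x w \<in> V}" by (rule subbasicsE)
    have "continuous_map L (Fo d) (l d x)" using hom_B_Top0[OF l_hom[OF d(1,2)]] by (simp add: hom_Top0)
    then have "openin L U"
      unfolding U by (rule openin_continuous_map_preimage) (rule KO_openin[OF d(3)])
    moreover have "{w \<in> topspace L. w \<in> U} = U" using U by auto
    ultimately show "openin L {w \<in> topspace L. w \<in> U}" by simp
  qed
  then have 2: "openin L U" if "openin ?A U" for U
    using openin_continuous_map_preimage[of L ?A "\<lambda>w. w" U] that openin_subset[OF that]
    by (simp add: T Collect_conj_eq Int_absorb1)
  show ?thesis unfolding topology_eq using 1 2 by blast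
qed

text \<open>The homomorphic sets of \<open>L\<close> are generated along the legs. A factorisation
  existing in \<open>B\<close> therefore pulls them back to homomorphic sets as soon as the cone
  that it factors consists of homomorphisms.\<close>

lemma limit_X_alg:
  shows "L \<in> obj (X_alg k)"
    and "\<And>d x. d \<in> obj D \<Longrightarrow> x \<in> carrier (Wo d) \<Longrightarrow> l d x \<in> hom (X_alg k) L (Fo d)"
    and "weighted_limit (X_alg k) D Fo Fm Wo Wm L l"
proof -
  have alg: "alg_space k L" and KO: "KO k L = kcl k (topspace L) subbasics"
    using alg_spaceI[OF t0_generated kbasis_generated] unfolding L_eq_generated[symmetric] by simp_all
  show Lobj: "L \<in> obj (X_alg k)"
    using alg obj_B[OF L_obj] by (simp add: obj_X_alg[OF inf] obj_Top0)
  show lh: "l d x \<in> hom (X_alg k) L (Fo d)" if d: "d \<in> obj D" "x \<in> carrier (Wo d)" for d x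
    unfolding hom_X_alg[OF inf] KO
    using Lobj Fo_obj[OF d(1)] l_PiE[OF d] kcl_base[OF subbasicsI[OF d]] by simp
  have coneX: "weighted_cone (X_alg k) D Fo Fm Wo Wm L l"
    using cone Lobj lh unfolding weighted_cone_def ops_X_alg_B by simp
  have sub_cone: "weighted_cone B D Fo Fm Wo Wm A a" if "weighted_cone (X_alg k) D Fo Fm Wo Wm A a" for A a
    using that X_alg_obj_B X_alg_hom_B unfolding weighted_cone_def ops_X_alg_B by blast
  have hom: "t \<in> hom (X_alg k) A L"
    if A: "weighted_cone (X_alg k) D Fo Fm Wo Wm A a" and t: "t \<in> hom B A L"
      and at: "\<forall>d\<in>obj D. \<forall>x\<in>carrier (Wo d). a d x = compose (topspace A) (l d x) t" for A a t
  proof -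
    have Aobj: "A \<in> obj (X_alg k)" using A by (simp add: weighted_cone_def)
    have ah: "a d x \<in> hom (X_alg k) A (Fo d)" if "d \<in> obj D" "x \<in> carrier (Wo d)" for d x
      using A that unfolding weighted_cone_def by (elim conjE) blast
    have tP: "t \<in> topspace A \<rightarrow>\<^sub>E topspace L" using hom_B_Top0[OF t] by (simp add: hom_Top0)
    have "{w \<in> topspace A. t w \<in> U} \<in> KO k A" if U: "U \<in> kcl k (topspace L) subbasics" for U
    proof (rule kcl_vimage[OF _ _ _ U])
      show "k_closed k (topspace A) (KO k A)"
        using Aobj alg_space_closed[of k A] by (simp add: obj_X_alg[OF inf])
      show "t \<in> topspace A \<rightarrow> topspace L" using tP by (simp add: PiE_def)
      fix W assume "W \<in> subbasics"
      then obtain d x V where d: "d \<in> obj D" "x \<in> carrier (Wo d)" "V \<in> KO k (Fo d)"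
        and W: "W = {w \<in> topspace L. l d x w \<in> V}" by (rule subbasicsE)
      have "a d x = compose (topspace A) (l d x) t" using at d by blast
      then have "{w \<in> topspace A. t w \<in> W} = {w \<in> topspace A. a d x w \<in> V}"
        unfolding W using PiE_mem[OF tP] by (intro Collect_cong conj_cong refl) (simp add: compose_eq)
      then show "{w \<in> topspace A. t w \<in> W} \<in> KO k A"
        using ah[OF d(1,2)] d(3) unfolding hom_X_alg[OF inf] by (elim conjE) (drule bspec, assumption, simp only:)
    qed
    then show ?thesis unfolding hom_X_alg[OF inf] KO using tP Aobj Lobj by simp
  qed
  show "weighted_limit (X_alg k) D Fo Fm Wo Wm L l"
    unfolding weighted_limit_def
  proof (intro conjI allI impI)
    show "weighted_cone (X_alg k) D Fo Fm Wo Wm L l" by (rule coneX)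
    fix A a assume A: "weighted_cone (X_alg k) D Fo Fm Wo Wm A a"
    show "\<exists>!t. t \<in> hom (X_alg k) A L \<and>
        (\<forall>d\<in>obj D. \<forall>x\<in>carrier (Wo d). a d x = hcomp (X_alg k) A L (Fo d) (l d x) t)"
      unfolding ops_X_alg_B hcomp_B
    proof -
      let ?P = "\<lambda>t. \<forall>d\<in>obj D. \<forall>x\<in>carrier (Wo d). a d x = compose (topspace A) (l d x) t"
      obtain t where t: "t \<in> hom B A L \<and> ?P t"
        and uniq: "\<forall>t'. t' \<in> hom B A L \<and> ?P t' \<longrightarrow> t' = t"
        using lim_factor[OF sub_cone[OF A]] by (rule ex1E)
      show "\<exists>!t. t \<in> hom (X_alg k) A L \<and> ?P t"
      proof (rule ex1I[of _ t])
        show "t \<in> hom (X_alg k) A L \<and> ?P t"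
          using hom[OF A conjunct1[OF t] conjunct2[OF t]] conjunct2[OF t] by (rule conjI)
        fix t' assume t': "t' \<in> hom (X_alg k) A L \<and> ?P t'"
        show "t' = t"
          by (rule uniq[THEN spec, THEN mp, OF conjI[OF X_alg_hom_B[OF conjunct1[OF t']] conjunct2[OF t']]])
      qed
    qed
  next
    show "\<forall>A\<in>obj (X_alg k). \<forall>t\<in>hom (X_alg k) A L. \<forall>t'\<in>hom (X_alg k) A L.
        (\<forall>d\<in>obj D. \<forall>x\<in>carrier (Wo d). hle (X_alg k) A (Fo d)
           (hcomp (X_alg k) A L (Fo d) (l d x) t) (hcomp (X_alg k) A L (Fo d) (l d x) t')) \<longrightarrow>
        hle (X_alg k) A L t t'"
      unfolding ops_X_alg_B hcomp_B hle_B
    proof (intro ballI impI)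
      fix A t t' w
      assume A: "A \<in> obj (X_alg k)" "t \<in> hom (X_alg k) A L" "t' \<in> hom (X_alg k) A L"
        and le: "\<forall>d\<in>obj D. \<forall>x\<in>carrier (Wo d). \<forall>w\<in>topspace A. spec_le (Fo d)
          (compose (topspace A) (l d x) t w) (compose (topspace A) (l d x) t' w)"
        and w: "w \<in> topspace A"
      show "spec_le L (t w) (t' w)"
      proof (rule lim_reflect[OF X_alg_obj_B[OF A(1)] X_alg_hom_B[OF A(2)] X_alg_hom_B[OF A(3)] _ w])
        fix d x v assume "d \<in> obj D" "x \<in> carrier (Wo d)" "v \<in> topspace A"
        then show "spec_le (Fo d) (l d x (t v)) (l d x (t' v))"
          using le[rule_format, of d x v] by (simp add: compose_eq)
      qed
    qed
  qed
qed

end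

lemma closed_X_alg: "closed_under_weighted_limits (X_alg k) B"
  unfolding closed_under_weighted_limits_def
proof (intro allI impI, elim conjE)
  fix D :: "('u, 'u) ocat" and Fo Fm and Wo :: "'u \<Rightarrow> 'u gorder" and Wm L l
  assume "order_functor D (X_alg k) Fo Fm" "order_functor D Pos Wo Wm" "weighted_limit B D Fo Fm Wo Wm L l"
  note * = limit_X_alg[OF this]
  show "L \<in> obj (X_alg k) \<and>
      (\<forall>d\<in>obj D. \<forall>x\<in>carrier (Wo d). l d x \<in> hom (X_alg k) L (Fo d)) \<and>
      weighted_limit (X_alg k) D Fo Fm Wo Wm L l"
    by (intro conjI ballI *)
qed

end

section \<open>Free algebras\<close>

text \<open>The sets \<open>sharp k Y A\<close> form a base that is closed under the operations, and
  a filter of them corresponds to a filter of open sets \<open>A\<close>, that is, to a point of the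
  filter space. The homeomorphism transports this to \<open>X\<close>.\<close>

lemma free_algebra_alg_space:
  fixes X :: "'u topology"
  assumes "free_algebra k X"
  shows "alg_space k X"
proof -
  obtain Y :: "'u topology" and a h where a: "algebra k X a" and h: "homeomorphic_map (filter_space k Y) X h"
    using assms unfolding free_algebra_def by (elim exE conjE)
  let ?Z = "filter_space k Y"
  define \<phi> where "\<phi> A = h ` sharp k Y A" for A
  let ?B = "\<phi> ` opens Y"
  have inj: "inj_on h (topspace ?Z)" and img: "h ` topspace ?Z = topspace X"
    using h homeomorphic_imp_injective_map homeomorphic_imp_surjective_map by blast+
  have sZ: "sharp k Y A \<subseteq> topspace ?Z" for A by (auto simp: sharp_def)
  have mem: "h z \<in> \<phi> A \<longleftrightarrow> A \<in> z" if "z \<in> topspace ?Z" for z A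
    using inj_on_image_mem_iff[OF inj that sZ] that by (simp add: \<phi>_def sharp_def)
  have top: "\<phi> (topspace Y) = topspace X" by (simp add: \<phi>_def sharp_topspace img)
  have Int: "\<phi> U \<inter> \<phi> V = \<phi> (U \<inter> V)" if "openin Y U" "openin Y V" for U V
    unfolding \<phi>_def sharp_Int[OF that] using inj_on_image_Int[OF inj sZ sZ] by simp
  have emp: "\<phi> {} = {}" if "k \<noteq> AllFilters"
    unfolding \<phi>_def sharp_empty[OF that] by simp
  have Un: "\<phi> U \<union> \<phi> V = \<phi> (U \<union> V)" if "k = PrimeFilters" "openin Y U" "openin Y V" for U V
    unfolding \<phi>_def using sharp_Un[OF that(2,3)] that(1) by (simp add: image_Un)
  have mono: "\<phi> U \<subseteq> \<phi> V" if "openin Y V" "U \<subseteq> V" for U V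
    unfolding \<phi>_def by (rule image_mono[OF sharp_mono[OF that]])
  have \<phi>o: "openin X (\<phi> A)" for A
    using h openin_sharp[of k Y A] homeomorphic_map_openness[OF h sZ] unfolding \<phi>_def by blast
  have "is_base X ?B"
    unfolding is_base_def
  proof (intro conjI ballI allI impI)
    show "openin X U" if "U \<in> ?B" for U using that \<phi>o by blast
    fix W x assume W: "openin X W \<and> x \<in> W"
    then have "x \<in> h ` topspace ?Z" using openin_subset img by blast
    then obtain z where z: "z \<in> topspace ?Z" "x = h z" by blast
    have "openin ?Z {z \<in> topspace ?Z. h z \<in> W}"
      using homeomorphic_imp_continuous_map[OF h] W by (simp add: continuous_map_def)
    then obtain A where A: "A \<in> z" "\<forall>G\<in>topspace ?Z. A \<in> G \<longrightarrow> G \<in> {z \<in> topspace ?Z. h z \<in> W}"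
      unfolding openin_filter_space using z W by blast
    have "openin Y A" using A(1) z(1) by (auto simp: topspace_filter_space dest: k_filter_subset)
    moreover have "\<phi> A \<subseteq> W" unfolding \<phi>_def sharp_def using A(2) by blast
    ultimately show "\<exists>U\<in>?B. x \<in> U \<and> U \<subseteq> W" using mem[OF z(1)] A(1) z(2) by blast
  qed
  moreover have cl: "k_closed k (topspace X) ?B"
    unfolding k_closed_def
  proof (intro conjI ballI impI)
    show "?B \<subseteq> Pow (topspace X)" using openin_subset[OF \<phi>o] by blast
    show "topspace X \<in> ?B" using top by (metis (no_types) imageI mem_Collect_eq openin_topspace)
    show "{} \<in> ?B" if "k \<noteq> AllFilters"
      using emp[OF that] by (metis (no_types) imageI mem_Collect_eq openin_empty)
    show "U \<inter> V \<in> ?B" if "U \<in> ?B" "V \<in> ?B" for U V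
    proof -
      obtain U' V' where "openin Y U'" "U = \<phi> U'" "openin Y V'" "V = \<phi> V'" using \<open>U \<in> ?B\<close> \<open>V \<in> ?B\<close> by blast
      then show ?thesis using Int[of U' V'] openin_Int[of Y U' V'] by simp
    qed
    show "U \<union> V \<in> ?B" if "k = PrimeFilters" "U \<in> ?B" "V \<in> ?B" for U V
    proof -
      obtain U' V' where "openin Y U'" "U = \<phi> U'" "openin Y V'" "V = \<phi> V'" using \<open>U \<in> ?B\<close> \<open>V \<in> ?B\<close> by blast
      then show ?thesis using Un[OF that(1), of U' V'] openin_Un[of Y U' V'] by simp
    qed
  qed
  moreover have "\<exists>x\<in>topspace X. F = {U \<in> ?B. x \<in> U}" if F: "k_filter k (topspace X) ?B F" for F
  proof -
    let ?z = "{A. openin Y A \<and> \<phi> A \<in> F}"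
    have "k_filter k (topspace Y) (opens Y) ?z"
      unfolding k_filter_def
    proof (intro conjI ballI impI)
      show "topspace Y \<in> ?z" using k_filter_top[OF F] by (simp add: top)
      show "{} \<notin> ?z" if "k \<noteq> AllFilters" using k_filter_empty[OF F that] by (simp add: emp[OF that])
      show "U \<inter> V \<in> ?z" if "U \<in> ?z" "V \<in> ?z" for U V
        using that k_filter_Int[OF F, of "\<phi> U" "\<phi> V"] by (simp add: Int openin_Int)
      show "V \<in> ?z" if "U \<in> ?z" "V \<in> opens Y" "U \<subseteq> V" for U V
        using that k_filter_mono[OF F, of "\<phi> U" "\<phi> V"] mono[of V U] by simp
      show "U \<in> ?z \<or> V \<in> ?z" if "k = PrimeFilters" "U \<in> opens Y" "V \<in> opens Y" "U \<union> V \<in> ?z" for U V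
        using that k_filter_prime[OF F that(1), of "\<phi> U" "\<phi> V"] Un[OF that(1), of U V] by simp
    qed auto
    then have z: "?z \<in> topspace ?Z" by (simp add: topspace_filter_space)
    have "h ?z \<in> U \<longleftrightarrow> U \<in> F" if "U \<in> ?B" for U
    proof -
      obtain A where "openin Y A" "U = \<phi> A" using \<open>U \<in> ?B\<close> by blast
      then show ?thesis using mem[OF z, of A] by simp
    qed
    then have "F = {U \<in> ?B. h ?z \<in> U}" using k_filter_subset[OF F] by blast
    moreover have "h ?z \<in> topspace X" using z img by blast
    ultimately show ?thesis by blast
  qed
  ultimately have "kbasis k X ?B" by (simp add: kbasis_def)
  then show ?thesis using alg_spaceI(1)[OF algebra_t0[OF a]] by blast
qed

lemma obj_Kleisli: "X \<in> obj (Kleisli k) \<longleftrightarrow> X \<in> obj (EM k) \<and> free_algebra k X"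
  by (auto simp: Kleisli_def full_subcategory_def)

lemma obj_Kleisli_X_alg:
  fixes X :: "'u topology"
  assumes "infinite (UNIV :: 'u set)" "X \<in> obj (Kleisli k)"
  shows "X \<in> obj (X_alg k)"
  using assms(2) free_algebra_alg_space[of k X]
  unfolding obj_Kleisli obj_X_alg[OF assms(1)] obj_EM by simp

lemma hom_Kleisli:
  fixes X :: "'u topology"
  assumes inf: "infinite (UNIV :: 'u set)" and X: "X \<in> obj (Kleisli k)" and Y: "Y \<in> obj (Kleisli k)"
  shows "hom (Kleisli k) X Y = hom (X_alg k) X Y"
proof -
  have "hom (Kleisli k) X Y = hom (EM k) X Y"
    using X Y unfolding obj_Kleisli by (simp add: Kleisli_def full_subcategory_def)
  also have "\<dots> = hom (X_alg k) X Y"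
    using obj_Kleisli_X_alg[OF inf X] obj_Kleisli_X_alg[OF inf Y]
    by (simp add: X_alg_def full_subcategory_def)
  finally show ?thesis .
qed

lemma subcategory_Kleisli_X_alg:
  assumes inf: "infinite (UNIV :: 'u set)"
  shows "subcategory (Kleisli k :: ('u topology, 'u \<Rightarrow> 'u) ocat) (X_alg k)"
  unfolding subcategory_def
proof (intro conjI ballI)
  have ops: "idn (Kleisli k) = idn (X_alg k)" "hcomp (Kleisli k) = hcomp (X_alg k)" "hle (Kleisli k) = hle (X_alg k)"
    by (simp_all add: Kleisli_def ops_full ops_X_alg ops_EM)
  show "idn (Kleisli k) = idn (X_alg k)" "hcomp (Kleisli k) = hcomp (X_alg k)" "hle (Kleisli k) = hle (X_alg k)"
    by (rule ops)+
  show "obj (Kleisli k) \<subseteq> (obj (X_alg k) :: 'u topology set)"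
    using obj_Kleisli_X_alg[OF inf] by (rule subsetI)
  fix X Y :: "'u topology" assume X: "X \<in> obj (Kleisli k)" and Y: "Y \<in> obj (Kleisli k)"
  show "hom (Kleisli k) X Y \<subseteq> hom (X_alg k) X Y" by (simp add: hom_Kleisli[OF inf X Y])
next
  fix X :: "'u topology" assume X: "X \<in> obj (Kleisli k)"
  show "idn (X_alg k) X \<in> hom (Kleisli k) X X"
    unfolding hom_Kleisli[OF inf X X] ops_X_alg ops_Top0
    by (rule X_alg_idn[OF inf obj_Kleisli_X_alg[OF inf X]])
next
  fix X Y Z :: "'u topology" and f g
  assume X: "X \<in> obj (Kleisli k)" and Y: "Y \<in> obj (Kleisli k)" and Z: "Z \<in> obj (Kleisli k)"
    and f: "f \<in> hom (Kleisli k) X Y" and g: "g \<in> hom (Kleisli k) Y Z"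
  show "hcomp (X_alg k) X Y Z g f \<in> hom (Kleisli k) X Z"
    using X_alg_compose[OF inf] f g
    unfolding hom_Kleisli[OF inf X Y] hom_Kleisli[OF inf Y Z] hom_Kleisli[OF inf X Z] ops_X_alg ops_Top0 .
qed

text \<open>
  A sufficient condition for a space to be free over one of its subspaces \<open>Y\<close>: its homomorphic open
  sets are in bijection with the open sets of \<open>Y\<close>.
\<close>

lemma free_algebraI:
  fixes X :: "'u topology"
  assumes X: "X \<in> obj Top0" and B: "kbasis k X B" and YX: "Y \<subseteq> topspace X"
    and reflect: "\<And>U V. U \<in> B \<Longrightarrow> V \<in> B \<Longrightarrow> U \<inter> Y \<subseteq> V \<inter> Y \<Longrightarrow> U \<subseteq> V"
    and surj: "\<And>U. openin X U \<Longrightarrow> \<exists>V\<in>B. V \<inter> Y = U \<inter> Y"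
  shows "free_algebra k X"
proof -
  have t0: "t0_space X" and sm: "small (topspace X)" using X by (simp_all add: obj_Top0)
  have base: "is_base X B" and cl: "k_closed k (topspace X) B"
    and real: "\<And>F. k_filter k (topspace X) B F \<Longrightarrow> \<exists>x\<in>topspace X. F = {U \<in> B. x \<in> U}"
    using B by (simp_all add: kbasis_def)
  obtain a where a: "algebra k X a"
    and aU: "\<And>F U. k_filter k (topspace X) (opens X) F \<Longrightarrow> U \<in> B \<Longrightarrow> a F \<in> U \<longleftrightarrow> U \<in> F"
    using kbasis_algebra[OF t0 B] by blast
  let ?Y = "subtopology X Y"
  let ?Z = "filter_space k ?Y"
  have TY: "topspace ?Y = Y" using YX by auto
  have Ytop: "?Y \<in> obj Top0"
  proof -
    have "small Y" using sm lesspoll_trans1[OF subset_imp_lepoll[OF YX]] by (simp add: small_def)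
    then show ?thesis using t0_space_subtopology[OF t0] unfolding obj_Top0 TY by simp
  qed
  have oY: "openin ?Y A \<longleftrightarrow> (\<exists>V\<in>B. A = V \<inter> Y)" for A
    unfolding openin_subtopology using surj is_base_openin[OF base] by metis
  have Yo: "openin ?Y (V \<inter> Y)" if "V \<in> B" for V using that oY by blast
  \<comment> \<open>The point whose basic neighbourhoods are the \<open>V\<close> with
    \<open>V \<inter> Y\<close> in \<open>F\<close>; this map will be the homeomorphism from the
    filter space of \<open>Y\<close>.\<close>
  define h where "h F = (SOME x. x \<in> topspace X \<and> {V \<in> B. V \<inter> Y \<in> F} = {V \<in> B. x \<in> V})" for F
  have h0: "h F \<in> topspace X \<and> {V \<in> B. V \<inter> Y \<in> F} = {V \<in> B. h F \<in> V}"
    if F: "k_filter k Y (opens ?Y) F" for F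
  proof -
    have e: "{y \<in> Y. y \<in> V} = V \<inter> Y" for V by auto
    have "k_filter k (topspace X) B {V \<in> B. {y \<in> Y. y \<in> V} \<in> F}"
    proof (rule k_filter_vimage[OF F])
      show "(\<lambda>y. y) \<in> Y \<rightarrow> topspace X" using YX by auto
      show "k_closed k (topspace X) B" by (rule cl)
      show "{y \<in> Y. y \<in> V} \<in> opens ?Y" if "V \<in> B" for V unfolding e using Yo[OF that] by simp
    qed
    then have "k_filter k (topspace X) B {V \<in> B. V \<inter> Y \<in> F}" unfolding e .
    from real[OF this] show ?thesis
      unfolding h_def Bex_def by (rule someI_ex)
  qed
  have hX: "h F \<in> topspace X" if "k_filter k Y (opens ?Y) F" for F using h0[OF that] by (rule conjunct1)
  have hV: "h F \<in> V \<longleftrightarrow> V \<inter> Y \<in> F" if "k_filter k Y (opens ?Y) F" "V \<in> B" for F V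
  proof -
    have "V \<in> {V \<in> B. V \<inter> Y \<in> F} \<longleftrightarrow> V \<in> {V \<in> B. h F \<in> V}"
      using conjunct2[OF h0[OF that(1)]] by (rule arg_cong)
    then show ?thesis using that(2) by simp
  qed
  have Zk: "F \<in> topspace ?Z \<longleftrightarrow> k_filter k Y (opens ?Y) F" for F
    by (simp only: topspace_filter_space TY mem_Collect_eq)
  have pre: "{F \<in> topspace ?Z. h F \<in> V} = sharp k ?Y (V \<inter> Y)" if "V \<in> B" for V
    unfolding sharp_def by (rule Collect_cong, rule conj_cong, rule refl, rule hV[OF Zk[THEN iffD1] that])
  have "\<exists>F. k_filter k Y (opens ?Y) F \<and> h F = x" if x: "x \<in> topspace X" for x
  proof -
    \<comment> \<open>The filter that \<open>h\<close> sends to \<open>x\<close>: the traces of the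
      basic neighbourhoods of \<open>x\<close>. Upward closure, properness and primeness hold
      because \<open>reflect\<close> recovers inclusions of basic sets from their traces.\<close>
    let ?F = "{A. \<exists>V\<in>B. x \<in> V \<and> A = V \<inter> Y}"
    have "k_filter k Y (opens ?Y) ?F"
      unfolding k_filter_def
    proof (intro conjI ballI impI)
      show "?F \<subseteq> opens ?Y" using Yo by auto
      show "Y \<in> ?F" using k_closed_top[OF cl] x YX by (intro CollectI bexI[of _ "topspace X"]) auto
      show "U \<inter> V \<in> ?F" if "U \<in> ?F" "V \<in> ?F" for U V
      proof -
        obtain U' V' where "U' \<in> B" "x \<in> U'" "U = U' \<inter> Y" "V' \<in> B" "x \<in> V'" "V = V' \<inter> Y"
          using \<open>U \<in> ?F\<close> \<open>V \<in> ?F\<close> by blast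
        then show ?thesis using k_closed_Int[OF cl, of U' V'] by (intro CollectI bexI[of _ "U' \<inter> V'"]) auto
      qed
      show "V \<in> ?F" if "U \<in> ?F" "V \<in> opens ?Y" "U \<subseteq> V" for U V
      proof -
        obtain U' V' where UV: "U' \<in> B" "x \<in> U'" "U = U' \<inter> Y" "V' \<in> B" "V = V' \<inter> Y"
          using \<open>U \<in> ?F\<close> \<open>V \<in> opens ?Y\<close> unfolding mem_Collect_eq oY by blast
        then have "U' \<subseteq> V'" using reflect[of U' V'] \<open>U \<subseteq> V\<close> by simp
        then show ?thesis using UV by (intro CollectI bexI[of _ V']) auto
      qed
      show "{} \<notin> ?F" if "k \<noteq> AllFilters"
      proof
        assume "{} \<in> ?F"
        then obtain V where V: "V \<in> B" "x \<in> V" "{} = V \<inter> Y" by blast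
        then have "V \<subseteq> {}" using reflect[OF V(1) k_closed_empty[OF cl that]] by simp
        then show False using V(2) by simp
      qed
      show "U \<in> ?F \<or> V \<in> ?F" if k: "k = PrimeFilters" and UV: "U \<in> opens ?Y" "V \<in> opens ?Y" "U \<union> V \<in> ?F" for U V
      proof -
        obtain U' V' W where W: "U' \<in> B" "U = U' \<inter> Y" "V' \<in> B" "V = V' \<inter> Y" "W \<in> B" "x \<in> W" "U \<union> V = W \<inter> Y"
          using UV unfolding mem_Collect_eq oY by blast
        have "W \<inter> Y \<subseteq> (U' \<union> V') \<inter> Y" unfolding W(7)[symmetric] W(2,4) by auto
        then have "W \<subseteq> U' \<union> V'" using reflect[OF W(5) k_closed_Un[OF cl k W(1,3)]] by simp
        then have "x \<in> U' \<or> x \<in> V'" using W(6) by auto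
        then show ?thesis using W(1-4) by blast
      qed
    qed
    moreover from this have "h ?F = x"
    proof (intro is_base_t0_eqI[OF base t0])
      fix V assume F: "k_filter k Y (opens ?Y) ?F" and V: "V \<in> B"
      have "V \<inter> Y \<in> ?F \<longleftrightarrow> x \<in> V"
      proof
        assume "V \<inter> Y \<in> ?F"
        then obtain W where W: "W \<in> B" "x \<in> W" "V \<inter> Y = W \<inter> Y" by blast
        then have "W \<subseteq> V" using reflect[OF W(1) V] by simp
        then show "x \<in> V" using W(2) by (rule subsetD)
      qed (use V in auto)
      then show "h ?F \<in> V \<longleftrightarrow> x \<in> V" using hV[OF F V] by simp
    qed (use x hX in auto)
    ultimately show ?thesis by blast
  qed
  then have img: "h ` topspace ?Z = topspace X" using hX Zk by blast
  have cont: "continuous_map ?Z X h"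
  proof (rule is_base_continuous_map[OF base])
    show "h \<in> topspace ?Z \<rightarrow> topspace X" using hX Zk by blast
    show "openin ?Z {F \<in> topspace ?Z. h F \<in> V}" if "V \<in> B" for V
      unfolding pre[OF that] by (rule openin_sharp)
  qed
  have "homeomorphic_map ?Z X h"
  proof (rule bijective_open_imp_homeomorphic_map[OF cont _ img])
    show "inj_on h (topspace ?Z)"
    proof (rule inj_onI)
      fix F F' assume F: "F \<in> topspace ?Z" "F' \<in> topspace ?Z" "h F = h F'"
      then have k: "k_filter k Y (opens ?Y) F" "k_filter k Y (opens ?Y) F'" using Zk by blast+
      have "A \<in> F \<longleftrightarrow> A \<in> F'" if A: "openin ?Y A" for A
      proof -
        obtain V where "V \<in> B" "A = V \<inter> Y" using A oY by blast
        then show ?thesis using hV[OF k(1)] hV[OF k(2)] F(3) by metis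
      qed
      then show "F = F'" using k_filter_subset[OF k(1)] k_filter_subset[OF k(2)] by blast
    qed
    show "open_map ?Z X h"
      unfolding open_map_def
    proof (intro allI impI)
      fix W assume W: "openin ?Z W"
      show "openin X (h ` W)"
      proof (subst openin_subopen, intro ballI)
        fix x assume "x \<in> h ` W"
        then obtain F where F: "F \<in> W" "x = h F" by blast
        then obtain A where A: "A \<in> F" "\<forall>G\<in>topspace ?Z. A \<in> G \<longrightarrow> G \<in> W"
          using W unfolding openin_filter_space by blast
        have FZ: "F \<in> topspace ?Z" using F W openin_subset by blast
        then have k: "k_filter k Y (opens ?Y) F" using Zk by blast
        then have "openin ?Y A" using A(1) k_filter_subset by blast
        then obtain V where V: "V \<in> B" "A = V \<inter> Y" using oY by blast
        have "V \<subseteq> h ` W"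
        proof
          fix y assume y: "y \<in> V"
          then have "y \<in> h ` topspace ?Z" using img openin_subset[OF is_base_openin[OF base V(1)]] by blast
          then obtain G where G: "G \<in> topspace ?Z" "y = h G" by blast
          then have "A \<in> G" using hV[of G V] V y Zk by blast
          then show "y \<in> h ` W" using A(2) G by blast
        qed
        moreover have "x \<in> V" using hV[OF k V(1)] A(1) V(2) F(2) by simp
        ultimately show "\<exists>T. openin X T \<and> x \<in> T \<and> T \<subseteq> h ` W"
          using is_base_openin[OF base V(1)] by blast
      qed
    qed
  qed
  moreover have "h (filter_mult k ?Y FF) = a (filter_map ?Z X h FF)"
    if FF: "FF \<in> topspace (filter_space k ?Z)" for FF
  proof (rule is_base_t0_eqI[OF base t0])
    have m: "k_filter k Y (opens ?Y) (filter_mult k ?Y FF)"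
      using filter_mult_in[OF FF] Zk by blast
    have M: "k_filter k (topspace X) (opens X) (filter_map ?Z X h FF)"
      using filter_map_in[OF cont FF] by (simp only: topspace_filter_space mem_Collect_eq)
    show "h (filter_mult k ?Y FF) \<in> topspace X" using hX[OF m] .
    show "a (filter_map ?Z X h FF) \<in> topspace X" using algebra_in[OF a M] .
    fix V assume V: "V \<in> B"
    have "h (filter_mult k ?Y FF) \<in> V \<longleftrightarrow> V \<inter> Y \<in> filter_mult k ?Y FF" by (rule hV[OF m V])
    also have "\<dots> \<longleftrightarrow> sharp k ?Y (V \<inter> Y) \<in> FF"
      unfolding filter_mult_eq mem_Collect_eq using Yo[OF V] by simp
    also have "\<dots> \<longleftrightarrow> V \<in> filter_map ?Z X h FF"
      unfolding filter_map_def pre[OF V] mem_Collect_eq using is_base_openin[OF base V] by simp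
    also have "\<dots> \<longleftrightarrow> a (filter_map ?Z X h FF) \<in> V" using aU[OF M V] by simp
    finally show "h (filter_mult k ?Y FF) \<in> V \<longleftrightarrow> a (filter_map ?Z X h FF) \<in> V" .
  qed
  ultimately show ?thesis
    unfolding free_algebra_def using Ytop a by blast
qed

text \<open>Every open set of a finite space is a finite union of basic sets. The closure for prime
  filters thus lists all open sets of the model spaces, whatever monad is being treated.\<close>

lemma finite_base_kcl_openin:
  assumes fin: "finite (topspace X)" and base: "is_base X (kcl PrimeFilters (topspace X) S)"
    and U: "openin X U"
  shows "U \<in> kcl PrimeFilters (topspace X) S"
proof -
  let ?K = "kcl PrimeFilters (topspace X) S"
  have S: "S \<subseteq> Pow (topspace X)" using openin_subset[OF is_base_openin[OF base kcl_base]] by blast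
  have "finite {V \<in> ?K. V \<subseteq> U}"
    by (rule finite_subset[of _ "Pow U"]) (use finite_subset[OF openin_subset[OF U] fin] in auto)
  then have "\<Union>{V \<in> ?K. V \<subseteq> U} \<in> ?K" by (rule k_closed_finite_Union[OF k_closed_kcl[OF S]]) auto
  moreover have "\<Union>{V \<in> ?K. V \<subseteq> U} = U" using is_baseE[OF base U] by blast
  ultimately show ?thesis by simp
qed

text \<open>A copy of the square of the Sierpinski space, with the inverse images of the open point
  under the two projections as subbase.\<close>

definition square_space :: "(bool \<times> bool \<Rightarrow> 'a) \<Rightarrow> 'a topology" where
  "square_space \<nu> = code_space \<nu> {{p. fst p}, {p. snd p}}"

lemma topspace_square_space: "topspace (square_space \<nu>) = range \<nu>"
  by (simp add: square_space_def topspace_code_space)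

lemma square_space_alg:
  assumes "inj \<nu>"
  shows "alg_space k (square_space \<nu>)"
    and "KO k (square_space \<nu>) = kcl k (topspace (square_space \<nu>)) {\<nu> ` {p. fst p}, \<nu> ` {p. snd p}}"
proof -
  have sep: "\<exists>P\<in>{{p. fst p}, {p. snd p}}. a \<in> P \<longleftrightarrow> b \<notin> P" if "a \<noteq> b" for a b :: "bool \<times> bool"
    using that by (cases a; cases b) auto
  have real: "\<exists>b. \<forall>P\<in>{{p. fst p}, {p. snd p}}. b \<in> P \<longleftrightarrow> Q P" for Q :: "(bool \<times> bool) set \<Rightarrow> bool"
    by (rule exI[of _ "(Q {p. fst p}, Q {p. snd p})"]) auto
  show "alg_space k (square_space \<nu>)"
    "KO k (square_space \<nu>) = kcl k (topspace (square_space \<nu>)) {\<nu> ` {p. fst p}, \<nu> ` {p. snd p}}"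
    unfolding square_space_def using code_space_alg[OF assms sep real, where k = k] by simp_all
qed

text \<open>
  For the filter monad, the two-point space is free over its smaller point and the square over its two
  incomparable points; for the proper filter monad, the square is free over the complement of its least
  point.
\<close>

lemma point_space_free:
  fixes \<iota> :: "bool \<Rightarrow> 'u"
  assumes inf: "infinite (UNIV :: 'u set)" and inj: "inj \<iota>"
  shows "point_space \<iota> \<in> obj (Kleisli k)"
proof -
  let ?X = "point_space \<iota>" and ?p = "{\<iota> True}"
  have T: "topspace ?X = {\<iota> False, \<iota> True}"
    by (simp add: topspace_point_space UNIV_bool insert_commute)
  have ne: "\<iota> True \<noteq> \<iota> False" using inj by (simp add: inj_eq)
  let ?E = "\<lambda>k. {topspace ?X, ?p} \<union> (if k = AllFilters then {} else {{}})"
  have K: "KO k ?X = ?E k" for k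
  proof
    show "KO k ?X \<subseteq> ?E k"
      unfolding point_space_alg(2)[OF inj]
      by (rule kcl_least) (auto simp: k_closed_def T ne)
    show "?E k \<subseteq> KO k ?X"
      unfolding point_space_alg(2)[OF inj] by (auto intro: kcl_base kcl_top kcl_empty split: if_splits)
  qed
  have op: "U \<in> {topspace ?X, ?p, {}}" if "openin ?X U" for U
  proof -
    have "U \<in> KO PrimeFilters ?X"
      unfolding point_space_alg(2)[OF inj]
    proof (rule finite_base_kcl_openin[OF _ _ that])
      show "is_base ?X (kcl PrimeFilters (topspace ?X) {?p})"
        using alg_space_base[OF point_space_alg(1)[OF inj]] unfolding point_space_alg(2)[OF inj] .
    qed (simp add: T)
    then show ?thesis unfolding K by auto
  qed
  have Top: "?X \<in> obj Top0"
    using alg_space_t0[OF point_space_alg(1)[OF inj, of k]] finite_small[OF inf]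
    by (simp add: obj_Top0 T)
  have kb: "kbasis k ?X (?E k)"
    using alg_space_kbasis[OF point_space_alg(1)[OF inj, of k]] unfolding K .
  have "free_algebra k ?X"
  proof (cases "k = AllFilters")
    case True
    show ?thesis
    proof (rule free_algebraI[OF Top kb, of "{\<iota> False}"])
      show "U \<subseteq> V" if "U \<in> ?E k" "V \<in> ?E k" "U \<inter> {\<iota> False} \<subseteq> V \<inter> {\<iota> False}" for U V
        using that True ne by (auto simp: T)
      show "\<exists>V\<in>?E k. V \<inter> {\<iota> False} = U \<inter> {\<iota> False}" if "openin ?X U" for U
        using op[OF that] True ne by (auto simp: T)
    qed (simp add: T)
  next
    case False
    show ?thesis
    \<comment> \<open>For the two other monads all open sets are homomorphic, and the space is free
      over itself.\<close>
    proof (rule free_algebraI[OF Top kb order_refl])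
      show "U \<subseteq> V" if "U \<in> ?E k" "V \<in> ?E k" "U \<inter> topspace ?X \<subseteq> V \<inter> topspace ?X" for U V
        using that by (auto simp: T split: if_splits)
      show "\<exists>V\<in>?E k. V \<inter> topspace ?X = U \<inter> topspace ?X" if "openin ?X U" for U
        using op[OF that] False by (intro bexI[of _ U]) auto
    qed
  qed
  then show ?thesis
    using Top alg_space_algebra[OF point_space_alg(1)[OF inj, of k]]
    unfolding obj_Kleisli obj_EM obj_Top0 by (intro conjI) simp_all
qed

lemma square_space_free:
  fixes \<nu> :: "bool \<times> bool \<Rightarrow> 'u"
  assumes inf: "infinite (UNIV :: 'u set)" and inj: "inj \<nu>"
  shows "square_space \<nu> \<in> obj (Kleisli k)"
proof -
  let ?X = "square_space \<nu>"
  define a b c d where abcd: "a = \<nu> (False, False)" "b = \<nu> (True, False)" "c = \<nu> (False, True)" "d = \<nu> (True, True)"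
  have ne: "a \<noteq> b" "a \<noteq> c" "a \<noteq> d" "b \<noteq> c" "b \<noteq> d" "c \<noteq> d" "b \<noteq> a" "c \<noteq> a" "d \<noteq> a" "c \<noteq> b" "d \<noteq> b" "d \<noteq> c"
    using inj by (simp_all add: abcd inj_eq)
  have "(UNIV :: (bool \<times> bool) set) = {(False, False), (True, False), (False, True), (True, True)}" by auto
  from arg_cong[OF this, of "image \<nu>"] have T: "topspace ?X = {a, b, c, d}"
    unfolding topspace_square_space abcd image_insert image_empty .
  have "{p :: bool \<times> bool. fst p} = {(True, False), (True, True)}"
    "{p :: bool \<times> bool. snd p} = {(False, True), (True, True)}" by auto
  then have PQ: "\<nu> ` {p. fst p} = {b, d}" "\<nu> ` {p. snd p} = {c, d}" by (simp_all add: abcd)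
  \<comment> \<open>The set \<open>{b, c, d}\<close> is a union of two generators; it is open, but
    homomorphic only for the prime filter monad.\<close>
  let ?E = "\<lambda>k. {{a, b, c, d}, {b, d}, {c, d}, {d}} \<union> (if k = AllFilters then {} else {{}}) \<union>
      (if k = PrimeFilters then {{b, c, d}} else {})"
  note KO = square_space_alg(2)[OF inj, unfolded PQ T]
  have K: "KO k ?X \<subseteq> ?E k" for k
    unfolding KO by (rule kcl_least) (auto simp: k_closed_def ne)
  have op: "U \<in> {{a, b, c, d}, {b, d}, {c, d}, {d}, {}, {b, c, d}}" if "openin ?X U" for U
  proof -
    have "U \<in> KO PrimeFilters ?X"
      unfolding square_space_alg(2)[OF inj]
    proof (rule finite_base_kcl_openin[OF _ _ that])
      show "is_base ?X (kcl PrimeFilters (topspace ?X) {\<nu> ` {p. fst p}, \<nu> ` {p. snd p}})"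
        using alg_space_base[OF square_space_alg(1)[OF inj]] unfolding square_space_alg(2)[OF inj] .
    qed (simp add: T)
    then have "U \<in> ?E PrimeFilters" using K by blast
    then show ?thesis by auto
  qed
  have bc: "{b, d} \<in> KO k ?X" "{c, d} \<in> KO k ?X" "{a, b, c, d} \<in> KO k ?X" for k
    unfolding KO by (auto intro: kcl_base kcl_top)
  have "{b, d} \<inter> {c, d} \<in> KO k ?X" for k unfolding KO by (intro kcl_Int) (auto intro: kcl_base)
  moreover have "{b, d} \<inter> {c, d} = {d}" using ne by auto
  ultimately have d: "{d} \<in> KO k ?X" for k by simp
  have Top: "?X \<in> obj Top0"
    using alg_space_t0[OF square_space_alg(1)[OF inj, of k]] finite_small[OF inf]
    by (simp add: obj_Top0 T)
  have kb: "kbasis k ?X (KO k ?X)"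
    using alg_space_kbasis[OF square_space_alg(1)[OF inj, of k]] .
  have "free_algebra k ?X"
  proof (cases k)
    case AllFilters
    show ?thesis
    proof (rule free_algebraI[OF Top kb, of "{b, c}"])
      show "U \<subseteq> V" if UV: "U \<in> KO k ?X" "V \<in> KO k ?X" and s: "U \<inter> {b, c} \<subseteq> V \<inter> {b, c}" for U V
      proof -
        have "U \<in> ?E k" "V \<in> ?E k" using UV K by blast+
        then show ?thesis using s ne AllFilters by auto
      qed
      show "\<exists>V\<in>KO k ?X. V \<inter> {b, c} = U \<inter> {b, c}" if U: "openin ?X U" for U
      proof -
        consider "U = {a, b, c, d} \<or> U = {b, c, d}" | "U = {b, d}" | "U = {c, d}" | "U = {d} \<or> U = {}"
          using op[OF U] unfolding insert_iff empty_iff by metis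
        then show ?thesis
        proof cases
          case 1 then show ?thesis by (intro bexI[OF _ bc(3)]) auto
        next
          case 2 then show ?thesis by (intro bexI[OF _ bc(1)]) auto
        next
          case 3 then show ?thesis by (intro bexI[OF _ bc(2)]) auto
        next
          case 4 then show ?thesis using ne by (intro bexI[OF _ d]) auto
        qed
      qed
    qed (simp add: T)
  next
    case ProperFilters
    have e: "{} \<in> KO k ?X" unfolding KO by (rule kcl_empty) (simp add: ProperFilters)
    show ?thesis
    proof (rule free_algebraI[OF Top kb, of "{b, c, d}"])
      show "U \<subseteq> V" if UV: "U \<in> KO k ?X" "V \<in> KO k ?X" and s: "U \<inter> {b, c, d} \<subseteq> V \<inter> {b, c, d}" for U V
      proof -
        have "U \<in> ?E k" "V \<in> ?E k" using UV K by blast+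
        then show ?thesis using s ne ProperFilters by auto
      qed
      show "\<exists>V\<in>KO k ?X. V \<inter> {b, c, d} = U \<inter> {b, c, d}" if U: "openin ?X U" for U
      proof -
        consider "U = {a, b, c, d} \<or> U = {b, c, d}" | "U \<in> KO k ?X"
          using op[OF U] bc[of k] d[of k] e unfolding insert_iff empty_iff by metis
        then show ?thesis
        proof cases
          case 1 then show ?thesis by (intro bexI[OF _ bc(3)]) auto
        next
          case 2 then show ?thesis by (intro bexI[OF _ 2]) auto
        qed
      qed
    qed (simp add: T)
  next
    case PrimeFilters
    show ?thesis
    \<comment> \<open>For prime filters the union of the generators is homomorphic as well, so all
      open sets are, and the square is free over itself.\<close>
    proof (rule free_algebraI[OF Top kb order_refl])
      have o: "U \<subseteq> topspace ?X" if "U \<in> KO k ?X" for U using openin_subset[OF KO_openin[OF that]] .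
      show "U \<subseteq> V" if "U \<in> KO k ?X" "V \<in> KO k ?X" "U \<inter> topspace ?X \<subseteq> V \<inter> topspace ?X" for U V
        using that o[OF that(1)] o[OF that(2)] by (simp add: Int_absorb2)
      show "\<exists>V\<in>KO k ?X. V \<inter> topspace ?X = U \<inter> topspace ?X" if U: "openin ?X U" for U
      proof (intro bexI[of _ U] refl)
        show "U \<in> KO k ?X"
          unfolding square_space_alg(2)[OF inj] PrimeFilters
        proof (rule finite_base_kcl_openin[OF _ _ U])
          show "is_base ?X (kcl PrimeFilters (topspace ?X) {\<nu> ` {p. fst p}, \<nu> ` {p. snd p}})"
            using alg_space_base[OF square_space_alg(1)[OF inj]] unfolding square_space_alg(2)[OF inj] .
        qed (simp add: T)
      qed
    qed
  qed
  then show ?thesis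
    using Top alg_space_algebra[OF square_space_alg(1)[OF inj, of k]]
    unfolding obj_Kleisli obj_EM obj_Top0 by (intro conjI) simp_all
qed

section \<open>The number of homomorphic open sets\<close>

lemma lepoll_iff_card_of:
  includes cardinal_syntax
  shows "A \<lesssim> B \<longleftrightarrow> |A| \<le>o |B|"
  by (simp add: lepoll_def card_of_ordLeq)

lemma infinite_UN_lepoll:
  assumes "infinite B" "I \<lesssim> B" "\<And>i. i \<in> I \<Longrightarrow> A i \<lesssim> B"
  shows "(\<Union>i\<in>I. A i) \<lesssim> B"
  using assms card_of_UNION_ordLeq_infinite[of B I A] unfolding lepoll_iff_card_of by blast

lemma infinite_Times_lepoll:
  assumes "infinite C" "A \<lesssim> C" "B \<lesssim> C"
  shows "A \<times> B \<lesssim> C"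
  using assms card_of_Times_ordLeq_infinite_Field[OF _ _ _ card_of_Card_order, of C A B]
  unfolding lepoll_iff_card_of by (simp add: Field_card_of)

lemma infinite_Un_lepoll:
  assumes "infinite C" "A \<lesssim> C" "B \<lesssim> C"
  shows "A \<union> B \<lesssim> C"
proof -
  have "(\<Union>i\<in>{True, False}. if i then A else B) \<lesssim> C"
  proof (rule infinite_UN_lepoll[OF assms(1)])
    show "{True, False} \<lesssim> C" using assms(1) by (rule finite_lepoll_infinite) simp
    show "(if i then A else B) \<lesssim> C" for i using assms(2,3) by (cases i) simp_all
  qed
  then show ?thesis by (simp add: Un_commute)
qed

text \<open>The closure is exhausted by countably many stages, each adding the pairwise
  intersections and unions of the previous one; neither these steps nor the countable union exceeds
  an infinite bound.\<close>

lemma infinite_kcl_lepoll: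
  fixes B :: "'b set" and S :: "'a set set"
  assumes inf: "infinite B" and S: "S \<lesssim> B"
  shows "kcl k T S \<lesssim> B"
proof -
  define g where "g = (\<lambda>C :: 'a set set. C \<union> ((\<lambda>(U, V). U \<inter> V) ` (C \<times> C) \<union> (\<lambda>(U, V). U \<union> V) ` (C \<times> C)))"
  define C where "C n = (g ^^ n) (insert T (insert {} S))" for n
  have C_Suc: "C (Suc n) = g (C n)" for n by (simp add: C_def)
  have mono: "C m \<subseteq> C n" if "m \<le> n" for m n
    using that by (induction rule: dec_induct) (auto simp: C_Suc g_def)
  have S0: "insert T (insert {} S) \<subseteq> C 0" by (simp add: C_def)
  have two: "U \<inter> V \<in> (\<Union>n. C n) \<and> U \<union> V \<in> (\<Union>n. C n)"
    if UV: "U \<in> (\<Union>n. C n)" "V \<in> (\<Union>n. C n)" for U V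
  proof -
    obtain m n where "U \<in> C m" "V \<in> C n" using UV by blast
    then have "U \<in> C (max m n)" "V \<in> C (max m n)"
      using mono[of m "max m n"] mono[of n "max m n"] by auto
    then have "U \<inter> V \<in> C (Suc (max m n))" "U \<union> V \<in> C (Suc (max m n))"
      unfolding C_Suc g_def by force+
    then show ?thesis by blast
  qed
  have "kcl k T S \<subseteq> (\<Union>n. C n)"
  proof
    fix U assume "U \<in> kcl k T S"
    then show "U \<in> (\<Union>n. C n)"
    proof induction
      case (kcl_Int U V)
      then show ?case using two by simp
    next
      case (kcl_Un U V)
      then show ?case using two by simp
    qed (use S0 in blast)+
  qed
  moreover have "C n \<lesssim> B" for n
  proof (induction n)
    case 0
    have "{T, {}} \<union> S \<lesssim> B"
      using inf S finite_lepoll_infinite[OF inf, of "{T, {}}"] by (intro infinite_Un_lepoll) simp_all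
    then show ?case by (simp add: C_def)
  next
    case (Suc n)
    then show ?case
      unfolding C_Suc g_def
      using inf by (intro infinite_Un_lepoll lepoll_trans[OF image_lepoll] infinite_Times_lepoll) simp_all
  qed
  then have "(\<Union>n\<in>UNIV. C n) \<lesssim> B"
    using inf by (intro infinite_UN_lepoll) (simp_all add: infinite_le_lepoll[symmetric])
  ultimately show ?thesis by (rule lepoll_trans[OF subset_imp_lepoll])
qed

text \<open>
  Choosing for all points \<open>x\<close>, \<open>y\<close> of a spectral space a compact open set that contains \<open>x\<close> but not
  \<open>y\<close>, if there is one, gives a family that generates all compact open sets.
\<close>

lemma alg_space_Prime_generated:
  assumes X: "alg_space PrimeFilters X"
  obtains S where "S \<lesssim> topspace X \<times> topspace X" "KO PrimeFilters X \<subseteq> kcl PrimeFilters (topspace X) S"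
proof -
  let ?K = "KO PrimeFilters X" and ?T = "topspace X"
  have base: "is_base X ?K" and cl: "k_closed PrimeFilters ?T ?K"
    using alg_space_base[OF X] alg_space_closed[OF X] .
  obtain a where a: "algebra PrimeFilters X a" using alg_space_algebra[OF X] ..
  define s where "s x y = (if \<exists>U\<in>?K. x \<in> U \<and> y \<notin> U then SOME U. U \<in> ?K \<and> x \<in> U \<and> y \<notin> U else ?T)" for x y
  have s: "s x y \<in> ?K \<and> x \<in> s x y \<and> y \<notin> s x y" if "U \<in> ?K" "x \<in> U" "y \<notin> U" for x y U
  proof -
    have ex: "\<exists>U. U \<in> ?K \<and> x \<in> U \<and> y \<notin> U" using that by blast
    then have "s x y = (SOME U. U \<in> ?K \<and> x \<in> U \<and> y \<notin> U)" by (auto simp: s_def)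
    then show ?thesis using someI_ex[OF ex] by simp
  qed
  have sK: "s x y \<in> ?K" for x y
  proof (cases "\<exists>U\<in>?K. x \<in> U \<and> y \<notin> U")
    case True
    then show ?thesis using s by blast
  next
    case False
    then have "s x y = ?T" unfolding s_def by (rule if_not_P)
    then show ?thesis using k_closed_top[OF cl] by simp
  qed
  let ?S = "(\<lambda>(x, y). s x y) ` (?T \<times> ?T)"
  let ?L = "kcl PrimeFilters ?T ?S"
  have SK: "?S \<subseteq> ?K" using sK by auto
  have LK: "?L \<subseteq> ?K" by (rule kcl_least[OF SK cl])
  \<comment> \<open>Otherwise a prime filter contains every generated neighbourhood of
    \<open>x\<close> but nothing below \<open>W\<close>. Its point \<open>p\<close> is outside
    \<open>W\<close>, so \<open>s x p\<close> contains \<open>x\<close> and omits \<open>p\<close>,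
    although as a generated neighbourhood of \<open>x\<close> it belongs to the filter of
    \<open>p\<close>.\<close>
  have nb: "\<exists>V\<in>?L. x \<in> V \<and> V \<subseteq> W" if W: "W \<in> ?K" "x \<in> W" for W x
  proof (rule ccontr)
    assume no: "\<not> ?thesis"
    have xT: "x \<in> ?T" using k_closed_subset[OF cl W(1)] W(2) by (rule subsetD)
    let ?F = "{V \<in> ?K. \<exists>G\<in>?L. x \<in> G \<and> G \<subseteq> V}" and ?I = "{V \<in> ?K. V \<subseteq> W}"
    have F: "k_filter AllFilters ?T ?K ?F"
      unfolding k_filter_def
    proof (intro conjI ballI impI)
      show "?T \<in> ?F" using k_closed_top[OF cl] kcl_top xT by blast
      show "U \<inter> V \<in> ?F" if UV: "U \<in> ?F" "V \<in> ?F" for U V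
      proof -
        obtain G H where GH: "G \<in> ?L" "x \<in> G" "G \<subseteq> U" "H \<in> ?L" "x \<in> H" "H \<subseteq> V" using UV by blast
        have "U \<inter> V \<in> ?K" using k_closed_Int[OF cl] UV by simp
        moreover have "x \<in> G \<inter> H \<and> G \<inter> H \<subseteq> U \<inter> V" using GH by (intro conjI IntI Int_mono)
        ultimately show ?thesis using kcl_Int[OF GH(1,4)] by blast
      qed
      show "V \<in> ?F" if UV: "U \<in> ?F" "V \<in> ?K" "U \<subseteq> V" for U V
      proof -
        obtain G where "G \<in> ?L" "x \<in> G" "G \<subseteq> U" using UV(1) by blast
        then show ?thesis using UV(2) order_trans[OF \<open>G \<subseteq> U\<close> UV(3)] by blast
      qed
    qed auto
    obtain P where P: "k_filter PrimeFilters ?T ?K P" "?F \<subseteq> P" "P \<inter> ?I = {}"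
    proof (rule prime_filter_exists[OF cl F, of ?I])
      show "{} \<in> ?I" using k_closed_empty[OF cl] by simp
      show "U \<union> V \<in> ?I" if "U \<in> ?I" "V \<in> ?I" for U V using that k_closed_Un[OF cl] by simp
      show "V \<in> ?I" if "U \<in> ?I" "V \<in> ?K" "V \<subseteq> U" for U V using that by (blast intro: order_trans)
      show "?F \<inter> ?I = {}" using no by (blast intro: order_trans)
    qed auto
    obtain p where p: "p \<in> ?T" "P = {U \<in> ?K. p \<in> U}" using alg_space_point[OF X P(1)] ..
    have "p \<notin> W"
    proof
      assume "p \<in> W"
      then have "W \<in> P" using W(1) p(2) by simp
      moreover have "W \<in> ?I" using W(1) by simp
      ultimately show False using P(3) by blast
    qed
    then have sp: "s x p \<in> ?K" "x \<in> s x p" "p \<notin> s x p" using s[OF W] by simp_all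
    have "s x p \<in> ?L" using xT p(1) by (intro kcl_base) blast
    then have "s x p \<in> ?F" using sp(1,2) by blast
    then have "s x p \<in> P" using P(2) by blast
    then show False using sp(3) p(2) by simp
  qed
  have "is_base X ?L"
    unfolding is_base_def
  proof (intro conjI ballI allI impI)
    show "openin X U" if "U \<in> ?L" for U using KO_openin[OF subsetD[OF LK that]] .
    fix W x assume W: "openin X W \<and> x \<in> W"
    obtain U where U: "U \<in> ?K" "x \<in> U" "U \<subseteq> W"
      using is_baseE[OF base conjunct1[OF W] conjunct2[OF W]] .
    then obtain V where "V \<in> ?L" "x \<in> V" "V \<subseteq> U" using nb by blast
    then show "\<exists>U\<in>?L. x \<in> U \<and> U \<subseteq> W" using order_trans[OF \<open>V \<subseteq> U\<close> U(3)] by blast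
  qed
  moreover have "k_closed PrimeFilters ?T ?L"
    using k_closed_subset[OF cl] SK by (intro k_closed_kcl) blast
  ultimately have "U \<in> ?L" if "U \<in> ?K" for U
    using base_compact_open[of X ?L U] KO_openin[OF that] KO_compact[OF a that] by simp
  then show thesis using that[of ?S] image_lepoll by blast
qed

text \<open>For filters and proper filters a nonempty homomorphic set is the up-set of a point; for
  prime filters all of them are generated by a family indexed by pairs of points.\<close>

lemma KO_lepoll:
  assumes X: "alg_space k X" and inf: "infinite (topspace X)"
  shows "KO k X \<lesssim> topspace X"
proof (cases "k = PrimeFilters")
  case True
  obtain S where S: "S \<lesssim> topspace X \<times> topspace X" "KO PrimeFilters X \<subseteq> kcl PrimeFilters (topspace X) S"
    using alg_space_Prime_generated[OF X[unfolded True]] .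
  have "S \<lesssim> topspace X" using S(1) infinite_Times_lepoll[OF inf lepoll_refl lepoll_refl] by (rule lepoll_trans)
  then have "kcl PrimeFilters (topspace X) S \<lesssim> topspace X" by (rule infinite_kcl_lepoll[OF inf])
  with subset_imp_lepoll[OF S(2)] show ?thesis unfolding True by (rule lepoll_trans)
next
  case False
  have "KO k X \<subseteq> {{}} \<union> up X ` topspace X"
  proof
    fix U assume U: "U \<in> KO k X"
    show "U \<in> {{}} \<union> up X ` topspace X"
    proof (cases "U = {}")
      case ne: False
      show ?thesis by (rule alg_space_principal[OF X False U disjI2[OF ne]]) blast
    qed simp
  qed
  moreover have "{{}} \<union> up X ` topspace X \<lesssim> topspace X"
    by (rule infinite_Un_lepoll[OF inf finite_lepoll_infinite[OF inf] image_lepoll]) simp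
  ultimately show ?thesis by (rule lepoll_trans[OF subset_imp_lepoll])
qed

text \<open>Weights have to be carried by small subsets of \<open>'u\<close>. Bounding by the number
  of points works for every infinite \<open>'u\<close>, whereas the power set of a small infinite
  space may fail to be small.\<close>

lemma KO_lesspoll:
  fixes X :: "'u topology"
  assumes X: "alg_space k X" and inf: "infinite (UNIV :: 'u set)" and small: "small (topspace X)"
  shows "KO k X \<prec> (UNIV :: 'u set)" "KO k X \<times> KO k X \<prec> (UNIV :: 'u set)"
proof -
  have *: "KO k X \<prec> (UNIV :: 'u set)"
  proof (cases "finite (topspace X)")
    case True
    have "KO k X \<subseteq> Pow (topspace X)" using k_closed_subset[OF alg_space_closed[OF X]] by blast
    then have "finite (KO k X)" using True by (simp add: finite_subset)
    then show ?thesis by (rule finite_lesspoll_infinite[OF inf])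
  next
    case False
    show ?thesis using KO_lepoll[OF X False] small unfolding small_def by (rule lesspoll_trans1)
  qed
  then show "KO k X \<prec> (UNIV :: 'u set)" .
  show "KO k X \<times> KO k X \<prec> (UNIV :: 'u set)"
  proof (cases "finite (KO k X)")
    case True
    then show ?thesis by (intro finite_lesspoll_infinite[OF inf]) simp
  next
    case False
    show ?thesis using infinite_Times_lepoll[OF False lepoll_refl lepoll_refl] * by (rule lesspoll_trans1)
  qed
qed

lemma lesspoll_code:
  assumes "A \<prec> (UNIV :: 'u set)"
  obtains e :: "'a \<Rightarrow> 'u" where "inj_on e A" "small (e ` A)"
proof -
  obtain e :: "'a \<Rightarrow> 'u" where e: "inj_on e A"
    using lesspoll_imp_lepoll[OF assms] by (auto simp: lepoll_def)
  have "e ` A \<prec> (UNIV :: 'u set)" using image_lepoll assms by (rule lesspoll_trans1)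
  then show thesis using that[OF e] by (simp add: small_def)
qed

lemma infinite_code:
  assumes "infinite (UNIV :: 'u set)"
  obtains e :: "'c :: countable \<Rightarrow> 'u" where "inj e"
proof -
  obtain g :: "nat \<Rightarrow> 'u" where "inj g" using infinite_countable_subset[OF assms] by blast
  then have "inj (g \<circ> (to_nat :: 'c \<Rightarrow> nat))" by (intro inj_compose) simp_all
  then show thesis by (rule that)
qed

section \<open>Presentation of algebraic spaces as weighted limits\<close>

text \<open>
  An algebraic space \<open>X\<close> is the space of maps \<open>KO k X \<rightarrow> 2\<close> that preserve the following operations. So
  it is the limit, weighted by the sets \<open>KO k X \<times> KO k X\<close> and \<open>KO k X\<close>, of the diagram that consists
  of the square of the two-point space, the two-point space, and one arrow for each operation.
\<close>

definition Ops :: "filter_kind \<Rightarrow> (bool \<times> bool \<Rightarrow> bool) set" where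
  "Ops k = {fst, snd, \<lambda>p. fst p \<and> snd p, \<lambda>p. True} \<union>
     (if k = AllFilters then {} else {\<lambda>p. False}) \<union>
     (if k = PrimeFilters then {\<lambda>p. fst p \<or> snd p} else {})"

text \<open>Cutting down to \<open>T\<close> makes the constant operation \<open>True\<close> yield
  the whole space.\<close>

definition op_set :: "'a set \<Rightarrow> (bool \<times> bool \<Rightarrow> bool) \<Rightarrow> 'a set \<Rightarrow> 'a set \<Rightarrow> 'a set" where
  "op_set T f U V = {x \<in> T. f (x \<in> U, x \<in> V)}"

lemma Ops_cases:
  assumes "f \<in> Ops k"
  obtains "f = fst" | "f = snd" | "f = (\<lambda>p. fst p \<and> snd p)" | "f = (\<lambda>p. True)"
  | "f = (\<lambda>p. False)" "k \<noteq> AllFilters" | "f = (\<lambda>p. fst p \<or> snd p)" "k = PrimeFilters"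
  using assms unfolding Ops_def by (auto split: if_splits)

lemma op_set_in:
  assumes B: "k_closed k T B" and f: "f \<in> Ops k" and U: "U \<in> B" and V: "V \<in> B"
  shows "op_set T f U V \<in> B"
proof -
  have UT: "U \<subseteq> T" "V \<subseteq> T" using k_closed_subset[OF B] U V by simp_all
  show ?thesis
  proof (rule Ops_cases[OF f])
    assume "f = fst"
    then have "op_set T f U V = U" using UT by (auto simp: op_set_def)
    then show ?thesis using U by simp
  next
    assume "f = snd"
    then have "op_set T f U V = V" using UT by (auto simp: op_set_def)
    then show ?thesis using V by simp
  next
    assume "f = (\<lambda>p. fst p \<and> snd p)"
    then have "op_set T f U V = U \<inter> V" using UT by (auto simp: op_set_def)
    then show ?thesis using k_closed_Int[OF B U V] by simp
  next
    assume "f = (\<lambda>p. True)"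
    then have "op_set T f U V = T" by (auto simp: op_set_def)
    then show ?thesis using k_closed_top[OF B] by simp
  next
    assume "f = (\<lambda>p. False)" "k \<noteq> AllFilters"
    then have "op_set T f U V = {}" by (auto simp: op_set_def)
    then show ?thesis using k_closed_empty[OF B \<open>k \<noteq> AllFilters\<close>] by simp
  next
    assume "f = (\<lambda>p. fst p \<or> snd p)" "k = PrimeFilters"
    then have "op_set T f U V = U \<union> V" using UT by (auto simp: op_set_def)
    then show ?thesis using k_closed_Un[OF B \<open>k = PrimeFilters\<close> U V] by simp
  qed
qed

text \<open>Each operation contributes one filter axiom; upward closure comes from meets, as
  \<open>U \<subseteq> V\<close> means \<open>U \<inter> V = U\<close>.\<close>

lemma k_filter_ops:
  assumes B: "k_closed k T B"
    and b: "\<And>f U V. f \<in> Ops k \<Longrightarrow> U \<in> B \<Longrightarrow> V \<in> B \<Longrightarrow> b (op_set T f U V) \<longleftrightarrow> f (b U, b V)"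
  shows "k_filter k T B {U \<in> B. b U}"
proof -
  have I: "b (U \<inter> V) \<longleftrightarrow> b U \<and> b V" if "U \<in> B" "V \<in> B" for U V
  proof -
    have "op_set T (\<lambda>p. fst p \<and> snd p) U V = U \<inter> V"
      using k_closed_subset[OF B that(1)] by (auto simp: op_set_def)
    then show ?thesis using b[of "\<lambda>p. fst p \<and> snd p" U V] that by (simp add: Ops_def)
  qed
  show ?thesis
    unfolding k_filter_def
  proof (intro conjI ballI impI)
    have "op_set T (\<lambda>p. True) T T = T" by (auto simp: op_set_def)
    then show "T \<in> {U \<in> B. b U}" using b[of "\<lambda>p. True" T T] k_closed_top[OF B] by (simp add: Ops_def)
    show "U \<inter> V \<in> {U \<in> B. b U}" if "U \<in> {U \<in> B. b U}" "V \<in> {U \<in> B. b U}" for U V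
      using that I k_closed_Int[OF B] by simp
    show "V \<in> {U \<in> B. b U}" if "U \<in> {U \<in> B. b U}" "V \<in> B" "U \<subseteq> V" for U V
      using I[of U V] that by (simp add: Int_absorb2)
    show "{} \<notin> {U \<in> B. b U}" if k: "k \<noteq> AllFilters"
    proof -
      have "op_set T (\<lambda>p. False) T T = {}" by (auto simp: op_set_def)
      then show ?thesis using b[of "\<lambda>p. False" T T] k_closed_top[OF B] k by (simp add: Ops_def)
    qed
    show "U \<in> {U \<in> B. b U} \<or> V \<in> {U \<in> B. b U}"
      if k: "k = PrimeFilters" and UV: "U \<in> B" "V \<in> B" "U \<union> V \<in> {U \<in> B. b U}" for U V
    proof -
      have "op_set T (\<lambda>p. fst p \<or> snd p) U V = U \<union> V"
        using k_closed_subset[OF B UV(1)] k_closed_subset[OF B UV(2)] by (auto simp: op_set_def)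
      then show ?thesis using b[of "\<lambda>p. fst p \<or> snd p" U V] UV k by (simp add: Ops_def)
    qed
  qed auto
qed

text \<open>The index category must live over \<open>'u\<close> as well: \<open>\<iota>\<close>
  codes its objects, \<open>\<tau>\<close> its arrows, with \<open>\<tau> None\<close> for
  identities, and \<open>\<nu>\<close> the points of the square.\<close>

locale presentation = ambient k B G \<iota>
  for k and B :: "('u topology, 'u \<Rightarrow> 'u) ocat" and G and \<iota> :: "bool \<Rightarrow> 'u" +
  fixes \<nu> :: "bool \<times> bool \<Rightarrow> 'u" and \<tau> :: "(bool \<times> bool \<Rightarrow> bool) option \<Rightarrow> 'u"
  assumes inj_\<nu>: "inj \<nu>" and inj_\<tau>: "inj \<tau>"
begin

abbreviation "S \<equiv> point_space \<iota>"
abbreviation "Q \<equiv> square_space \<nu>"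

lemmas T_S = topspace_point_space[of \<iota>]
lemmas T_Q = topspace_square_space[of \<nu>]

section \<open>The diagram on the two-point space and its square\<close>

definition op_map :: "(bool \<times> bool \<Rightarrow> bool) \<Rightarrow> 'u \<Rightarrow> 'u" where
  "op_map f = (\<lambda>s\<in>range \<nu>. \<iota> (f (inv \<nu> s)))"

lemma op_map_\<nu>: "op_map f (\<nu> p) = \<iota> (f p)"
  by (simp add: op_map_def inj_\<nu>)

lemma \<iota>_eq: "\<iota> b = \<iota> c \<longleftrightarrow> b = c"
  using inj by (simp add: inj_eq)

lemma Q_obj: "Q \<in> obj (X_alg k)"
  using obj_Kleisli_X_alg[OF inf square_space_free[OF inf inj_\<nu>]] .

lemma map_S:
  assumes X: "X \<in> obj (X_alg k)" and U: "U \<in> KO k X"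
  shows "(\<lambda>x\<in>topspace X. \<iota> (x \<in> U)) \<in> hom (X_alg k) X S"
  unfolding hom_X_alg[OF inf]
proof (intro conjI ballI X point_space_obj)
  let ?t = "\<lambda>x\<in>topspace X. \<iota> (x \<in> U)"
  show "?t \<in> topspace X \<rightarrow>\<^sub>E topspace S" by (simp add: T_S)
  have cl: "k_closed k (topspace X) (KO k X)"
    using X alg_space_closed[of k X] by (simp add: obj_X_alg[OF inf])
  fix V assume "V \<in> KO k S"
  then have V: "V \<in> kcl k (topspace S) {{\<iota> True}}" unfolding point_space_alg(2)[OF inj] .
  show "{x \<in> topspace X. ?t x \<in> V} \<in> KO k X"
  proof (rule kcl_vimage[OF cl _ _ V])
    show "?t \<in> topspace X \<rightarrow> topspace S" by (simp add: T_S)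
    fix W assume "W \<in> {{\<iota> True}}"
    then have "{x \<in> topspace X. ?t x \<in> W} = U"
      using k_closed_subset[OF cl U] by (auto simp: \<iota>_eq)
    then show "{x \<in> topspace X. ?t x \<in> W} \<in> KO k X" using U by simp
  qed
qed

lemma map_Q:
  assumes X: "X \<in> obj (X_alg k)" and U: "U \<in> KO k X" "V \<in> KO k X"
  shows "(\<lambda>x\<in>topspace X. \<nu> (x \<in> U, x \<in> V)) \<in> hom (X_alg k) X Q"
  unfolding hom_X_alg[OF inf]
proof (intro conjI ballI X Q_obj)
  let ?t = "\<lambda>x\<in>topspace X. \<nu> (x \<in> U, x \<in> V)"
  show "?t \<in> topspace X \<rightarrow>\<^sub>E topspace Q" by (simp add: T_Q)
  have cl: "k_closed k (topspace X) (KO k X)"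
    using X alg_space_closed[of k X] by (simp add: obj_X_alg[OF inf])
  fix W assume "W \<in> KO k Q"
  then have W: "W \<in> kcl k (topspace Q) {\<nu> ` {p. fst p}, \<nu> ` {p. snd p}}"
    unfolding square_space_alg(2)[OF inj_\<nu>] .
  show "{x \<in> topspace X. ?t x \<in> W} \<in> KO k X"
  proof (rule kcl_vimage[OF cl _ _ W])
    show "?t \<in> topspace X \<rightarrow> topspace Q" by (simp add: T_Q)
    have m: "\<nu> p \<in> \<nu> ` A \<longleftrightarrow> p \<in> A" for p A by (rule inj_image_mem_iff[OF inj_\<nu>])
    have UV: "{x \<in> topspace X. ?t x \<in> \<nu> ` {p. fst p}} = U" "{x \<in> topspace X. ?t x \<in> \<nu> ` {p. snd p}} = V"
      using k_closed_subset[OF cl U(1)] k_closed_subset[OF cl U(2)] by (auto simp: m)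
    fix R assume "R \<in> {\<nu> ` {p. fst p}, \<nu> ` {p. snd p}}"
    then have "R = \<nu> ` {p. fst p} \<or> R = \<nu> ` {p. snd p}" by simp
    then show "{x \<in> topspace X. ?t x \<in> R} \<in> KO k X" using U by (elim disjE) (simp_all only: UV)
  qed
qed

text \<open>\<open>op_map f\<close> classifies the subset of the square obtained by applying
  \<open>f\<close> to its two generating sets, and this subset is homomorphic.\<close>

lemma op_map_hom:
  assumes f: "f \<in> Ops k"
  shows "op_map f \<in> hom (X_alg k) Q S"
proof -
  have cl: "k_closed k (topspace Q) (KO k Q)"
    using alg_space_closed[OF square_space_alg(1)[OF inj_\<nu>]] .
  have P: "\<nu> ` {p. fst p} \<in> KO k Q" "\<nu> ` {p. snd p} \<in> KO k Q"
    unfolding square_space_alg(2)[OF inj_\<nu>] by (simp_all add: kcl_base)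
  let ?U = "op_set (topspace Q) f (\<nu> ` {p. fst p}) (\<nu> ` {p. snd p})"
  have m: "\<nu> p \<in> \<nu> ` A \<longleftrightarrow> p \<in> A" for p A by (rule inj_image_mem_iff[OF inj_\<nu>])
  have "op_map f = (\<lambda>x\<in>topspace Q. \<iota> (x \<in> ?U))"
  proof (rule extensionalityI[of _ "range \<nu>"])
    fix s assume "s \<in> range \<nu>"
    then obtain p where p: "s = \<nu> p" by blast
    show "op_map f s = (\<lambda>x\<in>topspace Q. \<iota> (x \<in> ?U)) s"
      unfolding p op_map_\<nu> by (simp add: T_Q op_set_def m)
  qed (simp_all add: op_map_def T_Q)
  then show ?thesis using map_S[OF Q_obj op_set_in[OF cl f P]] by simp
qed

text \<open>\<open>\<iota> True\<close> indexes the two-point space and \<open>\<iota> False\<close>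
  the square. Of two composable arrows at least one is an identity, so the composite is the other
  one.\<close>

definition D :: "('u, 'u) ocat" where
  "D = \<lparr> obj = range \<iota>,
     hom = (\<lambda>x y. if x = y then {\<tau> None} else if x = \<iota> False \<and> y = \<iota> True then (\<tau> \<circ> Some) ` Ops k else {}),
     idn = (\<lambda>x. \<tau> None), hcomp = (\<lambda>x y z g f. if g = \<tau> None then f else g), hle = (\<lambda>x y f g. f = g) \<rparr>"

definition Fo :: "'u \<Rightarrow> 'u topology" where
  "Fo d = (if d = \<iota> True then S else Q)"

definition Fm :: "'u \<Rightarrow> 'u \<Rightarrow> 'u \<Rightarrow> 'u \<Rightarrow> 'u" where
  "Fm d d' n = (if d = d' then \<lambda>x\<in>topspace (Fo d). x else op_map (the (inv \<tau> n)))"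

lemma obj_D: "obj D = {\<iota> False, \<iota> True}"
  by (auto simp: D_def UNIV_bool)

lemma \<tau>_ne: "\<tau> (Some f) \<noteq> \<tau> None"
  using inj_\<tau> by (simp add: inj_eq)

lemma hom_D_simps:
  "hom D (\<iota> b) (\<iota> b) = {\<tau> None}"
  "hom D (\<iota> True) (\<iota> False) = {}"
  "hom D (\<iota> False) (\<iota> True) = (\<tau> \<circ> Some) ` Ops k"
  by (simp_all add: D_def \<iota>_eq)

lemma D_ops: "idn D x = \<tau> None" "hcomp D x y z g f = (if g = \<tau> None then f else g)" "hle D x y f g \<longleftrightarrow> f = g"
  by (simp_all add: D_def)

lemma Fo_simps: "Fo (\<iota> True) = S" "Fo (\<iota> False) = Q"
  by (simp_all add: Fo_def \<iota>_eq)

lemma Fm_simps: "Fm d d n = (\<lambda>x\<in>topspace (Fo d). x)" "Fm (\<iota> False) (\<iota> True) (\<tau> (Some f)) = op_map f"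
  by (simp_all add: Fm_def \<iota>_eq inj_\<tau>)

lemma small_D: "small_category D"
proof -
  have "finite (Ops k)" by (simp add: Ops_def)
  then have "finite (hom D x y)" for x y by (simp add: D_def)
  then have "\<forall>x\<in>obj D. \<forall>y\<in>obj D. small (hom D x y)" by (intro ballI finite_small[OF inf])
  moreover have "small (obj D)" by (rule finite_small[OF inf]) (simp add: obj_D)
  moreover have "order_category D"
    unfolding order_category_def D_ops
  proof (intro conjI ballI impI)
    show "\<tau> None \<in> hom D x x" for x by (simp add: D_def)
    fix x y z f g assume f: "f \<in> hom D x y" and g: "g \<in> hom D y z"
    show "(if g = \<tau> None then f else g) \<in> hom D x z"
    proof (cases "g = \<tau> None")
      case True
      then have "y = z" using g by (auto simp: D_def inj_eq[OF inj_\<tau>] split: if_splits)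
      then show ?thesis using f True by simp
    next
      case False
      then have "y = \<iota> False" using g by (auto simp: D_def split: if_splits)
      then have "x = y" using f \<iota>_eq by (auto simp: D_def split: if_splits)
      then show ?thesis using g False by simp
    qed
  next
    show "(if f = \<tau> None then \<tau> None else f) = f" "(if \<tau> None = \<tau> None then f else \<tau> None) = f" for f
      by simp_all
    show "(if h = \<tau> None then if g = \<tau> None then f else g else h) =
        (if (if h = \<tau> None then g else h) = \<tau> None then f else if h = \<tau> None then g else h)" for f g h
      by simp
    show "f = g" if "f = g \<and> g = f" for f g :: 'u using that by (rule conjunct1)
    show "f = h" if "f = g \<and> g = h" for f g h :: 'u using that by (elim conjE) (rule trans)
    show "(if g = \<tau> None then f else g) = (if g' = \<tau> None then f' else g')"
      if "f = f' \<and> g = g'" for f f' g g' using that by simp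
  qed (rule refl)
  ultimately show ?thesis by (simp add: small_category_def)
qed

text \<open>Kept general in \<open>A\<close> because the diagram has to be read in an arbitrary
  subcategory competing for the closure.\<close>

lemma order_functor_D:
  assumes ops_A: "idn A = idn Top0" "hcomp A = hcomp Top0" "hle A = hle Top0"
    and obj: "S \<in> obj A" "Q \<in> obj A"
    and idn: "(\<lambda>x\<in>topspace S. x) \<in> hom A S S" "(\<lambda>x\<in>topspace Q. x) \<in> hom A Q Q"
    and op: "\<And>f. f \<in> Ops k \<Longrightarrow> op_map f \<in> hom A Q S"
  shows "order_functor D A Fo Fm"
proof -
  have r: "compose (topspace Q) (\<lambda>x\<in>topspace S. x) (op_map f) = op_map f" if "f \<in> Ops k" for f
    by (rule extensionalityI[of _ "range \<nu>"])
      (auto simp: T_S T_Q compose_def op_map_def inj_\<nu>)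
  have l: "compose (topspace Q) (op_map f) (\<lambda>x\<in>topspace Q. x) = op_map f" for f
    by (rule extensionalityI[of _ "range \<nu>"]) (auto simp: T_Q compose_def op_map_def)
  have i: "compose (topspace X) (\<lambda>x\<in>topspace X. x) (\<lambda>x\<in>topspace X. x) = (\<lambda>x\<in>topspace X. x)" for X :: "'u topology"
    by (rule extensionalityI[of _ "topspace X"]) (simp_all add: compose_def)
  show ?thesis
    unfolding order_functor_def obj_D D_ops ops_A ops_Top0
  proof (intro conjI ballI impI)
    show "Fo d \<in> obj A" if "d \<in> {\<iota> False, \<iota> True}" for d using that obj by (auto simp: Fo_simps)
    show "Fm d d' n \<in> hom A (Fo d) (Fo d')"
      if "d \<in> {\<iota> False, \<iota> True}" "d' \<in> {\<iota> False, \<iota> True}" "n \<in> hom D d d'" for d d' n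
      using that idn op by (auto simp: hom_D_simps Fo_simps Fm_simps)
    show "Fm d d (\<tau> None) = (\<lambda>x\<in>topspace (Fo d). x)" for d by (rule Fm_simps)
    fix d d' d'' n n'
    assume d: "d \<in> {\<iota> False, \<iota> True}" "d' \<in> {\<iota> False, \<iota> True}" "d'' \<in> {\<iota> False, \<iota> True}"
      "n \<in> hom D d d'" "n' \<in> hom D d' d''"
    show "Fm d d'' (if n' = \<tau> None then n else n') = compose (topspace (Fo d)) (Fm d' d'' n') (Fm d d' n)"
    proof (cases "d' = d''")
      case True
      then have n': "n' = \<tau> None" using d(3,5) by (auto simp: hom_D_simps)
      show ?thesis
      proof (cases "d = d'")
        case True
        then show ?thesis using n' \<open>d' = d''\<close> by (simp add: Fm_simps i)
      next
        case False
        then obtain f where "d = \<iota> False" "d' = \<iota> True" "f \<in> Ops k" "n = \<tau> (Some f)"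
          using d by (auto simp: hom_D_simps)
        then show ?thesis using n' \<open>d' = d''\<close> r by (simp add: Fm_simps Fo_simps)
      qed
    next
      case False
      then obtain f where f: "d' = \<iota> False" "d'' = \<iota> True" "n' = \<tau> (Some f)" using d by (auto simp: hom_D_simps)
      then have "d = \<iota> False" using d(1,4) by (auto simp: hom_D_simps)
      then show ?thesis using f l by (simp add: Fm_simps Fo_simps \<tau>_ne)
    qed
  qed (auto simp: spec_le_refl)
qed

context
  fixes X :: "'u topology" and c1 :: "'u set \<Rightarrow> 'u" and c2 :: "'u set \<times> 'u set \<Rightarrow> 'u"
  assumes X: "X \<in> obj (X_alg k)"
    and c1: "inj_on c1 (KO k X)" "small (c1 ` KO k X)"
    and c2: "inj_on c2 (KO k X \<times> KO k X)" "small (c2 ` (KO k X \<times> KO k X))"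
begin

lemma alg: "alg_space k X"
  using X by (simp add: obj_X_alg[OF inf])

definition dec1 where "dec1 = inv_into (KO k X) c1"
definition dec2 where "dec2 = inv_into (KO k X \<times> KO k X) c2"

lemma dec1: "U \<in> KO k X \<Longrightarrow> dec1 (c1 U) = U"
  unfolding dec1_def using c1(1) by (rule inv_into_f_f)

lemma dec2: "U \<in> KO k X \<Longrightarrow> V \<in> KO k X \<Longrightarrow> dec2 (c2 (U, V)) = (U, V)"
  unfolding dec2_def using c2(1) by (intro inv_into_f_f) simp_all

text \<open>The weights are discrete: monotonicity in the members of \<open>KO k X\<close> results
  from the preservation of binary meets.\<close>

definition Wo :: "'u \<Rightarrow> 'u gorder" where
  "Wo d = \<lparr> carrier = (if d = \<iota> True then c1 ` KO k X else c2 ` (KO k X \<times> KO k X)), eq = (=), le = (=) \<rparr>"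

definition Wm :: "'u \<Rightarrow> 'u \<Rightarrow> 'u \<Rightarrow> 'u \<Rightarrow> 'u" where
  "Wm d d' n = (\<lambda>w\<in>carrier (Wo d). if d = d' then w else
     c1 (op_set (topspace X) (the (inv \<tau> n)) (fst (dec2 w)) (snd (dec2 w))))"

definition leg :: "'u \<Rightarrow> 'u \<Rightarrow> 'u \<Rightarrow> 'u" where
  "leg d w = (\<lambda>x\<in>topspace X. if d = \<iota> True then \<iota> (x \<in> dec1 w)
     else \<nu> (x \<in> fst (dec2 w), x \<in> snd (dec2 w)))"

lemma carrier_Wo: "carrier (Wo (\<iota> True)) = c1 ` KO k X" "carrier (Wo (\<iota> False)) = c2 ` (KO k X \<times> KO k X)"
  by (simp_all add: Wo_def \<iota>_eq)

lemma le_Wo: "x \<sqsubseteq>\<^bsub>Wo d\<^esub> y \<longleftrightarrow> x = y"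
  by (simp add: Wo_def)

lemma op_set_KO: "f \<in> Ops k \<Longrightarrow> U \<in> KO k X \<Longrightarrow> V \<in> KO k X \<Longrightarrow> op_set (topspace X) f U V \<in> KO k X"
  by (rule op_set_in[OF alg_space_closed[OF alg]])

lemma Wm_simps:
  "w \<in> carrier (Wo d) \<Longrightarrow> Wm d d n w = w"
  "U \<in> KO k X \<Longrightarrow> V \<in> KO k X \<Longrightarrow>
    Wm (\<iota> False) (\<iota> True) (\<tau> (Some f)) (c2 (U, V)) = c1 (op_set (topspace X) f U V)"
  by (simp_all add: Wm_def carrier_Wo \<iota>_eq inj_\<tau> dec2)

lemma leg_simps:
  "U \<in> KO k X \<Longrightarrow> leg (\<iota> True) (c1 U) = (\<lambda>x\<in>topspace X. \<iota> (x \<in> U))"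
  "U \<in> KO k X \<Longrightarrow> V \<in> KO k X \<Longrightarrow> leg (\<iota> False) (c2 (U, V)) = (\<lambda>x\<in>topspace X. \<nu> (x \<in> U, x \<in> V))"
  by (simp_all add: leg_def dec1 dec2 \<iota>_eq)

lemma order_functor_W: "order_functor D Pos Wo Wm"
proof -
  have P: "Wo d \<in> obj Pos" if "d \<in> {\<iota> False, \<iota> True}" for d
  proof -
    have "partial_order (Wo d)" by unfold_locales (simp_all add: Wo_def)
    moreover have "small (carrier (Wo d))" using that c1(2) c2(2) by (auto simp: carrier_Wo)
    ultimately show ?thesis by (simp add: Pos_def)
  qed
  have h: "Wm d d' n \<in> hom Pos (Wo d) (Wo d')"
    if dd: "d \<in> {\<iota> False, \<iota> True}" "d' \<in> {\<iota> False, \<iota> True}" "n \<in> hom D d d'" for d d' n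
  proof (cases "d = d'")
    case True
    then show ?thesis by (auto simp: Pos_def Wm_def le_Wo)
  next
    case False
    then obtain f where f: "d = \<iota> False" "d' = \<iota> True" "f \<in> Ops k" "n = \<tau> (Some f)"
      using dd by (auto simp: hom_D_simps)
    have "Wm d d' n w \<in> carrier (Wo d')" if "w \<in> carrier (Wo d)" for w
      using that f(3) op_set_KO unfolding f(1,2,4) by (auto simp: carrier_Wo Wm_simps)
    then show ?thesis by (auto simp: Pos_def le_Wo Wm_def)
  qed
  have i: "Wm d d n = (\<lambda>w\<in>carrier (Wo d). w)" for d n
    by (rule extensionalityI[of _ "carrier (Wo d)"]) (simp_all add: Wm_def)
  have cl: "compose (carrier (Wo d)) (\<lambda>w\<in>carrier (Wo d'). w) (Wm d d' n) = Wm d d' n"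
    if "d \<in> {\<iota> False, \<iota> True}" "d' \<in> {\<iota> False, \<iota> True}" "n \<in> hom D d d'" for d d' n
  proof (rule extensionalityI[of _ "carrier (Wo d)"])
    fix w assume w: "w \<in> carrier (Wo d)"
    have "Wm d d' n w \<in> carrier (Wo d')" using h[OF that] w by (auto simp: Pos_def)
    then show "compose (carrier (Wo d)) (\<lambda>w\<in>carrier (Wo d'). w) (Wm d d' n) w = Wm d d' n w"
      using w by (simp add: compose_eq)
  qed (simp_all add: Wm_def)
  have cr: "compose (carrier (Wo d)) (Wm d d' n) (\<lambda>w\<in>carrier (Wo d). w) = Wm d d' n" for d d' n
    by (rule extensionalityI[of _ "carrier (Wo d)"]) (simp_all add: Wm_def compose_eq)
  show ?thesis
    unfolding order_functor_def obj_D D_ops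
  proof (intro conjI ballI)
    show "Wo d \<in> obj Pos" if "d \<in> {\<iota> False, \<iota> True}" for d using P[OF that] .
    show "Wm d d' n \<in> hom Pos (Wo d) (Wo d')"
      if "d \<in> {\<iota> False, \<iota> True}" "d' \<in> {\<iota> False, \<iota> True}" "n \<in> hom D d d'" for d d' n
      using h[OF that] .
    show "Wm d d (\<tau> None) = idn Pos (Wo d)" for d by (simp add: i Pos_def)
    fix d d' d'' n n'
    assume d: "d \<in> {\<iota> False, \<iota> True}" "d' \<in> {\<iota> False, \<iota> True}" "d'' \<in> {\<iota> False, \<iota> True}"
      "n \<in> hom D d d'" "n' \<in> hom D d' d''"
    have hc: "hcomp Pos (Wo d) (Wo d') (Wo d'') g f = compose (carrier (Wo d)) g f" for g f
      by (simp add: Pos_def)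
    show "Wm d d'' (if n' = \<tau> None then n else n') = hcomp Pos (Wo d) (Wo d') (Wo d'') (Wm d' d'' n') (Wm d d' n)"
    proof (cases "d' = d''")
      case True
      then have "n' = \<tau> None" using d(3,5) by (auto simp: hom_D_simps)
      then show ?thesis unfolding hc using cl[OF d(1,2,4)] True by (simp add: i)
    next
      case False
      then have f: "d' = \<iota> False" "d'' = \<iota> True" using d by (auto simp: hom_D_simps)
      then have "d = d'" "n' \<noteq> \<tau> None" using d \<tau>_ne by (auto simp: hom_D_simps)
      then show ?thesis unfolding hc using cr by (simp add: i)
    qed
  next
    show "n = n' \<longrightarrow> hle Pos (Wo d) (Wo d') (Wm d d' n) (Wm d d' n')" for d d' n n'
      by (simp add: Pos_def le_Wo)
  qed
qed

text \<open>The predicate \<open>H\<close> is abstract since the lemma serves both for hom-sets out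
  of \<open>X\<close> and for maps whose composite with a fixed map is a morphism.\<close>

lemma leg_hom:
  assumes A: "\<And>U. U \<in> KO k X \<Longrightarrow> (\<lambda>x\<in>topspace X. \<iota> (x \<in> U)) \<in> H S"
    "\<And>U V. U \<in> KO k X \<Longrightarrow> V \<in> KO k X \<Longrightarrow> (\<lambda>x\<in>topspace X. \<nu> (x \<in> U, x \<in> V)) \<in> H Q"
    and d: "d \<in> obj D" "w \<in> carrier (Wo d)"
  shows "leg d w \<in> H (Fo d)"
proof (cases "d = \<iota> True")
  case True
  then obtain U where "U \<in> KO k X" "w = c1 U" using d(2) by (auto simp: carrier_Wo)
  then show ?thesis using A(1) by (simp add: True leg_simps Fo_simps)
next
  case False
  then have F: "d = \<iota> False" using d(1) by (simp add: obj_D)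
  then obtain U V where "U \<in> KO k X" "V \<in> KO k X" "w = c2 (U, V)" using d(2) by (auto simp: carrier_Wo)
  then show ?thesis using A(2) by (simp add: F leg_simps Fo_simps)
qed

lemma leg_natural:
  assumes d: "d \<in> obj D" "d' \<in> obj D" "n \<in> hom D d d'" "w \<in> carrier (Wo d)" and x: "x \<in> topspace X"
  shows "Fm d d' n (leg d w x) = leg d' (Wm d d' n w) x"
proof (cases "d = d'")
  case True
  have "leg d w x \<in> topspace (Fo d)"
    using d(1) x by (auto simp: obj_D leg_def Fo_simps T_S T_Q)
  then show ?thesis using True d(4) by (simp add: Fm_simps Wm_simps)
next
  case False
  then obtain f where f: "d = \<iota> False" "d' = \<iota> True" "f \<in> Ops k" "n = \<tau> (Some f)"
    using d by (auto simp: obj_D hom_D_simps)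
  obtain U V where UV: "U \<in> KO k X" "V \<in> KO k X" "w = c2 (U, V)"
    using d(4) by (auto simp: f(1) carrier_Wo)
  show ?thesis
    unfolding f(1,2,4) UV(3) Wm_simps(2)[OF UV(1,2)] leg_simps(1)[OF op_set_KO[OF f(3) UV(1,2)]]
      leg_simps(2)[OF UV(1,2)] Fm_simps
    using x by (simp add: op_map_\<nu> op_set_def)
qed

text \<open>In a cone with vertex \<open>A\<close> the legs at the two-point space are truth values
  \<open>b U v\<close>. Naturality says that \<open>b\<close> commutes with the operations in
  \<open>U\<close>, so each \<open>v\<close> gives a filter of homomorphic sets, and the point
  realising it is the value of the factorisation at \<open>v\<close>.\<close>

lemma leg_weighted_limit: "weighted_limit B D Fo Fm Wo Wm X leg"
proof -
  have base: "is_base X (KO k X)" and t0: "t0_space X" and cl: "k_closed k (topspace X) (KO k X)"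
    using alg_space_base[OF alg] alg_space_t0[OF alg] alg_space_closed[OF alg] .
  have iT: "\<iota> True \<in> obj D" and iF: "\<iota> False \<in> obj D" by (simp_all add: obj_D)
  have w1: "c1 U \<in> carrier (Wo (\<iota> True))" if "U \<in> KO k X" for U using that by (simp add: carrier_Wo)
  have w2: "c2 (U, V) \<in> carrier (Wo (\<iota> False))" if "U \<in> KO k X" "V \<in> KO k X" for U V
    using that by (simp add: carrier_Wo)
  have KS: "{\<iota> True} \<in> KO k S" unfolding point_space_alg(2)[OF inj] by (simp add: kcl_base)
  show ?thesis
    unfolding weighted_limit_def
  proof (intro conjI allI impI ballI)
    show "weighted_cone B D Fo Fm Wo Wm X leg"
      unfolding weighted_cone_def hcomp_B hle_B
    proof (intro conjI ballI impI)
      show "X \<in> obj B" using X_alg_obj_B[OF X] .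
      show "leg d w \<in> hom B X (Fo d)" if "d \<in> obj D" "w \<in> carrier (Wo d)" for d w
        by (rule leg_hom[where H = "hom B X", OF _ _ that]) (intro X_alg_hom_B map_S[OF X] map_Q[OF X]; assumption)+
      show "spec_le (Fo d) (leg d v x) (leg d w x)" if "v \<sqsubseteq>\<^bsub>Wo d\<^esub> w" for d v w x
        using that by (simp add: le_Wo spec_le_refl)
      show "compose (topspace X) (Fm d d' n) (leg d w) = leg d' (Wm d d' n w)"
        if "d \<in> obj D" "d' \<in> obj D" "n \<in> hom D d d'" "w \<in> carrier (Wo d)" for d d' n w
        by (rule extensionalityI[of _ "topspace X"])
          (simp_all add: compose_eq leg_natural[OF that], simp add: leg_def)
    qed
  next
    fix A a assume a: "weighted_cone B D Fo Fm Wo Wm A a"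
    have A: "A \<in> obj B" using a by (simp add: weighted_cone_def)
    have a_hom: "a d w \<in> hom B A (Fo d)" if "d \<in> obj D" "w \<in> carrier (Wo d)" for d w
      using a that unfolding weighted_cone_def by (elim conjE) blast
    have a_nat: "compose (topspace A) (Fm d d' n) (a d w) = a d' (Wm d d' n w)"
      if "d \<in> obj D" "d' \<in> obj D" "n \<in> hom D d d'" "w \<in> carrier (Wo d)" for d d' n w
      using a that unfolding weighted_cone_def hcomp_B by (elim conjE) blast
    have a_PiE: "a d w \<in> topspace A \<rightarrow>\<^sub>E topspace (Fo d)" if "d \<in> obj D" "w \<in> carrier (Wo d)" for d w
      using hom_B_Top0[OF a_hom[OF that]] by (simp add: hom_Top0)
    define b where "b U v \<longleftrightarrow> a (\<iota> True) (c1 U) v = \<iota> True" for U v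
    have a1: "a (\<iota> True) (c1 U) v = \<iota> (b U v)" if "U \<in> KO k X" "v \<in> topspace A" for U v
    proof -
      have "a (\<iota> True) (c1 U) v \<in> range \<iota>"
        using PiE_mem[OF a_PiE[OF iT w1[OF that(1)]] that(2)] by (simp add: Fo_simps T_S)
      then obtain e where "a (\<iota> True) (c1 U) v = \<iota> e" by blast
      then show ?thesis by (cases e) (simp_all add: b_def \<iota>_eq)
    qed
    have op: "\<iota> (b (op_set (topspace X) f U V) v) = op_map f (a (\<iota> False) (c2 (U, V)) v)"
      if f: "f \<in> Ops k" and UV: "U \<in> KO k X" "V \<in> KO k X" and v: "v \<in> topspace A" for f U V v
    proof -
      have "\<tau> (Some f) \<in> hom D (\<iota> False) (\<iota> True)" using f by (simp add: hom_D_simps)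
      from a_nat[OF iF iT this w2[OF UV]]
      have "compose (topspace A) (op_map f) (a (\<iota> False) (c2 (U, V))) =
          a (\<iota> True) (c1 (op_set (topspace X) f U V))"
        unfolding Fm_simps Wm_simps(2)[OF UV] .
      from fun_cong[OF this, of v] show ?thesis
        using v a1[OF op_set_KO[OF f UV] v] by (simp add: compose_eq)
    qed
    \<comment> \<open>Naturality along the arrows \<open>fst\<close> and \<open>snd\<close> forces
      the leg at the square to be the pair of legs at the two-point space.\<close>
    have a2: "a (\<iota> False) (c2 (U, V)) v = \<nu> (b U v, b V v)"
      if UV: "U \<in> KO k X" "V \<in> KO k X" and v: "v \<in> topspace A" for U V v
    proof -
      have "a (\<iota> False) (c2 (U, V)) v \<in> range \<nu>"
        using PiE_mem[OF a_PiE[OF iF w2[OF UV]] v] by (simp add: Fo_simps T_Q)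
      then obtain p where p: "a (\<iota> False) (c2 (U, V)) v = \<nu> p" by blast
      have s: "op_set (topspace X) fst U V = U" "op_set (topspace X) snd U V = V"
        using k_closed_subset[OF cl UV(1)] k_closed_subset[OF cl UV(2)] by (auto simp: op_set_def)
      have "b U v = fst p" "b V v = snd p"
        using op[of fst, OF _ UV v] op[of snd, OF _ UV v] by (simp_all add: s p op_map_\<nu> \<iota>_eq Ops_def)
      then show ?thesis using p by simp
    qed
    have "k_filter k (topspace X) (KO k X) {U \<in> KO k X. b U v}" if v: "v \<in> topspace A" for v
    proof (rule k_filter_ops[OF cl])
      show "b (op_set (topspace X) f U V) v \<longleftrightarrow> f (b U v, b V v)"
        if "f \<in> Ops k" "U \<in> KO k X" "V \<in> KO k X" for f U V
        using op[OF that v] a2[OF that(2,3) v] by (simp add: op_map_\<nu> \<iota>_eq)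
    qed
    from alg_space_point[OF alg this]
    have "\<forall>v\<in>topspace A. \<exists>x. x \<in> topspace X \<and> {U \<in> KO k X. b U v} = {U \<in> KO k X. x \<in> U}"
      by (simp only: Bex_def) (rule ballI)
    from bchoice[OF this] obtain t where
      t: "\<forall>v\<in>topspace A. t v \<in> topspace X \<and> {U \<in> KO k X. b U v} = {U \<in> KO k X. t v \<in> U}" ..
    have tX: "t v \<in> topspace X" if "v \<in> topspace A" for v using t that by blast
    have tU: "t v \<in> U \<longleftrightarrow> b U v" if "v \<in> topspace A" "U \<in> KO k X" for v U
    proof -
      have "U \<in> {U \<in> KO k X. b U v} \<longleftrightarrow> U \<in> {U \<in> KO k X. t v \<in> U}"
        using bspec[OF t that(1), THEN conjunct2] by (rule arg_cong)
      then show ?thesis using that(2) by simp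
    qed
    let ?t = "restrict t (topspace A)"
    have t_hom: "?t \<in> hom B A X"
      unfolding hom_B[OF A X]
    proof (intro conjI ballI)
      show "?t \<in> topspace A \<rightarrow>\<^sub>E topspace X" using tX by simp
      fix U assume U: "U \<in> KO k X"
      have "{v \<in> topspace A. a (\<iota> True) (c1 U) v \<in> {\<iota> True}} \<in> G A"
        using a_hom[OF iT w1[OF U]] KS unfolding Fo_simps hom_B[OF A point_space_obj] by blast
      moreover have "{v \<in> topspace A. a (\<iota> True) (c1 U) v \<in> {\<iota> True}} = {v \<in> topspace A. ?t v \<in> U}"
        using tU[OF _ U] by (intro Collect_cong conj_cong) (simp_all add: b_def)
      ultimately show "{v \<in> topspace A. ?t v \<in> U} \<in> G A" by simp
    qed
    have t_leg: "a d w = compose (topspace A) (leg d w) ?t" if d: "d \<in> obj D" "w \<in> carrier (Wo d)" for d w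
    proof (rule extensionalityI[of _ "topspace A"])
      show "a d w \<in> extensional (topspace A)" using a_PiE[OF d] by (simp add: PiE_def)
      fix v assume v: "v \<in> topspace A"
      show "a d w v = compose (topspace A) (leg d w) ?t v"
      proof (cases "d = \<iota> True")
        case True
        then obtain U where U: "U \<in> KO k X" "w = c1 U" using d(2) by (auto simp: carrier_Wo)
        show ?thesis
          unfolding True U(2) a1[OF U(1) v] leg_simps(1)[OF U(1)]
          using v tX[OF v] tU[OF v U(1)] by (simp add: compose_eq)
      next
        case False
        then have F: "d = \<iota> False" using d(1) by (simp add: obj_D)
        then obtain U V where UV: "U \<in> KO k X" "V \<in> KO k X" "w = c2 (U, V)"
          using d(2) by (auto simp: carrier_Wo)
        show ?thesis
          unfolding F UV(3) a2[OF UV(1,2) v] leg_simps(2)[OF UV(1,2)]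
          using v tX[OF v] tU[OF v UV(1)] tU[OF v UV(2)] by (simp add: compose_eq)
      qed
    qed simp
    show "\<exists>!t. t \<in> hom B A X \<and>
        (\<forall>d\<in>obj D. \<forall>w\<in>carrier (Wo d). a d w = hcomp B A X (Fo d) (leg d w) t)"
      unfolding hcomp_B
    proof (rule ex1I[of _ ?t])
      show "?t \<in> hom B A X \<and> (\<forall>d\<in>obj D. \<forall>w\<in>carrier (Wo d). a d w = compose (topspace A) (leg d w) ?t)"
        using t_hom t_leg by (intro conjI ballI)
      fix t' assume t': "t' \<in> hom B A X \<and>
        (\<forall>d\<in>obj D. \<forall>w\<in>carrier (Wo d). a d w = compose (topspace A) (leg d w) t')"
      have t'P: "t' \<in> topspace A \<rightarrow>\<^sub>E topspace X" using t' hom_B[OF A X, of t'] by blast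
      show "t' = ?t"
      proof (rule extensionalityI[of _ "topspace A"])
        show "t' \<in> extensional (topspace A)" using t'P by (simp add: PiE_def)
        fix v assume v: "v \<in> topspace A"
        have "t' v = t v"
        proof (rule is_base_t0_eqI[OF base t0 PiE_mem[OF t'P v] tX[OF v]])
          fix U assume U: "U \<in> KO k X"
          have "a (\<iota> True) (c1 U) = compose (topspace A) (leg (\<iota> True) (c1 U)) t'"
            using conjunct2[OF t', rule_format, OF iT w1[OF U]] .
          from fun_cong[OF this, of v] have "\<iota> (b U v) = \<iota> (t' v \<in> U)"
            unfolding a1[OF U v] leg_simps(1)[OF U] using v PiE_mem[OF t'P v] by (simp add: compose_eq)
          then show "t' v \<in> U \<longleftrightarrow> t v \<in> U" using tU[OF v U] by (simp add: \<iota>_eq)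
        qed
        then show "t' v = ?t v" using v by simp
      qed simp
    qed
  next
    fix A t t'
    assume A: "A \<in> obj B" and t: "t \<in> hom B A X" and t': "t' \<in> hom B A X"
      and le: "\<forall>d\<in>obj D. \<forall>w\<in>carrier (Wo d).
        hle B A (Fo d) (hcomp B A X (Fo d) (leg d w) t) (hcomp B A X (Fo d) (leg d w) t')"
    have tP: "t v \<in> topspace X" "t' v \<in> topspace X" if "v \<in> topspace A" for v
      using t t' PiE_mem[OF _ that] unfolding hom_B[OF A X] by blast+
    show "hle B A X t t'"
      unfolding hle_B is_base_spec_le[OF base]
    proof (intro ballI impI)
      fix v U assume v: "v \<in> topspace A" and U: "U \<in> KO k X" and tv: "t v \<in> U"
      have "hle B A S (hcomp B A X S (leg (\<iota> True) (c1 U)) t) (hcomp B A X S (leg (\<iota> True) (c1 U)) t')"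
        using le[rule_format, OF iT w1[OF U]] unfolding Fo_simps .
      from bspec[OF this[unfolded hle_B hcomp_B leg_simps(1)[OF U]] v]
      have "spec_le S (\<iota> (t v \<in> U)) (\<iota> (t' v \<in> U))"
        using v tP[OF v] by (simp add: compose_eq)
      then have "\<iota> (t' v \<in> U) \<in> {\<iota> True}"
        by (rule spec_leD[OF _ KO_openin[OF KS]]) (use tv in simp)
      then show "t' v \<in> U" by (simp add: \<iota>_eq)
    qed
  qed
qed

end

lemma codes:
  assumes "X \<in> obj (X_alg k)"
  obtains c1 :: "'u set \<Rightarrow> 'u" and c2 :: "'u set \<times> 'u set \<Rightarrow> 'u"
  where "inj_on c1 (KO k X)" "small (c1 ` KO k X)"
    "inj_on c2 (KO k X \<times> KO k X)" "small (c2 ` (KO k X \<times> KO k X))"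
proof -
  have X: "alg_space k X" "small (topspace X)" using assms by (simp_all add: obj_X_alg[OF inf])
  obtain c1 :: "'u set \<Rightarrow> 'u" where c1: "inj_on c1 (KO k X)" "small (c1 ` KO k X)"
    using lesspoll_code[OF KO_lesspoll(1)[OF X(1) inf X(2)]] .
  obtain c2 :: "'u set \<times> 'u set \<Rightarrow> 'u" where "inj_on c2 (KO k X \<times> KO k X)" "small (c2 ` (KO k X \<times> KO k X))"
    using lesspoll_code[OF KO_lesspoll(2)[OF X(1) inf X(2)]] .
  with c1 show thesis by (rule that)
qed

section \<open>Closed subcategories contain all algebraic spaces and their maps\<close>

context
  fixes A :: "('u topology, 'u \<Rightarrow> 'u) ocat"
  assumes AB: "subcategory A B" and KA: "subcategory (Kleisli k) A" and clA: "closed_under_weighted_limits A B"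
begin

lemma ops_A: "idn A = idn Top0" "hcomp A = hcomp Top0" "hle A = hle Top0"
  using KA by (simp_all add: subcategory_def Kleisli_def ops_full ops_EM)

lemma Kleisli_hom_A:
  assumes "Y \<in> obj (Kleisli k)" "Z \<in> obj (Kleisli k)" "f \<in> hom (X_alg k) Y Z"
  shows "f \<in> hom A Y Z"
proof -
  have "\<forall>x\<in>obj (Kleisli k). \<forall>y\<in>obj (Kleisli k). hom (Kleisli k) x y \<subseteq> hom A x y"
    using KA unfolding subcategory_def by (elim conjE)
  from this[THEN bspec, THEN bspec, OF assms(1,2)] show ?thesis
    using assms(3) unfolding hom_Kleisli[OF inf assms(1,2)] by (rule subsetD)
qed

lemma order_functor_A: "order_functor D A Fo Fm"
proof (rule order_functor_D[OF ops_A])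
  have K: "S \<in> obj (Kleisli k)" "Q \<in> obj (Kleisli k)"
    by (rule point_space_free[OF inf inj], rule square_space_free[OF inf inj_\<nu>])
  show "S \<in> obj A" "Q \<in> obj A" using KA K by (auto simp: subcategory_def)
  show "(\<lambda>x\<in>topspace S. x) \<in> hom A S S" "(\<lambda>x\<in>topspace Q. x) \<in> hom A Q Q"
    by (rule Kleisli_hom_A[OF K(1,1) X_alg_idn[OF inf point_space_obj]],
        rule Kleisli_hom_A[OF K(2,2) X_alg_idn[OF inf Q_obj]])
  show "op_map f \<in> hom A Q S" if "f \<in> Ops k" for f by (rule Kleisli_hom_A[OF K(2,1) op_map_hom[OF that]])
qed

text \<open>The diagram takes its values among free algebras, so it lies in \<open>A\<close>;
  closure of \<open>A\<close> then yields not only \<open>X\<close> but also the legs and the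
  universal property within \<open>A\<close>.\<close>

lemma limit_A:
  assumes X: "X \<in> obj (X_alg k)"
    and c: "inj_on c1 (KO k X)" "small (c1 ` KO k X)"
      "inj_on c2 (KO k X \<times> KO k X)" "small (c2 ` (KO k X \<times> KO k X))"
  shows "X \<in> obj A \<and> (\<forall>d\<in>obj D. \<forall>x\<in>carrier (Wo X c1 c2 d). leg X c1 c2 d x \<in> hom A X (Fo d)) \<and>
    weighted_limit A D Fo Fm (Wo X c1 c2) (Wm X c1 c2) X (leg X c1 c2)"
proof -
  have "small_category D \<and> order_functor D A Fo Fm \<and> order_functor D Pos (Wo X c1 c2) (Wm X c1 c2) \<and>
      weighted_limit B D Fo Fm (Wo X c1 c2) (Wm X c1 c2) X (leg X c1 c2)"
    by (intro conjI small_D order_functor_A order_functor_W[OF X c] leg_weighted_limit[OF X c])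
  then show ?thesis using clA unfolding closed_under_weighted_limits_def by blast
qed

lemma X_alg_obj_A: "X \<in> obj (X_alg k) \<Longrightarrow> X \<in> obj A"
  using codes[of X] limit_A[of X] by metis

lemma map_A:
  assumes X: "X \<in> obj (X_alg k)"
  shows "U \<in> KO k X \<Longrightarrow> (\<lambda>x\<in>topspace X. \<iota> (x \<in> U)) \<in> hom A X S"
    and "U \<in> KO k X \<Longrightarrow> V \<in> KO k X \<Longrightarrow> (\<lambda>x\<in>topspace X. \<nu> (x \<in> U, x \<in> V)) \<in> hom A X Q"
proof -
  obtain c1 :: "'u set \<Rightarrow> 'u" and c2 :: "'u set \<times> 'u set \<Rightarrow> 'u"
    where c: "inj_on c1 (KO k X)" "small (c1 ` KO k X)"
    "inj_on c2 (KO k X \<times> KO k X)" "small (c2 ` (KO k X \<times> KO k X))" using codes[OF X] .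
  have l: "leg X c1 c2 d x \<in> hom A X (Fo d)" if "d \<in> obj D" "x \<in> carrier (Wo X c1 c2 d)" for d x
    using limit_A[OF X c] that by blast
  show "(\<lambda>x\<in>topspace X. \<iota> (x \<in> U)) \<in> hom A X S" if "U \<in> KO k X"
    using l[of "\<iota> True" "c1 U"] that
    by (simp add: obj_D carrier_Wo[OF X c] leg_simps[OF X c] Fo_simps)
  show "(\<lambda>x\<in>topspace X. \<nu> (x \<in> U, x \<in> V)) \<in> hom A X Q" if "U \<in> KO k X" "V \<in> KO k X"
    using l[of "\<iota> False" "c2 (U, V)"] that
    by (simp add: obj_D carrier_Wo[OF X c] leg_simps[OF X c] Fo_simps)
qed

text \<open>\<open>A\<close> need not be full, so \<open>f\<close> must be produced inside it.
  Composing the legs of \<open>Y\<close> with \<open>f\<close> gives a cone in \<open>A\<close> over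
  the presenting diagram of \<open>Y\<close>; its factorisation is a morphism of \<open>A\<close>
  and agrees with \<open>f\<close>, because the legs separate points.\<close>

lemma X_alg_hom_A:
  assumes f: "f \<in> hom (X_alg k) X Y"
  shows "f \<in> hom A X Y"
proof -
  have X: "X \<in> obj (X_alg k)" and Y: "Y \<in> obj (X_alg k)" and fP: "f \<in> topspace X \<rightarrow>\<^sub>E topspace Y"
    and fK: "\<And>V. V \<in> KO k Y \<Longrightarrow> {x \<in> topspace X. f x \<in> V} \<in> KO k X"
    using f by (simp_all add: hom_X_alg[OF inf])
  obtain c1 :: "'u set \<Rightarrow> 'u" and c2 :: "'u set \<times> 'u set \<Rightarrow> 'u"
    where c: "inj_on c1 (KO k Y)" "small (c1 ` KO k Y)"
    "inj_on c2 (KO k Y \<times> KO k Y)" "small (c2 ` (KO k Y \<times> KO k Y))" using codes[OF Y] .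
  let ?Wo = "Wo Y c1 c2" and ?Wm = "Wm Y c1 c2" and ?l = "leg Y c1 c2"
  have lim: "weighted_limit A D Fo Fm ?Wo ?Wm Y ?l" using limit_A[OF Y c] by blast
  \<comment> \<open>A leg of \<open>Y\<close> composed with \<open>f\<close> classifies inverse
    images under \<open>f\<close>. These are homomorphic in \<open>X\<close>, so the composite is a
    leg of the presentation of \<open>X\<close>, which lies in \<open>A\<close>.\<close>
  have comp_hom: "compose (topspace X) (?l d w) f \<in> hom A X (Fo d)"
    if d: "d \<in> obj D" "w \<in> carrier (?Wo d)" for d w
  proof (rule leg_hom[OF Y c, where H = "\<lambda>Z. {g. compose (topspace X) g f \<in> hom A X Z}", OF _ _ d,
        unfolded mem_Collect_eq])
    fix U assume U: "U \<in> KO k Y"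
    have "compose (topspace X) (\<lambda>y\<in>topspace Y. \<iota> (y \<in> U)) f =
        (\<lambda>x\<in>topspace X. \<iota> (x \<in> {x \<in> topspace X. f x \<in> U}))"
      using PiE_mem[OF fP] by (intro extensionalityI[of _ "topspace X"]) (simp_all add: compose_eq)
    then show "compose (topspace X) (\<lambda>y\<in>topspace Y. \<iota> (y \<in> U)) f \<in> hom A X S"
      using map_A(1)[OF X fK[OF U]] by simp
  next
    fix U V assume UV: "U \<in> KO k Y" "V \<in> KO k Y"
    have "compose (topspace X) (\<lambda>y\<in>topspace Y. \<nu> (y \<in> U, y \<in> V)) f =
        (\<lambda>x\<in>topspace X. \<nu> (x \<in> {x \<in> topspace X. f x \<in> U}, x \<in> {x \<in> topspace X. f x \<in> V}))"
      using PiE_mem[OF fP] by (intro extensionalityI[of _ "topspace X"]) (simp_all add: compose_eq)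
    then show "compose (topspace X) (\<lambda>y\<in>topspace Y. \<nu> (y \<in> U, y \<in> V)) f \<in> hom A X Q"
      using map_A(2)[OF X fK[OF UV(1)] fK[OF UV(2)]] by simp
  qed
  have "weighted_cone A D Fo Fm ?Wo ?Wm X (\<lambda>d w. compose (topspace X) (?l d w) f)"
    unfolding weighted_cone_def ops_A ops_Top0
  proof (intro conjI ballI impI)
    show "X \<in> obj A" using X_alg_obj_A[OF X] .
    show "compose (topspace X) (?l d w) f \<in> hom A X (Fo d)" if "d \<in> obj D" "w \<in> carrier (?Wo d)" for d w
      using comp_hom[OF that] .
    show "spec_le (Fo d) (compose (topspace X) (?l d v) f x) (compose (topspace X) (?l d w) f x)"
      if "v \<sqsubseteq>\<^bsub>?Wo d\<^esub> w" for d v w x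
      using that by (simp add: le_Wo[OF Y c] spec_le_refl)
    show "compose (topspace X) (Fm d d' n) (compose (topspace X) (?l d w) f) =
        compose (topspace X) (?l d' (?Wm d d' n w)) f"
      if "d \<in> obj D" "d' \<in> obj D" "n \<in> hom D d d'" "w \<in> carrier (?Wo d)" for d d' n w
      using PiE_mem[OF fP] leg_natural[OF Y c that]
      by (intro extensionalityI[of _ "topspace X"]) (simp_all add: compose_eq)
  qed
  then have "\<exists>!t. t \<in> hom A X Y \<and> (\<forall>d\<in>obj D. \<forall>w\<in>carrier (?Wo d).
      compose (topspace X) (?l d w) f = hcomp A X Y (Fo d) (?l d w) t)"
    using lim unfolding weighted_limit_def by (elim conjE allE impE) assumption+
  then obtain t where t: "t \<in> hom A X Y" and eq: "\<forall>d\<in>obj D. \<forall>w\<in>carrier (?Wo d).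
      compose (topspace X) (?l d w) f = compose (topspace X) (?l d w) t"
    unfolding ops_A ops_Top0 by (elim ex1E conjE)
  have tP: "t \<in> topspace X \<rightarrow>\<^sub>E topspace Y"
  proof -
    have "\<forall>x\<in>obj A. \<forall>y\<in>obj A. hom A x y \<subseteq> hom B x y" using AB unfolding subcategory_def by (elim conjE)
    from this[THEN bspec, THEN bspec, OF X_alg_obj_A[OF X] X_alg_obj_A[OF Y]]
    have "t \<in> hom B X Y" using t by (rule subsetD)
    then show ?thesis using hom_B_Top0 by (simp add: hom_Top0)
  qed
  have algY: "alg_space k Y" using Y by (simp add: obj_X_alg[OF inf])
  have "t = f"
  proof (rule extensionalityI[of _ "topspace X"])
    show "t \<in> extensional (topspace X)" "f \<in> extensional (topspace X)" using tP fP by (simp_all add: PiE_def)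
    fix x assume x: "x \<in> topspace X"
    show "t x = f x"
    proof (rule is_base_t0_eqI[OF alg_space_base[OF algY] alg_space_t0[OF algY] PiE_mem[OF tP x] PiE_mem[OF fP x]])
      fix U assume U: "U \<in> KO k Y"
      have "compose (topspace X) (?l (\<iota> True) (c1 U)) f = compose (topspace X) (?l (\<iota> True) (c1 U)) t"
        using eq U by (simp add: obj_D carrier_Wo[OF Y c])
      from fun_cong[OF this, of x] show "t x \<in> U \<longleftrightarrow> f x \<in> U"
        unfolding leg_simps(1)[OF Y c U] using x PiE_mem[OF tP x] PiE_mem[OF fP x]
        by (simp add: compose_eq \<iota>_eq)
    qed
  qed
  then show ?thesis using t by simp
qed

lemma X_alg_subcategory_A: "subcategory (X_alg k) A"
  unfolding subcategory_def ops_X_alg ops_A ops_Top0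
proof (intro conjI ballI refl)
  show "obj (X_alg k) \<subseteq> obj A" using X_alg_obj_A by (rule subsetI)
  show "hom (X_alg k) X Y \<subseteq> hom A X Y" for X Y using X_alg_hom_A by (rule subsetI)
qed (auto intro: X_alg_idn[OF inf] X_alg_compose[OF inf])

end

lemma is_closure: "is_weighted_limit_closure B (Kleisli k) (X_alg k)"
  unfolding is_weighted_limit_closure_def
  using sub subcategory_Kleisli_X_alg[OF inf] closed_X_alg X_alg_subcategory_A by blast

end

section \<open>The two ambient categories\<close>

lemma ambient_Top0:
  assumes inf: "infinite (UNIV :: 'u set)" and inj: "inj (\<iota> :: bool \<Rightarrow> 'u)"
  shows "ambient k (Top0 :: ('u topology, 'u \<Rightarrow> 'u) ocat) opens \<iota>"
proof
  have PTop: "point_space \<iota> \<in> obj Top0"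
    using alg_space_t0[OF point_space_alg(1)[OF inj, of AllFilters]] finite_small[OF inf, of "range \<iota>"]
    unfolding obj_Top0 topspace_point_space by simp
  show "infinite (UNIV :: 'u set)" "inj \<iota>" by fact+
  show "subcategory (X_alg k :: ('u topology, 'u \<Rightarrow> 'u) ocat) Top0" by (rule subcategory_X_alg_Top0[OF inf])
  show "t \<in> hom Top0 A X \<longleftrightarrow>
       t \<in> topspace A \<rightarrow>\<^sub>E topspace X \<and> (\<forall>V\<in>KO k X. {w \<in> topspace A. t w \<in> V} \<in> opens A)"
    if A: "A \<in> obj Top0" and X: "X \<in> obj (X_alg k)" for A X :: "'u topology" and t
  proof -
    have alg: "alg_space k X" and XT: "X \<in> obj Top0"
      using X alg_space_t0[of k X] by (simp_all add: obj_X_alg[OF inf] obj_Top0)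
    show ?thesis
    proof
      assume t: "t \<in> hom Top0 A X"
      have "openin A {w \<in> topspace A. t w \<in> V}" if "V \<in> KO k X" for V
        using t KO_openin[OF that] by (intro openin_continuous_map_preimage[of A X t]) (simp_all add: hom_Top0)
      then show "t \<in> topspace A \<rightarrow>\<^sub>E topspace X \<and> (\<forall>V\<in>KO k X. {w \<in> topspace A. t w \<in> V} \<in> opens A)"
        using t by (simp add: hom_Top0)
    next
      assume R: "t \<in> topspace A \<rightarrow>\<^sub>E topspace X \<and> (\<forall>V\<in>KO k X. {w \<in> topspace A. t w \<in> V} \<in> opens A)"
      then have "continuous_map A X t"
        by (intro is_base_continuous_map[OF alg_space_base[OF alg]]) (simp_all add: PiE_def)
      then show "t \<in> hom Top0 A X" using R A XT by (simp add: hom_Top0)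
    qed
  qed
  show "\<exists>e. \<forall>q\<in>topspace L. e q \<in> hom Top0 (point_space \<iota>) L \<and> e q (\<iota> False) = q \<and>
       (\<forall>q'\<in>topspace L. \<forall>s. e q s = e q' s \<or> e q s = q \<and> e q' s = q')"
    if L: "L \<in> obj Top0" for L :: "'u topology"
  \<comment> \<open>In \<open>Top0\<close> constant maps are morphisms, so the probe of
    \<open>q\<close> is constant.\<close>
  proof (intro exI[of _ "\<lambda>q. \<lambda>s\<in>range \<iota>. q"] ballI conjI allI)
    fix q assume q: "q \<in> topspace L"
    have "continuous_map (point_space \<iota>) L (\<lambda>s\<in>range \<iota>. q)"
      by (rule continuous_map_eq[of _ _ "\<lambda>s. q"]) (simp_all add: q topspace_point_space)
    then show "(\<lambda>s\<in>range \<iota>. q) \<in> hom Top0 (point_space \<iota>) L"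
      using L PTop q by (simp add: hom_Top0 topspace_point_space)
  qed auto
qed (simp_all add: hom_Top0)

text \<open>For the filter monad \<open>b (opens L)\<close>, the limit of the improper filter, is
  the top element and has to be the value at the open point; for the other monads the map is
  constant. A filter on the two-point space is carried to the neighbourhood filter of
  \<open>q\<close>, to that of the top or to the improper filter, and these converge as
  required.\<close>

lemma algebra_hom_probe:
  assumes b: "algebra k L b" and inj: "inj (\<iota> :: bool \<Rightarrow> 'u)" and q: "q \<in> topspace L"
  defines "e \<equiv> \<lambda>s\<in>range \<iota>. if s = \<iota> False \<or> k \<noteq> AllFilters then q else b (opens L)"
  shows "algebra_hom k (point_space \<iota>) L e"
proof -
  let ?S = "point_space \<iota>"
  have T: "topspace ?S = {\<iota> False, \<iota> True}" by (simp add: topspace_point_space UNIV_bool insert_commute)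
  have r: "range \<iota> = {\<iota> False, \<iota> True}" using T by (simp add: topspace_point_space)
  have ne: "\<iota> True \<noteq> \<iota> False" using inj by (simp add: inj_eq)
  have al: "alg_space k ?S" using point_space_alg(1)[OF inj] .
  obtain a where a: "algebra k ?S a" using alg_space_algebra[OF al] ..
  have KS: "{\<iota> True} \<in> KO k ?S" unfolding point_space_alg(2)[OF inj] by (simp add: kcl_base)
  have aT: "a F = (if {\<iota> True} \<in> F then \<iota> True else \<iota> False)" if F: "k_filter k (topspace ?S) (opens ?S) F" for F
  proof -
    have "a F \<in> {\<iota> True} \<longleftrightarrow> {\<iota> True} \<in> F" using KS F unfolding KO_iff[OF a] by blast
    moreover have "a F \<in> {\<iota> False, \<iota> True}" using algebra_in[OF a F] unfolding T .
    ultimately show ?thesis by auto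
  qed
  have improper: "k_filter k (topspace L) (opens L) (opens L)" if "k = AllFilters"
    unfolding k_filter_def using that by auto
  have tL: "b (opens L) \<in> topspace L" if "k = AllFilters" using algebra_in[OF b improper[OF that]] .
  have top: "b (opens L) \<in> V" if "k = AllFilters" "openin L V" "V \<noteq> {}" for V
  proof -
    obtain x where x: "x \<in> V" using \<open>V \<noteq> {}\<close> by blast
    show ?thesis
      by (rule algebra_largest[OF b improper[OF that(1)] _ that(2) x]) (auto simp: filter_unit_def)
  qed
  have unit: "b (filter_unit L x) = x" if "x \<in> topspace L" for x
    using algebra_unit[OF b] that by blast
  have eL: "e s \<in> topspace L" if "s \<in> topspace ?S" for s
    using that q tL by (auto simp: e_def topspace_point_space)
  have pre: "{s \<in> topspace ?S. e s \<in> V} = (if q \<in> V then topspace ?S else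
      if k = AllFilters \<and> V \<noteq> {} then {\<iota> True} else {})" if "openin L V" for V
    using top[OF _ that] ne by (auto simp: T e_def r)
  have op: "openin ?S {s \<in> topspace ?S. e s \<in> V}" if "openin L V" for V
    unfolding pre[OF that] using KO_openin[OF KS] by simp
  show ?thesis
    unfolding algebra_hom_def
  proof (intro conjI exI ballI)
    show "continuous_map ?S L e" unfolding continuous_map_def using eL op by blast
    show "algebra k ?S a" "algebra k L b" by fact+
    fix F assume "F \<in> topspace (filter_space k ?S)"
    then have F: "k_filter k (topspace ?S) (opens ?S) F" by (simp only: topspace_filter_space mem_Collect_eq)
    \<comment> \<open>The inverse image of an open \<open>V\<close> is the whole space, the open
      point or empty, according to \<open>q \<in> V\<close> and to whether \<open>V\<close> is
      nonempty in the case of the filter monad.\<close>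
    have mapF: "filter_map ?S L e F = {V. openin L V \<and>
        (q \<in> V \<or> k = AllFilters \<and> V \<noteq> {} \<and> {\<iota> True} \<in> F \<or> {} \<in> F)}"
    proof -
      have "{s \<in> topspace ?S. e s \<in> V} \<in> F \<longleftrightarrow> q \<in> V \<or> k = AllFilters \<and> V \<noteq> {} \<and> {\<iota> True} \<in> F \<or> {} \<in> F"
        if V: "openin L V" for V
      proof -
        have "{\<iota> True} \<in> F" if "{} \<in> F"
          using k_filter_mono[OF F that, of "{\<iota> True}"] KO_openin[OF KS] by simp
        then show ?thesis unfolding pre[OF V] using k_filter_top[OF F] by (auto split: if_splits)
      qed
      then show ?thesis unfolding filter_map_def by blast
    qed
    show "e (a F) = b (filter_map ?S L e F)"
    proof (cases "k = AllFilters \<and> {\<iota> True} \<in> F")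
      case True
      then have "e (a F) = b (opens L)" unfolding aT[OF F] using ne by (simp add: e_def)
      also have "\<dots> = b (filter_map ?S L e F)"
      proof (cases "{} \<in> F")
        case True
        then have "filter_map ?S L e F = opens L" unfolding mapF by simp
        then show ?thesis by simp
      next
        case False
        have "filter_map ?S L e F = filter_unit L (b (opens L))"
          unfolding mapF filter_unit_def using True False top by auto
        then show ?thesis using unit[OF tL] True by simp
      qed
      finally show ?thesis .
    next
      case False
      have "{} \<notin> F"
      proof
        assume e: "{} \<in> F"
        then have "k = AllFilters" using k_filter_empty[OF F] by blast
        moreover have "{\<iota> True} \<in> F"
          using k_filter_mono[OF F e, of "{\<iota> True}"] KO_openin[OF KS] by simp
        ultimately show False using False by simp
      qed
      then have "filter_map ?S L e F = filter_unit L q"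
        unfolding mapF filter_unit_def using False by auto
      moreover have "e (a F) = q" unfolding aT[OF F] using False by (auto simp: e_def)
      ultimately show ?thesis using unit[OF q] by simp
    qed
  qed
qed

lemma ambient_EM:
  assumes inf: "infinite (UNIV :: 'u set)" and inj: "inj (\<iota> :: bool \<Rightarrow> 'u)"
  shows "ambient k (EM k :: ('u topology, 'u \<Rightarrow> 'u) ocat) (KO k) \<iota>"
proof
  show "infinite (UNIV :: 'u set)" "inj \<iota>" by fact+
  show sub: "subcategory (X_alg k :: ('u topology, 'u \<Rightarrow> 'u) ocat) (EM k)" by (rule subcategory_X_alg_EM[OF inf])
  have objX: "X \<in> obj (EM k)" if "X \<in> obj (X_alg k)" for X :: "'u topology"
    using sub that by (auto simp: subcategory_def)
  show "hcomp (EM k) = hcomp Top0" "hle (EM k) = hle Top0" by (rule ops_EM)+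
  show "A \<in> obj (EM k) \<Longrightarrow> A \<in> obj Top0" for A :: "'u topology" by (simp add: obj_EM obj_Top0)
  show "f \<in> hom (EM k) A A' \<Longrightarrow> f \<in> hom Top0 A A'" for A A' :: "'u topology" and f
    by (simp add: hom_EM hom_Top0 obj_EM obj_Top0 algebra_hom_def)
  show "t \<in> hom (EM k) A X \<longleftrightarrow>
       t \<in> topspace A \<rightarrow>\<^sub>E topspace X \<and> (\<forall>V\<in>KO k X. {w \<in> topspace A. t w \<in> V} \<in> KO k A)"
    if A: "A \<in> obj (EM k)" and X: "X \<in> obj (X_alg k)" for A X :: "'u topology" and t
  proof -
    have alg: "alg_space k X" using X by (simp add: obj_X_alg[OF inf])
    have "\<exists>a. algebra k A a" using A by (simp add: obj_EM)
    from algebra_hom_iff_KO[OF this alg, of t] show ?thesis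
      using A objX[OF X] unfolding hom_EM by (auto simp: PiE_def)
  qed
  show "\<exists>e. \<forall>q\<in>topspace L. e q \<in> hom (EM k) (point_space \<iota>) L \<and> e q (\<iota> False) = q \<and>
       (\<forall>q'\<in>topspace L. \<forall>s. e q s = e q' s \<or> e q s = q \<and> e q' s = q')"
    if L: "L \<in> obj (EM k)" for L :: "'u topology"
  proof -
    obtain b where b: "algebra k L b" using L by (auto simp: obj_EM)
    let ?e = "\<lambda>q. \<lambda>s\<in>range \<iota>. if s = \<iota> False \<or> k \<noteq> AllFilters then q else b (opens L)"
    have "point_space \<iota> \<in> obj (EM k)"
      using obj_Kleisli_X_alg[OF inf point_space_free[OF inf inj]] by (rule objX)
    then have "?e q \<in> hom (EM k) (point_space \<iota>) L" if q: "q \<in> topspace L" for q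
    proof -
      have h: "algebra_hom k (point_space \<iota>) L (?e q)" by (rule algebra_hom_probe[OF b inj q])
      then have "?e q \<in> topspace (point_space \<iota>) \<rightarrow> topspace L"
        by (simp add: algebra_hom_def continuous_map_def)
      then show ?thesis
        using h L \<open>point_space \<iota> \<in> obj (EM k)\<close> by (simp add: hom_EM PiE_def topspace_point_space)
    qed
    moreover have "?e q (\<iota> False) = q" for q by simp
    moreover have "?e q s = ?e q' s \<or> ?e q s = q \<and> ?e q' s = q'" for q q' s by simp
    ultimately show ?thesis by (intro exI[of _ ?e] ballI conjI allI)
  qed
qed

theorem corollary5p4:
  assumes "infinite (UNIV :: 'u set)"
  shows "(X_alg AllFilters :: ('u topology, 'u \<Rightarrow> 'u) ocat) = ALat \<and>
         (X_alg ProperFilters :: ('u topology, 'u \<Rightarrow> 'u) ocat) = ADom \<and>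
         (X_alg PrimeFilters :: ('u topology, 'u \<Rightarrow> 'u) ocat) = Spec \<and>
         (\<forall>k. is_weighted_limit_closure (EM k) (Kleisli k)
                (X_alg k :: ('u topology, 'u \<Rightarrow> 'u) ocat) \<and>
              is_weighted_limit_closure Top0 (Kleisli k)
                (X_alg k :: ('u topology, 'u \<Rightarrow> 'u) ocat))"
proof -
  obtain \<iota> :: "bool \<Rightarrow> 'u" where \<iota>: "inj \<iota>" using infinite_code[OF assms] .
  obtain \<nu> :: "bool \<times> bool \<Rightarrow> 'u" where \<nu>: "inj \<nu>" using infinite_code[OF assms] .
  obtain \<tau> :: "(bool \<times> bool \<Rightarrow> bool) option \<Rightarrow> 'u" where \<tau>: "inj \<tau>" using infinite_code[OF assms] .
  have "presentation k (EM k) (KO k) \<iota> \<nu> \<tau>" "presentation k Top0 opens \<iota> \<nu> \<tau>" for k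
    using ambient_EM[OF assms \<iota>, of k] ambient_Top0[OF assms \<iota>, of k] \<nu> \<tau>
    by (simp_all add: presentation_def presentation_axioms_def)
  from this[THEN presentation.is_closure] show ?thesis
    using X_alg_AllFilters[OF assms] X_alg_ProperFilters[OF assms] X_alg_PrimeFilters[OF assms] by blast
qed

end
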